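(* Let $W$ be a negative definite $\mathrm{SU}(2)$ connection on $P\to M$ with orientation-compatible frame 1-form $E$ satisfying $F(W)=E\wedge E$. Let $\omega$ be a closed 3-form on $M$, $b$ a 2-form on $M$, and let $$\Omega=CS(W)+\omega+db,\qquad \rho:=\frac{\omega+db}{v},$$ where $v$ is the volume form on $M$ of the metric for $E$. Assume $\Omega$ is stable of negative type. Then: (i) the connection on $P$ defined by the almost-complex structure $J_\Omega$ is $W_J=W-\rho E$, and the metric on $M$ defined by $J_\Omega$ has frame $\sqrt{1-\rho^2}\,E$; (ii) $d\hat\Omega=0$ if and only if $d\rho=0$ and $\nabla_WE=2\rho\,E\wedge E$; the second equation is equivalent to the statement that $W_J$ is compatible with $E$, $\nabla_{W_J}E=0$; (iii) when $d\hat\Omega=0$, the curvature of $W_J$ satisfies $F(W_J)=(1-\rho^2)\,E\wedge E$ with $\rho$ constant (so the metric has constant negative curvature).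
   Context: Setting. $M$ is an oriented connected smooth 3-manifold and $P\to M$ is a principal $\mathrm{SU}(2)$ bundle (right action). The 6-manifold $P$ is oriented. $\mathfrak{su}(2)$ consists of tracefree anti-hermitian $2\times2$ matrices with basis $\tau_i=-\frac{\mathrm{i}}{2}\sigma_i$ ($\sigma_i$ the Pauli matrices). Products of matrix-valued forms combine matrix product and wedge product; forms and functions on $M$ are pulled back to $P$ without change of notation. A connection is an $\mathfrak{su}(2)$-valued 1-form $W$ on $P$ (in a trivialisation $W=g^{-1}\mathbf{w}g+g^{-1}dg$), with curvature $F(W)=dW+W\wedge W$. Frames. A frame 1-form is a horizontal $\mathfrak{su}(2)$-valued 1-form $E=E^i\tau_i$ on $P$ with $R_g^*E=g^{-1}Eg$ and with $E^1,E^2,E^3$ pointwise linearly independent. The metric for $E$ is the metric on $M$ to which $-2\,\mathrm{Tr}(E\otimes E)$ descends. $E$ is orientation-compatible if $-\frac23\mathrm{Tr}(E\wedge E\wedge E)$, which descends to $M$, is positive; it is then the volume form of the metric for $E$. The covariant exterior derivative is $\nabla_WE=dE+W\wedge E+E\wedge W$. Chern-Simons form. $CS(W)=\mathrm{Tr}\left(W\wedge dW+\frac23W\wedge W\wedge W\right)$, a 3-form on $P$. Stable 3-forms in 6D. For a real 3-form $\Omega$ on $P$ and a positive volume form $v_0$ on $P$, define $K_\Omega:T^*P\to T^*P$ by $i_\xi(K_\Omega(\alpha))=\alpha\wedge i_\xi\Omega\wedge\Omega/v_0$ for all tangent vectors $\xi$. Then $K_\Omega^2=\lambda(\Omega)\,\mathbb{I}$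 with $\lambda(\Omega)=\frac16\mathrm{Tr}(K_\Omega^2)$. $\Omega$ is stable of negative type if $\lambda(\Omega)<0$ everywhere; then $J_\Omega=K_\Omega/\sqrt{-\lambda(\Omega)}$ is an almost-complex structure on $P$ (acting on vectors by duality, $(J\alpha)(X)=\alpha(JX)$), and $\hat\Omega:=-J_\Omega(\Omega)$, where $J_\Omega$ acts on all three form indices. $W$ is called negative definite if $CS(W)$ is stable of negative type; equivalently $F(W)=E\wedge E$ for a frame 1-form $E$. Connection and metric defined by $J$. For an $\mathrm{SU}(2)$-invariant almost-complex structure $J$ on $P$ with $J(V)\cap V=0$, $V\subset TP$ the vertical subbundle, the connection defined by $J$ is the one with horizontal subbundle $J(V)$. The metric on $M$ defined by $J$ is $(\xi,\eta)_M:=(J\xi_H,J\eta_H)_{\mathrm{SU}(2)}$, where $\xi_H,\eta_H$ are the horizontal lifts and $(\cdot,\cdot)_{\mathrm{SU}(2)}$ is the metric on the fibres given by $-2\,\mathrm{Tr}(xy)$ under the identification of vertical vectors with $\mathfrak{su}(2)$. *)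

theory Defs
  imports "HOL-Analysis.Analysis" "HOL-Combinatorics.Permutations"
begin

section \<open>Smooth functions on open subsets of normed spaces\<close>

text \<open>Meant for open \<open>S\<close> and finite-dimensional domains, where asking for all iterated
  directional derivatives is the usual notion of \<open>k\<close>-fold continuous differentiability.\<close>

fun Ck_on :: "nat \<Rightarrow> 'a::real_normed_vector set \<Rightarrow> ('a \<Rightarrow> 'b::real_normed_vector) \<Rightarrow> bool" where
  "Ck_on 0 S f = continuous_on S f"
| "Ck_on (Suc k) S f =
     ((\<forall>x\<in>S. f differentiable (at x)) \<and> (\<forall>u. Ck_on k S (\<lambda>x. frechet_derivative f (at x) u)))"

definition smooth_on :: "'a::real_normed_vector set \<Rightarrow> ('a \<Rightarrow> 'b::real_normed_vector) \<Rightarrow> bool" where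
  "smooth_on S f \<longleftrightarrow> (\<forall>k. Ck_on k S f)"


section \<open>Oriented smooth manifolds\<close>

text \<open>The manifold is the whole type; a chart is a domain together with a coordinate map, whose
  values outside the domain are irrelevant. The atlas need not be maximal.\<close>

type_synonym ('m, 'n) chart = "'m set \<times> ('m \<Rightarrow> real ^ 'n)"

abbreviation chart_inv :: "('m, 'n::finite) chart \<Rightarrow> real ^ 'n \<Rightarrow> 'm" where
  "chart_inv c \<equiv> inv_into (fst c) (snd c)"

definition is_chart :: "('m::topological_space, 'n::finite) chart \<Rightarrow> bool" where
  "is_chart c \<longleftrightarrow> open (fst c) \<and> open (snd c ` fst c) \<and>
     homeomorphism (fst c) (snd c ` fst c) (snd c) (chart_inv c)"

definition oriented_atlas ::
    "('m::{t2_space,second_countable_topology}, 'n::finite) chart set \<Rightarrow> bool" where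
  "oriented_atlas A \<longleftrightarrow>
     (\<forall>c\<in>A. is_chart c) \<and> (\<Union>c\<in>A. fst c) = UNIV \<and>
     (\<forall>c\<in>A. \<forall>d\<in>A.
        smooth_on (snd c ` (fst c \<inter> fst d)) (snd d \<circ> chart_inv c) \<and>
        (\<forall>x\<in>snd c ` (fst c \<inter> fst d).
           det (matrix (frechet_derivative (snd d \<circ> chart_inv c) (at x))) > 0))"

definition smooth_fun_on ::
    "('m, 'n::finite) chart set \<Rightarrow> 'm set \<Rightarrow> ('m \<Rightarrow> 'b::real_normed_vector) \<Rightarrow> bool" where
  "smooth_fun_on A N f \<longleftrightarrow> (\<forall>c\<in>A. smooth_on (snd c ` (fst c \<inter> N)) (f \<circ> chart_inv c))"

definition smooth_at ::
    "('m::topological_space, 'n::finite) chart set \<Rightarrow> 'm \<Rightarrow> ('m \<Rightarrow> real) \<Rightarrow> bool" where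
  "smooth_at A p f \<longleftrightarrow> (\<exists>N. open N \<and> p \<in> N \<and> smooth_fun_on A N f)"

definition smooth_map ::
    "('m::topological_space, 'n::finite) chart set \<Rightarrow>
     ('q::topological_space, 'k::finite) chart set \<Rightarrow> ('m \<Rightarrow> 'q) \<Rightarrow> bool" where
  "smooth_map A B F \<longleftrightarrow> continuous_on UNIV F \<and>
     (\<forall>c\<in>A. \<forall>d\<in>B. smooth_on (snd c ` (fst c \<inter> F -` fst d)) (snd d \<circ> F \<circ> chart_inv c))"

text \<open>Smoothness of a map from \<open>U \<times> S\<close> into a manifold, where \<open>U\<close> is an open subset of a manifold
  and \<open>S\<close> an embedded submanifold of a normed space (here \<open>SU(2)\<close> in the complex matrices):
  in coordinates the map extends locally to a smooth map on an open set.\<close>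

definition smooth_on_product ::
    "('m, 'n::finite) chart set \<Rightarrow> ('q, 'k::finite) chart set \<Rightarrow> 'm set \<Rightarrow>
     'g::real_normed_vector set \<Rightarrow> ('m \<Rightarrow> 'g \<Rightarrow> 'q) \<Rightarrow> bool" where
  "smooth_on_product A B U S F \<longleftrightarrow>
     (\<forall>c\<in>A. \<forall>d\<in>B. \<forall>x\<in>U. \<forall>g\<in>S. x \<in> fst c \<and> F x g \<in> fst d \<longrightarrow>
        (\<exists>N G. open N \<and> (snd c x, g) \<in> N \<and> smooth_on N G \<and>
          (\<forall>y\<in>fst c \<inter> U. \<forall>h\<in>S. (snd c y, h) \<in> N \<longrightarrow>
             F y h \<in> fst d \<and> snd d (F y h) = G (snd c y, h))))"


section \<open>Tangent vectors\<close>

text \<open>A tangent vector at \<open>p\<close> is a directional derivative operator on functions smooth near \<open>p\<close>,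
  set to \<open>0\<close> on all other functions so that equality of tangent vectors is equality of operators.\<close>

type_synonym 'm tvec = "('m \<Rightarrow> real) \<Rightarrow> real"

definition coord_vec ::
    "('m::topological_space, 'n::finite) chart set \<Rightarrow> ('m, 'n) chart \<Rightarrow> 'm \<Rightarrow> real ^ 'n \<Rightarrow> 'm tvec" where
  "coord_vec A c p u =
     (\<lambda>f. if smooth_at A p f then frechet_derivative (f \<circ> chart_inv c) (at (snd c p)) u else 0)"

definition tangent :: "('m::topological_space, 'n::finite) chart set \<Rightarrow> 'm \<Rightarrow> 'm tvec set" where
  "tangent A p = {coord_vec A c p u | c u. c \<in> A \<and> p \<in> fst c}"

definition coords :: "('m, 'n::finite) chart \<Rightarrow> 'm tvec \<Rightarrow> real ^ 'n" where
  "coords c X = (\<chi> i. X (\<lambda>q. snd c q $ i))"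

definition tzero :: "'m tvec" where "tzero = (\<lambda>f. 0)"
definition tadd :: "'m tvec \<Rightarrow> 'm tvec \<Rightarrow> 'm tvec" where "tadd X Y = (\<lambda>f. X f + Y f)"
definition tscale :: "real \<Rightarrow> 'm tvec \<Rightarrow> 'm tvec" where "tscale r X = (\<lambda>f. r * X f)"

definition push ::
    "('q::topological_space, 'k::finite) chart set \<Rightarrow> ('m \<Rightarrow> 'q) \<Rightarrow> 'm \<Rightarrow> 'm tvec \<Rightarrow> 'q tvec" where
  "push B F p X = (\<lambda>f. if smooth_at B (F p) f then X (f \<circ> F) else 0)"

definition some_chart :: "('m, 'n::finite) chart set \<Rightarrow> 'm \<Rightarrow> ('m, 'n) chart" where
  "some_chart A p = (SOME c. c \<in> A \<and> p \<in> fst c)"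

text \<open>The basis \<open>e\<^sub>1, \<dots>, e\<^sub>n\<close> in its standard order, which fixes orientations
  (in the type \<open>3\<close>, the index \<open>3\<close> is the element \<open>0\<close>, so the order of the index type is not used).\<close>

definition std_basis :: "(real ^ 'n::{finite,comm_ring_1}) list" where
  "std_basis = map (\<lambda>i. axis (of_nat (Suc i)) 1) [0..<CARD('n)]"

lemma std_basis_3: "(std_basis :: (real ^ 3) list) = [axis 1 1, axis 2 1, axis 3 1]"
  by (simp add: std_basis_def upt_rec numeral_2_eq_2 [symmetric] numeral_3_eq_3 [symmetric])


section \<open>Differential forms\<close>

text \<open>Forms take values in a normed space and are applied to lists of tangent vectors; only their
  values on tangent vectors matter, so forms are compared with \<open>form_eq\<close>.\<close>

type_synonym ('m, 'b) form = "'m \<Rightarrow> 'm tvec list \<Rightarrow> 'b"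

definition alternating_on :: "'m tvec set \<Rightarrow> nat \<Rightarrow> ('m tvec list \<Rightarrow> 'b::real_vector) \<Rightarrow> bool" where
  "alternating_on T k a \<longleftrightarrow>
     (\<forall>Xs. length Xs = k \<and> set Xs \<subseteq> T \<longrightarrow>
       (\<forall>i<k. \<forall>Y\<in>T. a (Xs[i := tadd (Xs ! i) Y]) = a Xs + a (Xs[i := Y])) \<and>
       (\<forall>i<k. \<forall>r. a (Xs[i := tscale r (Xs ! i)]) = r *\<^sub>R a Xs) \<and>
       (\<forall>i<k. \<forall>j<k. i \<noteq> j \<and> Xs ! i = Xs ! j \<longrightarrow> a Xs = 0))"

definition form_component ::
    "('m::topological_space, 'n::finite) chart set \<Rightarrow> ('m, 'n) chart \<Rightarrow> ('m, 'b) form \<Rightarrow>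
     (real ^ 'n) list \<Rightarrow> real ^ 'n \<Rightarrow> 'b" where
  "form_component A c \<alpha> us x = \<alpha> (chart_inv c x) (map (coord_vec A c (chart_inv c x)) us)"

definition is_form ::
    "('m::topological_space, 'n::finite) chart set \<Rightarrow> nat \<Rightarrow> ('m, 'b::real_normed_vector) form \<Rightarrow> bool" where
  "is_form A k \<alpha> \<longleftrightarrow>
     (\<forall>p. alternating_on (tangent A p) k (\<alpha> p)) \<and>
     (\<forall>c\<in>A. \<forall>us. length us = k \<longrightarrow> smooth_on (snd c ` fst c) (form_component A c \<alpha> us))"

definition form_eq ::
    "('m::topological_space, 'n::finite) chart set \<Rightarrow> nat \<Rightarrow> ('m, 'b) form \<Rightarrow> ('m, 'b) form \<Rightarrow> bool" where
  "form_eq A k \<alpha> \<beta> \<longleftrightarrow>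
     (\<forall>p Xs. length Xs = k \<and> set Xs \<subseteq> tangent A p \<longrightarrow> \<alpha> p Xs = \<beta> p Xs)"

definition fzero :: "('m, 'b::zero) form" where "fzero = (\<lambda>p Xs. 0)"
definition fadd :: "('m, 'b::plus) form \<Rightarrow> ('m, 'b) form \<Rightarrow> ('m, 'b) form" where
  "fadd \<alpha> \<beta> = (\<lambda>p Xs. \<alpha> p Xs + \<beta> p Xs)"
definition fscale :: "('m \<Rightarrow> real) \<Rightarrow> ('m, 'b::real_vector) form \<Rightarrow> ('m, 'b) form" where
  "fscale f \<alpha> = (\<lambda>p Xs. f p *\<^sub>R \<alpha> p Xs)"
definition form_of_fun :: "('m \<Rightarrow> 'b) \<Rightarrow> ('m, 'b) form" where
  "form_of_fun f = (\<lambda>p Xs. f p)"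

definition pullback ::
    "('q::topological_space, 'k::finite) chart set \<Rightarrow> ('m \<Rightarrow> 'q) \<Rightarrow> ('q, 'b) form \<Rightarrow> ('m, 'b) form" where
  "pullback B F \<alpha> = (\<lambda>p Xs. \<alpha> (F p) (map (push B F p) Xs))"

text \<open>Wedge product of a \<open>k\<close>-form and an \<open>l\<close>-form combined with the product \<open>m\<close> of values, normalised so
  that \<open>(\<alpha> \<and> \<beta>)(X, Y) = \<alpha>(X) \<beta>(Y) - \<alpha>(Y) \<beta>(X)\<close> for 1-forms.\<close>

definition alt_wedge ::
    "('b \<Rightarrow> 'b \<Rightarrow> 'b::real_vector) \<Rightarrow> nat \<Rightarrow> nat \<Rightarrow> ('x list \<Rightarrow> 'b) \<Rightarrow> ('x list \<Rightarrow> 'b) \<Rightarrow> 'x list \<Rightarrow> 'b" where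
  "alt_wedge m k l a b Xs =
     (1 / (fact k * fact l)) *\<^sub>R
       (\<Sum>\<sigma> | \<sigma> permutes {..<k + l}. real_of_int (sign \<sigma>) *\<^sub>R
          m (a (map (\<lambda>i. Xs ! \<sigma> i) [0..<k])) (b (map (\<lambda>i. Xs ! \<sigma> i) [k..<k + l])))"

definition wedge ::
    "('b \<Rightarrow> 'b \<Rightarrow> 'b::real_vector) \<Rightarrow> nat \<Rightarrow> nat \<Rightarrow> ('m, 'b) form \<Rightarrow> ('m, 'b) form \<Rightarrow> ('m, 'b) form" where
  "wedge m k l \<alpha> \<beta> = (\<lambda>p. alt_wedge m k l (\<alpha> p) (\<beta> p))"

text \<open>Exterior derivative, computed in a chart around the point; the result does not depend on the
  chart. The degree of \<open>\<alpha>\<close> is \<open>length Xs - 1\<close>.\<close>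

definition extd ::
    "('m::topological_space, 'n::finite) chart set \<Rightarrow> ('m, 'b::real_normed_vector) form \<Rightarrow> ('m, 'b) form" where
  "extd A \<alpha> p Xs =
     (let c = some_chart A p; us = map (coords c) Xs in
        \<Sum>i<length Xs. (- 1) ^ i *\<^sub>R
          frechet_derivative (form_component A c \<alpha> (take i us @ drop (Suc i) us)) (at (snd c p)) (us ! i))"

text \<open>The quotient \<open>\<mu> / \<nu>\<close> of top-degree forms at \<open>p\<close>.\<close>

definition top_ratio ::
    "('m::topological_space, 'n::finite) chart set \<Rightarrow> 'm \<Rightarrow> ('m tvec list \<Rightarrow> real) \<Rightarrow>
     ('m tvec list \<Rightarrow> real) \<Rightarrow> real" where
  "top_ratio A p \<mu> \<nu> =
     (THE r. \<forall>Xs. length Xs = CARD('n) \<and> set Xs \<subseteq> tangent A p \<longrightarrow> \<mu> Xs = r * \<nu> Xs)"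

definition positive_volume_form ::
    "('m::topological_space, 'n::{finite,comm_ring_1}) chart set \<Rightarrow> ('m, real) form \<Rightarrow> bool" where
  "positive_volume_form A v \<longleftrightarrow> is_form A CARD('n) v \<and>
     (\<forall>c\<in>A. \<forall>p\<in>fst c. v p (map (coord_vec A c p) std_basis) > 0)"


section \<open>Riemannian metrics and sectional curvature\<close>

definition metric_matrix ::
    "('m::topological_space, 'n::finite) chart set \<Rightarrow> ('m \<Rightarrow> 'm tvec \<Rightarrow> 'm tvec \<Rightarrow> real) \<Rightarrow>
     ('m, 'n) chart \<Rightarrow> real ^ 'n \<Rightarrow> real ^ 'n ^ 'n" where
  "metric_matrix A g c x = (let q = chart_inv c x in
     \<chi> i j. g q (coord_vec A c q (axis i 1)) (coord_vec A c q (axis j 1)))"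

definition riemannian_metric ::
    "('m::topological_space, 'n::finite) chart set \<Rightarrow> ('m \<Rightarrow> 'm tvec \<Rightarrow> 'm tvec \<Rightarrow> real) \<Rightarrow> bool" where
  "riemannian_metric A g \<longleftrightarrow>
     (\<forall>p. \<forall>X\<in>tangent A p. \<forall>Y\<in>tangent A p. \<forall>Z\<in>tangent A p. \<forall>r.
        g p X Y = g p Y X \<and>
        g p (tadd X Y) Z = g p X Z + g p Y Z \<and>
        g p (tscale r X) Y = r * g p X Y \<and>
        (X \<noteq> tzero \<longrightarrow> g p X X > 0)) \<and>
     (\<forall>c\<in>A. smooth_on (snd c ` fst c) (metric_matrix A g c))"

definition volume_form_of ::
    "('m::topological_space, 'n::{finite,comm_ring_1}) chart set \<Rightarrow>
     ('m \<Rightarrow> 'm tvec \<Rightarrow> 'm tvec \<Rightarrow> real) \<Rightarrow> ('m, real) form \<Rightarrow> bool" where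
  "volume_form_of A g v \<longleftrightarrow> is_form A CARD('n) v \<and>
     (\<forall>c\<in>A. \<forall>p\<in>fst c.
        v p (map (coord_vec A c p) std_basis) = sqrt (det (metric_matrix A g c (snd c p))))"

definition pd :: "'n::finite \<Rightarrow> (real ^ 'n \<Rightarrow> real) \<Rightarrow> real ^ 'n \<Rightarrow> real" where
  "pd i f x = frechet_derivative f (at x) (axis i 1)"

text \<open>\<open>christoffel A g c k i j\<close> is \<open>\<Gamma>\<^sup>k\<^sub>i\<^sub>j\<close> of the Levi-Civita connection, and
  \<open>curvature_tensor A g c l k i j\<close> is \<open>R\<^sup>l\<^sub>k\<^sub>i\<^sub>j\<close> with \<open>R(\<partial>\<^sub>i, \<partial>\<^sub>j) \<partial>\<^sub>k = R\<^sup>l\<^sub>k\<^sub>i\<^sub>j \<partial>\<^sub>l\<close>.\<close>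

definition christoffel ::
    "('m::topological_space, 'n::finite) chart set \<Rightarrow> ('m \<Rightarrow> 'm tvec \<Rightarrow> 'm tvec \<Rightarrow> real) \<Rightarrow>
     ('m, 'n) chart \<Rightarrow> 'n \<Rightarrow> 'n \<Rightarrow> 'n \<Rightarrow> real ^ 'n \<Rightarrow> real" where
  "christoffel A g c k i j x =
     (let G = metric_matrix A g c in
       (1 / 2) * (\<Sum>l\<in>UNIV. matrix_inv (G x) $ k $ l *
         (pd i (\<lambda>y. G y $ j $ l) x + pd j (\<lambda>y. G y $ i $ l) x - pd l (\<lambda>y. G y $ i $ j) x)))"

definition curvature_tensor ::
    "('m::topological_space, 'n::finite) chart set \<Rightarrow> ('m \<Rightarrow> 'm tvec \<Rightarrow> 'm tvec \<Rightarrow> real) \<Rightarrow>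
     ('m, 'n) chart \<Rightarrow> 'n \<Rightarrow> 'n \<Rightarrow> 'n \<Rightarrow> 'n \<Rightarrow> real ^ 'n \<Rightarrow> real" where
  "curvature_tensor A g c l k i j x =
     (let \<Gamma> = christoffel A g c in
       pd i (\<Gamma> l j k) x - pd j (\<Gamma> l i k) x +
       (\<Sum>m\<in>UNIV. \<Gamma> l i m x * \<Gamma> m j k x - \<Gamma> l j m x * \<Gamma> m i k x))"

text \<open>Sectional curvature \<open>g(R(u,w)w, u) / (g(u,u) g(w,w) - g(u,w)\<^sup>2)\<close> of the plane spanned by the
  vectors with coordinates \<open>u\<close>, \<open>w\<close>.\<close>

definition sectional_curvature ::
    "('m::topological_space, 'n::finite) chart set \<Rightarrow> ('m \<Rightarrow> 'm tvec \<Rightarrow> 'm tvec \<Rightarrow> real) \<Rightarrow>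
     ('m, 'n) chart \<Rightarrow> real ^ 'n \<Rightarrow> real ^ 'n \<Rightarrow> real ^ 'n \<Rightarrow> real" where
  "sectional_curvature A g c x u w =
     (let G = metric_matrix A g c x; ip = (\<lambda>a b. a \<bullet> (G *v b)) in
       (\<Sum>m\<in>UNIV. \<Sum>l\<in>UNIV. \<Sum>k\<in>UNIV. \<Sum>i\<in>UNIV. \<Sum>j\<in>UNIV.
          G $ m $ l * curvature_tensor A g c l k i j x * u $ i * w $ j * w $ k * u $ m) /
       (ip u u * ip w w - (ip u w)\<^sup>2))"

definition constant_negative_curvature ::
    "('m::topological_space, 'n::finite) chart set \<Rightarrow> ('m \<Rightarrow> 'm tvec \<Rightarrow> 'm tvec \<Rightarrow> real) \<Rightarrow> bool" where
  "constant_negative_curvature A g \<longleftrightarrow>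
     (\<exists>\<kappa><0. \<forall>c\<in>A. \<forall>x\<in>snd c ` fst c. \<forall>u w. u \<noteq> w \<and> independent {u, w} \<longrightarrow>
        sectional_curvature A g c x u w = \<kappa>)"


section \<open>\<open>SU(2)\<close> and its Lie algebra\<close>

type_synonym cmat = "complex ^ 2 ^ 2"

definition adjoint_mat :: "cmat \<Rightarrow> cmat" where
  "adjoint_mat a = (\<chi> i j. cnj (a $ j $ i))"

definition SU2 :: "cmat set" where
  "SU2 = {g. g ** adjoint_mat g = mat 1 \<and> det g = 1}"

definition su2 :: "cmat set" where
  "su2 = {a. adjoint_mat a = - a \<and> trace a = 0}"

definition pauli :: "3 \<Rightarrow> cmat" where
  "pauli i =
     (if i = 1 then vector [vector [0, 1], vector [1, 0]]
      else if i = 2 then vector [vector [0, - \<i>], vector [\<i>, 0]]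
      else vector [vector [1, 0], vector [0, - 1]])"

definition \<tau> :: "3 \<Rightarrow> cmat" where
  "\<tau> i = (\<chi> a b. - (\<i> / 2) * pauli i $ a $ b)"

text \<open>The trace of the matrix-valued forms considered here is real, so real forms are obtained by
  taking its real part.\<close>

definition form_tr :: "('m, cmat) form \<Rightarrow> ('m, real) form" where
  "form_tr \<alpha> = (\<lambda>p Xs. Re (trace (\<alpha> p Xs)))"

definition su2_inner :: "cmat \<Rightarrow> cmat \<Rightarrow> real" where
  "su2_inner a b = Re (- 2 * trace (a ** b))"

abbreviation mwedge :: "nat \<Rightarrow> nat \<Rightarrow> ('m, cmat) form \<Rightarrow> ('m, cmat) form \<Rightarrow> ('m, cmat) form" where
  "mwedge \<equiv> wedge (**)"


section \<open>Principal \<open>SU(2)\<close> bundles\<close>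

text \<open>\<open>AM\<close>, \<open>AP\<close> are the atlases of the base and the total space, \<open>pr\<close> is the projection and
  \<open>act\<close> the right action (relevant only on \<open>SU2\<close>).\<close>

definition local_trivialisation ::
    "('m::topological_space, 'n::finite) chart set \<Rightarrow> ('p::topological_space, 'k::finite) chart set \<Rightarrow>
     ('p \<Rightarrow> 'm) \<Rightarrow> ('p \<Rightarrow> cmat \<Rightarrow> 'p) \<Rightarrow> 'm set \<Rightarrow> ('p \<Rightarrow> cmat) \<Rightarrow> bool" where
  "local_trivialisation AM AP pr act U \<gamma> \<longleftrightarrow>
     open U \<and>
     bij_betw (\<lambda>p. (pr p, \<gamma> p)) (pr -` U) (U \<times> SU2) \<and>
     smooth_fun_on AP (pr -` U) \<gamma> \<and>
     smooth_on_product AM AP U SU2 (\<lambda>x g. inv_into (pr -` U) (\<lambda>p. (pr p, \<gamma> p)) (x, g)) \<and>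
     (\<forall>p\<in>pr -` U. \<forall>g\<in>SU2. \<gamma> (act p g) = \<gamma> p ** g)"

definition principal_SU2_bundle ::
    "('m::topological_space, 'n::finite) chart set \<Rightarrow> ('p::topological_space, 'k::finite) chart set \<Rightarrow>
     ('p \<Rightarrow> 'm) \<Rightarrow> ('p \<Rightarrow> cmat \<Rightarrow> 'p) \<Rightarrow> bool" where
  "principal_SU2_bundle AM AP pr act \<longleftrightarrow>
     smooth_map AP AM pr \<and>
     (\<forall>p. act p (mat 1) = p) \<and>
     (\<forall>p. \<forall>g\<in>SU2. \<forall>h\<in>SU2. act (act p g) h = act p (g ** h)) \<and>
     (\<forall>p. \<forall>g\<in>SU2. pr (act p g) = pr p) \<and>
     smooth_on_product AP AP UNIV SU2 act \<and>
     (\<forall>x. \<exists>U \<gamma>. x \<in> U \<and> local_trivialisation AM AP pr act U \<gamma>)"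

definition vertical ::
    "('m::topological_space, 'n::finite) chart set \<Rightarrow> ('p::topological_space, 'k::finite) chart set \<Rightarrow>
     ('p \<Rightarrow> 'm) \<Rightarrow> 'p \<Rightarrow> 'p tvec set" where
  "vertical AM AP pr p = {X \<in> tangent AP p. push AM pr p X = tzero}"

text \<open>The identification of vertical vectors with \<open>su(2)\<close>: \<open>X\<close> is the image of \<open>a\<close> under the
  differential at the identity of the orbit map \<open>g \<mapsto> p g\<close>.\<close>

definition generates ::
    "('p::topological_space, 'k::finite) chart set \<Rightarrow> ('p \<Rightarrow> cmat \<Rightarrow> 'p) \<Rightarrow> 'p \<Rightarrow> cmat \<Rightarrow> 'p tvec \<Rightarrow> bool" where
  "generates AP act p a X \<longleftrightarrow> X \<in> tangent AP p \<and>
     (\<exists>\<theta>. \<theta> 0 = mat 1 \<and> (\<forall>t. \<theta> t \<in> SU2) \<and> (\<theta> has_vector_derivative a) (at (0::real)) \<and>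
        (\<forall>f. smooth_at AP p f \<longrightarrow> ((\<lambda>t. f (act p (\<theta> t))) has_real_derivative X f) (at 0)))"

definition equivariant_form ::
    "('p::topological_space, 'k::finite) chart set \<Rightarrow> ('p \<Rightarrow> cmat \<Rightarrow> 'p) \<Rightarrow> nat \<Rightarrow> ('p, cmat) form \<Rightarrow> bool" where
  "equivariant_form AP act k \<alpha> \<longleftrightarrow>
     (\<forall>g\<in>SU2. form_eq AP k (pullback AP (\<lambda>p. act p g) \<alpha>) (\<lambda>p Xs. matrix_inv g ** \<alpha> p Xs ** g))"

definition su2_valued ::
    "('p::topological_space, 'k::finite) chart set \<Rightarrow> ('p, cmat) form \<Rightarrow> bool" where
  "su2_valued AP \<alpha> \<longleftrightarrow> (\<forall>p. \<forall>X\<in>tangent AP p. \<alpha> p [X] \<in> su2)"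

definition is_connection ::
    "('p::topological_space, 'k::finite) chart set \<Rightarrow> ('p \<Rightarrow> cmat \<Rightarrow> 'p) \<Rightarrow> ('p, cmat) form \<Rightarrow> bool" where
  "is_connection AP act W \<longleftrightarrow> is_form AP 1 W \<and> su2_valued AP W \<and> equivariant_form AP act 1 W \<and>
     (\<forall>p X. \<forall>a\<in>su2. generates AP act p a X \<longrightarrow> W p [X] = a)"

definition curvature ::
    "('p::topological_space, 'k::finite) chart set \<Rightarrow> ('p, cmat) form \<Rightarrow> ('p, cmat) form" where
  "curvature AP W = fadd (extd AP W) (mwedge 1 1 W W)"

definition cov_ext_deriv ::
    "('p::topological_space, 'k::finite) chart set \<Rightarrow> ('p, cmat) form \<Rightarrow> ('p, cmat) form \<Rightarrow> ('p, cmat) form" where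
  "cov_ext_deriv AP W E = fadd (extd AP E) (fadd (mwedge 1 1 W E) (mwedge 1 1 E W))"

definition chern_simons ::
    "('p::topological_space, 'k::finite) chart set \<Rightarrow> ('p, cmat) form \<Rightarrow> ('p, real) form" where
  "chern_simons AP W = form_tr
     (fadd (mwedge 1 2 W (extd AP W)) (fscale (\<lambda>p. 2 / 3) (mwedge 2 1 (mwedge 1 1 W W) W)))"

definition is_frame ::
    "('m::topological_space, 'n::finite) chart set \<Rightarrow> ('p::topological_space, 'k::finite) chart set \<Rightarrow>
     ('p \<Rightarrow> 'm) \<Rightarrow> ('p \<Rightarrow> cmat \<Rightarrow> 'p) \<Rightarrow> ('p, cmat) form \<Rightarrow> bool" where
  "is_frame AM AP pr act E \<longleftrightarrow> is_form AP 1 E \<and> su2_valued AP E \<and> equivariant_form AP act 1 E \<and>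
     (\<forall>p. \<forall>X\<in>vertical AM AP pr p. E p [X] = 0) \<and>
     (\<forall>p. \<exists>e. (\<forall>X\<in>tangent AP p. E p [X] = (\<Sum>i\<in>UNIV. e i X *\<^sub>R \<tau> i)) \<and>
        (\<forall>s::3 \<Rightarrow> real. (\<forall>X\<in>tangent AP p. (\<Sum>i\<in>UNIV. s i * e i X) = 0) \<longrightarrow> (\<forall>i. s i = 0)))"

definition metric_of_frame ::
    "('m::topological_space, 'n::finite) chart set \<Rightarrow> ('p::topological_space, 'k::finite) chart set \<Rightarrow>
     ('p \<Rightarrow> 'm) \<Rightarrow> ('p, cmat) form \<Rightarrow> ('m \<Rightarrow> 'm tvec \<Rightarrow> 'm tvec \<Rightarrow> real) \<Rightarrow> bool" where
  "metric_of_frame AM AP pr E g \<longleftrightarrow> riemannian_metric AM g \<and>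
     (\<forall>p. \<forall>X\<in>tangent AP p. \<forall>Y\<in>tangent AP p.
        g (pr p) (push AM pr p X) (push AM pr p Y) = su2_inner (E p [X]) (E p [Y]))"

definition orientation_compatible ::
    "('m::topological_space, 'n::{finite,comm_ring_1}) chart set \<Rightarrow>
     ('p::topological_space, 'k::finite) chart set \<Rightarrow> ('p \<Rightarrow> 'm) \<Rightarrow> ('p, cmat) form \<Rightarrow> bool" where
  "orientation_compatible AM AP pr E \<longleftrightarrow>
     (\<exists>\<mu>. positive_volume_form AM \<mu> \<and>
        form_eq AP 3 (pullback AM pr \<mu>)
          (fscale (\<lambda>p. - (2 / 3)) (form_tr (mwedge 2 1 (mwedge 1 1 E E) E))))"


section \<open>Stable 3-forms in six dimensions\<close>

text \<open>\<open>K_op A v0 \<Omega> p\<close> maps a covector \<open>\<alpha>\<close> at \<open>p\<close>, a function on tangent vectors, to the covector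
  \<open>\<xi> \<mapsto> \<alpha> \<and> i\<^sub>\<xi>\<Omega> \<and> \<Omega> / v\<^sub>0\<close>.\<close>

definition K_op ::
    "('p::topological_space, 6) chart set \<Rightarrow> ('p, real) form \<Rightarrow> ('p, real) form \<Rightarrow> 'p \<Rightarrow>
     ('p tvec \<Rightarrow> real) \<Rightarrow> 'p tvec \<Rightarrow> real" where
  "K_op A v0 \<Omega> p \<alpha> \<xi> =
     top_ratio A p
       (alt_wedge (*) 3 3 (alt_wedge (*) 1 2 (\<lambda>Ys. \<alpha> (hd Ys)) (\<lambda>Ys. \<Omega> p (\<xi> # Ys))) (\<Omega> p))
       (v0 p)"

text \<open>The trace of an endomorphism of the cotangent space at \<open>p\<close>, in the basis \<open>dx\<^sup>i\<close> of a chart.\<close>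

definition cotangent_trace ::
    "('p::topological_space, 'k::finite) chart set \<Rightarrow> 'p \<Rightarrow>
     (('p tvec \<Rightarrow> real) \<Rightarrow> 'p tvec \<Rightarrow> real) \<Rightarrow> real" where
  "cotangent_trace A p L = (let c = some_chart A p in
     \<Sum>i\<in>UNIV. L (\<lambda>X. coords c X $ i) (coord_vec A c p (axis i 1)))"

definition lambda_of ::
    "('p::topological_space, 6) chart set \<Rightarrow> ('p, real) form \<Rightarrow> ('p, real) form \<Rightarrow> 'p \<Rightarrow> real" where
  "lambda_of A v0 \<Omega> p = (1 / 6) * cotangent_trace A p (K_op A v0 \<Omega> p \<circ> K_op A v0 \<Omega> p)"

definition stable_negative ::
    "('p::topological_space, 6) chart set \<Rightarrow> ('p, real) form \<Rightarrow> ('p, real) form \<Rightarrow> bool" where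
  "stable_negative A v0 \<Omega> \<longleftrightarrow> (\<forall>p. lambda_of A v0 \<Omega> p < 0)"

definition covector ::
    "('p::topological_space, 'k::finite) chart set \<Rightarrow> 'p \<Rightarrow> ('p tvec \<Rightarrow> real) \<Rightarrow> bool" where
  "covector A p \<alpha> \<longleftrightarrow> (\<forall>X\<in>tangent A p. \<forall>Y\<in>tangent A p. \<forall>r.
     \<alpha> (tadd X Y) = \<alpha> X + \<alpha> Y \<and> \<alpha> (tscale r X) = r * \<alpha> X)"

definition J_cotangent ::
    "('p::topological_space, 6) chart set \<Rightarrow> ('p, real) form \<Rightarrow> ('p, real) form \<Rightarrow> 'p \<Rightarrow>
     ('p tvec \<Rightarrow> real) \<Rightarrow> 'p tvec \<Rightarrow> real" where
  "J_cotangent A v0 \<Omega> p \<alpha> X = K_op A v0 \<Omega> p \<alpha> X / sqrt (- lambda_of A v0 \<Omega> p)"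

definition J_of ::
    "('p::topological_space, 6) chart set \<Rightarrow> ('p, real) form \<Rightarrow> ('p, real) form \<Rightarrow> 'p \<Rightarrow>
     'p tvec \<Rightarrow> 'p tvec" where
  "J_of A v0 \<Omega> p X =
     (THE Y. Y \<in> tangent A p \<and> (\<forall>\<alpha>. covector A p \<alpha> \<longrightarrow> \<alpha> Y = J_cotangent A v0 \<Omega> p \<alpha> X))"

definition hat ::
    "('p::topological_space, 6) chart set \<Rightarrow> ('p, real) form \<Rightarrow> ('p, real) form \<Rightarrow> ('p, real) form" where
  "hat A v0 \<Omega> = (\<lambda>p Xs. - \<Omega> p (map (J_of A v0 \<Omega> p) Xs))"

definition negative_definite ::
    "('p::topological_space, 6) chart set \<Rightarrow> ('p, real) form \<Rightarrow> ('p, cmat) form \<Rightarrow> bool" where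
  "negative_definite AP v0 W \<longleftrightarrow> stable_negative AP v0 (chern_simons AP W)"


section \<open>Connection and metric defined by an invariant almost-complex structure\<close>

definition almost_complex_structure ::
    "('p::topological_space, 'k::finite) chart set \<Rightarrow> ('p \<Rightarrow> 'p tvec \<Rightarrow> 'p tvec) \<Rightarrow> bool" where
  "almost_complex_structure A J \<longleftrightarrow>
     (\<forall>p. \<forall>X\<in>tangent A p. \<forall>Y\<in>tangent A p. \<forall>r.
        J p X \<in> tangent A p \<and> J p (tadd X Y) = tadd (J p X) (J p Y) \<and>
        J p (tscale r X) = tscale r (J p X) \<and> J p (J p X) = tscale (- 1) X) \<and>
     (\<forall>c\<in>A. \<forall>u. smooth_on (snd c ` fst c)
        (\<lambda>x. coords c (J (chart_inv c x) (coord_vec A c (chart_inv c x) u))))"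

definition admissible_acs ::
    "('m::topological_space, 'n::finite) chart set \<Rightarrow> ('p::topological_space, 'k::finite) chart set \<Rightarrow>
     ('p \<Rightarrow> 'm) \<Rightarrow> ('p \<Rightarrow> cmat \<Rightarrow> 'p) \<Rightarrow> ('p \<Rightarrow> 'p tvec \<Rightarrow> 'p tvec) \<Rightarrow> bool" where
  "admissible_acs AM AP pr act J \<longleftrightarrow> almost_complex_structure AP J \<and>
     (\<forall>g\<in>SU2. \<forall>p. \<forall>X\<in>tangent AP p.
        push AP (\<lambda>q. act q g) p (J p X) = J (act p g) (push AP (\<lambda>q. act q g) p X)) \<and>
     (\<forall>p. J p ` vertical AM AP pr p \<inter> vertical AM AP pr p = {tzero})"

definition connection_defined_by ::
    "('m::topological_space, 'n::finite) chart set \<Rightarrow> ('p::topological_space, 'k::finite) chart set \<Rightarrow>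
     ('p \<Rightarrow> 'm) \<Rightarrow> ('p \<Rightarrow> cmat \<Rightarrow> 'p) \<Rightarrow> ('p \<Rightarrow> 'p tvec \<Rightarrow> 'p tvec) \<Rightarrow> ('p, cmat) form \<Rightarrow> bool" where
  "connection_defined_by AM AP pr act J A \<longleftrightarrow>
     admissible_acs AM AP pr act J \<and> is_connection AP act A \<and>
     (\<forall>p. {X \<in> tangent AP p. A p [X] = 0} = J p ` vertical AM AP pr p)"

text \<open>Horizontal lifts are the vectors of \<open>J(V)\<close>, so the metric is prescribed by its values on
  projections of vectors of \<open>J(V)\<close>.\<close>

definition metric_defined_by ::
    "('m::topological_space, 'n::finite) chart set \<Rightarrow> ('p::topological_space, 'k::finite) chart set \<Rightarrow>
     ('p \<Rightarrow> 'm) \<Rightarrow> ('p \<Rightarrow> cmat \<Rightarrow> 'p) \<Rightarrow> ('p \<Rightarrow> 'p tvec \<Rightarrow> 'p tvec) \<Rightarrow>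
     ('m \<Rightarrow> 'm tvec \<Rightarrow> 'm tvec \<Rightarrow> real) \<Rightarrow> bool" where
  "metric_defined_by AM AP pr act J g \<longleftrightarrow>
     admissible_acs AM AP pr act J \<and> riemannian_metric AM g \<and>
     (\<forall>p. \<forall>X\<in>J p ` vertical AM AP pr p. \<forall>Y\<in>J p ` vertical AM AP pr p. \<forall>a\<in>su2. \<forall>b\<in>su2.
        generates AP act p a (J p X) \<and> generates AP act p b (J p Y) \<longrightarrow>
        g (pr p) (push AM pr p X) (push AM pr p Y) = su2_inner a b)"

end

theory Submission
  imports Defs
begin

text \<open>The connection and the frame give a coframe \<open>(w, e)\<close> of \<open>P\<close> with values in \<open>\<real>\<^sup>3 \<oplus> \<real>\<^sup>3\<close>, where
  \<open>su(2)\<close> is identified with \<open>\<real>\<^sup>3\<close> and its bracket with the cross product. In this coframe, \<open>2\<Omega>\<close> is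
  \<open>www - (wee + ewe + eew) + 2\<rho> eee\<close> in terms of triple products, so \<open>K\<^sub>\<Omega>\<close>, \<open>\<lambda>(\<Omega>)\<close> and
  \<open>J\<^sub>\<Omega>\<close> are computed by linear algebra: \<open>\<lambda>\<close> is a positive multiple of \<open>\<rho>\<^sup>2 - 1\<close>, and \<open>J\<close> maps \<open>w, e\<close> to
  \<open>\<epsilon>(\<rho>w - e)/\<surd>(1 - \<rho>\<^sup>2)\<close>, \<open>\<epsilon>(w - \<rho>e)/\<surd>(1 - \<rho>\<^sup>2)\<close> with a locally constant sign \<open>\<epsilon>\<close>. The vectors of \<open>J(V)\<close> are
  those with \<open>w = \<rho>e\<close>, which gives the connection and the metric. The Bianchi identity for \<open>F(W) = E \<and> E\<close>
  makes the torsion \<open>T = \<nabla>\<^sub>W E\<close> horizontal, and the component of \<open>d(hat \<Omega>)\<close> of vertical degree 3 is a nonzero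
  multiple of \<open>d\<rho> \<and> www\<close>, while the one of vertical degree 2 is then a multiple of \<open>(T - 2\<rho> e \<times> e) \<and> ww\<close>; the
  remaining components vanish as soon as these two do. For constant \<open>\<rho>\<close> the connection \<open>W - \<rho>E\<close> is
  torsion-free, hence the Levi-Civita connection, with curvature \<open>(1 - \<rho>\<^sup>2) e \<times> e\<close>.\<close>

text \<open>Forms and vectors are only meaningful on tangent spaces, and \<open>extd\<close> works
  in a chart that may jump from point to point. Derivatives are therefore taken along smooth
  parametrisations: inverse charts of P, and local sections of P composed with inverse charts of M.
  Pull-back of 1-forms commutes with d because second derivatives are symmetric, so the chart choice
  drops out. The definite descriptions \<open>top_ratio\<close> and \<open>J_of\<close> are
  evaluated by exhibiting a candidate; uniqueness comes from nonvanishing volume forms and from the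
  coframe, which separates tangent vectors. The sign \<epsilon> compares the coframe with
  \<open>v0\<close>: nothing relates these two orientations beforehand, so its constancy along
  charts and along fibres needs an argument of its own. The factor 1/2 in \<Omega> comes from the
  trace of products of the \<tau> matrices; the coefficient \<rho> of eee is undivided because v
  pulls back to the triple product of e. Mixed cubic identities are read off from the one for www by
  replacing w with w + z e and comparing powers of z.\<close>

section \<open>Closure properties of iterated directional derivatives\<close>

lemma Ck_on_cong:
  assumes "open S" "\<And>x. x \<in> S \<Longrightarrow> f x = g x" "Ck_on k S f"
  shows "Ck_on k S g"
  using assms(2,3)
proof (induction k arbitrary: f g)
  case 0
  then show ?case using continuous_on_cong by force
next
  case (Suc k)
  have fg: "frechet_derivative g (at x) = frechet_derivative f (at x) \<and> g differentiable (at x)" if "x \<in> S" for x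
  proof -
    have "f differentiable (at x)" using Suc.prems that by simp
    then have "(f has_derivative frechet_derivative f (at x)) (at x)"
      by (simp add: frechet_derivative_works)
    then have "(g has_derivative frechet_derivative f (at x)) (at x)"
      by (rule has_derivative_transform_within_open[OF _ assms(1) that]) (use Suc.prems in auto)
    then show ?thesis by (metis frechet_derivative_at differentiable_def)
  qed
  show ?case
    using Suc.prems fg Suc.IH[of "\<lambda>x. frechet_derivative f (at x) u" "\<lambda>x. frechet_derivative g (at x) u" for u]
    by simp
qed

lemma Ck_on_subset:
  assumes "Ck_on k S f" "T \<subseteq> S"
  shows "Ck_on k T f"
  using assms
proof (induction k arbitrary: f)
  case (Suc k)
  then show ?case by (simp add: subset_iff)
qed (simp add: continuous_on_subset)

lemma Ck_on_imp_continuous_on: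
  assumes "Ck_on k S f"
  shows "continuous_on S f"
proof (cases k)
  case (Suc l)
  then have "f differentiable (at x)" if "x \<in> S" for x using assms that by simp
  then show ?thesis by (intro continuous_at_imp_continuous_on ballI differentiable_imp_continuous_within)
qed (use assms in simp)

lemma Ck_on_Suc_imp: "Ck_on (Suc k) S f \<Longrightarrow> Ck_on k S f"
proof (induction k arbitrary: f)
  case 0
  then show ?case using Ck_on_imp_continuous_on[OF 0] by simp
next
  case (Suc k)
  have a: "\<forall>x\<in>S. f differentiable at x" and b: "\<And>u. Ck_on (Suc k) S (\<lambda>x. frechet_derivative f (at x) u)"
    using Suc.prems by (subst (asm) Ck_on.simps(2), blast)+
  show ?case
    by (subst Ck_on.simps(2)) (use a Suc.IH[OF b] in blast)
qed

text \<open>Derivatives in \<open>Ck_on\<close> are taken \<open>at x\<close> and not within S, so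
  every clause sees only a neighbourhood of the point.\<close>

lemma Ck_on_local:
  assumes "\<And>x. x \<in> S \<Longrightarrow> \<exists>N. open N \<and> x \<in> N \<and> Ck_on k N f"
  shows "Ck_on k S f"
  using assms
proof (induction k arbitrary: f)
  case 0
  have "continuous (at x within S) f" if x: "x \<in> S" for x
  proof -
    obtain N where "open N" "x \<in> N" "continuous_on N f" using 0[OF x] by auto
    then show ?thesis using continuous_at_imp_continuous_at_within continuous_on_eq_continuous_at by blast
  qed
  then show ?case by (simp add: continuous_on_eq_continuous_within)
next
  case (Suc k)
  have "f differentiable at x" if x: "x \<in> S" for x
    using Suc.prems[OF x] by auto
  moreover have "Ck_on k S (\<lambda>x. frechet_derivative f (at x) u)" for u
    by (rule Suc.IH) (use Suc.prems in fastforce)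
  ultimately show ?case by simp
qed

lemma Ck_on_const: "Ck_on k S (\<lambda>x. c)"
  by (induction k arbitrary: c) simp_all

lemma Ck_on_bounded_linear_comp:
  assumes "bounded_linear h" "open S" "Ck_on k S f"
  shows "Ck_on k S (\<lambda>x. h (f x))"
  using assms(3)
proof (induction k arbitrary: f)
  case 0
  then show ?case using assms(1) by (auto intro: bounded_linear.continuous_on)
next
  case (Suc k)
  have d: "((\<lambda>x. h (f x)) has_derivative (\<lambda>u. h (frechet_derivative f (at x) u))) (at x)" if "x \<in> S" for x
    using Suc.prems that by (intro bounded_linear.has_derivative[OF assms(1)]) (simp add: frechet_derivative_works[symmetric])
  have "Ck_on k S (\<lambda>x. frechet_derivative (\<lambda>x. h (f x)) (at x) u)" for u
  proof (rule Ck_on_cong[OF assms(2)])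
    show "Ck_on k S (\<lambda>x. h (frechet_derivative f (at x) u))" using Suc by auto
    show "h (frechet_derivative f (at x) u) = frechet_derivative (\<lambda>x. h (f x)) (at x) u" if "x \<in> S" for x
      using frechet_derivative_at[OF d[OF that]] by metis
  qed
  with d show ?case by (auto simp: differentiable_def)
qed

lemma Ck_on_add:
  assumes S: "open S" and "Ck_on k S F" "Ck_on k S G"
  shows "Ck_on k S (\<lambda>x. F x + G x)"
  using assms(2,3)
proof (induction k arbitrary: F G)
  case 0
  then show ?case by (simp add: continuous_on_add)
next
  case (Suc k)
  have d: "((\<lambda>x. F x + G x) has_derivative (\<lambda>u. frechet_derivative F (at x) u + frechet_derivative G (at x) u)) (at x)" if "x \<in> S" for x
    using Suc.prems that by (intro has_derivative_add) (simp_all add: frechet_derivative_works[symmetric])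
  have "Ck_on k S (\<lambda>x. frechet_derivative (\<lambda>x. F x + G x) (at x) u)" for u
  proof (rule Ck_on_cong[OF S])
    show "Ck_on k S (\<lambda>x. frechet_derivative F (at x) u + frechet_derivative G (at x) u)" using Suc by simp
    show "frechet_derivative F (at x) u + frechet_derivative G (at x) u = frechet_derivative (\<lambda>x. F x + G x) (at x) u" if "x \<in> S" for x
      using frechet_derivative_at[OF d[OF that]] by metis
  qed
  with d show ?case by (auto simp: differentiable_def)
qed

text \<open>Leibniz gives two products with one factor differentiated; the other factor keeps the
  lower order by \<open>Ck_on_Suc_imp\<close>, so the induction hypothesis covers both.\<close>

lemma Ck_on_bilinear:
  assumes B: "bounded_bilinear B" and S: "open S" and "Ck_on k S f" "Ck_on k S g"
  shows "Ck_on k S (\<lambda>x. B (f x) (g x))"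
  using assms(3,4)
proof (induction k arbitrary: f g)
  case 0
  then show ?case using B by (simp add: bounded_bilinear.continuous_on)
next
  case (Suc k)
  have d: "((\<lambda>x. B (f x) (g x)) has_derivative (\<lambda>u. B (f x) (frechet_derivative g (at x) u) + B (frechet_derivative f (at x) u) (g x))) (at x)" if "x \<in> S" for x
    using Suc.prems that by (intro bounded_bilinear.FDERIV[OF B]) (simp_all add: frechet_derivative_works[symmetric])
  have "Ck_on k S (\<lambda>x. frechet_derivative (\<lambda>x. B (f x) (g x)) (at x) u)" for u
  proof (rule Ck_on_cong[OF S])
    show "Ck_on k S (\<lambda>x. B (f x) (frechet_derivative g (at x) u) + B (frechet_derivative f (at x) u) (g x))"
      using Suc.prems[THEN Ck_on_Suc_imp] Suc.prems[unfolded Ck_on.simps(2)]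
      by (intro Ck_on_add S Suc.IH) blast+
    show "B (f x) (frechet_derivative g (at x) u) + B (frechet_derivative f (at x) u) (g x) = frechet_derivative (\<lambda>x. B (f x) (g x)) (at x) u" if "x \<in> S" for x
      using frechet_derivative_at[OF d[OF that]] by metis
  qed
  with d show ?case by (auto simp: differentiable_def)
qed

lemma Ck_on_sum:
  assumes "open S" "\<And>i. i \<in> I \<Longrightarrow> Ck_on k S (f i)"
  shows "Ck_on k S (\<lambda>x. \<Sum>i\<in>I. f i x)"
  using assms(2)
proof (induction I rule: infinite_finite_induct)
  case (insert a I)
  then show ?case using Ck_on_add[OF assms(1), of k "f a" "\<lambda>x. sum (\<lambda>i. f i x) I"] by simp
qed (simp_all add: Ck_on_const)

text \<open>In the chain rule the direction of differentiation of f depends on x, which the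
  induction hypothesis does not allow. Expanding that direction in \<open>Basis\<close> leaves a
  finite sum of scalar functions times derivatives of f in fixed directions.\<close>

lemma Ck_on_compose:
  fixes g :: "'a::real_normed_vector \<Rightarrow> 'b::euclidean_space"
  assumes S: "open S" and T: "g ` S \<subseteq> T" and "Ck_on k T f" "Ck_on k S g"
  shows "Ck_on k S (\<lambda>x. f (g x))"
  using assms(3,4)
proof (induction k arbitrary: f)
  case 0
  then show ?case using T by (auto intro: continuous_on_compose2)
next
  case (Suc k)
  have d: "((\<lambda>x. f (g x)) has_derivative (\<lambda>u. frechet_derivative f (at (g x)) (frechet_derivative g (at x) u))) (at x)" if "x \<in> S" for x
    using Suc.prems that T by (intro has_derivative_compose[of g _ _ _ f]) (auto simp add: frechet_derivative_works[symmetric])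
  have "Ck_on k S (\<lambda>x. frechet_derivative (\<lambda>x. f (g x)) (at x) u)" for u
  proof (rule Ck_on_cong[OF S])
    show "Ck_on k S (\<lambda>x. \<Sum>b\<in>Basis. (frechet_derivative g (at x) u \<bullet> b) *\<^sub>R frechet_derivative f (at (g x)) b)"
      using Suc.prems(2)[THEN Ck_on_Suc_imp] Suc.prems[unfolded Ck_on.simps(2)]
      by (intro Ck_on_sum S Ck_on_bilinear[OF bounded_bilinear_scaleR S] Ck_on_bounded_linear_comp[OF bounded_linear_inner_left S] Suc.IH) blast+
    show "(\<Sum>b\<in>Basis. (frechet_derivative g (at x) u \<bullet> b) *\<^sub>R frechet_derivative f (at (g x)) b) = frechet_derivative (\<lambda>x. f (g x)) (at x) u" if "x \<in> S" for x
    proof -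
      have lin: "linear (frechet_derivative f (at (g x)))"
        using Suc.prems T that by (intro linear_frechet_derivative) auto
      have "frechet_derivative (\<lambda>x. f (g x)) (at x) u = frechet_derivative f (at (g x)) (frechet_derivative g (at x) u)"
        using frechet_derivative_at[OF d[OF that]] by metis
      also have "\<dots> = frechet_derivative f (at (g x)) (\<Sum>b\<in>Basis. (frechet_derivative g (at x) u \<bullet> b) *\<^sub>R b)"
        by (simp add: euclidean_representation)
      also have "\<dots> = (\<Sum>b\<in>Basis. (frechet_derivative g (at x) u \<bullet> b) *\<^sub>R frechet_derivative f (at (g x)) b)"
        by (simp add: linear_sum[OF lin] linear_cmul[OF lin])
      finally show ?thesis by simp
    qed
  qed
  with d show ?case by (auto simp: differentiable_def)
qed

text \<open>The derivative is a product of copies of \<open>inverse\<close> itself, so the induction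
  feeds on its own conclusion.\<close>

lemma Ck_on_inverse: "Ck_on k {x. x \<noteq> 0} (inverse :: real \<Rightarrow> real)"
proof (induction k)
  case 0
  show ?case by (auto intro!: continuous_intros)
next
  case (Suc k)
  have S: "open {x::real. x \<noteq> 0}" by (simp add: open_Collect_neq)
  have d: "(inverse has_derivative (\<lambda>u. - (inverse x * u * inverse x))) (at x)" if "x \<noteq> 0" for x :: real
    using that by (auto intro!: derivative_eq_intros)
  have "Ck_on k {x. x \<noteq> 0} (\<lambda>x. frechet_derivative inverse (at x) u)" for u :: real
  proof (rule Ck_on_cong[OF S])
    show "Ck_on k {x. x \<noteq> 0} (\<lambda>x. (-u) * (inverse x * inverse x))"
      by (intro Ck_on_bilinear[OF bounded_bilinear_mult S] Ck_on_const Suc)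
    show "(-u) * (inverse x * inverse x) = frechet_derivative inverse (at x) u" if "x \<in> {x. x \<noteq> 0}" for x
      using fun_cong[OF frechet_derivative_at[OF d[of x]], of u] that by (simp add: ac_simps)
  qed
  with d show ?case by (auto simp: differentiable_def)
qed

text \<open>The derivative is a constant times \<open>inverse\<close> composed with
  \<open>sqrt\<close>, so the lower-order claim for \<open>sqrt\<close> is all that the composition
  rule asks for.\<close>

lemma Ck_on_sqrt: "Ck_on k {x. x > 0} sqrt"
proof (induction k)
  case 0
  show ?case by (auto intro!: continuous_intros)
next
  case (Suc k)
  have S: "open {x::real. x > 0}" by (simp add: open_Collect_less)
  have d: "(sqrt has_derivative (\<lambda>u. u * (inverse (sqrt x) / 2))) (at x)" if "x > 0" for x :: real
    by (rule has_derivative_eq_rhs[OF DERIV_real_sqrt[OF that, unfolded has_field_derivative_def]])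
       (simp add: fun_eq_iff)
  have "Ck_on k {x. x > 0} (\<lambda>x. frechet_derivative sqrt (at x) u)" for u :: real
  proof (rule Ck_on_cong[OF S])
    show "Ck_on k {x. x > 0} (\<lambda>x. (u / 2) * inverse (sqrt x))"
      by (intro Ck_on_bilinear[OF bounded_bilinear_mult S] Ck_on_const Ck_on_compose[OF S _ Ck_on_inverse Suc]) auto
    show "(u / 2) * inverse (sqrt x) = frechet_derivative sqrt (at x) u" if "x \<in> {x. x > 0}" for x
      using fun_cong[OF frechet_derivative_at[OF d[of x]], of u] that by (simp add: field_simps)
  qed
  with d show ?case by (auto simp: differentiable_def)
qed

subsection \<open>Closure properties of smooth functions\<close>

lemma smooth_on_Ck: "smooth_on S f \<Longrightarrow> Ck_on k S f"
  by (simp add: smooth_on_def)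

lemma smooth_on_cong: "smooth_on S f \<Longrightarrow> open S \<Longrightarrow> (\<And>x. x \<in> S \<Longrightarrow> f x = g x) \<Longrightarrow> smooth_on S g"
  unfolding smooth_on_def by (blast intro: Ck_on_cong[of S f g])

lemma smooth_on_subset: "smooth_on S f \<Longrightarrow> T \<subseteq> S \<Longrightarrow> smooth_on T f"
  unfolding smooth_on_def by (blast intro: Ck_on_subset[of _ S f T])

lemma smooth_on_local:
  assumes "\<And>x. x \<in> S \<Longrightarrow> \<exists>N. open N \<and> x \<in> N \<and> smooth_on N f"
  shows "smooth_on S f"
  unfolding smooth_on_def using assms by (auto intro!: Ck_on_local dest: smooth_on_Ck)

lemma smooth_on_const: "smooth_on S (\<lambda>x. c)"
  by (simp add: smooth_on_def Ck_on_const)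

lemma smooth_on_imp_differentiable: "smooth_on S f \<Longrightarrow> x \<in> S \<Longrightarrow> f differentiable (at x)"
  using smooth_on_Ck[of S f "Suc 0"] by simp

lemma smooth_on_imp_continuous_on: "smooth_on S f \<Longrightarrow> continuous_on S f"
  using smooth_on_Ck[of S f 0] by simp

lemma smooth_on_frechet:
  assumes "smooth_on S f"
  shows "smooth_on S (\<lambda>x. frechet_derivative f (at x) u)"
proof -
  have "Ck_on k S (\<lambda>x. frechet_derivative f (at x) u)" for k
    using smooth_on_Ck[OF assms, of "Suc k"] by simp
  then show ?thesis by (simp add: smooth_on_def)
qed

lemma smooth_on_bounded_linear_comp:
  "bounded_linear h \<Longrightarrow> open S \<Longrightarrow> smooth_on S f \<Longrightarrow> smooth_on S (\<lambda>x. h (f x))"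
  by (simp add: smooth_on_def Ck_on_bounded_linear_comp)

lemma smooth_on_bilinear:
  "bounded_bilinear B \<Longrightarrow> open S \<Longrightarrow> smooth_on S f \<Longrightarrow> smooth_on S g \<Longrightarrow> smooth_on S (\<lambda>x. B (f x) (g x))"
  by (simp add: smooth_on_def Ck_on_bilinear)

lemma smooth_on_compose:
  fixes g :: "'a::real_normed_vector \<Rightarrow> 'b::euclidean_space"
  shows "smooth_on T f \<Longrightarrow> smooth_on S g \<Longrightarrow> open S \<Longrightarrow> g ` S \<subseteq> T \<Longrightarrow> smooth_on S (\<lambda>x. f (g x))"
  by (simp add: smooth_on_def Ck_on_compose)

lemma smooth_on_add:
  assumes "open S" "smooth_on S f" "smooth_on S g"
  shows "smooth_on S (\<lambda>x. f x + g x)"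
  using assms by (simp add: smooth_on_def Ck_on_add)

lemma smooth_on_sum:
  "open S \<Longrightarrow> (\<And>i. i \<in> I \<Longrightarrow> smooth_on S (f i)) \<Longrightarrow> smooth_on S (\<lambda>x. \<Sum>i\<in>I. f i x)"
  by (simp add: smooth_on_def Ck_on_sum)

lemma smooth_on_mult:
  fixes f g :: "_ \<Rightarrow> real"
  shows "open S \<Longrightarrow> smooth_on S f \<Longrightarrow> smooth_on S g \<Longrightarrow> smooth_on S (\<lambda>x. f x * g x)"
  by (rule smooth_on_bilinear[OF bounded_bilinear_mult])

lemma smooth_on_scaleR:
  "open S \<Longrightarrow> smooth_on S f \<Longrightarrow> smooth_on S g \<Longrightarrow> smooth_on S (\<lambda>x. f x *\<^sub>R g x)"
  by (rule smooth_on_bilinear[OF bounded_bilinear_scaleR])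

lemma smooth_on_minus: "open S \<Longrightarrow> smooth_on S f \<Longrightarrow> smooth_on S (\<lambda>x. - f x)"
  by (rule smooth_on_bounded_linear_comp[OF bounded_linear_minus[OF bounded_linear_ident]])

lemma smooth_on_diff: "open S \<Longrightarrow> smooth_on S f \<Longrightarrow> smooth_on S g \<Longrightarrow> smooth_on S (\<lambda>x. f x - g x)"
  using smooth_on_add[of S f "\<lambda>x. - g x"] smooth_on_minus[of S g] by simp

lemma smooth_on_prod:
  fixes f :: "_ \<Rightarrow> _ \<Rightarrow> real"
  assumes "open S" "\<And>i. i \<in> I \<Longrightarrow> smooth_on S (f i)"
  shows "smooth_on S (\<lambda>x. \<Prod>i\<in>I. f i x)"
  using assms(2)
  by (induction I rule: infinite_finite_induct) (simp_all add: smooth_on_const smooth_on_mult[OF assms(1)])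

lemma smooth_on_divide:
  fixes f g :: "_ \<Rightarrow> real"
  assumes "open S" "smooth_on S f" "smooth_on S g" "\<And>x. x \<in> S \<Longrightarrow> g x \<noteq> 0"
  shows "smooth_on S (\<lambda>x. f x / g x)"
proof -
  have "smooth_on {x::real. x \<noteq> 0} inverse" using Ck_on_inverse by (simp add: smooth_on_def)
  then have "smooth_on S (\<lambda>x. inverse (g x))" by (rule smooth_on_compose) (use assms in auto)
  then show ?thesis using smooth_on_mult[OF assms(1,2)] by (simp add: divide_inverse)
qed

lemma smooth_on_sqrt:
  assumes "open S" "smooth_on S g" "\<And>x. x \<in> S \<Longrightarrow> g x > 0"
  shows "smooth_on S (\<lambda>x. sqrt (g x))"
proof -
  have "smooth_on {x::real. x > 0} sqrt" using Ck_on_sqrt by (simp add: smooth_on_def)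
  then show ?thesis by (rule smooth_on_compose) (use assms in auto)
qed

lemma smooth_on_vec_nth: "open S \<Longrightarrow> smooth_on S f \<Longrightarrow> smooth_on S (\<lambda>x. f x $ i)"
  by (rule smooth_on_bounded_linear_comp[OF bounded_linear_vec_nth])

text \<open>Each \<open>axis i\<close> is a norm-preserving linear embedding, so a vector-valued
  function is a finite sum of bounded linear images of its components.\<close>

lemma smooth_on_vec:
  fixes f :: "_ \<Rightarrow> 'b::real_normed_vector ^ 'n"
  assumes "open S" "\<And>i. smooth_on S (\<lambda>x. f x $ i)"
  shows "smooth_on S f"
proof -
  have b: "bounded_linear (axis i :: 'b \<Rightarrow> 'b ^ 'n)" for i
    by (rule bounded_linear_intro[where K=1])
       (simp_all add: axis_def vec_eq_iff norm_vec_def L2_set_def if_distrib[of norm] if_distrib[of "\<lambda>x. x\<^sup>2"] cong: if_cong)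
  have "f x = (\<Sum>i\<in>UNIV. axis i (f x $ i))" for x
    by (simp add: vec_eq_iff axis_def if_distrib cong: if_cong)
  moreover have "smooth_on S (\<lambda>x. \<Sum>i\<in>UNIV. axis i (f x $ i))"
    by (intro smooth_on_sum assms smooth_on_bounded_linear_comp[OF b])
  ultimately show ?thesis by presburger
qed

lemma smooth_on_ident: "smooth_on S (\<lambda>x. x)"
proof -
  have "Ck_on k S (\<lambda>x. x)" for k by (cases k) (auto simp: Ck_on_const)
  then show ?thesis by (simp add: smooth_on_def)
qed

lemma smooth_on_bounded_linear: "open S \<Longrightarrow> bounded_linear h \<Longrightarrow> smooth_on S h"
  using smooth_on_bounded_linear_comp[OF _ _ smooth_on_ident, of h S] by simp

lemma smooth_on_det:
  fixes M :: "_ \<Rightarrow> real ^ 'n ^ 'n"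
  assumes "open S" "\<And>i j. smooth_on S (\<lambda>x. M x $ i $ j)"
  shows "smooth_on S (\<lambda>x. det (M x))"
  unfolding det_def by (intro smooth_on_sum smooth_on_mult smooth_on_const smooth_on_prod assms)

text \<open>Cramer's rule writes the solution as a quotient of determinants. It yields smoothness of
  Christoffel symbols and of vector fields known through their coframe values.\<close>

lemma smooth_on_linear_solve:
  fixes M :: "_ \<Rightarrow> real ^ 'n ^ 'n"
  assumes S: "open S" "\<And>i j. smooth_on S (\<lambda>x. M x $ i $ j)" "\<And>i. smooth_on S (\<lambda>x. b x $ i)"
    and "\<And>x. x \<in> S \<Longrightarrow> det (M x) \<noteq> 0" "\<And>x. x \<in> S \<Longrightarrow> M x *v y x = b x"
  shows "smooth_on S y"
proof (rule smooth_on_vec[OF S(1)])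
  fix k
  have "smooth_on S (\<lambda>x. (\<chi> i j. if j = k then b x $ i else M x $ i $ j) $ i $ j)" for i j
    by (cases "j = k") (simp_all add: S)
  then have "smooth_on S (\<lambda>x. det (\<chi> i j. if j = k then b x $ i else M x $ i $ j) / det (M x))"
    by (intro smooth_on_divide smooth_on_det) (simp_all add: S assms(4))
  then show "smooth_on S (\<lambda>x. y x $ k)"
  proof (rule smooth_on_cong[OF _ S(1)])
    fix x assume "x \<in> S"
    then show "det (\<chi> i j. if j = k then b x $ i else M x $ i $ j) / det (M x) = y x $ k"
      using cramer[of "M x" "y x" "b x"] assms(4,5) by simp
  qed
qed

lemmas smooth_on_has_derivative =
  smooth_on_imp_differentiable[THEN frechet_derivative_works[THEN iffD1]]

subsection \<open>Symmetry of second derivatives\<close>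

text \<open>Mean value theorem twice: along u for the difference of f between two lines a step r v
  apart, then along v for the derivative of f in the direction u.\<close>

lemma second_difference_mvt:
  fixes f :: "'a::real_normed_vector \<Rightarrow> real"
  assumes "r > 0" "\<And>s t. \<bar>s\<bar> \<le> r \<Longrightarrow> \<bar>t\<bar> \<le> r \<Longrightarrow> x + s *\<^sub>R u + t *\<^sub>R v \<in> S"
    and "\<And>y. y \<in> S \<Longrightarrow> (f has_derivative f' y) (at y)"
    and "\<And>y. y \<in> S \<Longrightarrow> ((\<lambda>y. f' y u) has_derivative f'' y) (at y)"
  shows "\<exists>s t. 0 < s \<and> s < r \<and> 0 < t \<and> t < r \<and>
     f (x + r *\<^sub>R u + r *\<^sub>R v) - f (x + r *\<^sub>R u) - (f (x + r *\<^sub>R v) - f x)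
       = r\<^sup>2 * f'' (x + s *\<^sub>R u + t *\<^sub>R v) v"
proof -
  define g where "g s = f (x + s *\<^sub>R u + r *\<^sub>R v) - f (x + s *\<^sub>R u)" for s
  have inS0: "x + s *\<^sub>R u \<in> S" if "\<bar>s\<bar> \<le> r" for s using assms(2)[OF that, of 0] assms(1) by simp
  have lin: "linear (f' y)" if "y \<in> S" for y using assms(3)[OF that] has_derivative_linear by blast
  have lin2: "linear (f'' y)" if "y \<in> S" for y using assms(4)[OF that] has_derivative_linear by blast
  have line: "((\<lambda>s. f (a + s *\<^sub>R w)) has_derivative (\<lambda>h. f' (a + s *\<^sub>R w) (h *\<^sub>R w))) (at s)"
    if "a + s *\<^sub>R w \<in> S" for a w s
    by (rule has_derivative_compose[of "\<lambda>s. a + s *\<^sub>R w", OF _ assms(3)[OF that]]) (auto intro!: derivative_eq_intros)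
  have "\<exists>s>0. s < r \<and> g r - g 0 = (r - 0) * (f' (x + s *\<^sub>R u + r *\<^sub>R v) u - f' (x + s *\<^sub>R u) u)"
  proof (rule MVT2[OF assms(1)])
    fix s assume s: "0 \<le> s" "s \<le> r"
    have "x + s *\<^sub>R u + r *\<^sub>R v \<in> S" using s assms(1) by (intro assms(2)) auto
    then have 1: "((\<lambda>s. f (x + s *\<^sub>R u + r *\<^sub>R v)) has_derivative (\<lambda>h. f' (x + s *\<^sub>R u + r *\<^sub>R v) (h *\<^sub>R u))) (at s)"
      by (intro has_derivative_compose[of "\<lambda>s. x + s *\<^sub>R u + r *\<^sub>R v", OF _ assms(3)]) (auto intro!: derivative_eq_intros)
    have 2: "((\<lambda>s. f (x + s *\<^sub>R u)) has_derivative (\<lambda>h. f' (x + s *\<^sub>R u) (h *\<^sub>R u))) (at s)"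
      by (rule line) (use inS0 s in auto)
    have "x + s *\<^sub>R u + r *\<^sub>R v \<in> S" "x + s *\<^sub>R u \<in> S" using s assms(1) by (auto intro!: assms(2) inS0)
    then show "(g has_real_derivative f' (x + s *\<^sub>R u + r *\<^sub>R v) u - f' (x + s *\<^sub>R u) u) (at s)"
      unfolding g_def has_field_derivative_def
      by - (rule has_derivative_eq_rhs[OF has_derivative_diff[OF 1 2]], simp add: fun_eq_iff linear_cmul[OF lin] algebra_simps)
  qed
  then obtain s where s: "0 < s" "s < r" "g r - g 0 = r * (f' (x + s *\<^sub>R u + r *\<^sub>R v) u - f' (x + s *\<^sub>R u) u)" by auto
  have "\<exists>t>0. t < r \<and> f' (x + s *\<^sub>R u + r *\<^sub>R v) u - f' (x + s *\<^sub>R u + 0 *\<^sub>R v) u = (r - 0) * f'' (x + s *\<^sub>R u + t *\<^sub>R v) v"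
  proof (rule MVT2[OF assms(1)])
    fix t assume t: "0 \<le> t" "t \<le> r"
    have i: "x + s *\<^sub>R u + t *\<^sub>R v \<in> S" using s t by (intro assms(2)) auto
    have "((\<lambda>t. f' (x + s *\<^sub>R u + t *\<^sub>R v) u) has_derivative (\<lambda>h. f'' (x + s *\<^sub>R u + t *\<^sub>R v) (h *\<^sub>R v))) (at t)"
      by (rule has_derivative_compose[of "\<lambda>t. x + s *\<^sub>R u + t *\<^sub>R v", OF _ assms(4)[OF i]]) (auto intro!: derivative_eq_intros)
    then show "((\<lambda>t. f' (x + s *\<^sub>R u + t *\<^sub>R v) u) has_real_derivative f'' (x + s *\<^sub>R u + t *\<^sub>R v) v) (at t)"
      unfolding has_field_derivative_def
      by (rule has_derivative_eq_rhs) (simp add: fun_eq_iff linear_cmul[OF lin2[OF i]])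
  qed
  then obtain t where "t > 0" "t < r" "f' (x + s *\<^sub>R u + r *\<^sub>R v) u - f' (x + s *\<^sub>R u) u = r * f'' (x + s *\<^sub>R u + t *\<^sub>R v) v" by auto
  with s show ?thesis by (intro exI[of _ s] exI[of _ t]) (auto simp: g_def power2_eq_square algebra_simps)
qed

text \<open>The second difference is symmetric in u and v. By the mean value theorem it is r^2 times
  either mixed derivative at points close to x, so continuity of both derivatives makes them agree
  at x.\<close>

lemma frechet_derivative_commute_real:
  fixes f :: "'a::real_normed_vector \<Rightarrow> real"
  assumes S: "open S" "x \<in> S" and f: "smooth_on S f"
  shows "frechet_derivative (\<lambda>y. frechet_derivative f (at y) u) (at x) v
       = frechet_derivative (\<lambda>y. frechet_derivative f (at y) v) (at x) u"
proof -
  define F where "F u v y = frechet_derivative (\<lambda>y. frechet_derivative f (at y) u) (at y) v" for u v y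
  have cont: "isCont (F a b) x" for a b
    unfolding F_def using smooth_on_imp_continuous_on[OF smooth_on_frechet[OF smooth_on_frechet[OF f]]] S
    by (simp add: continuous_on_eq_continuous_at)
  obtain d where d: "d > 0" "ball x d \<subseteq> S" using S openE by blast
  \<comment> \<open>The summand 1 keeps c positive when u and v both vanish; with r = m / (2c) the
    whole square of side r stays within distance m of x.\<close>
  define c where "c = norm u + norm v + 1"
  have c: "c > 0" unfolding c_def using norm_ge_zero[of u] norm_ge_zero[of v] by linarith
  have main: "\<bar>F u v x - F v u x\<bar> < \<epsilon>" if \<epsilon>: "\<epsilon> > 0" for \<epsilon>
  proof -
    obtain d1 where d1: "d1 > 0" "\<And>y. dist y x < d1 \<Longrightarrow> dist (F u v y) (F u v x) < \<epsilon> / 2"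
      using cont[of u v] \<epsilon> half_gt_zero[OF \<epsilon>] unfolding continuous_at_eps_delta by blast
    obtain d2 where d2: "d2 > 0" "\<And>y. dist y x < d2 \<Longrightarrow> dist (F v u y) (F v u x) < \<epsilon> / 2"
      using cont[of v u] \<epsilon> half_gt_zero[OF \<epsilon>] unfolding continuous_at_eps_delta by blast
    define m where "m = Min {d, d1, d2}"
    have m: "m > 0" "m \<le> d" "m \<le> d1" "m \<le> d2" using d d1 d2 by (auto simp: m_def)
    define r where "r = m / (2 * c)"
    have r: "r > 0" using m c by (simp add: r_def)
    have near: "dist (x + s *\<^sub>R a + t *\<^sub>R b) x < m" if "\<bar>s\<bar> \<le> r" "\<bar>t\<bar> \<le> r" "{a,b} = {u,v}" for s t a b
    proof -
      have "norm (s *\<^sub>R a + t *\<^sub>R b) \<le> \<bar>s\<bar> * norm a + \<bar>t\<bar> * norm b"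
        using norm_triangle_ineq[of "s *\<^sub>R a" "t *\<^sub>R b"] by simp
      also have "\<dots> \<le> r * norm a + r * norm b" using that by (intro add_mono mult_right_mono) auto
      also have "\<dots> \<le> r * (2 * (norm u + norm v))"
      proof -
        have "norm a + norm b = norm u + norm v" using that(3) by (auto simp: doubleton_eq_iff)
        then have "norm a + norm b \<le> 2 * (norm u + norm v)" using norm_ge_zero[of u] norm_ge_zero[of v] by simp
        then have "r * (norm a + norm b) \<le> r * (2 * (norm u + norm v))" using r by (intro mult_left_mono) auto
        then show ?thesis by (simp add: distrib_left)
      qed
      also have "\<dots> < r * (2 * c)" using r by (simp add: c_def)
      also have "\<dots> = m" using c by (simp add: r_def)
      finally show ?thesis by (simp add: dist_norm add.assoc)
    qed
    have inS: "x + s *\<^sub>R a + t *\<^sub>R b \<in> S" if "\<bar>s\<bar> \<le> r" "\<bar>t\<bar> \<le> r" "{a,b} = {u,v}" for s t a b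
    proof -
      have "x + s *\<^sub>R a + t *\<^sub>R b \<in> ball x d" using near[OF that] m by (simp add: dist_commute)
      then show ?thesis using d by blast
    qed
    have der: "(f has_derivative frechet_derivative f (at y)) (at y)"
      "((\<lambda>y. frechet_derivative f (at y) a) has_derivative (\<lambda>b. F a b y)) (at y)" if "y \<in> S" for y a
      using smooth_on_has_derivative[OF f that] smooth_on_has_derivative[OF smooth_on_frechet[OF f] that]
      by (simp_all add: F_def)
    obtain s t where st: "0 < s" "s < r" "0 < t" "t < r"
      "f (x + r *\<^sub>R u + r *\<^sub>R v) - f (x + r *\<^sub>R u) - (f (x + r *\<^sub>R v) - f x) = r\<^sup>2 * F u v (x + s *\<^sub>R u + t *\<^sub>R v)"
      using second_difference_mvt[OF r inS der] by blast
    obtain s' t' where st': "0 < s'" "s' < r" "0 < t'" "t' < r"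
      "f (x + r *\<^sub>R v + r *\<^sub>R u) - f (x + r *\<^sub>R v) - (f (x + r *\<^sub>R u) - f x) = r\<^sup>2 * F v u (x + s' *\<^sub>R v + t' *\<^sub>R u)"
      using second_difference_mvt[OF r inS[of _ _ v u] der] by blast
    have "r\<^sup>2 * F u v (x + s *\<^sub>R u + t *\<^sub>R v) = r\<^sup>2 * F v u (x + s' *\<^sub>R v + t' *\<^sub>R u)"
      using st(5) st'(5) by (simp add: algebra_simps)
    then have "F u v (x + s *\<^sub>R u + t *\<^sub>R v) = F v u (x + s' *\<^sub>R v + t' *\<^sub>R u)" using r by simp
    moreover have "dist (F u v (x + s *\<^sub>R u + t *\<^sub>R v)) (F u v x) < \<epsilon> / 2"
      using near[of s t u v] st m by (intro d1) auto
    moreover have "dist (F v u (x + s' *\<^sub>R v + t' *\<^sub>R u)) (F v u x) < \<epsilon> / 2"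
      using near[of s' t' v u] st' m by (intro d2) (auto simp: insert_commute)
    ultimately show ?thesis unfolding dist_real_def by linarith
  qed
  have "F u v x = F v u x"
    using main[of "\<bar>F u v x - F v u x\<bar>"] by force
  then show ?thesis by (simp add: F_def)
qed

lemma frechet_derivative_bounded_linear:
  "bounded_linear h \<Longrightarrow> f differentiable (at x) \<Longrightarrow>
    frechet_derivative (\<lambda>x. h (f x)) (at x) u = h (frechet_derivative f (at x) u)"
  using fun_cong[OF frechet_derivative_at[OF bounded_linear.has_derivative[OF _ frechet_derivative_works[THEN iffD1]], of h f x], of u]
  by simp

lemma frechet_derivative_cong_open:
  assumes "open S" "x \<in> S" "\<And>y. y \<in> S \<Longrightarrow> f y = g y"
  shows "frechet_derivative f (at x) = frechet_derivative g (at x)"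
proof -
  have "(f has_derivative D) (at x) \<longleftrightarrow> (g has_derivative D) (at x)" for D
    using has_derivative_transform_within_open[OF _ assms(1,2)] assms(3) by metis
  then show ?thesis unfolding frechet_derivative_def by simp
qed

lemma frechet_derivative_commute:
  fixes f :: "'a::real_normed_vector \<Rightarrow> 'b::euclidean_space"
  assumes S: "open S" "x \<in> S" and f: "smooth_on S f"
  shows "frechet_derivative (\<lambda>y. frechet_derivative f (at y) u) (at x) v
       = frechet_derivative (\<lambda>y. frechet_derivative f (at y) v) (at x) u"
proof (rule euclidean_eqI)
  fix b :: 'b assume "b \<in> Basis"
  note bl = bounded_linear_inner_left[of b]
  have fb: "smooth_on S (\<lambda>x. f x \<bullet> b)" by (rule smooth_on_bounded_linear_comp[OF bl S(1) f])
  have *: "frechet_derivative (\<lambda>y. frechet_derivative f (at y) u) (at x) v \<bullet> b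
    = frechet_derivative (\<lambda>y. frechet_derivative (\<lambda>x. f x \<bullet> b) (at y) u) (at x) v" for u v
  proof -
    have "frechet_derivative (\<lambda>y. frechet_derivative (\<lambda>x. f x \<bullet> b) (at y) u) (at x)
        = frechet_derivative (\<lambda>y. frechet_derivative f (at y) u \<bullet> b) (at x)"
      by (rule frechet_derivative_cong_open[OF S])
         (simp add: frechet_derivative_bounded_linear[OF bl] smooth_on_imp_differentiable[OF f])
    then show ?thesis
      by (simp add: frechet_derivative_bounded_linear[OF bl smooth_on_imp_differentiable[OF smooth_on_frechet[OF f] S(2)]])
  qed
  show "frechet_derivative (\<lambda>y. frechet_derivative f (at y) u) (at x) v \<bullet> b =
     frechet_derivative (\<lambda>y. frechet_derivative f (at y) v) (at x) u \<bullet> b"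
    unfolding * by (rule frechet_derivative_commute_real[OF S fb])
qed

subsection \<open>Charts, parametrisations and tangent vectors\<close>

lemma
  assumes "oriented_atlas A" "c \<in> A"
  shows chart_open_dom: "open (fst c)" and chart_open_image: "open (snd c ` fst c)"
    and chart_inv_left: "p \<in> fst c \<Longrightarrow> chart_inv c (snd c p) = p"
    and chart_inv_in: "x \<in> snd c ` fst c \<Longrightarrow> chart_inv c x \<in> fst c"
    and chart_inv_right: "x \<in> snd c ` fst c \<Longrightarrow> snd c (chart_inv c x) = x"
    and chart_continuous: "continuous_on (fst c) (snd c)"
    and chart_inv_continuous: "continuous_on (snd c ` fst c) (chart_inv c)"
proof -
  have "is_chart c" using assms by (auto simp: oriented_atlas_def)
  then have h: "open (fst c)" "open (snd c ` fst c)" "homeomorphism (fst c) (snd c ` fst c) (snd c) (chart_inv c)"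
    by (auto simp: is_chart_def)
  then show "open (fst c)" "open (snd c ` fst c)" "p \<in> fst c \<Longrightarrow> chart_inv c (snd c p) = p"
    "x \<in> snd c ` fst c \<Longrightarrow> chart_inv c x \<in> fst c" "x \<in> snd c ` fst c \<Longrightarrow> snd c (chart_inv c x) = x"
    "continuous_on (fst c) (snd c)" "continuous_on (snd c ` fst c) (chart_inv c)"
    by (auto simp: homeomorphism_def)
qed

lemma chart_at: "oriented_atlas A \<Longrightarrow> \<exists>c\<in>A. p \<in> fst c"
  unfolding oriented_atlas_def by blast

lemma some_chart_in: 
  assumes "oriented_atlas A"
  shows "some_chart A p \<in> A" "p \<in> fst (some_chart A p)"
proof -
  have "\<exists>c. c \<in> A \<and> p \<in> fst c" using chart_at[OF assms] by blast
  then have "some_chart A p \<in> A \<and> p \<in> fst (some_chart A p)"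
    unfolding some_chart_def by (rule someI_ex)
  then show "some_chart A p \<in> A" "p \<in> fst (some_chart A p)" by auto
qed

text \<open>A smooth map into the manifold from an open set of a normed space. Inverse charts, their
  composites with smooth maps, and local sections are all instances, so pull-back is treated
  once.\<close>

definition smooth_param ::
    "('m::topological_space, 'n::finite) chart set \<Rightarrow> 'a::real_normed_vector set \<Rightarrow> ('a \<Rightarrow> 'm) \<Rightarrow> bool" where
  "smooth_param B S \<phi> \<longleftrightarrow> open S \<and> continuous_on S \<phi> \<and>
     (\<forall>d\<in>B. smooth_on (S \<inter> \<phi> -` fst d) (snd d \<circ> \<phi>))"

text \<open>The image of u under the differential of \<phi>, as a derivation. The value 0 on
  functions not smooth near the image point follows the convention of
  \<open>coord_vec\<close>.\<close>

definition pvec ::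
    "('m::topological_space, 'n::finite) chart set \<Rightarrow> ('a::real_normed_vector \<Rightarrow> 'm) \<Rightarrow> 'a \<Rightarrow> 'a \<Rightarrow> 'm tvec" where
  "pvec B \<phi> x u = (\<lambda>f. if smooth_at B (\<phi> x) f then frechet_derivative (f \<circ> \<phi>) (at x) u else 0)"

lemma smooth_param_open: "smooth_param B S \<phi> \<Longrightarrow> open S"
  by (simp add: smooth_param_def)

lemma smooth_param_preimage: "smooth_param B S \<phi> \<Longrightarrow> open U \<Longrightarrow> open (S \<inter> \<phi> -` U)"
  by (simp add: smooth_param_def continuous_open_preimage)

lemma smooth_param_coord: "smooth_param B S \<phi> \<Longrightarrow> d \<in> B \<Longrightarrow> smooth_on (S \<inter> \<phi> -` fst d) (snd d \<circ> \<phi>)"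
  by (simp add: smooth_param_def)

lemma smooth_param_subset:
  assumes "smooth_param B S \<phi>" "open T" "T \<subseteq> S"
  shows "smooth_param B T \<phi>"
  unfolding smooth_param_def
proof (intro conjI ballI)
  show "continuous_on T \<phi>" using assms continuous_on_subset unfolding smooth_param_def by blast
  show "smooth_on (T \<inter> \<phi> -` fst d) (snd d \<circ> \<phi>)" if "d \<in> B" for d
    by (rule smooth_on_subset[OF smooth_param_coord[OF assms(1) that]]) (use assms in auto)
qed fact

lemma chart_preimage_eq:
  assumes "oriented_atlas A" "c \<in> A"
  shows "snd c ` fst c \<inter> chart_inv c -` U = snd c ` (fst c \<inter> U)"
  using chart_inv_left[OF assms] chart_inv_in[OF assms] by force

lemma chart_image_open:
  assumes "oriented_atlas A" "c \<in> A" "open U"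
  shows "open (snd c ` (fst c \<inter> U))"
  unfolding chart_preimage_eq[OF assms(1,2), symmetric]
  by (rule continuous_open_preimage[OF chart_inv_continuous chart_open_image]) (use assms in auto)

lemma smooth_param_chart:
  assumes "oriented_atlas A" "c \<in> A"
  shows "smooth_param A (snd c ` fst c) (chart_inv c)"
  unfolding smooth_param_def chart_preimage_eq[OF assms]
  using chart_open_image[OF assms] chart_inv_continuous[OF assms] assms by (auto simp: oriented_atlas_def)

text \<open>Near x the composite factors as f read in a chart after \<phi> read in the same
  chart.\<close>

lemma smooth_at_param:
  assumes B: "oriented_atlas B" and \<phi>: "smooth_param B S \<phi>" and x: "x \<in> S" and f: "smooth_at B (\<phi> x) f"
  obtains N where "open N" "x \<in> N" "N \<subseteq> S" "smooth_on N (f \<circ> \<phi>)"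
proof -
  obtain U where U: "open U" "\<phi> x \<in> U" "smooth_fun_on B U f" using f by (auto simp: smooth_at_def)
  obtain d where d: "d \<in> B" "\<phi> x \<in> fst d" using chart_at[OF B] by blast
  define N where "N = S \<inter> \<phi> -` (fst d \<inter> U)"
  have N: "open N" "x \<in> N" "N \<subseteq> S"
    unfolding N_def using smooth_param_preimage[OF \<phi> open_Int[OF chart_open_dom[OF B d(1)] U(1)]] U d x by auto
  have "smooth_on N (\<lambda>x. (f \<circ> chart_inv d) ((snd d \<circ> \<phi>) x))"
  proof (rule smooth_on_compose[OF _ smooth_on_subset[OF smooth_param_coord[OF \<phi> d(1)]] N(1)])
    show "smooth_on (snd d ` (fst d \<inter> U)) (f \<circ> chart_inv d)" using U(3) d(1) by (simp add: smooth_fun_on_def)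
  qed (auto simp: N_def)
  then have "smooth_on N (f \<circ> \<phi>)"
    by (rule smooth_on_cong[OF _ N(1)]) (simp add: N_def chart_inv_left[OF B d(1)])
  then show thesis using that N by blast
qed

lemma smooth_at_param_differentiable:
  assumes "oriented_atlas B" "smooth_param B S \<phi>" "x \<in> S" "smooth_at B (\<phi> x) f"
  shows "(f \<circ> \<phi>) differentiable (at x)"
  using smooth_at_param[OF assms] smooth_on_imp_differentiable by metis

lemma coord_vec_eq_pvec:
  assumes "oriented_atlas A" "c \<in> A" "p \<in> fst c"
  shows "coord_vec A c p u = pvec A (chart_inv c) (snd c p) u"
  using chart_inv_left[OF assms(1,2,3)] by (simp add: coord_vec_def pvec_def fun_eq_iff)

lemma coord_vec_eq_pvec':
  assumes "oriented_atlas A" "c \<in> A" "x \<in> snd c ` fst c"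
  shows "coord_vec A c (chart_inv c x) u = pvec A (chart_inv c) x u"
  using coord_vec_eq_pvec[OF assms(1,2) chart_inv_in[OF assms]] chart_inv_right[OF assms] by simp

lemma frechet_derivative_linear_simps:
  assumes "f differentiable (at x)"
  shows "frechet_derivative f (at x) (u + v) = frechet_derivative f (at x) u + frechet_derivative f (at x) v"
    "frechet_derivative f (at x) (r *\<^sub>R u) = r *\<^sub>R frechet_derivative f (at x) u"
  using linear_frechet_derivative[OF assms] by (simp_all add: linear_add linear_cmul)

lemma pvec_linear:
  assumes "oriented_atlas B" "smooth_param B S \<phi>" "x \<in> S"
  shows "tadd (pvec B \<phi> x u) (pvec B \<phi> x v) = pvec B \<phi> x (u + v)"
    and "tscale r (pvec B \<phi> x u) = pvec B \<phi> x (r *\<^sub>R u)"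
  using frechet_derivative_linear_simps[OF smooth_at_param_differentiable[OF assms]]
  by (auto simp: tadd_def tscale_def pvec_def fun_eq_iff)

text \<open>Chain rule through the chart d. It links derivatives along a parametrisation with
  coordinates in an arbitrary chart, and contains the change of charts as the case of an inverse
  chart.\<close>

lemma pvec_coord:
  assumes B: "oriented_atlas B" and \<phi>: "smooth_param B S \<phi>" and x: "x \<in> S" and d: "d \<in> B" "\<phi> x \<in> fst d"
  shows "pvec B \<phi> x u = coord_vec B d (\<phi> x) (frechet_derivative (snd d \<circ> \<phi>) (at x) u)"
proof
  fix f
  show "pvec B \<phi> x u f = coord_vec B d (\<phi> x) (frechet_derivative (snd d \<circ> \<phi>) (at x) u) f"
  proof (cases "smooth_at B (\<phi> x) f")
    case True
    define N where "N = S \<inter> \<phi> -` fst d"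
    have N: "open N" "x \<in> N" unfolding N_def
      using smooth_param_preimage[OF \<phi>] d x chart_open_dom[OF B d(1)] by auto
    have "smooth_at B (chart_inv d (snd d (\<phi> x))) f" using True chart_inv_left[OF B d] by simp
    then have "(f \<circ> chart_inv d) differentiable (at (snd d (\<phi> x)))"
      using smooth_at_param_differentiable[OF B smooth_param_chart[OF B d(1)]] d by blast
    moreover have "(snd d \<circ> \<phi>) differentiable (at x)"
      using smooth_on_imp_differentiable[OF smooth_param_coord[OF \<phi> d(1)]] d x by auto
    ultimately have "frechet_derivative ((f \<circ> chart_inv d) \<circ> (snd d \<circ> \<phi>)) (at x) =
       frechet_derivative (f \<circ> chart_inv d) (at (snd d (\<phi> x))) \<circ> frechet_derivative (snd d \<circ> \<phi>) (at x)"
      by (subst frechet_derivative_compose) auto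
    moreover have "frechet_derivative (f \<circ> \<phi>) (at x) = frechet_derivative ((f \<circ> chart_inv d) \<circ> (snd d \<circ> \<phi>)) (at x)"
      by (rule frechet_derivative_cong_open[OF N]) (simp add: N_def chart_inv_left[OF B d(1)])
    ultimately show ?thesis using True by (simp add: pvec_def coord_vec_def)
  qed (simp add: pvec_def coord_vec_def)
qed

lemma coord_vec_in_tangent: "c \<in> A \<Longrightarrow> p \<in> fst c \<Longrightarrow> coord_vec A c p u \<in> tangent A p"
  unfolding tangent_def by blast

lemma pvec_in_tangent:
  assumes "oriented_atlas B" "smooth_param B S \<phi>" "x \<in> S"
  shows "pvec B \<phi> x u \<in> tangent B (\<phi> x)"
proof -
  obtain d where d: "d \<in> B" "\<phi> x \<in> fst d" using chart_at[OF assms(1)] by blast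
  then show ?thesis using pvec_coord[OF assms d] coord_vec_in_tangent by metis
qed

text \<open>Needed so that \<open>coords\<close> does not read off the default value 0. The values
  of a coordinate function outside the chart domain do no harm, since smoothness at a point is
  local.\<close>

lemma smooth_at_coord:
  assumes A: "oriented_atlas A" and c: "c \<in> A" "p \<in> fst c"
  shows "smooth_at A p (\<lambda>q. snd c q $ i)"
  unfolding smooth_at_def
proof (intro exI[of _ "fst c"] conjI)
  show "open (fst c)" by (rule chart_open_dom[OF A c(1)])
  show "smooth_fun_on A (fst c) (\<lambda>q. snd c q $ i)"
    unfolding smooth_fun_on_def
  proof
    fix d assume d: "d \<in> A"
    have "smooth_on (snd d ` (fst d \<inter> fst c)) (snd c \<circ> chart_inv d)"
      using A c d by (auto simp: oriented_atlas_def)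
    from smooth_on_vec_nth[OF chart_image_open[OF A d chart_open_dom[OF A c(1)]] this]
    show "smooth_on (snd d ` (fst d \<inter> fst c)) ((\<lambda>q. snd c q $ i) \<circ> chart_inv d)"
      by (simp add: o_def)
  qed
qed fact

lemma coords_coord_vec:
  assumes A: "oriented_atlas A" and c: "c \<in> A" "p \<in> fst c"
  shows "coords c (coord_vec A c p u) = u"
proof -
  have "frechet_derivative ((\<lambda>q. snd c q $ i) \<circ> chart_inv c) (at (snd c p)) = frechet_derivative (\<lambda>x. x $ i) (at (snd c p))" for i
    by (rule frechet_derivative_cong_open[OF chart_open_image[OF A c(1)]]) (use c in \<open>auto simp: chart_inv_left[OF A c(1)]\<close>)
  moreover have "frechet_derivative (\<lambda>x. x $ i) (at (snd c p)) = (\<lambda>u. u $ i)" for i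
    using frechet_derivative_at[OF bounded_linear_imp_has_derivative[OF bounded_linear_vec_nth]] by metis
  ultimately show ?thesis
    by (simp add: coords_def coord_vec_def vec_eq_iff smooth_at_coord[OF A c])
qed

text \<open>A vector given in another chart is a \<open>pvec\<close> of the inverse of that chart,
  and \<open>pvec_coord\<close> rewrites it in the chart c.\<close>

lemma coord_vec_coords:
  assumes A: "oriented_atlas A" and c: "c \<in> A" "p \<in> fst c" and X: "X \<in> tangent A p"
  shows "coord_vec A c p (coords c X) = X"
proof -
  obtain d u where d: "d \<in> A" "p \<in> fst d" "X = coord_vec A d p u" using X by (auto simp: tangent_def)
  have "X = pvec A (chart_inv d) (snd d p) u" using d coord_vec_eq_pvec[OF A d(1,2)] by simp
  also have "\<dots> = coord_vec A c p (frechet_derivative (snd c \<circ> chart_inv d) (at (snd d p)) u)"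
    using pvec_coord[OF A smooth_param_chart[OF A d(1)], of "snd d p" c] d(2) c chart_inv_left[OF A d(1,2)] by simp
  finally obtain v where "X = coord_vec A c p v" by blast
  then show ?thesis using coords_coord_vec[OF A c] by simp
qed

lemma coord_vec_linear:
  assumes A: "oriented_atlas A" and c: "c \<in> A" "p \<in> fst c"
  shows "tadd (coord_vec A c p u) (coord_vec A c p v) = coord_vec A c p (u + v)"
    "tscale r (coord_vec A c p u) = coord_vec A c p (r *\<^sub>R u)"
  unfolding coord_vec_eq_pvec[OF A c]
  using pvec_linear[OF A smooth_param_chart[OF A c(1)], of "snd c p"] c(2) by auto

lemma coord_vec_0:
  assumes "oriented_atlas A" "c \<in> A" "p \<in> fst c"
  shows "coord_vec A c p 0 = tzero"
proof -
  have "tscale 0 (coord_vec A c p 0) = tzero" by (simp add: tscale_def tzero_def)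
  then show ?thesis unfolding coord_vec_linear(2)[OF assms] by simp
qed

lemma tangent_linear:
  assumes A: "oriented_atlas A" and "X \<in> tangent A p" "Y \<in> tangent A p"
  shows "tadd X Y \<in> tangent A p" "tscale r X \<in> tangent A p" "tzero \<in> tangent A p"
proof -
  obtain c where c: "c \<in> A" "p \<in> fst c" using chart_at[OF A] by blast
  show "tadd X Y \<in> tangent A p" "tscale r X \<in> tangent A p" "tzero \<in> tangent A p"
    using coord_vec_linear[OF A c] coord_vec_0[OF A c] coord_vec_coords[OF A c] assms coord_vec_in_tangent[OF c]
    by metis+
qed

lemma coords_linear:
  assumes A: "oriented_atlas A" and c: "c \<in> A" "p \<in> fst c" and "X \<in> tangent A p" "Y \<in> tangent A p"
  shows "coords c (tadd X Y) = coords c X + coords c Y" "coords c (tscale r X) = r *\<^sub>R coords c X"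
  using coord_vec_linear[OF A c] coord_vec_coords[OF A c] assms coords_coord_vec[OF A c] by metis+

subsection \<open>Smooth maps and push-forward\<close>

lemma smooth_at_comp:
  assumes A: "oriented_atlas A" and B: "oriented_atlas B" and F: "smooth_map A B F" and f: "smooth_at B (F p) f"
  shows "smooth_at A p (f \<circ> F)"
proof -
  obtain U where U: "open U" "F p \<in> U" "smooth_fun_on B U f" using f by (auto simp: smooth_at_def)
  obtain d where d: "d \<in> B" "F p \<in> fst d" using chart_at[OF B] by blast
  define N where "N = F -` (fst d \<inter> U)"
  have N: "open N" unfolding N_def
    using F U chart_open_dom[OF B d(1)] open_vimage by (auto simp: smooth_map_def)
  have "smooth_on (snd c ` (fst c \<inter> N)) (f \<circ> F \<circ> chart_inv c)" if c: "c \<in> A" for c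
  proof -
    have o: "open (snd c ` (fst c \<inter> N))" by (rule chart_image_open[OF A c N])
    have "smooth_on (snd c ` (fst c \<inter> F -` fst d)) (snd d \<circ> F \<circ> chart_inv c)"
      using F c d by (auto simp: smooth_map_def)
    then have 1: "smooth_on (snd c ` (fst c \<inter> N)) (snd d \<circ> F \<circ> chart_inv c)"
      by (rule smooth_on_subset) (auto simp: N_def)
    have "smooth_on (snd c ` (fst c \<inter> N)) (\<lambda>x. (f \<circ> chart_inv d) ((snd d \<circ> F \<circ> chart_inv c) x))"
    proof (rule smooth_on_compose[OF _ 1 o])
      show "smooth_on (snd d ` (fst d \<inter> U)) (f \<circ> chart_inv d)" using U(3) d(1) by (simp add: smooth_fun_on_def)
      show "(snd d \<circ> F \<circ> chart_inv c) ` snd c ` (fst c \<inter> N) \<subseteq> snd d ` (fst d \<inter> U)"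
        using chart_inv_left[OF A c] by (auto simp: N_def)
    qed
    then show ?thesis
      by (rule smooth_on_cong[OF _ o]) (auto simp add: N_def chart_inv_left[OF A c] chart_inv_left[OF B d(1)])
  qed
  then show ?thesis using N U d unfolding smooth_at_def smooth_fun_on_def
    by (intro exI[of _ N]) (auto simp: N_def)
qed

lemma push_pvec:
  assumes "oriented_atlas A" "oriented_atlas B" "smooth_map A B F"
  shows "push B F (\<phi> x) (pvec A \<phi> x u) = pvec B (F \<circ> \<phi>) x u"
  using smooth_at_comp[OF assms] by (auto simp: push_def pvec_def fun_eq_iff o_assoc)

lemma smooth_param_comp:
  assumes A: "oriented_atlas A" and B: "oriented_atlas B" and F: "smooth_map A B F" and \<phi>: "smooth_param A S \<phi>"
  shows "smooth_param B S (F \<circ> \<phi>)"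
  unfolding smooth_param_def
proof (intro conjI ballI)
  show "open S" using \<phi> by (rule smooth_param_open)
  have "continuous_on UNIV F" using F by (simp add: smooth_map_def)
  then show "continuous_on S (F \<circ> \<phi>)"
    unfolding comp_def by (rule continuous_on_compose2[OF _ _ subset_UNIV]) (use \<phi> in \<open>simp add: smooth_param_def\<close>)
  fix d assume d: "d \<in> B"
  show "smooth_on (S \<inter> (F \<circ> \<phi>) -` fst d) (snd d \<circ> (F \<circ> \<phi>))"
  proof (rule smooth_on_local)
    fix x assume x: "x \<in> S \<inter> (F \<circ> \<phi>) -` fst d"
    obtain c where c: "c \<in> A" "\<phi> x \<in> fst c" using chart_at[OF A] by blast
    define N where "N = S \<inter> \<phi> -` (fst c \<inter> F -` fst d)"
    have "continuous_on UNIV F" using F by (simp add: smooth_map_def)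
    then have oF: "open (F -` fst d)" using chart_open_dom[OF B d] by (simp add: open_vimage)
    have N: "open N" unfolding N_def
      by (rule smooth_param_preimage[OF \<phi> open_Int[OF chart_open_dom[OF A c(1)] oF]])
    have xN: "x \<in> N" using x c by (auto simp: N_def)
    have "smooth_on N (\<lambda>x. (snd d \<circ> F \<circ> chart_inv c) ((snd c \<circ> \<phi>) x))"
    proof (rule smooth_on_compose[OF _ smooth_on_subset[OF smooth_param_coord[OF \<phi> c(1)]] N])
      show "smooth_on (snd c ` (fst c \<inter> F -` fst d)) (snd d \<circ> F \<circ> chart_inv c)"
        using F c(1) d by (simp add: smooth_map_def)
    qed (auto simp: N_def)
    then have "smooth_on N (snd d \<circ> (F \<circ> \<phi>))"
      by (rule smooth_on_cong[OF _ N]) (simp add: N_def chart_inv_left[OF A c(1)])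
    then show "\<exists>N. open N \<and> x \<in> N \<and> smooth_on N (snd d \<circ> (F \<circ> \<phi>))" using N xN by blast
  qed
qed

lemma push_tangent:
  assumes A: "oriented_atlas A" and B: "oriented_atlas B" and F: "smooth_map A B F" and X: "X \<in> tangent A p"
  shows "push B F p X \<in> tangent B (F p)"
proof -
  obtain c where c: "c \<in> A" "p \<in> fst c" using chart_at[OF A] by blast
  have "push B F p (pvec A (chart_inv c) (snd c p) u) \<in> tangent B (F p)" for u
    using push_pvec[OF A B F, of "chart_inv c" "snd c p" u]
      pvec_in_tangent[OF B smooth_param_comp[OF A B F smooth_param_chart[OF A c(1)]], of "snd c p" u]
      chart_inv_left[OF A c] c(2) by simp
  then show ?thesis using coord_vec_coords[OF A c X] coord_vec_eq_pvec[OF A c] by metis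
qed

lemma push_linear:
  shows "push B F p (tadd X Y) = tadd (push B F p X) (push B F p Y)"
    "push B F p (tscale r X) = tscale r (push B F p X)"
  by (auto simp: push_def tadd_def tscale_def fun_eq_iff)

subsection \<open>Pull-back of one-forms and the exterior derivative\<close>

text \<open>Leibniz rule for a linear map depending on a parameter, applied to a moving vector.
  Expanding the vector in \<open>Basis\<close> reduces it to scalar multiples of \<beta> on fixed
  vectors, so that no space of operators is involved.\<close>

lemma deriv_linear_family:
  fixes \<beta> :: "'a::euclidean_space \<Rightarrow> 'c::euclidean_space \<Rightarrow> 'b::real_normed_vector"
  assumes S: "open S" and \<beta>: "\<And>w. smooth_on T (\<lambda>z. \<beta> z w)" "\<And>z. z \<in> T \<Longrightarrow> linear (\<beta> z)"
    and \<psi>: "smooth_on S \<psi>" "\<psi> ` S \<subseteq> T" and p: "smooth_on S p"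
  shows "smooth_on S (\<lambda>x. \<beta> (\<psi> x) (p x))"
    and "open T \<Longrightarrow> x \<in> S \<Longrightarrow> frechet_derivative (\<lambda>x. \<beta> (\<psi> x) (p x)) (at x) u =
      frechet_derivative (\<lambda>z. \<beta> z (p x)) (at (\<psi> x)) (frechet_derivative \<psi> (at x) u)
      + \<beta> (\<psi> x) (frechet_derivative p (at x) u)"
proof -
  have expand: "\<beta> z w = (\<Sum>b\<in>Basis. (w \<bullet> b) *\<^sub>R \<beta> z b)" if "z \<in> T" for z w
  proof -
    have "\<beta> z w = \<beta> z (\<Sum>b\<in>Basis. (w \<bullet> b) *\<^sub>R b)" by (simp add: euclidean_representation)
    then show ?thesis by (simp add: linear_sum[OF \<beta>(2)[OF that]] linear_cmul[OF \<beta>(2)[OF that]])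
  qed
  have e: "(\<Sum>b\<in>Basis. (p x \<bullet> b) *\<^sub>R \<beta> (\<psi> x) b) = \<beta> (\<psi> x) (p x)" if "x \<in> S" for x
    using expand[of "\<psi> x" "p x"] \<psi>(2) that by force
  have "smooth_on S (\<lambda>x. \<Sum>b\<in>Basis. (p x \<bullet> b) *\<^sub>R \<beta> (\<psi> x) b)"
    by (intro smooth_on_sum smooth_on_scaleR smooth_on_bounded_linear_comp[OF bounded_linear_inner_left] S p
        smooth_on_compose[OF \<beta>(1) \<psi>(1) S \<psi>(2)])
  then show "smooth_on S (\<lambda>x. \<beta> (\<psi> x) (p x))"
    by (rule smooth_on_cong[OF _ S e])
  assume T: "open T" and x: "x \<in> S"
  have \<psi>x: "\<psi> x \<in> T" using \<psi>(2) x by auto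
  have db: "((\<lambda>z. \<beta> z b) has_derivative frechet_derivative (\<lambda>z. \<beta> z b) (at (\<psi> x))) (at (\<psi> x))" for b
    using smooth_on_has_derivative[OF \<beta>(1) \<psi>x] .
  have dp: "(p has_derivative frechet_derivative p (at x)) (at x)" using smooth_on_has_derivative[OF p x] .
  have d\<psi>: "(\<psi> has_derivative frechet_derivative \<psi> (at x)) (at x)" using smooth_on_has_derivative[OF \<psi>(1) x] .
  have 1: "((\<lambda>x. \<Sum>b\<in>Basis. (p x \<bullet> b) *\<^sub>R \<beta> (\<psi> x) b) has_derivative
     (\<lambda>u. \<Sum>b\<in>Basis. (p x \<bullet> b) *\<^sub>R frechet_derivative (\<lambda>z. \<beta> z b) (at (\<psi> x)) (frechet_derivative \<psi> (at x) u)
        + (frechet_derivative p (at x) u \<bullet> b) *\<^sub>R \<beta> (\<psi> x) b)) (at x)"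
    by (intro has_derivative_sum has_derivative_scaleR has_derivative_inner_left dp has_derivative_compose[OF d\<psi> db])
  have 2: "((\<lambda>z. \<Sum>b\<in>Basis. (p x \<bullet> b) *\<^sub>R \<beta> z b) has_derivative
     (\<lambda>v. \<Sum>b\<in>Basis. (p x \<bullet> b) *\<^sub>R frechet_derivative (\<lambda>z. \<beta> z b) (at (\<psi> x)) v)) (at (\<psi> x))"
    by (intro has_derivative_sum has_derivative_scaleR_right db)
  have "frechet_derivative (\<lambda>x. \<beta> (\<psi> x) (p x)) (at x) = frechet_derivative (\<lambda>x. \<Sum>b\<in>Basis. (p x \<bullet> b) *\<^sub>R \<beta> (\<psi> x) b) (at x)"
    by (rule frechet_derivative_cong_open[OF S x]) (use e in simp)
  moreover have "frechet_derivative (\<lambda>z. \<beta> z (p x)) (at (\<psi> x)) = frechet_derivative (\<lambda>z. \<Sum>b\<in>Basis. (p x \<bullet> b) *\<^sub>R \<beta> z b) (at (\<psi> x))"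
    by (rule frechet_derivative_cong_open[OF T \<psi>x]) (rule expand)
  ultimately show "frechet_derivative (\<lambda>x. \<beta> (\<psi> x) (p x)) (at x) u =
      frechet_derivative (\<lambda>z. \<beta> z (p x)) (at (\<psi> x)) (frechet_derivative \<psi> (at x) u)
      + \<beta> (\<psi> x) (frechet_derivative p (at x) u)"
    using fun_cong[OF frechet_derivative_at[OF 1], of u]
      fun_cong[OF frechet_derivative_at[OF 2], of "frechet_derivative \<psi> (at x) u"] expand[OF \<psi>x, of "frechet_derivative p (at x) u"]
    by (simp add: sum.distrib)
qed

lemma is_form_1_linear:
  assumes "is_form A 1 \<alpha>" "X \<in> tangent A p" 
  shows "Y \<in> tangent A p \<Longrightarrow> \<alpha> p [tadd X Y] = \<alpha> p [X] + \<alpha> p [Y]" "\<alpha> p [tscale r X] = r *\<^sub>R \<alpha> p [X]"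
proof -
  have "alternating_on (tangent A p) 1 (\<alpha> p)" using assms by (simp add: is_form_def)
  then show "Y \<in> tangent A p \<Longrightarrow> \<alpha> p [tadd X Y] = \<alpha> p [X] + \<alpha> p [Y]" "\<alpha> p [tscale r X] = r *\<^sub>R \<alpha> p [X]"
    unfolding alternating_on_def using assms(2) by (auto dest!: spec[of _ "[X]"])
qed

lemma form_component_1_linear:
  assumes A: "oriented_atlas A" and c: "c \<in> A" "x \<in> snd c ` fst c" and \<alpha>: "is_form A 1 \<alpha>"
  shows "linear (\<lambda>u. form_component A c \<alpha> [u] x)"
proof -
  have p: "chart_inv c x \<in> fst c" by (rule chart_inv_in[OF A c])
  show ?thesis
    unfolding form_component_def
    by (rule linearI)
       (simp_all add: coord_vec_linear[OF A c(1) p, symmetric] is_form_1_linear[OF \<alpha>] coord_vec_in_tangent[OF c(1) p])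
qed

lemma extd_1:
  "extd A \<alpha> p [X, Y] = (let c = some_chart A p in
     frechet_derivative (form_component A c \<alpha> [coords c Y]) (at (snd c p)) (coords c X)
     - frechet_derivative (form_component A c \<alpha> [coords c X]) (at (snd c p)) (coords c Y))"
  by (simp add: extd_def Let_def lessThan_Suc numeral_2_eq_2)

text \<open>In coordinates the pulled-back form is a linear family applied to the derivative of
  \<psi>. Its antisymmetrised derivative contains the second derivatives of \<psi>, which cancel by
  symmetry. This removes the dependence of \<open>extd\<close> on \<open>some_chart\<close>.\<close>

lemma pullback_1_form:
  assumes B: "oriented_atlas B" and \<phi>: "smooth_param B S \<phi>" and \<alpha>: "is_form B 1 \<alpha>"
  shows "smooth_on S (\<lambda>y. \<alpha> (\<phi> y) [pvec B \<phi> y (u::'a::real_normed_vector)])"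
    and "x \<in> S \<Longrightarrow> frechet_derivative (\<lambda>y. \<alpha> (\<phi> y) [pvec B \<phi> y v]) (at x) u
      - frechet_derivative (\<lambda>y. \<alpha> (\<phi> y) [pvec B \<phi> y u]) (at x) v = extd B \<alpha> (\<phi> x) [pvec B \<phi> x u, pvec B \<phi> x v]"
proof -
  have local: "smooth_on (S \<inter> \<phi> -` fst d) (\<lambda>y. \<alpha> (\<phi> y) [pvec B \<phi> y u]) \<and> 
     (x \<in> S \<inter> \<phi> -` fst d \<longrightarrow> frechet_derivative (\<lambda>y. \<alpha> (\<phi> y) [pvec B \<phi> y u]) (at x) v =
       frechet_derivative (form_component B d \<alpha> [frechet_derivative (snd d \<circ> \<phi>) (at x) u]) (at (snd d (\<phi> x))) (frechet_derivative (snd d \<circ> \<phi>) (at x) v)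
      + form_component B d \<alpha> [frechet_derivative (\<lambda>y. frechet_derivative (snd d \<circ> \<phi>) (at y) u) (at x) v] (snd d (\<phi> x)))"
    if d: "d \<in> B" for d u v x
  proof -
    define N where "N = S \<inter> \<phi> -` fst d"
    have N: "open N" unfolding N_def by (rule smooth_param_preimage[OF \<phi> chart_open_dom[OF B d]])
    define \<psi> where "\<psi> = snd d \<circ> \<phi>"
    have \<psi>: "smooth_on N \<psi>" unfolding N_def \<psi>_def by (rule smooth_param_coord[OF \<phi> d])
    define \<beta> where "\<beta> z w = form_component B d \<alpha> [w] z" for z w
    have \<beta>: "smooth_on (snd d ` fst d) (\<lambda>z. \<beta> z w)" for w
      using \<alpha> d unfolding \<beta>_def is_form_def by simp
    have lin: "linear (\<beta> z)" if "z \<in> snd d ` fst d" for z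
      unfolding \<beta>_def by (rule form_component_1_linear[OF B d that \<alpha>])
    have sub: "\<psi> ` N \<subseteq> snd d ` fst d" by (auto simp: N_def \<psi>_def)
    have eq: "\<beta> (\<psi> y) (frechet_derivative \<psi> (at y) u) = \<alpha> (\<phi> y) [pvec B \<phi> y u]" if "y \<in> N" for y
      using that pvec_coord[OF B \<phi> _ d, of y u] chart_inv_left[OF B d, of "\<phi> y"]
      by (simp add: N_def \<beta>_def \<psi>_def form_component_def)
    note dl = deriv_linear_family[OF N \<beta> lin \<psi> sub smooth_on_frechet[OF \<psi>]]
    have "smooth_on N (\<lambda>y. \<alpha> (\<phi> y) [pvec B \<phi> y u])"
      by (rule smooth_on_cong[OF dl(1) N eq])
    moreover have dl2: "frechet_derivative (\<lambda>y. \<beta> (\<psi> y) (frechet_derivative \<psi> (at y) u)) (at x) v =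
        frechet_derivative (\<lambda>z. \<beta> z (frechet_derivative \<psi> (at x) u)) (at (\<psi> x)) (frechet_derivative \<psi> (at x) v)
       + \<beta> (\<psi> x) (frechet_derivative (\<lambda>y. frechet_derivative \<psi> (at y) u) (at x) v)" if "x \<in> N"
      by (rule dl(2)[OF _ chart_open_image[OF B d] that])
    moreover have "frechet_derivative (\<lambda>y. \<alpha> (\<phi> y) [pvec B \<phi> y u]) (at x) v =
        frechet_derivative (\<lambda>z. \<beta> z (frechet_derivative \<psi> (at x) u)) (at (\<psi> x)) (frechet_derivative \<psi> (at x) v)
       + \<beta> (\<psi> x) (frechet_derivative (\<lambda>y. frechet_derivative \<psi> (at y) u) (at x) v)" if "x \<in> N"
      using dl2[OF that] frechet_derivative_cong_open[OF N that eq] by simp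
    ultimately show ?thesis by (simp add: N_def \<beta>_def \<psi>_def)
  qed
  show "smooth_on S (\<lambda>y. \<alpha> (\<phi> y) [pvec B \<phi> y u])"
  proof (rule smooth_on_local)
    fix x assume x: "x \<in> S"
    obtain d where d: "d \<in> B" "\<phi> x \<in> fst d" using chart_at[OF B] by blast
    show "\<exists>N. open N \<and> x \<in> N \<and> smooth_on N (\<lambda>y. \<alpha> (\<phi> y) [pvec B \<phi> y u])"
      using local[OF d(1)] smooth_param_preimage[OF \<phi> chart_open_dom[OF B d(1)]] d x
      by (intro exI[of _ "S \<inter> \<phi> -` fst d"]) auto
  qed
  assume x: "x \<in> S"
  define d where "d = some_chart B (\<phi> x)"
  have d: "d \<in> B" "\<phi> x \<in> fst d" using some_chart_in[OF B] by (auto simp: d_def)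
  have xN: "x \<in> S \<inter> \<phi> -` fst d" using x d by auto
  have sym: "frechet_derivative (\<lambda>y. frechet_derivative (snd d \<circ> \<phi>) (at y) u) (at x) v
     = frechet_derivative (\<lambda>y. frechet_derivative (snd d \<circ> \<phi>) (at y) v) (at x) u"
    by (rule frechet_derivative_commute[OF smooth_param_preimage[OF \<phi> chart_open_dom[OF B d(1)]] xN smooth_param_coord[OF \<phi> d(1)]])
  have co: "coords d (pvec B \<phi> x u) = frechet_derivative (snd d \<circ> \<phi>) (at x) u" for u
    using pvec_coord[OF B \<phi> x d] coords_coord_vec[OF B d] by simp
  show "frechet_derivative (\<lambda>y. \<alpha> (\<phi> y) [pvec B \<phi> y v]) (at x) u
      - frechet_derivative (\<lambda>y. \<alpha> (\<phi> y) [pvec B \<phi> y u]) (at x) v = extd B \<alpha> (\<phi> x) [pvec B \<phi> x u, pvec B \<phi> x v]"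
    using local[OF d(1), of v x u] local[OF d(1), of u x v] xN sym
    by (simp add: extd_1 Let_def d_def[symmetric] co)
qed

subsection \<open>Alternating multilinear functions on lists of vectors\<close>

text \<open>Counterpart of \<open>alternating_on\<close> for arguments in a vector space type.
  Tangent vectors have only \<open>tadd\<close> and \<open>tscale\<close>, so linear algebra is done
  on their coordinates.\<close>

definition multi_alt :: "nat \<Rightarrow> ('v::real_vector list \<Rightarrow> 'b::real_vector) \<Rightarrow> bool" where
  "multi_alt n f \<longleftrightarrow> (\<forall>us. length us = n \<longrightarrow>
     (\<forall>i<n. \<forall>v. f (us[i := us ! i + v]) = f us + f (us[i := v])) \<and>
     (\<forall>i<n. \<forall>r. f (us[i := r *\<^sub>R us ! i]) = r *\<^sub>R f us) \<and>
     (\<forall>i<n. \<forall>j<n. i \<noteq> j \<and> us ! i = us ! j \<longrightarrow> f us = 0))"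

lemma
  assumes "multi_alt n f" "length us = n"
  shows multi_alt_add: "i < n \<Longrightarrow> f (us[i := x + y]) = f (us[i := x]) + f (us[i := y])"
    and multi_alt_scale: "i < n \<Longrightarrow> f (us[i := r *\<^sub>R x]) = r *\<^sub>R f (us[i := x])"
    and multi_alt_eq: "i < n \<Longrightarrow> j < n \<Longrightarrow> i \<noteq> j \<Longrightarrow> us ! i = us ! j \<Longrightarrow> f us = 0"
proof -
  note d = assms(1)[unfolded multi_alt_def, rule_format]
  show "f (us[i := x + y]) = f (us[i := x]) + f (us[i := y])" if "i < n"
    using d[of "us[i := x]"] that assms(2) by auto
  show "f (us[i := r *\<^sub>R x]) = r *\<^sub>R f (us[i := x])" if "i < n"
    using d[of "us[i := x]"] that assms(2) by auto
  show "f us = 0" if "i < n" "j < n" "i \<noteq> j" "us ! i = us ! j"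
    using d[of us] that assms(2) by auto
qed

text \<open>Put x + y into both slots i and j and expand.\<close>

lemma multi_alt_swap:
  assumes f: "multi_alt n f" and us: "length us = n" "i < n" "j < n" "i \<noteq> j"
  shows "f (us[i := us ! j, j := us ! i]) = - f us"
proof -
  define g where "g x y = f (us[i := x, j := y])" for x y
  have add1: "g (x + x') y = g x y + g x' y" for x x' y
    using multi_alt_add[OF f, of "us[j := y]" i x x'] us by (simp add: g_def list_update_swap)
  have add2: "g x (y + y') = g x y + g x y'" for x y y'
    using multi_alt_add[OF f, of "us[i := x]" j y y'] us by (simp add: g_def)
  have eq: "g x x = 0" for x
    using multi_alt_eq[OF f, of "us[i := x, j := x]" i j] us by (simp add: g_def)
  have "0 = g (us ! i + us ! j) (us ! i + us ! j)" by (simp add: eq)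
  also have "\<dots> = g (us ! i) (us ! j) + g (us ! j) (us ! i)" unfolding add1 add2 by (simp add: eq)
  finally have "g (us ! j) (us ! i) + g (us ! i) (us ! j) = 0" by (metis add.commute)
  then have "g (us ! j) (us ! i) = - g (us ! i) (us ! j)" by (simp only: eq_neg_iff_add_eq_0)
  then show ?thesis by (simp add: g_def)
qed

text \<open>By multilinearity every value is a combination of values on lists taken from
  \<open>bs\<close>; such a list either repeats an entry or is a permutation of
  \<open>bs\<close>.\<close>

lemma multi_alt_zero:
  assumes f: "multi_alt n f" and bs: "length bs = n" "\<And>v. \<exists>c. v = (\<Sum>i<n. c i *\<^sub>R bs ! i)" and 0: "f bs = 0"
    and us: "length us = n"
  shows "f us = 0"
proof -
  \<comment> \<open>Selection sort: k is the length of the prefix already in place, and each swap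
    only changes the sign.\<close>
  have perm: "f (map ((!) bs) js) = 0"
    if "distinct js" "set js = {..<n}" "k \<le> n" "\<forall>i<k. js ! i = i" for k js
    using that
  proof (induction "n - k" arbitrary: k js)
    case 0
    then have "length js = n" by (metis card_lessThan distinct_card)
    then have "map ((!) bs) js = bs" using 0 bs(1) by (intro nth_equalityI) auto
    then show ?case using assms(4) by simp
  next
    case (Suc m)
    have len: "length js = n" using Suc.prems by (metis card_lessThan distinct_card)
    have kn: "k < n" using Suc by simp
    then obtain j where j: "j < n" "js ! j = k" using Suc.prems(2) len by (metis in_set_conv_nth lessThan_iff)
    show ?case
    proof (cases "j = k")
      case True
      then show ?thesis using Suc.hyps(1)[of "Suc k" js] Suc.hyps(2) Suc.prems kn j by (auto simp: less_Suc_eq)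
    next
      case False
      have jk: "\<not> j < k" using Suc.prems(4) j False by auto
      define js' where "js' = js[j := js ! k, k := js ! j]"
      have "f (map ((!) bs) js') = 0"
      proof (rule Suc.hyps(1)[of "Suc k"])
        show "distinct js'" unfolding js'_def using distinct_swap[of j js k] Suc.prems(1) len j(1) kn by metis
        show "set js' = {..<n}" unfolding js'_def using set_swap[of j js k] Suc.prems(2) len j(1) kn by metis
        show "\<forall>i<Suc k. js' ! i = i" unfolding js'_def using Suc.prems(4) j len kn jk by (auto simp: nth_list_update less_Suc_eq)
      qed (use Suc.hyps(2) kn in auto)
      moreover have "map ((!) bs) js' = (map ((!) bs) js)[j := map ((!) bs) js ! k, k := map ((!) bs) js ! j]"
        using j len kn by (simp add: js'_def map_update)
      ultimately show ?thesis
        using multi_alt_swap[OF f, of "map ((!) bs) js" j k] len j kn False by simp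
    qed
  qed
  have idx: "f (map ((!) bs) js) = 0" if js: "length js = n" "set js \<subseteq> {..<n}" for js
  proof (cases "distinct js")
    case True
    then have "set js = {..<n}" using js by (metis card_lessThan card_subset_eq distinct_card finite_lessThan)
    then show ?thesis using perm[of js 0] True by simp
  next
    case False
    then obtain i j where "i < n" "j < n" "i \<noteq> j" "js ! i = js ! j" using js(1) by (auto simp: distinct_conv_nth)
    then show ?thesis using multi_alt_eq[OF f, of "map ((!) bs) js" i j] js(1) by simp
  qed
  \<comment> \<open>k bounds the positions still holding arbitrary vectors; the induction expands
    the last of them in \<open>bs\<close>.\<close>
  have gen: "f us = 0" if "length us = n" "k \<le> n" "\<forall>i. k \<le> i \<and> i < n \<longrightarrow> us ! i \<in> set bs" for us k
    using that
  proof (induction k arbitrary: us)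
    case 0
    then have "\<forall>i<n. \<exists>j<n. us ! i = bs ! j" using bs(1) by (metis in_set_conv_nth le0)
    then obtain g where g: "\<forall>i<n. g i < n \<and> us ! i = bs ! g i" by metis
    then have "us = map ((!) bs) (map g [0..<n])" using 0 by (intro nth_equalityI) auto
    moreover have "f (map ((!) bs) (map g [0..<n])) = 0" by (rule idx) (use g in auto)
    ultimately show ?case by (simp only:)
  next
    case (Suc k)
    obtain c where c: "us ! k = (\<Sum>i<n. c i *\<^sub>R bs ! i)" using bs(2) by blast
    have fin: "f (us[k := (\<Sum>i\<in>I. c i *\<^sub>R bs ! i)]) = (\<Sum>i\<in>I. c i *\<^sub>R f (us[k := bs ! i]))" if "finite I" for I
      using that
    proof (induction I rule: finite_induct)
      case empty
      show ?case using multi_alt_scale[OF f Suc.prems(1), of k 0 "us ! k"] Suc.prems(2) by simp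
    next
      case (insert a I)
      then show ?case using multi_alt_add[OF f Suc.prems(1), of k] multi_alt_scale[OF f Suc.prems(1), of k] Suc.prems(2) by simp
    qed
    have "f (us[k := bs ! i]) = 0" if "i < n" for i
      using that bs(1) Suc.prems by (intro Suc.IH) (auto simp: nth_list_update Suc_le_eq)
    then have "f (us[k := (\<Sum>i<n. c i *\<^sub>R bs ! i)]) = 0" using fin[of "{..<n}"] by simp
    then show ?case using c by (metis list_update_id)
  qed
  show ?thesis by (rule gen[OF us, of n]) auto
qed

text \<open>The alternating form \<open>f us * g bs - f bs * g us\<close> vanishes on the spanning
  list \<open>bs\<close>.\<close>

lemma multi_alt_proportional:
  fixes f g :: "'v::real_vector list \<Rightarrow> real"
  assumes f: "multi_alt n f" and g: "multi_alt n g"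
    and bs: "length bs = n" "\<And>v. \<exists>c. v = (\<Sum>i<n. c i *\<^sub>R bs ! i)"
    and us: "length us = n"
  shows "f us * g bs = f bs * g us"
proof -
  have "multi_alt n (\<lambda>us. f us * g bs - f bs * g us)"
    using f g unfolding multi_alt_def by (simp add: algebra_simps)
  from multi_alt_zero[OF this bs _ us] show ?thesis by simp
qed

lemma multi_alt_of_alternating:
  assumes A: "oriented_atlas A" and c: "c \<in> A" "p \<in> fst c" and a: "alternating_on (tangent A p) k a"
  shows "multi_alt k (\<lambda>us. a (map (coord_vec A c p) us))"
  unfolding multi_alt_def
proof (intro allI impI)
  fix us :: "(real ^ 'b) list" assume us: "length us = k"
  let ?X = "map (coord_vec A c p) us"
  have X: "length ?X = k" "set ?X \<subseteq> tangent A p" using us coord_vec_in_tangent[OF c] by auto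
  note d = a[unfolded alternating_on_def, rule_format, OF conjI[OF X]]
  have t: "coord_vec A c p v \<in> tangent A p" for v by (rule coord_vec_in_tangent[OF c])
  show "(\<forall>i<k. \<forall>v. a (map (coord_vec A c p) (us[i := us ! i + v])) = a ?X + a (map (coord_vec A c p) (us[i := v]))) \<and>
    (\<forall>i<k. \<forall>r. a (map (coord_vec A c p) (us[i := r *\<^sub>R us ! i])) = r *\<^sub>R a ?X) \<and>
    (\<forall>i<k. \<forall>j<k. i \<noteq> j \<and> us ! i = us ! j \<longrightarrow> a ?X = 0)"
    using d t us by (auto simp: map_update coord_vec_linear[OF A c, symmetric])
qed

subsection \<open>Exterior products of covectors\<close>

text \<open>The determinant of the values of the covectors on the vectors, which is their wedge
  product in the normalisation of \<open>alt_wedge\<close>. The argument type is arbitrary, so it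
  applies to tangent vectors directly.\<close>

definition ext_prod :: "('x \<Rightarrow> real) list \<Rightarrow> 'x list \<Rightarrow> real" where
  "ext_prod cs Xs = (\<Sum>\<sigma> | \<sigma> permutes {..<length cs}. real_of_int (sign \<sigma>) * (\<Prod>i<length cs. (cs ! i) (Xs ! \<sigma> i)))"

lemma sum_permutes_compose_right:
  assumes "\<theta> permutes S" "finite S"
  shows "(\<Sum>\<sigma> | \<sigma> permutes S. real_of_int (sign \<sigma>) * F \<sigma>) =
     real_of_int (sign \<theta>) * (\<Sum>\<sigma> | \<sigma> permutes S. real_of_int (sign \<sigma>) * F (\<sigma> \<circ> \<theta>))"
proof -
  have bij: "bij_betw (\<lambda>\<sigma>. \<sigma> \<circ> \<theta>) {\<sigma>. \<sigma> permutes S} {\<sigma>. \<sigma> permutes S}"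
    using assms
    by (intro bij_betw_byWitness[where f' = "\<lambda>\<sigma>. \<sigma> \<circ> inv \<theta>"])
       (auto simp: o_assoc[symmetric] permutes_inv_o intro: permutes_compose permutes_inv)
  have "(\<Sum>\<sigma> | \<sigma> permutes S. real_of_int (sign \<sigma>) * F \<sigma>) = (\<Sum>\<sigma> | \<sigma> permutes S. real_of_int (sign (\<sigma> \<circ> \<theta>)) * F (\<sigma> \<circ> \<theta>))"
    using sum.reindex_bij_betw[OF bij, of "\<lambda>\<sigma>. real_of_int (sign \<sigma>) * F \<sigma>"] by simp
  also have "\<dots> = (\<Sum>\<sigma> | \<sigma> permutes S. real_of_int (sign \<theta>) * (real_of_int (sign \<sigma>) * F (\<sigma> \<circ> \<theta>)))"
  proof (rule sum.cong[OF refl])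
    fix \<sigma> assume "\<sigma> \<in> {\<sigma>. \<sigma> permutes S}"
    then have "permutation \<sigma>" "permutation \<theta>" using assms permutation_permutes by blast+
    then show "real_of_int (sign (\<sigma> \<circ> \<theta>)) * F (\<sigma> \<circ> \<theta>) = real_of_int (sign \<theta>) * (real_of_int (sign \<sigma>) * F (\<sigma> \<circ> \<theta>))"
      by (simp add: sign_compose)
  qed
  finally show ?thesis by (simp add: sum_distrib_left)
qed

lemma ext_prod_permute:
  assumes "\<theta> permutes {..<n}" "length cs = n"
  shows "ext_prod (map (\<lambda>k. cs ! \<theta> k) [0..<n]) Xs = real_of_int (sign \<theta>) * ext_prod cs Xs"
proof -
  have inv: "inv \<theta> permutes {..<n}" using assms permutes_inv by blast
  have "ext_prod cs Xs = real_of_int (sign (inv \<theta>)) *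
     (\<Sum>\<sigma> | \<sigma> permutes {..<n}. real_of_int (sign \<sigma>) * (\<Prod>i<n. (cs ! i) (Xs ! (\<sigma> \<circ> inv \<theta>) i)))"
    unfolding ext_prod_def assms(2) by (rule sum_permutes_compose_right[OF inv]) simp
  also have "\<dots> = real_of_int (sign (inv \<theta>)) * ext_prod (map (\<lambda>k. cs ! \<theta> k) [0..<n]) Xs"
    unfolding ext_prod_def
  proof (intro arg_cong2[of _ _ _ _ "(*)"] sum.cong refl)
    fix \<sigma>
    have "(\<Prod>i<n. (cs ! i) (Xs ! (\<sigma> \<circ> inv \<theta>) i)) = (\<Prod>i<n. (cs ! \<theta> i) (Xs ! \<sigma> i))"
      using prod.permute[OF assms(1), of "\<lambda>i. (cs ! i) (Xs ! (\<sigma> \<circ> inv \<theta>) i)"] assms(1)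
      by (simp add: o_def permutes_inverses)
    then show "(\<Prod>i<n. (cs ! i) (Xs ! (\<sigma> \<circ> inv \<theta>) i)) =
       (\<Prod>i<length (map (\<lambda>k. cs ! \<theta> k) [0..<n]). (map (\<lambda>k. cs ! \<theta> k) [0..<n] ! i) (Xs ! \<sigma> i))"
      by simp
  qed simp
  finally have e: "ext_prod cs Xs = real_of_int (sign (inv \<theta>)) * ext_prod (map (\<lambda>k. cs ! \<theta> k) [0..<n]) Xs" .
  have "sign (inv \<theta>) = sign \<theta>" using assms(1) permutation_permutes sign_inverse by blast
  then show ?thesis using e by (simp add: sign_def)
qed

text \<open>The i-th argument occurs in exactly one factor of each summand, the one with index
  \<open>inv \<sigma> i\<close>; isolating it makes linearity visible.\<close>

lemma ext_prod_alt:
  assumes "length cs = n" "length Xs = n"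
  shows "i < n \<Longrightarrow> ext_prod cs (Xs[i := Z]) =
      (\<Sum>\<sigma> | \<sigma> permutes {..<n}. real_of_int (sign \<sigma>) * (cs ! inv \<sigma> i) Z * (\<Prod>k\<in>{..<n} - {inv \<sigma> i}. (cs ! k) (Xs ! \<sigma> k)))"
    and "i < n \<Longrightarrow> j < n \<Longrightarrow> i \<noteq> j \<Longrightarrow> Xs ! i = Xs ! j \<Longrightarrow> ext_prod cs Xs = 0"
proof -
  show "ext_prod cs (Xs[i := Z]) =
      (\<Sum>\<sigma> | \<sigma> permutes {..<n}. real_of_int (sign \<sigma>) * (cs ! inv \<sigma> i) Z * (\<Prod>k\<in>{..<n} - {inv \<sigma> i}. (cs ! k) (Xs ! \<sigma> k)))" if i: "i < n"
    unfolding ext_prod_def assms(1)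
  proof (rule sum.cong[OF refl])
    fix \<sigma> assume "\<sigma> \<in> {\<sigma>. \<sigma> permutes {..<n}}"
    then have \<sigma>: "\<sigma> permutes {..<n}" by simp
    have m: "inv \<sigma> i \<in> {..<n}" using permutes_in_image[OF permutes_inv[OF \<sigma>], of i] i by simp
    have si: "\<sigma> (inv \<sigma> i) = i" by (rule permutes_inverses(1)[OF \<sigma>])
    have "(\<Prod>k<n. (cs ! k) (Xs[i := Z] ! \<sigma> k)) = (cs ! inv \<sigma> i) Z * (\<Prod>k\<in>{..<n} - {inv \<sigma> i}. (cs ! k) (Xs[i := Z] ! \<sigma> k))"
      by (subst prod.remove[OF _ m]) (use i assms(2) si in auto)
    also have "(\<Prod>k\<in>{..<n} - {inv \<sigma> i}. (cs ! k) (Xs[i := Z] ! \<sigma> k)) = (\<Prod>k\<in>{..<n} - {inv \<sigma> i}. (cs ! k) (Xs ! \<sigma> k))"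
    proof (rule prod.cong[OF refl])
      fix k assume "k \<in> {..<n} - {inv \<sigma> i}"
      then have "\<sigma> k \<noteq> i" using permutes_inverses(2)[OF \<sigma>, of k] by auto
      then show "(cs ! k) (Xs[i := Z] ! \<sigma> k) = (cs ! k) (Xs ! \<sigma> k)" by simp
    qed
    finally show "real_of_int (sign \<sigma>) * (\<Prod>k<n. (cs ! k) (Xs[i := Z] ! \<sigma> k)) =
       real_of_int (sign \<sigma>) * (cs ! inv \<sigma> i) Z * (\<Prod>k\<in>{..<n} - {inv \<sigma> i}. (cs ! k) (Xs ! \<sigma> k))" by simp
  qed
  show "ext_prod cs Xs = 0" if ij: "i < n" "j < n" "i \<noteq> j" "Xs ! i = Xs ! j"
  proof -
    define t where "t = Transposition.transpose i j"
    have t: "t permutes {..<n}" using ij by (simp add: t_def permutes_swap_id)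
    have Xt: "Xs ! t k = Xs ! k" for k using ij by (auto simp: t_def Transposition.transpose_def)
    have inv: "inv \<sigma> permutes {..<n}" if "\<sigma> permutes {..<n}" for \<sigma> using that permutes_inv by blast
    \<comment> \<open>Left composition with the transposition reverses the signs but keeps the
      products, since the two arguments are equal. Thus the sum equals its own negative.\<close>
    have bij: "bij_betw (\<lambda>\<sigma>. t \<circ> \<sigma>) {\<sigma>. \<sigma> permutes {..<n}} {\<sigma>. \<sigma> permutes {..<n}}"
      by (intro bij_betw_byWitness[where f' = "\<lambda>\<sigma>. t \<circ> \<sigma>"])
         (use t in \<open>auto simp: o_assoc t_def intro: permutes_compose\<close>)
    have "ext_prod cs Xs = (\<Sum>\<sigma> | \<sigma> permutes {..<n}. real_of_int (sign (t \<circ> \<sigma>)) * (\<Prod>k<n. (cs ! k) (Xs ! (t \<circ> \<sigma>) k)))"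
      unfolding ext_prod_def assms(1)
      using sum.reindex_bij_betw[OF bij, of "\<lambda>\<sigma>. real_of_int (sign \<sigma>) * (\<Prod>k<n. (cs ! k) (Xs ! \<sigma> k))"] by simp
    also have "\<dots> = (\<Sum>\<sigma> | \<sigma> permutes {..<n}. - (real_of_int (sign \<sigma>) * (\<Prod>k<n. (cs ! k) (Xs ! \<sigma> k))))"
    proof (rule sum.cong[OF refl])
      fix \<sigma> assume "\<sigma> \<in> {\<sigma>. \<sigma> permutes {..<n}}"
      then have p: "permutation \<sigma>" "permutation t" using t permutation_permutes by blast+
      have "sign t = -1" using ij by (simp add: t_def sign_swap_id)
      then show "real_of_int (sign (t \<circ> \<sigma>)) * (\<Prod>k<n. (cs ! k) (Xs ! (t \<circ> \<sigma>) k)) = - (real_of_int (sign \<sigma>) * (\<Prod>k<n. (cs ! k) (Xs ! \<sigma> k)))"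
        using sign_compose[OF p(2,1)] by (simp add: Xt)
    qed
    also have "\<dots> = - ext_prod cs Xs" by (simp add: ext_prod_def assms(1) sum_negf)
    finally show ?thesis by simp
  qed
qed

lemma multi_alt_ext_prod:
  fixes cs :: "('v::real_vector \<Rightarrow> real) list"
  assumes "length cs = n" "\<And>c. c \<in> set cs \<Longrightarrow> linear c"
  shows "multi_alt n (ext_prod cs)"
  unfolding multi_alt_def
proof (intro allI impI conjI)
  fix us :: "'v list" assume us: "length us = n"
  have lin: "linear (cs ! inv \<sigma> i)" if "i < n" "\<sigma> permutes {..<n}" for \<sigma> i
    using permutes_in_image[OF permutes_inv[OF that(2)], of i] that(1) assms by simp
  note e = ext_prod_alt(1)[OF assms(1) us]
  have e0: "ext_prod cs us = ext_prod cs (us[i := us ! i])" for i by simp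
  show "ext_prod cs (us[i := us ! i + v]) = ext_prod cs us + ext_prod cs (us[i := v])" if i: "i < n" for i v
    unfolding e0[of i] e[OF i] sum.distrib[symmetric]
    by (rule sum.cong) (auto simp: linear_add[OF lin[OF i]] algebra_simps)
  show "ext_prod cs (us[i := r *\<^sub>R us ! i]) = r *\<^sub>R ext_prod cs us" if i: "i < n" for i r
    unfolding e0[of i] e[OF i] scaleR_sum_right
    by (rule sum.cong) (auto simp: linear_cmul[OF lin[OF i]] algebra_simps)
  show "ext_prod cs us = 0" if "i < n" "j < n" "i \<noteq> j \<and> us ! i = us ! j" for i j
    using ext_prod_alt(2)[OF assms(1) us] that by blast
qed

lemma prod_lessThan_add:
  "(\<Prod>i<k + l. f i) = (\<Prod>i<k. f i) * (\<Prod>i<l. f (k + i))" for k l :: nat and f :: "nat \<Rightarrow> real"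
  by (induction l) (simp_all add: mult.assoc)

text \<open>Embeds permutations of l letters as permutations of the last l among k + l letters. The
  sign is preserved because transpositions go to transpositions.\<close>

lemma sign_shift:
  fixes k l :: nat
  assumes "\<rho> permutes {..<l}"
  defines "sh \<equiv> \<lambda>\<rho> i. if k \<le> i \<and> i < k + l then k + \<rho> (i - k) else (i::nat)"
  shows "sh \<rho> permutes {..<k + l} \<and> sign (sh \<rho>) = sign \<rho>"
  using assms(1) finite_lessThan
proof (induction rule: permutes_induct)
  case id
  have "sh id = id" by (auto simp: sh_def)
  then show ?case by (simp only: permutes_id sign_id simp_thms)
next
  case (swap a b p)
  have ab: "a < l" "b < l" using swap by auto
  have pin: "p i < l" if "i < l" for i using permutes_in_image[OF \<open>p permutes {..<l}\<close>, of i] that by simp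
  have sh: "sh (Transposition.transpose a b \<circ> p) = Transposition.transpose (k + a) (k + b) \<circ> sh p"
  proof
    fix i
    show "sh (Transposition.transpose a b \<circ> p) i = (Transposition.transpose (k + a) (k + b) \<circ> sh p) i"
    proof (cases "k \<le> i \<and> i < k + l")
      case True
      then show ?thesis by (simp add: sh_def Transposition.transpose_def)
    next
      case False
      then have "i \<noteq> k + a" "i \<noteq> k + b" using ab by auto
      then show ?thesis using False unfolding sh_def comp_def if_not_P[OF False] by (simp add: Transposition.transpose_def)
    qed
  qed
  have t: "Transposition.transpose (k + a) (k + b) permutes {..<k + l}" using ab by (intro permutes_swap_id) auto
  have IH: "sh p permutes {..<k + l}" "sign (sh p) = sign p" using swap.IH by blast+
  have p1: "permutation (sh p)" using IH(1) permutation_permutes by blast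
  have p2: "permutation p" using \<open>p permutes {..<l}\<close> permutation_permutes by blast
  have "sh (Transposition.transpose a b \<circ> p) permutes {..<k + l}"
    unfolding sh by (rule permutes_compose[OF IH(1) t])
  moreover have "sign (sh (Transposition.transpose a b \<circ> p)) = sign (Transposition.transpose a b \<circ> p)"
    unfolding sh using \<open>a \<noteq> b\<close>
    by (simp only: sign_compose[OF permutation_swap_id p1] sign_compose[OF permutation_swap_id p2] sign_swap_id IH(2)) simp
  ultimately show ?case by blast
qed

text \<open>Expanding both factors gives a triple sum over \<sigma>, \<pi>, \<rho>. For fixed \<pi>
  and \<rho>, composing \<sigma> with the block permutation they define turns the sum over \<sigma>
  into the full product, and the k! l! pairs cancel the normalising factor.\<close>

lemma alt_wedge_ext_prod:
  assumes as: "length as = k" and bs: "length bs = l"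
  shows "alt_wedge (*) k l (ext_prod as) (ext_prod bs) Xs = ext_prod (as @ bs) Xs"
proof -
  let ?S = "\<lambda>n::nat. {\<sigma>. \<sigma> permutes {..<n}}"
  define F where "F \<sigma> = (\<Prod>i<k+l. ((as @ bs) ! i) (Xs ! \<sigma> i))" for \<sigma>
  define sh where "sh \<rho> i = (if k \<le> i \<and> i < k + l then k + \<rho> (i - k) else (i::nat))" for \<rho> i
  have E: "ext_prod (as @ bs) Xs = (\<Sum>\<sigma>\<in>?S (k+l). real_of_int (sign \<sigma>) * F \<sigma>)"
    by (simp add: ext_prod_def as bs F_def)
  have summand: "ext_prod as (map (\<lambda>i. Xs ! \<sigma> i) [0..<k]) * ext_prod bs (map (\<lambda>i. Xs ! \<sigma> i) [k..<k + l])
     = (\<Sum>\<pi>\<in>?S k. \<Sum>\<rho>\<in>?S l. real_of_int (sign (\<pi> \<circ> sh \<rho>)) * F (\<sigma> \<circ> (\<pi> \<circ> sh \<rho>)))" for \<sigma>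
    unfolding ext_prod_def as bs sum_product
  proof (intro sum.cong refl)
    fix \<pi> \<rho> assume "\<pi> \<in> ?S k" "\<rho> \<in> ?S l"
    then have p: "\<pi> permutes {..<k}" "\<rho> permutes {..<l}" by auto
    have p\<pi>: "\<pi> permutes {..<k+l}" using permutes_subset[OF p(1)] by auto
    have sh: "sh \<rho> permutes {..<k + l}" "sign (sh \<rho>) = sign \<rho>"
      using sign_shift[OF p(2), of k] by (auto simp: sh_def[abs_def])
    have sg: "sign (\<pi> \<circ> sh \<rho>) = sign \<pi> * sign \<rho>"
      using sign_compose[of \<pi> "sh \<rho>"] sh p\<pi> permutation_permutes by (metis finite_lessThan)
    have \<pi>in: "\<pi> i < k" if "i < k" for i using permutes_in_image[OF p(1), of i] that by simp
    have \<pi>out: "\<pi> i = i" if "\<not> i < k" for i using permutes_not_in[OF p(1), of i] that by simp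
    have \<rho>in: "\<rho> i < l" if "i < l" for i using permutes_in_image[OF p(2), of i] that by simp
    have "F (\<sigma> \<circ> (\<pi> \<circ> sh \<rho>)) = (\<Prod>i<k. ((as @ bs) ! i) (Xs ! (\<sigma> \<circ> (\<pi> \<circ> sh \<rho>)) i)) * (\<Prod>i<l. ((as @ bs) ! (k + i)) (Xs ! (\<sigma> \<circ> (\<pi> \<circ> sh \<rho>)) (k + i)))"
      unfolding F_def by (rule prod_lessThan_add) 
    also have "(\<Prod>i<k. ((as @ bs) ! i) (Xs ! (\<sigma> \<circ> (\<pi> \<circ> sh \<rho>)) i)) = (\<Prod>i<k. (as ! i) (map (\<lambda>i. Xs ! \<sigma> i) [0..<k] ! \<pi> i))"
      by (rule prod.cong) (auto simp: nth_append as sh_def \<pi>in)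
    also have "(\<Prod>i<l. ((as @ bs) ! (k + i)) (Xs ! (\<sigma> \<circ> (\<pi> \<circ> sh \<rho>)) (k + i))) = (\<Prod>i<l. (bs ! i) (map (\<lambda>i. Xs ! \<sigma> i) [k..<k + l] ! \<rho> i))"
      by (rule prod.cong) (auto simp: nth_append as sh_def \<pi>out \<rho>in)
    finally have fin: "F (\<sigma> \<circ> (\<pi> \<circ> sh \<rho>)) = (\<Prod>i<k. (as ! i) (map (\<lambda>i. Xs ! \<sigma> i) [0..<k] ! \<pi> i)) * (\<Prod>i<l. (bs ! i) (map (\<lambda>i. Xs ! \<sigma> i) [k..<k + l] ! \<rho> i))" .
    show "real_of_int (sign \<pi>) * (\<Prod>i<k. (as ! i) (map (\<lambda>i. Xs ! \<sigma> i) [0..<k] ! \<pi> i)) *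
         (real_of_int (sign \<rho>) * (\<Prod>i<l. (bs ! i) (map (\<lambda>i. Xs ! \<sigma> i) [k..<k + l] ! \<rho> i)))
       = real_of_int (sign (\<pi> \<circ> sh \<rho>)) * F (\<sigma> \<circ> (\<pi> \<circ> sh \<rho>))"
      unfolding fin sg by simp
  qed
  \<comment> \<open>The block permutation is a fixed element of the large permutation group, so
    right translation by it only reindexes the sum.\<close>
  have inner: "(\<Sum>\<sigma>\<in>?S (k+l). real_of_int (sign \<sigma>) * (real_of_int (sign (\<pi> \<circ> sh \<rho>)) * F (\<sigma> \<circ> (\<pi> \<circ> sh \<rho>)))) = ext_prod (as @ bs) Xs"
    if "\<pi> \<in> ?S k" "\<rho> \<in> ?S l" for \<pi> \<rho>
  proof -
    have "\<pi> \<circ> sh \<rho> permutes {..<k+l}"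
      using that sign_shift[of \<rho> l k] permutes_subset[of \<pi> "{..<k}" "{..<k+l}"]
      by (intro permutes_compose) (auto simp: sh_def[abs_def])
    from sum_permutes_compose_right[OF this, of F] show ?thesis
      unfolding E by (simp add: sum_distrib_left mult.left_commute)
  qed
  have "alt_wedge (*) k l (ext_prod as) (ext_prod bs) Xs = 1 / (fact k * fact l) *
     (\<Sum>\<sigma>\<in>?S (k+l). \<Sum>\<pi>\<in>?S k. \<Sum>\<rho>\<in>?S l. real_of_int (sign \<sigma>) * (real_of_int (sign (\<pi> \<circ> sh \<rho>)) * F (\<sigma> \<circ> (\<pi> \<circ> sh \<rho>))))"
    unfolding alt_wedge_def summand by (simp add: sum_distrib_left)
  also have "(\<Sum>\<sigma>\<in>?S (k+l). \<Sum>\<pi>\<in>?S k. \<Sum>\<rho>\<in>?S l. real_of_int (sign \<sigma>) * (real_of_int (sign (\<pi> \<circ> sh \<rho>)) * F (\<sigma> \<circ> (\<pi> \<circ> sh \<rho>))))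
     = (\<Sum>\<pi>\<in>?S k. \<Sum>\<rho>\<in>?S l. \<Sum>\<sigma>\<in>?S (k+l). real_of_int (sign \<sigma>) * (real_of_int (sign (\<pi> \<circ> sh \<rho>)) * F (\<sigma> \<circ> (\<pi> \<circ> sh \<rho>))))"
    by (subst sum.swap) (intro sum.cong refl sum.swap)
  also have "\<dots> = (\<Sum>\<pi>\<in>?S k. \<Sum>\<rho>\<in>?S l. ext_prod (as @ bs) Xs)"
    by (intro sum.cong refl inner) auto
  also have "\<dots> = fact k * fact l * ext_prod (as @ bs) Xs"
    using card_permutations[of "{..<k}" k] card_permutations[of "{..<l}" l] by simp
  finally show ?thesis by simp
qed

text \<open>The factors are evaluated only on members of Xs. This is how expansions valid just on
  tangent vectors enter wedge products.\<close>

lemma alt_wedge_cong: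
  assumes "\<And>Ys. length Ys = k \<Longrightarrow> set Ys \<subseteq> set Xs \<Longrightarrow> a Ys = a' Ys"
    and "\<And>Ys. length Ys = l \<Longrightarrow> set Ys \<subseteq> set Xs \<Longrightarrow> b Ys = b' Ys" and "length Xs = k + l"
  shows "alt_wedge m k l a b Xs = alt_wedge m k l a' b' Xs"
  unfolding alt_wedge_def
proof (intro arg_cong2[of _ _ _ _ scaleR] sum.cong refl arg_cong2[of _ _ _ _ m] assms(1,2))
  fix \<sigma> assume "\<sigma> \<in> {\<sigma>. \<sigma> permutes {..<k + l}}"
  then have "\<sigma> i < k + l" if "i < k + l" for i using permutes_in_image[of \<sigma> "{..<k+l}" i] that by simp
  then show "set (map (\<lambda>i. Xs ! \<sigma> i) [0..<k]) \<subseteq> set Xs" "set (map (\<lambda>i. Xs ! \<sigma> i) [k..<k + l]) \<subseteq> set Xs"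
    using assms(3) by auto
qed simp_all

text \<open>A form with constant coefficients in a coframe \<beta>, encoded as a list of
  coefficients with index words. Wedge products then become operations on lists that rewriting can
  carry out.\<close>

definition comb :: "(nat \<Rightarrow> 'x \<Rightarrow> real) \<Rightarrow> (real \<times> nat list) list \<Rightarrow> 'x list \<Rightarrow> real" where
  "comb \<beta> ts Xs = (\<Sum>(c, is)\<leftarrow>ts. c * ext_prod (map \<beta> is) Xs)"

lemma alt_wedge_add_left: "alt_wedge (*) k l (\<lambda>Y. c * a Y + a' Y) b Xs = c * alt_wedge (*) k l a b Xs + alt_wedge (*) k l a' (b :: _ \<Rightarrow> real) Xs"
  unfolding alt_wedge_def by (simp add: algebra_simps sum.distrib sum_distrib_left)

lemma alt_wedge_add_right: "alt_wedge (*) k l a (\<lambda>Y. c * b Y + b' Y) Xs = c * alt_wedge (*) k l a b Xs + alt_wedge (*) k l a (b' :: _ \<Rightarrow> real) Xs"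
  unfolding alt_wedge_def by (simp add: algebra_simps sum.distrib sum_distrib_left)

lemma alt_wedge_comb:
  assumes "\<And>t. t \<in> set ts \<Longrightarrow> length (snd t) = k" "\<And>t. t \<in> set us \<Longrightarrow> length (snd t) = l"
  shows "alt_wedge (*) k l (comb \<beta> ts) (comb \<beta> us) Xs =
    comb \<beta> (concat (map (\<lambda>(c, is). map (\<lambda>(d, js). (c * d, is @ js)) us) ts)) Xs"
  using assms(1)
proof (induction ts)
  case Nil
  show ?case by (simp add: comb_def alt_wedge_def)
next
  case (Cons t ts)
  obtain c "is" where t: "t = (c, is)" by (cases t)
  have 1: "alt_wedge (*) k l (ext_prod (map \<beta> is)) (comb \<beta> us) Xs = (\<Sum>(d, js)\<leftarrow>us. d * ext_prod (map \<beta> (is @ js)) Xs)"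
    using assms(2)
  proof (induction us)
    case Nil
    show ?case by (simp add: comb_def alt_wedge_def)
  next
    case (Cons s us)
    obtain d js where s: "s = (d, js)" by (cases s)
    have "comb \<beta> (s # us) = (\<lambda>Y. d * ext_prod (map \<beta> js) Y + comb \<beta> us Y)" by (simp add: comb_def s fun_eq_iff)
    then show ?case using Cons t Cons.prems(1)[of s] \<open>\<And>ta. ta \<in> set (t # ts) \<Longrightarrow> length (snd ta) = k\<close>[of t]
      by (simp add: alt_wedge_add_right alt_wedge_ext_prod s)
  qed
  have "comb \<beta> (t # ts) = (\<lambda>Y. c * ext_prod (map \<beta> is) Y + comb \<beta> ts Y)" by (simp add: comb_def t fun_eq_iff)
  moreover have "comb \<beta> (map (\<lambda>(d, js). (c * d, is @ js)) us) Xs = c * (\<Sum>(d, js)\<leftarrow>us. d * ext_prod (map \<beta> (is @ js)) Xs)"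
    by (simp add: comb_def o_def case_prod_unfold sum_list_const_mult[symmetric] mult.assoc)
  moreover have "comb \<beta> (xs @ ys) Xs = comb \<beta> xs Xs + comb \<beta> ys Xs" for xs ys by (simp add: comb_def)
  ultimately show ?case using Cons by (simp add: alt_wedge_add_left 1 t)
qed

unbundle cross3_syntax

subsection \<open>The Lie algebra of SU(2) as Euclidean three-space\<close>

definition su2_of_vec :: "real ^ 3 \<Rightarrow> cmat" where
  "su2_of_vec v = (\<Sum>i\<in>UNIV. v $ i *\<^sub>R \<tau> i)"

text \<open>The \<tau> matrices are orthonormal for \<open>su2_inner\<close>, so these are
  coordinates on su(2). The map is linear on all matrices, hence can be applied before membership in
  su(2) is known.\<close>

definition vec_of_su2 :: "cmat \<Rightarrow> real ^ 3" where
  "vec_of_su2 a = (\<chi> i. su2_inner (\<tau> i) a)"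

lemma su2_of_vec_entries:
  "su2_of_vec v $ 1 $ 1 = Complex 0 (- (v $ 3) / 2)" "su2_of_vec v $ 1 $ 2 = Complex (- (v $ 2) / 2) (- (v $ 1) / 2)"
  "su2_of_vec v $ 2 $ 1 = Complex (v $ 2 / 2) (- (v $ 1) / 2)" "su2_of_vec v $ 2 $ 2 = Complex 0 (v $ 3 / 2)"
  by (simp_all add: su2_of_vec_def sum_3 \<tau>_def pauli_def complex_eq_iff)

lemma su2_entries:
  assumes "a \<in> su2"
  shows "a $ 1 $ 1 = Complex 0 (Im (a $ 1 $ 1))" "a $ 2 $ 2 = Complex 0 (- Im (a $ 1 $ 1))"
    "a $ 1 $ 2 = Complex (- Re (a $ 2 $ 1)) (Im (a $ 2 $ 1))"
proof -
  have h: "cnj (a $ j $ i) = - (a $ i $ j)" for i j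
  proof -
    have "adjoint_mat a $ i $ j = (- a) $ i $ j" using assms by (simp add: su2_def)
    then show ?thesis by (simp add: adjoint_mat_def)
  qed
  have t: "a $ 1 $ 1 + a $ 2 $ 2 = 0" using assms by (simp add: su2_def trace_def sum_2)
  show "a $ 1 $ 1 = Complex 0 (Im (a $ 1 $ 1))" "a $ 2 $ 2 = Complex 0 (- Im (a $ 1 $ 1))"
    "a $ 1 $ 2 = Complex (- Re (a $ 2 $ 1)) (Im (a $ 2 $ 1))"
    using h[of 1 1] h[of 2 2] h[of 2 1] t by (auto simp: complex_eq_iff)
qed

lemma vec_of_su2_of_vec [simp]: "vec_of_su2 (su2_of_vec v) = v"
  by (simp add: vec_of_su2_def vec_eq_iff forall_3 su2_inner_def trace_def sum_2 matrix_matrix_mult_def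
      su2_of_vec_entries) (simp add: \<tau>_def pauli_def)

lemma su2_of_vec_of_su2: "a \<in> su2 \<Longrightarrow> su2_of_vec (vec_of_su2 a) = a"
  using su2_entries[of a]
  by (simp add: vec_eq_iff forall_2 su2_of_vec_entries)
     (simp add: vec_of_su2_def su2_inner_def trace_def sum_2 matrix_matrix_mult_def \<tau>_def pauli_def complex_eq_iff)

lemma su2_of_vec_in_su2: "su2_of_vec v \<in> su2"
  by (simp add: su2_def adjoint_mat_def vec_eq_iff forall_2 su2_of_vec_entries trace_def sum_2 complex_eq_iff)

lemma linear_su2_of_vec: "linear su2_of_vec"
  by (rule linearI) (simp_all add: su2_of_vec_def algebra_simps sum.distrib scaleR_sum_right)

lemma linear_vec_of_su2: "linear vec_of_su2"
  by (rule linearI)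
     (simp_all add: vec_of_su2_def vec_eq_iff su2_inner_def trace_def sum_2 matrix_matrix_mult_def algebra_simps)

lemma bounded_linear_su2_of_vec: "bounded_linear su2_of_vec"
  using linear_su2_of_vec linear_conv_bounded_linear by blast

lemma bounded_linear_vec_of_su2: "bounded_linear vec_of_su2"
  using linear_vec_of_su2 linear_conv_bounded_linear by blast

lemma su2_of_vec_eq_iff: "su2_of_vec u = su2_of_vec v \<longleftrightarrow> u = v"
  by (metis vec_of_su2_of_vec)

lemma su2_of_vec_simps:
  "su2_of_vec (u + v) = su2_of_vec u + su2_of_vec v" "su2_of_vec (u - v) = su2_of_vec u - su2_of_vec v"
  "su2_of_vec (r *\<^sub>R u) = r *\<^sub>R su2_of_vec u" "su2_of_vec 0 = 0" "su2_of_vec (- u) = - su2_of_vec u"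
  using linear_su2_of_vec by (simp_all add: linear_add linear_diff linear_cmul linear_0 linear_neg)

text \<open>The factor -i/2 in \<tau> is the one for which the commutator is the cross product with
  no further constant.\<close>

lemma su2_of_vec_commutator:
  "su2_of_vec a ** su2_of_vec b - su2_of_vec b ** su2_of_vec a = su2_of_vec (a \<times> b)"
  by (simp add: vec_eq_iff forall_2 matrix_matrix_mult_def sum_2 su2_of_vec_entries complex_eq_iff cross_components field_simps)

lemma su2_inner_of_vec: "su2_inner (su2_of_vec a) (su2_of_vec b) = a \<bullet> b"
  by (simp add: su2_inner_def trace_def sum_2 matrix_matrix_mult_def su2_of_vec_entries inner_vec_def sum_3 field_simps)

definition tr3 :: "real ^ 3 \<Rightarrow> real ^ 3 \<Rightarrow> real ^ 3 \<Rightarrow> real" where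
  "tr3 a b c = a \<bullet> (b \<times> c)"

text \<open>Products of two and of three \<tau> matrices have real trace parts -1/2 and -1/4 times
  the Kronecker and Levi-Civita symbols; all constants of the normal form of \<Omega> originate
  here.\<close>

lemma trace_su2_of_vec:
  "Re (trace (su2_of_vec a ** su2_of_vec b)) = - (a \<bullet> b) / 2"
  "Re (trace (su2_of_vec a ** (su2_of_vec b ** su2_of_vec c))) = - tr3 a b c / 4"
  by (simp_all add: trace_def sum_2 matrix_matrix_mult_def su2_of_vec_entries inner_vec_def sum_3 tr3_def cross_components)
     (simp_all add: field_simps)

lemma tr3_linear:
  "tr3 (a + a') b c = tr3 a b c + tr3 a' b c" "tr3 a (b + b') c = tr3 a b c + tr3 a b' c" "tr3 a b (c + c') = tr3 a b c + tr3 a b c'"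
  "tr3 (a - a') b c = tr3 a b c - tr3 a' b c" "tr3 a (b - b') c = tr3 a b c - tr3 a b' c" "tr3 a b (c - c') = tr3 a b c - tr3 a b c'"
  "tr3 (r *\<^sub>R a) b c = r * tr3 a b c" "tr3 a (r *\<^sub>R b) c = r * tr3 a b c" "tr3 a b (r *\<^sub>R c) = r * tr3 a b c"
  "tr3 (- a) b c = - tr3 a b c" "tr3 a (- b) c = - tr3 a b c" "tr3 a b (- c) = - tr3 a b c"
  "tr3 0 b c = 0" "tr3 a 0 c = 0" "tr3 a b 0 = 0"
  by (simp_all add: tr3_def inner_add inner_diff Cross3.left_diff_distrib Cross3.right_diff_distrib
      cross_add_left cross_add_right cross_mult_left cross_mult_right)

lemma tr3_components:
  "tr3 a b c = a$1 * (b$2 * c$3 - b$3 * c$2) + a$2 * (b$3 * c$1 - b$1 * c$3) + a$3 * (b$1 * c$2 - b$2 * c$1)"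
  by (simp add: tr3_def inner_vec_def sum_3 cross_components mult.commute)

subsection \<open>Wedge products in low degrees\<close>

lemma sum_permutes_2:
  "(\<Sum>\<sigma> | \<sigma> permutes {..<2::nat}. f \<sigma>) = f id + f (Transposition.transpose 0 1)"
proof -
  have "{..<2::nat} = {0, 1}" by auto
  then show ?thesis
    by (simp only:) (subst sum_over_permutations_insert; simp add: permutes_sing)
qed

lemma sum_permutes_3:
  fixes f :: "(nat \<Rightarrow> nat) \<Rightarrow> 'a::comm_monoid_add"
  shows "(\<Sum>\<sigma> | \<sigma> permutes {..<3::nat}. f \<sigma>) =
    (f id + f (Transposition.transpose 1 2)) +
    ((f (Transposition.transpose 0 1) + f (Transposition.transpose 0 1 \<circ> Transposition.transpose 1 2)) +
    (f (Transposition.transpose 0 2) + f (Transposition.transpose 0 2 \<circ> Transposition.transpose 1 2)))"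
proof -
  have "{..<3::nat} = {0, 1, 2}" by auto
  then show ?thesis
    by (simp only:) (subst sum_over_permutations_insert; simp add: sum_over_permutations_insert permutes_sing)
qed

lemmas perm_signs = sign_compose[OF permutation_swap_id permutation_swap_id] sign_swap_id

lemma alt_wedge_1_1: "alt_wedge m 1 1 a b [X, Y] = m (a [X]) (b [Y]) - m (a [Y]) (b [X])"
  unfolding alt_wedge_def one_add_one sum_permutes_2
  by (simp add: perm_signs Transposition.transpose_def numeral_2_eq_2)

lemma alt_wedge_1_2: "alt_wedge m 1 2 a b [X, Y, Z] = (1 / 2) *\<^sub>R
   (m (a [X]) (b [Y, Z]) - m (a [X]) (b [Z, Y]) - m (a [Y]) (b [X, Z]) + m (a [Y]) (b [Z, X])
    + m (a [Z]) (b [X, Y]) - m (a [Z]) (b [Y, X]))"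
proof -
  have e: "(1::nat) + 2 = 3" by simp
  show ?thesis
    unfolding alt_wedge_def e sum_permutes_3
    by (simp add: perm_signs Transposition.transpose_def upt_rec)
qed

lemma alt_wedge_2_1: "alt_wedge m 2 1 a b [X, Y, Z] = (1 / 2) *\<^sub>R
   (m (a [X, Y]) (b [Z]) - m (a [Y, X]) (b [Z]) - m (a [X, Z]) (b [Y]) + m (a [Z, X]) (b [Y])
    + m (a [Y, Z]) (b [X]) - m (a [Z, Y]) (b [X]))"
proof -
  have "(2::nat) + 1 = 3" by simp
  then show ?thesis
    unfolding alt_wedge_def 
    by (simp add: sum_permutes_3 perm_signs Transposition.transpose_def upt_rec)
qed

lemma ext_prod_1: "ext_prod [c] [X] = c X"
  by (simp add: ext_prod_def lessThan_Suc permutes_sing)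

lemma ext_prod_2: "ext_prod [c, d] [X, Y] = c X * d Y - c Y * d X"
  using sum_permutes_2[of "\<lambda>\<sigma>. real_of_int (sign \<sigma>) * (\<Prod>i<2. ([c, d] ! i) ([X, Y] ! \<sigma> i))"]
  by (simp add: ext_prod_def numeral_2_eq_2 perm_signs Transposition.transpose_def algebra_simps)

lemma ext_prod_3: "ext_prod [c, d, e] [X, Y, Z] =
   c X * (d Y * e Z - d Z * e Y) + c Y * (d Z * e X - d X * e Z) + c Z * (d X * e Y - d Y * e X)"
  using sum_permutes_3[of "\<lambda>\<sigma>. real_of_int (sign \<sigma>) * (\<Prod>i<3. ([c, d, e] ! i) ([X, Y, Z] ! \<sigma> i))"]
  by (simp add: ext_prod_def numeral_3_eq_3 numeral_2_eq_2 perm_signs Transposition.transpose_def algebra_simps)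

subsection \<open>The operator of a three-form in normal form\<close>

definition cov :: "('x \<Rightarrow> real ^ 3) \<Rightarrow> ('x \<Rightarrow> real ^ 3) \<Rightarrow> nat \<Rightarrow> 'x \<Rightarrow> real" where
  "cov w e n X = ([w X $ 1, w X $ 2, w X $ 3, e X $ 1, e X $ 2, e X $ 3] ! n)"

definition normal_form :: "real \<Rightarrow> ('x \<Rightarrow> real ^ 3) \<Rightarrow> ('x \<Rightarrow> real ^ 3) \<Rightarrow> 'x list \<Rightarrow> real" where
  "normal_form \<rho> w e Xs = (tr3 (w (Xs!0)) (w (Xs!1)) (w (Xs!2)) - tr3 (w (Xs!0)) (e (Xs!1)) (e (Xs!2))
      - tr3 (e (Xs!0)) (w (Xs!1)) (e (Xs!2)) - tr3 (e (Xs!0)) (e (Xs!1)) (w (Xs!2))) / 2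
      + \<rho> * tr3 (e (Xs!0)) (e (Xs!1)) (e (Xs!2))"

text \<open>Numbers 0, 1, 2 stand for the components of w and 3, 4, 5 for those of e. The words
  follow the cyclic order, hence \<open>[1,5,3]\<close>, so that the three mixed terms have the same
  sign.\<close>

abbreviation normal_terms :: "real \<Rightarrow> (real \<times> nat list) list" where
  "normal_terms \<rho> \<equiv> [(1/2, [0,1,2]), (-1/2, [0,4,5]), (-1/2, [1,5,3]), (-1/2, [2,3,4]), (\<rho>, [3,4,5])]"

lemma normal_form_eq_comb:
  "normal_form \<rho> w e [X, Y, Z] = comb (cov w e) (normal_terms \<rho>) [X, Y, Z]"
  by (simp add: normal_form_def comb_def ext_prod_3 tr3_components cov_def) (simp add: field_simps)

text \<open>Interior product with a vector whose coframe components are x, on the list encoding of a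
  3-form.\<close>

definition contract_terms :: "(nat \<Rightarrow> real) \<Rightarrow> (real \<times> nat list) list \<Rightarrow> (real \<times> nat list) list" where
  "contract_terms x ts = concat (map (\<lambda>(c, is).
     [(c * x (is!0), [is!1, is!2]), (- c * x (is!1), [is!0, is!2]), (c * x (is!2), [is!0, is!1])]) ts)"

lemma ext_prod_contract:
  "ext_prod [c, d, e] [\<xi>, Y, Z] = c \<xi> * ext_prod [d, e] [Y, Z] - d \<xi> * ext_prod [c, e] [Y, Z] + e \<xi> * ext_prod [c, d] [Y, Z]"
  unfolding ext_prod_3 ext_prod_2 by algebra

lemma comb_contract:
  "comb \<beta> (normal_terms \<rho>) [\<xi>, Y, Z] = comb \<beta> (contract_terms (\<lambda>i. \<beta> i \<xi>) (normal_terms \<rho>)) [Y, Z]"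
  by (simp add: comb_def contract_terms_def ext_prod_contract) (simp add: field_simps)

lemma ext_prod_swaps:
  "ext_prod [b,a,c,d,e,f] Xs = - ext_prod [a,b,c,d,e,f] Xs" "ext_prod [a,c,b,d,e,f] Xs = - ext_prod [a,b,c,d,e,f] Xs"
  "ext_prod [a,b,d,c,e,f] Xs = - ext_prod [a,b,c,d,e,f] Xs" "ext_prod [a,b,c,e,d,f] Xs = - ext_prod [a,b,c,d,e,f] Xs"
  "ext_prod [a,b,c,d,f,e] Xs = - ext_prod [a,b,c,d,e,f] Xs"
proof -
  have *: "ext_prod (map (\<lambda>k. [a,b,c,d,e,f] ! Transposition.transpose i (Suc i) k) [0..<6]) Xs = - ext_prod [a,b,c,d,e,f] Xs"
    if "i < 5" for i
  proof -
    have t: "Transposition.transpose i (Suc i) permutes {..<6}" using that by (intro permutes_swap_id) auto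
    show ?thesis using ext_prod_permute[OF t, of "[a,b,c,d,e,f]" Xs] by (simp add: sign_swap_id)
  qed
  have u: "[0..<6] = [0,1,2,3,4,5]" by (simp add: upt_rec)
  have "map (\<lambda>k. [a,b,c,d,e,f] ! Transposition.transpose 0 (Suc 0) k) [0..<6] = [b,a,c,d,e,f]"
    unfolding u by (simp add: Transposition.transpose_def)
  then show "ext_prod [b,a,c,d,e,f] Xs = - ext_prod [a,b,c,d,e,f] Xs" using *[of 0] by simp
  have "map (\<lambda>k. [a,b,c,d,e,f] ! Transposition.transpose 1 (Suc 1) k) [0..<6] = [a,c,b,d,e,f]"
    unfolding u by (simp add: Transposition.transpose_def)
  then show "ext_prod [a,c,b,d,e,f] Xs = - ext_prod [a,b,c,d,e,f] Xs" using *[of 1] by simp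
  have "map (\<lambda>k. [a,b,c,d,e,f] ! Transposition.transpose 2 (Suc 2) k) [0..<6] = [a,b,d,c,e,f]"
    unfolding u by (simp add: Transposition.transpose_def)
  then show "ext_prod [a,b,d,c,e,f] Xs = - ext_prod [a,b,c,d,e,f] Xs" using *[of 2] by simp
  have "map (\<lambda>k. [a,b,c,d,e,f] ! Transposition.transpose 3 (Suc 3) k) [0..<6] = [a,b,c,e,d,f]"
    unfolding u by (simp add: Transposition.transpose_def)
  then show "ext_prod [a,b,c,e,d,f] Xs = - ext_prod [a,b,c,d,e,f] Xs" using *[of 3] by simp
  have "map (\<lambda>k. [a,b,c,d,e,f] ! Transposition.transpose 4 (Suc 4) k) [0..<6] = [a,b,c,d,f,e]"
    unfolding u by (simp add: Transposition.transpose_def)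
  then show "ext_prod [a,b,c,d,f,e] Xs = - ext_prod [a,b,c,d,e,f] Xs" using *[of 4] by simp
qed

lemma ext_prod_repeat:
  assumes "length cs = n" "i < n" "j < n" "i \<noteq> j" "cs ! i = cs ! j"
  shows "ext_prod cs Xs = 0"
proof -
  have t: "Transposition.transpose i j permutes {..<n}" using assms by (intro permutes_swap_id) auto
  have "map (\<lambda>k. cs ! Transposition.transpose i j k) [0..<n] = cs"
    using assms by (intro nth_equalityI) (auto simp: Transposition.transpose_def)
  then show ?thesis using ext_prod_permute[OF t assms(1), of Xs] assms by (simp add: sign_swap_id)
qed

text \<open>The indices are kept as separate numerals so that \<open>six_sort\<close> can test their
  order: it exchanges neighbours only when they are out of order, so rewriting is a terminating
  bubble sort, and \<open>six_repeat\<close> removes words with a repeated letter.\<close>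

definition six :: "(nat \<Rightarrow> 'x \<Rightarrow> real) \<Rightarrow> 'x list \<Rightarrow> nat \<Rightarrow> nat \<Rightarrow> nat \<Rightarrow> nat \<Rightarrow> nat \<Rightarrow> nat \<Rightarrow> real" where
  "six \<beta> Xs a b c d e f = ext_prod (map \<beta> [a,b,c,d,e,f]) Xs"

lemma six_sort:
  "b > a \<Longrightarrow> six \<beta> Xs b a c d e f = - six \<beta> Xs a b c d e f" "c > b \<Longrightarrow> six \<beta> Xs a c b d e f = - six \<beta> Xs a b c d e f"
  "d > c \<Longrightarrow> six \<beta> Xs a b d c e f = - six \<beta> Xs a b c d e f" "e > d \<Longrightarrow> six \<beta> Xs a b c e d f = - six \<beta> Xs a b c d e f"
  "f > e \<Longrightarrow> six \<beta> Xs a b c d f e = - six \<beta> Xs a b c d e f"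
  unfolding six_def list.map by (rule ext_prod_swaps)+

lemma six_repeat:
  "six \<beta> Xs a a c d e f = 0"
  "six \<beta> Xs a b a d e f = 0"
  "six \<beta> Xs a b c a e f = 0"
  "six \<beta> Xs a b c d a f = 0"
  "six \<beta> Xs a b c d e a = 0"
  "six \<beta> Xs a b b d e f = 0"
  "six \<beta> Xs a b c b e f = 0"
  "six \<beta> Xs a b c d b f = 0"
  "six \<beta> Xs a b c d e b = 0"
  "six \<beta> Xs a b c c e f = 0"
  "six \<beta> Xs a b c d c f = 0"
  "six \<beta> Xs a b c d e c = 0"
  "six \<beta> Xs a b c d d f = 0"
  "six \<beta> Xs a b c d e d = 0"
  "six \<beta> Xs a b c d e e = 0"
  unfolding six_def
  subgoal by (rule ext_prod_repeat[where n = 6 and i = 0 and j = 1]) simp_all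
  subgoal by (rule ext_prod_repeat[where n = 6 and i = 0 and j = 2]) simp_all
  subgoal by (rule ext_prod_repeat[where n = 6 and i = 0 and j = 3]) simp_all
  subgoal by (rule ext_prod_repeat[where n = 6 and i = 0 and j = 4]) simp_all
  subgoal by (rule ext_prod_repeat[where n = 6 and i = 0 and j = 5]) simp_all
  subgoal by (rule ext_prod_repeat[where n = 6 and i = 1 and j = 2]) simp_all
  subgoal by (rule ext_prod_repeat[where n = 6 and i = 1 and j = 3]) simp_all
  subgoal by (rule ext_prod_repeat[where n = 6 and i = 1 and j = 4]) simp_all
  subgoal by (rule ext_prod_repeat[where n = 6 and i = 1 and j = 5]) simp_all
  subgoal by (rule ext_prod_repeat[where n = 6 and i = 2 and j = 3]) simp_all
  subgoal by (rule ext_prod_repeat[where n = 6 and i = 2 and j = 4]) simp_all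
  subgoal by (rule ext_prod_repeat[where n = 6 and i = 2 and j = 5]) simp_all
  subgoal by (rule ext_prod_repeat[where n = 6 and i = 3 and j = 4]) simp_all
  subgoal by (rule ext_prod_repeat[where n = 6 and i = 3 and j = 5]) simp_all
  subgoal by (rule ext_prod_repeat[where n = 6 and i = 4 and j = 5]) simp_all
  done

lemma comb_Cons: "comb \<beta> ((c, [i,j,k,l,m,n]) # ts) Xs = c * six \<beta> Xs i j k l m n + comb \<beta> ts Xs"
  and comb_Nil: "comb \<beta> [] Xs = 0"
  by (simp_all add: comb_def six_def)

text \<open>This is K on the coframe, before the division by \<open>v0\<close>: the components of w
  go to those of (\<rho>w - e)/2 and those of e to (w - \<rho>e)/2, times the product of all six
  covectors.\<close>

lemma wedge_contract_basis:
  assumes "i < 6"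
  shows "comb \<beta> (concat (map (\<lambda>(c, is). map (\<lambda>(d, js). (c * d, is @ js)) (normal_terms \<rho>))
       (concat (map (\<lambda>(c, is). map (\<lambda>(d, js). (c * d, is @ js)) (contract_terms x (normal_terms \<rho>))) [(1, [i])])))) Xs
    = (if i < 3 then \<rho> * x i - x (i + 3) else x (i - 3) - \<rho> * x i) / 2 * six \<beta> Xs 0 1 2 3 4 5"
proof -
  have "i = 0 \<or> i = 1 \<or> i = 2 \<or> i = 3 \<or> i = 4 \<or> i = 5" using assms by auto
  then show ?thesis
    by (elim disjE; simp add: contract_terms_def comb_Cons comb_Nil six_repeat six_sort; simp add: field_simps)
qed

text \<open>The expansions of \<alpha> and \<Omega> hold only on the tangent space T, so they are
  substituted through \<open>alt_wedge_cong\<close>; linearity in \<alpha> then reduces to single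
  covectors of the coframe.\<close>

lemma wedge_contract:
  assumes \<alpha>: "\<And>X. X \<in> T \<Longrightarrow> \<alpha> X = (\<Sum>i<6. a i * \<beta> i X)"
    and \<Omega>: "\<And>X Y Z. X \<in> T \<Longrightarrow> Y \<in> T \<Longrightarrow> Z \<in> T \<Longrightarrow> \<Omega> [X, Y, Z] = comb \<beta> (normal_terms \<rho>) [X, Y, Z]"
    and \<xi>: "\<xi> \<in> T" and Xs: "length Xs = 6" "set Xs \<subseteq> T"
  shows "alt_wedge (*) 3 3 (alt_wedge (*) 1 2 (\<lambda>Ys. \<alpha> (hd Ys)) (\<lambda>Ys. \<Omega> (\<xi> # Ys))) \<Omega> Xs =
     (\<Sum>i<6. a i * ((if i < 3 then \<rho> * \<beta> i \<xi> - \<beta> (i + 3) \<xi> else \<beta> (i - 3) \<xi> - \<rho> * \<beta> i \<xi>) / 2)) * six \<beta> Xs 0 1 2 3 4 5"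
proof -
  let ?C = "comb \<beta> (contract_terms (\<lambda>i. \<beta> i \<xi>) (normal_terms \<rho>))"
  let ?N = "comb \<beta> (normal_terms \<rho>)"
  have l3: "\<exists>X Y Z. Ys = [X, Y, Z]" if "length Ys = 3" for Ys :: "'a list"
    using that by (auto simp: numeral_3_eq_3 length_Suc_conv)
  have l2: "\<exists>X Y. Ys = [X, Y]" if "length Ys = 2" for Ys :: "'a list"
    using that by (auto simp: numeral_2_eq_2 length_Suc_conv)
  have l1: "\<exists>X. Ys = [X]" if "length Ys = 1" for Ys :: "'a list"
    using that by (auto simp: length_Suc_conv)
  have inner: "alt_wedge (*) 1 2 (\<lambda>Ys. \<alpha> (hd Ys)) (\<lambda>Ys. \<Omega> (\<xi> # Ys)) Ys = alt_wedge (*) 1 2 (\<lambda>Ys. \<Sum>i<6. a i * comb \<beta> [(1, [i])] Ys) ?C Ys"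
    if Ys: "length Ys = 3" "set Ys \<subseteq> T" for Ys
  proof (rule alt_wedge_cong)
    fix Zs assume Zs: "length Zs = 1" "set Zs \<subseteq> set Ys"
    then obtain X where "Zs = [X]" using l1 by blast
    then show "\<alpha> (hd Zs) = (\<Sum>i<6. a i * comb \<beta> [(1, [i])] Zs)" using \<alpha>[of X] Ys Zs by (auto simp: comb_def ext_prod_1)
  next
    fix Zs assume Zs: "length Zs = 2" "set Zs \<subseteq> set Ys"
    then obtain X Y where "Zs = [X, Y]" using l2 by blast
    then show "\<Omega> (\<xi> # Zs) = ?C Zs" using \<Omega>[of \<xi> X Y] \<xi> Ys Zs comb_contract[of \<beta> \<rho> \<xi> X Y] by auto
  qed (use Ys in simp)
  have sum1: "alt_wedge (*) k l (\<lambda>Ys. \<Sum>i\<in>I. a i * F i Ys) G Zs = (\<Sum>i\<in>I. a i * alt_wedge (*) k l (F i) G Zs)"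
    if "finite I" for I F and G :: "'a list \<Rightarrow> real" and k l Zs
    using that
  proof (induction I rule: finite_induct)
    case empty
    show ?case by (simp add: alt_wedge_def)
  next
    case (insert x I)
    then show ?case by (simp add: alt_wedge_add_left)
  qed
  define C1 where "C1 i = concat (map (\<lambda>(c, is). map (\<lambda>(d, js). (c * d, is @ js)) (contract_terms (\<lambda>i. \<beta> i \<xi>) (normal_terms \<rho>))) [(1, [i])])" for i :: nat
  have C1: "alt_wedge (*) 1 2 (comb \<beta> [(1, [i])]) ?C Ys = comb \<beta> (C1 i) Ys" for i Ys
    unfolding C1_def by (rule alt_wedge_comb) (auto simp: contract_terms_def)
  have "alt_wedge (*) 3 3 (alt_wedge (*) 1 2 (\<lambda>Ys. \<alpha> (hd Ys)) (\<lambda>Ys. \<Omega> (\<xi> # Ys))) \<Omega> Xs =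
     alt_wedge (*) 3 3 (\<lambda>Ys. \<Sum>i<6. a i * comb \<beta> (C1 i) Ys) ?N Xs"
  proof (rule alt_wedge_cong)
    fix Ys assume Ys: "length Ys = 3" "set Ys \<subseteq> set Xs"
    show "alt_wedge (*) 1 2 (\<lambda>Ys. \<alpha> (hd Ys)) (\<lambda>Ys. \<Omega> (\<xi> # Ys)) Ys = (\<Sum>i<6. a i * comb \<beta> (C1 i) Ys)"
      unfolding inner[OF Ys(1) subset_trans[OF Ys(2) Xs(2)]] C1[symmetric] by (rule sum1) simp
    obtain X Y Z where "Ys = [X, Y, Z]" using l3 Ys by blast
    then show "\<Omega> Ys = ?N Ys" using \<Omega>[of X Y Z] Ys Xs by auto
  qed (use Xs in simp)
  also have "\<dots> = (\<Sum>i<6. a i * alt_wedge (*) 3 3 (comb \<beta> (C1 i)) ?N Xs)"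
    by (rule sum1) simp
  also have "\<dots> = (\<Sum>i<6. a i * ((if i < 3 then \<rho> * \<beta> i \<xi> - \<beta> (i + 3) \<xi> else \<beta> (i - 3) \<xi> - \<rho> * \<beta> i \<xi>) / 2 * six \<beta> Xs 0 1 2 3 4 5))"
  proof (rule sum.cong[OF refl])
    fix i :: nat assume "i \<in> {..<6}"
    then have i: "i < 6" by simp
    have "alt_wedge (*) 3 3 (comb \<beta> (C1 i)) ?N Xs = comb \<beta> (concat (map (\<lambda>(c, is). map (\<lambda>(d, js). (c * d, is @ js)) (normal_terms \<rho>)) (C1 i))) Xs"
      by (rule alt_wedge_comb) (auto simp: C1_def contract_terms_def)
    then show "a i * alt_wedge (*) 3 3 (comb \<beta> (C1 i)) ?N Xs =
      a i * ((if i < 3 then \<rho> * \<beta> i \<xi> - \<beta> (i + 3) \<xi> else \<beta> (i - 3) \<xi> - \<rho> * \<beta> i \<xi>) / 2 * six \<beta> Xs 0 1 2 3 4 5)"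
      using wedge_contract_basis[OF i, of \<beta> \<rho> "\<lambda>i. \<beta> i \<xi>" Xs] by (simp only: C1_def)
  qed
  finally show ?thesis by (simp add: sum_distrib_right mult.assoc)
qed

text \<open>A cubic expression in the rotated covectors carries (\<epsilon>/s)^3, and expanding it
  produces a common factor 1 - \<rho>^2 = s^2. Since \<epsilon>^2 = 1, what remains is
  \<epsilon>/s.\<close>

lemma normal_form_rotate:
  fixes w e w' e' :: "'x \<Rightarrow> real ^ 3"
  assumes "\<epsilon>\<^sup>2 = 1" "s\<^sup>2 = 1 - \<rho>\<^sup>2" "s \<noteq> 0"
    and "\<And>U. U \<in> {X, Y, Z} \<Longrightarrow> w' U = (\<epsilon> / s) *\<^sub>R (\<rho> *\<^sub>R w U - e U)"
    and "\<And>U. U \<in> {X, Y, Z} \<Longrightarrow> e' U = (\<epsilon> / s) *\<^sub>R (w U - \<rho> *\<^sub>R e U)"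
  shows "normal_form \<rho> w' e' [X, Y, Z] = \<epsilon> / (2 * s) * (- \<rho> * tr3 (w X) (w Y) (w Z)
     + (tr3 (w X) (w Y) (e Z) + tr3 (w X) (e Y) (w Z) + tr3 (e X) (w Y) (w Z))
     - \<rho> * (tr3 (w X) (e Y) (e Z) + tr3 (e X) (w Y) (e Z) + tr3 (e X) (e Y) (w Z))
     + (2 * \<rho>\<^sup>2 - 1) * tr3 (e X) (e Y) (e Z))" (is "_ = \<epsilon> / (2 * s) * ?R")
proof -
  define t where "t = \<epsilon> / s"
  have ws: "w' X = t *\<^sub>R (\<rho> *\<^sub>R w X - e X)" "w' Y = t *\<^sub>R (\<rho> *\<^sub>R w Y - e Y)" "w' Z = t *\<^sub>R (\<rho> *\<^sub>R w Z - e Z)"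
    "e' X = t *\<^sub>R (w X - \<rho> *\<^sub>R e X)" "e' Y = t *\<^sub>R (w Y - \<rho> *\<^sub>R e Y)" "e' Z = t *\<^sub>R (w Z - \<rho> *\<^sub>R e Z)"
    unfolding t_def by (intro assms; simp)+
  have "normal_form \<rho> w' e' [X, Y, Z] = t ^ 3 * ((1 - \<rho>\<^sup>2) / 2 * ?R)"
    unfolding normal_form_def nth_Cons_0 nth_Cons_Suc One_nat_def numeral_2_eq_2 ws tr3_linear
    by (simp add: power3_eq_cube power2_eq_square field_simps)
  also have "\<dots> = \<epsilon> / (2 * s) * ?R"
  proof -
    have "t ^ 3 * ((1 - \<rho>\<^sup>2) / 2) = \<epsilon> / (2 * s)"
      unfolding assms(2)[symmetric] t_def using assms(1,3) by (simp add: power3_eq_cube power2_eq_square field_simps)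
    then show ?thesis by (simp only: mult.assoc[symmetric])
  qed
  finally show ?thesis .
qed

subsection \<open>Principal SU(2) bundles\<close>

lemma smooth_on_Pair_const:
  fixes S :: "'a::real_normed_vector set"
  assumes "open S"
  shows "smooth_on S (\<lambda>x. (x, g::'b::real_normed_vector))"
proof -
  have "smooth_on S (\<lambda>x. (x, 0::'b) + (0, g))"
    by (intro smooth_on_add smooth_on_const smooth_on_bounded_linear assms bounded_linear_Pair bounded_linear_ident bounded_linear_zero)
  then show ?thesis by simp
qed

text \<open>The local extension G is smooth on an open set of pairs of coordinates and matrices, so
  freezing the matrix restricts G to an open slice.\<close>

lemma smooth_on_product_param:
  fixes F :: "'m::{t2_space,second_countable_topology} \<Rightarrow> 'g::euclidean_space \<Rightarrow> 'q::{t2_space,second_countable_topology}"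
  assumes A: "oriented_atlas A" and B: "oriented_atlas B" and F: "smooth_on_product A B U S F"
    and c: "c \<in> A" and U: "open U" and g: "g \<in> S"
  shows "smooth_param B (snd c ` (fst c \<inter> U)) (\<lambda>x. F (chart_inv c x) g)"
proof -
  let ?T = "snd c ` (fst c \<inter> U)"
  let ?\<phi> = "\<lambda>x. F (chart_inv c x) g"
  have T: "open ?T" by (rule chart_image_open[OF A c U])
  have local: "\<exists>N G. open N \<and> x \<in> N \<and> N \<subseteq> ?T \<and> smooth_on N G \<and> (\<forall>y\<in>N. ?\<phi> y \<in> fst d \<and> snd d (?\<phi> y) = G y)"
    if x: "x \<in> ?T" and d: "d \<in> B" "?\<phi> x \<in> fst d" for x d
  proof -
    have ci: "chart_inv c x \<in> U" "chart_inv c x \<in> fst c" "snd c (chart_inv c x) = x"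
      using x chart_inv_left[OF A c] by auto
    then obtain N G where N: "open N" "(x, g) \<in> N" "smooth_on N G"
      "\<And>y h. y \<in> fst c \<inter> U \<Longrightarrow> h \<in> S \<Longrightarrow> (snd c y, h) \<in> N \<Longrightarrow> F y h \<in> fst d \<and> snd d (F y h) = G (snd c y, h)"
      using F[unfolded smooth_on_product_def, rule_format, OF c d(1), of "chart_inv c x" g] d g by auto
    define N' where "N' = ?T \<inter> (\<lambda>y. (y, g)) -` N"
    have N': "open N'" unfolding N'_def
      using T N(1) by (intro open_Int open_vimage continuous_intros) auto
    have "smooth_on N' (\<lambda>y. G (y, g))"
      by (rule smooth_on_compose[OF N(3) smooth_on_Pair_const[OF N'] N']) (auto simp: N'_def)
    moreover have "?\<phi> y \<in> fst d \<and> snd d (?\<phi> y) = G (y, g)" if "y \<in> N'" for y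
      using that N(4)[of "chart_inv c y" g] g chart_inv_left[OF A c] by (auto simp: N'_def)
    ultimately show ?thesis using N' N(2) x by (intro exI[of _ N'] exI[of _ "\<lambda>y. G (y, g)"]) (auto simp: N'_def)
  qed
  show ?thesis
    unfolding smooth_param_def
  proof (intro conjI ballI T)
    show "continuous_on ?T ?\<phi>"
    proof (rule continuous_at_imp_continuous_on, rule ballI)
      fix x assume x: "x \<in> ?T"
      obtain d where d: "d \<in> B" "?\<phi> x \<in> fst d" using chart_at[OF B] by blast
      obtain N G where N: "open N" "x \<in> N" "smooth_on N G" "\<forall>y\<in>N. ?\<phi> y \<in> fst d \<and> snd d (?\<phi> y) = G y"
        using local[OF x d] by blast
      have "continuous_on N (\<lambda>y. chart_inv d (G y))"
        by (rule continuous_on_compose2[OF chart_inv_continuous[OF B d(1)] smooth_on_imp_continuous_on[OF N(3)]]) (use N(4) in force)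
      then have "continuous_on N ?\<phi>"
        by (rule continuous_on_cong[THEN iffD1, OF refl, rotated]) (metis N(4) chart_inv_left[OF B d(1)])
      then show "isCont ?\<phi> x" using N continuous_on_eq_continuous_at by blast
    qed
    fix d assume d: "d \<in> B"
    show "smooth_on (?T \<inter> ?\<phi> -` fst d) (snd d \<circ> ?\<phi>)"
    proof (rule smooth_on_local)
      fix x assume "x \<in> ?T \<inter> ?\<phi> -` fst d"
      then obtain N G where N: "open N" "x \<in> N" "smooth_on N G" "\<forall>y\<in>N. ?\<phi> y \<in> fst d \<and> snd d (?\<phi> y) = G y"
        using local[of x d] d by blast
      have "smooth_on N (snd d \<circ> ?\<phi>)" by (rule smooth_on_cong[OF N(3,1)]) (use N(4) in simp)
      then show "\<exists>N. open N \<and> x \<in> N \<and> smooth_on N (snd d \<circ> ?\<phi>)" using N by blast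
    qed
  qed
qed

lemma smooth_map_of_param:
  assumes A: "oriented_atlas A" and "\<And>c. c \<in> A \<Longrightarrow> smooth_param B (snd c ` fst c) (\<lambda>x. F (chart_inv c x))"
  shows "smooth_map A B F"
  unfolding smooth_map_def
proof (intro conjI ballI)
  show "continuous_on UNIV F"
  proof (rule continuous_at_imp_continuous_on, rule ballI)
    fix p
    obtain c where c: "c \<in> A" "p \<in> fst c" using chart_at[OF A] by blast
    have "continuous_on (fst c) (\<lambda>q. F (chart_inv c (snd c q)))"
      by (rule continuous_on_compose2[OF _ chart_continuous[OF A c(1)] order_refl])
         (use assms(2)[OF c(1)] in \<open>simp add: smooth_param_def\<close>)
    then have "continuous_on (fst c) F"
      by (rule continuous_on_cong[THEN iffD1, OF refl, rotated]) (simp add: chart_inv_left[OF A c(1)])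
    then show "isCont F p" using c chart_open_dom[OF A c(1)] continuous_on_eq_continuous_at by blast
  qed
  fix c d assume c: "c \<in> A" and d: "d \<in> B"
  have "snd c ` fst c \<inter> (\<lambda>x. F (chart_inv c x)) -` fst d = snd c ` (fst c \<inter> F -` fst d)"
    using chart_inv_left[OF A c] chart_inv_in[OF A c] by force
  then show "smooth_on (snd c ` (fst c \<inter> F -` fst d)) (snd d \<circ> F \<circ> chart_inv c)"
    using smooth_param_coord[OF assms(2)[OF c] d] by (simp add: comp_def)
qed

lemma bounded_linear_matrix_mult_left: "bounded_linear (\<lambda>x::cmat. a ** x)"
  and bounded_linear_matrix_mult_right: "bounded_linear (\<lambda>x::cmat. x ** a)"
proof -
  have "linear (\<lambda>x::cmat. a ** x)" "linear (\<lambda>x::cmat. x ** a)"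
    by (auto intro!: linearI simp: vec_eq_iff matrix_matrix_mult_def sum.distrib algebra_simps scaleR_sum_right)
  then show "bounded_linear (\<lambda>x::cmat. a ** x)" "bounded_linear (\<lambda>x::cmat. x ** a)"
    using linear_conv_bounded_linear by blast+
qed

lemma SU2_one: "mat 1 \<in> SU2"
  by (simp add: SU2_def adjoint_mat_def vec_eq_iff forall_2 mat_def matrix_matrix_mult_def sum_2 det_2)

text \<open>Normalising \<open>1 + t a\<close> gives a curve in \<open>SU(2)\<close> with velocity \<open>a\<close>, since
  \<open>(1 + t a) (1 + t a)\<^sup>* = det (1 + t a) = 1 + t\<^sup>2 det a\<close> for \<open>a \<in> su(2)\<close>.\<close>

lemma SU2_curve:
  assumes "a \<in> su2"
  obtains \<theta> where "\<theta> 0 = mat 1" "\<And>t. \<theta> t \<in> SU2" "(\<theta> has_vector_derivative a) (at (0::real))"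
proof -
  obtain v where a: "a = su2_of_vec v" using su2_of_vec_of_su2[OF assms] by metis
  define n where "n t = sqrt (1 + t\<^sup>2 * ((v \<bullet> v) / 4))" for t :: real
  define \<theta> where "\<theta> t = (1 / n t) *\<^sub>R (mat 1 + t *\<^sub>R a)" for t
  have pos: "1 + t\<^sup>2 * ((v \<bullet> v) / 4) > 0" for t by (rule add_pos_nonneg) auto
  have n: "n t > 0" "(n t)\<^sup>2 = 1 + t\<^sup>2 * ((v \<bullet> v) / 4)" for t
    using pos[of t] by (auto simp: n_def)
  have adj: "adjoint_mat (r *\<^sub>R (mat 1 + t *\<^sub>R a)) = r *\<^sub>R (mat 1 - t *\<^sub>R a)" for r t
    by (simp add: a adjoint_mat_def vec_eq_iff forall_2 su2_of_vec_entries mat_def complex_eq_iff)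
  have prod: "(mat 1 + t *\<^sub>R a) ** (mat 1 - t *\<^sub>R a) = ((n t)\<^sup>2) *\<^sub>R mat 1" for t
    unfolding n(2) by (simp add: a matrix_matrix_mult_def vec_eq_iff forall_2 sum_2 su2_of_vec_entries mat_def complex_eq_iff
        inner_vec_def sum_3 power2_eq_square field_simps)
  have dt: "det (mat 1 + t *\<^sub>R a) = complex_of_real ((n t)\<^sup>2)" for t
    unfolding n(2) by (simp add: a det_2 su2_of_vec_entries mat_def complex_eq_iff inner_vec_def sum_3 power2_eq_square field_simps)
  have sc: "(r *\<^sub>R A) ** (s *\<^sub>R B) = (r * s) *\<^sub>R (A ** B)" for r s and A B :: cmat
    by (simp add: matrix_matrix_mult_def vec_eq_iff sum_2 algebra_simps)
  have "\<theta> t \<in> SU2" for t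
  proof -
    have "\<theta> t ** adjoint_mat (\<theta> t) = mat 1"
      unfolding \<theta>_def adj sc prod using n(1)[of t] by (simp add: power2_eq_square)
    moreover have "det (\<theta> t) = complex_of_real ((1 / n t)\<^sup>2) * det (mat 1 + t *\<^sub>R a)"
      by (simp add: \<theta>_def det_2 scaleR_conv_of_real[where 'a = complex] power2_eq_square algebra_simps)
    then have "det (\<theta> t) = 1"
      unfolding dt of_real_mult[symmetric] using n(1)[of t] by (simp add: power_divide)
    ultimately show ?thesis by (simp add: SU2_def)
  qed
  moreover have "\<theta> 0 = mat 1" by (simp add: \<theta>_def n_def)
  moreover have "(\<theta> has_vector_derivative a) (at 0)"
  proof -
    have 1: "((\<lambda>t. 1 / n t) has_real_derivative 0) (at 0)"
      unfolding n_def by (auto intro!: derivative_eq_intros)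
    have 2: "((\<lambda>t. mat 1 + t *\<^sub>R a) has_vector_derivative a) (at 0)"
      unfolding has_vector_derivative_def by (auto intro!: derivative_eq_intros)
    show ?thesis
      using has_vector_derivative_scaleR[OF 1 2] by (simp add: \<theta>_def[abs_def] n_def)
  qed
  ultimately show thesis using that by blast
qed

section \<open>Sections and fundamental vectors of the bundle\<close>

locale su2_bundle =
  fixes AM :: "('m::{t2_space,second_countable_topology}, 3) chart set"
    and AP :: "('p::{t2_space,second_countable_topology}, 6) chart set"
    and pr :: "'p \<Rightarrow> 'm" and act :: "'p \<Rightarrow> cmat \<Rightarrow> 'p"
  assumes M: "oriented_atlas AM" and P: "oriented_atlas AP" and pbundle: "principal_SU2_bundle AM AP pr act"
begin

lemma smooth_pr: "smooth_map AP AM pr"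
  using pbundle by (simp add: principal_SU2_bundle_def)

lemma pr_act: "g \<in> SU2 \<Longrightarrow> pr (act p g) = pr p"
  using pbundle by (simp add: principal_SU2_bundle_def)

lemma act_one: "act p (mat 1) = p"
  using pbundle by (simp add: principal_SU2_bundle_def)

lemma smooth_act:
  assumes "g \<in> SU2"
  shows "smooth_map AP AP (\<lambda>p. act p g)"
proof (rule smooth_map_of_param[OF P])
  fix c assume c: "c \<in> AP"
  have "smooth_on_product AP AP UNIV SU2 act" using pbundle by (simp add: principal_SU2_bundle_def)
  from smooth_on_product_param[OF P P this c open_UNIV assms]
  show "smooth_param AP (snd c ` fst c) (\<lambda>x. act (chart_inv c x) g)" by simp
qed

text \<open>In a trivialisation, keep the group coordinate of p and vary the base point.\<close>

lemma local_section:
  obtains U \<sigma> where "open U" "pr p \<in> U" "\<sigma> (pr p) = p" "\<And>x. x \<in> U \<Longrightarrow> pr (\<sigma> x) = x"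
    "\<And>c. c \<in> AM \<Longrightarrow> smooth_param AP (snd c ` (fst c \<inter> U)) (\<lambda>x. \<sigma> (chart_inv c x))"
proof -
  obtain U \<gamma> where U: "pr p \<in> U" "local_trivialisation AM AP pr act U \<gamma>"
    using pbundle unfolding principal_SU2_bundle_def by blast
  let ?T = "\<lambda>p. (pr p, \<gamma> p)"
  have lt: "open U" "bij_betw ?T (pr -` U) (Sigma U (\<lambda>_. SU2))"
    "smooth_on_product AM AP U SU2 (\<lambda>x g. inv_into (pr -` U) ?T (x, g))"
    using U(2) by (auto simp: local_trivialisation_def)
  define \<sigma> where "\<sigma> x = inv_into (pr -` U) ?T (x, \<gamma> p)" for x
  have \<gamma>: "\<gamma> p \<in> SU2" using lt(2) U(1) by (auto simp: bij_betw_def)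
  have 1: "\<sigma> (pr p) = p" unfolding \<sigma>_def
    using bij_betw_inv_into_left[OF lt(2), of p] U(1) by simp
  have 2: "pr (\<sigma> x) = x" if "x \<in> U" for x
    using bij_betw_inv_into_right[OF lt(2), of "(x, \<gamma> p)"] that \<gamma> unfolding \<sigma>_def by simp
  have "smooth_param AP (snd c ` (fst c \<inter> U)) (\<lambda>x. \<sigma> (chart_inv c x))" if "c \<in> AM" for c
    unfolding \<sigma>_def by (rule smooth_on_product_param[OF M P lt(3) that lt(1) \<gamma>])
  then show thesis using that lt(1) U(1) 1 2 by blast
qed

text \<open>The projection undoes the section, so sections lift coordinate vectors of M. This gives
  surjectivity of the push-forward and later a coframe on M itself.\<close>

lemma push_section:
  assumes c: "c \<in> AM" and U: "open U" "\<And>x. x \<in> U \<Longrightarrow> pr (\<sigma> x) = x"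
    and x: "x \<in> snd c ` (fst c \<inter> U)"
  shows "push AM pr (\<sigma> (chart_inv c x)) (pvec AP (\<lambda>x. \<sigma> (chart_inv c x)) x u) = coord_vec AM c (chart_inv c x) u"
proof -
  have T: "open (snd c ` (fst c \<inter> U))" by (rule chart_image_open[OF M c U(1)])
  have eq: "pr (\<sigma> (chart_inv c y)) = chart_inv c y" if "y \<in> snd c ` (fst c \<inter> U)" for y
    using that U(2) chart_inv_left[OF M c] by auto
  have "push AM pr (\<sigma> (chart_inv c x)) (pvec AP (\<lambda>x. \<sigma> (chart_inv c x)) x u) = pvec AM (\<lambda>x. pr (\<sigma> (chart_inv c x))) x u"
    using push_pvec[OF P M smooth_pr, of "\<lambda>x. \<sigma> (chart_inv c x)" x u] by (simp add: comp_def)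
  also have "\<dots> = pvec AM (chart_inv c) x u"
  proof
    fix f :: "'m \<Rightarrow> real"
    have "frechet_derivative (f \<circ> (\<lambda>x. pr (\<sigma> (chart_inv c x)))) (at x) = frechet_derivative (f \<circ> chart_inv c) (at x)"
      by (rule frechet_derivative_cong_open[OF T x]) (simp add: eq)
    then show "pvec AM (\<lambda>x. pr (\<sigma> (chart_inv c x))) x u f = pvec AM (chart_inv c) x u f"
      by (simp add: pvec_def eq[OF x])
  qed
  also have "\<dots> = coord_vec AM c (chart_inv c x) u"
    by (rule coord_vec_eq_pvec'[symmetric, OF M c]) (use x in auto)
  finally show ?thesis .
qed

lemma push_surj:
  assumes "Y \<in> tangent AM (pr p)"
  obtains X where "X \<in> tangent AP p" "push AM pr p X = Y"
proof -
  obtain U \<sigma> where s: "open U" "pr p \<in> U" "\<sigma> (pr p) = p" "\<And>x. x \<in> U \<Longrightarrow> pr (\<sigma> x) = x"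
    "\<And>c. c \<in> AM \<Longrightarrow> smooth_param AP (snd c ` (fst c \<inter> U)) (\<lambda>x. \<sigma> (chart_inv c x))"
    using local_section[of p] by blast
  obtain c where c: "c \<in> AM" "pr p \<in> fst c" using chart_at[OF M] by blast
  define x where "x = snd c (pr p)"
  have x: "x \<in> snd c ` (fst c \<inter> U)" "chart_inv c x = pr p"
    using c s(2) chart_inv_left[OF M c] by (auto simp: x_def)
  have "push AM pr p (pvec AP (\<lambda>x. \<sigma> (chart_inv c x)) x (coords c Y)) = Y"
    using push_section[OF c(1) s(1,4) x(1), of "coords c Y"] coord_vec_coords[OF M c assms] by (simp add: x(2) s(3))
  moreover have "pvec AP (\<lambda>x. \<sigma> (chart_inv c x)) x (coords c Y) \<in> tangent AP p"
    using pvec_in_tangent[OF P s(5)[OF c(1)] x(1)] by (simp add: x(2) s(3))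
  ultimately show thesis using that by blast
qed

text \<open>Differentiate the orbit of p along the curve of \<open>SU2_curve\<close>. The action is
  smooth only through a local extension G to all matrices, so the coordinates of the vector are the
  derivative of G in the direction (0, a).\<close>

lemma generates_exists:
  assumes a: "a \<in> su2"
  obtains X where "generates AP act p a X"
proof -
  obtain \<theta> where \<theta>: "\<theta> 0 = mat 1" "\<And>t. \<theta> t \<in> SU2" "(\<theta> has_vector_derivative a) (at (0::real))"
    using SU2_curve[OF a] by blast
  obtain c where c: "c \<in> AP" "p \<in> fst c" using chart_at[OF P] by blast
  have "smooth_on_product AP AP UNIV SU2 act" using pbundle by (simp add: principal_SU2_bundle_def)
  then obtain N G where N: "open N" "(snd c p, mat 1) \<in> N" "smooth_on N G"
    "\<And>y h. y \<in> fst c \<Longrightarrow> h \<in> SU2 \<Longrightarrow> (snd c y, h) \<in> N \<Longrightarrow> act y h \<in> fst c \<and> snd c (act y h) = G (snd c y, h)"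
    unfolding smooth_on_product_def using c act_one[of p] SU2_one by (metis IntI UNIV_I)
  define \<psi> where "\<psi> t = G (snd c p, \<theta> t)" for t
  have d1: "((\<lambda>t. (snd c p, \<theta> t)) has_vector_derivative (0, a)) (at 0)"
    using has_vector_derivative_Pair[OF has_vector_derivative_const \<theta>(3)] .
  have "(G has_derivative frechet_derivative G (at (snd c p, \<theta> 0))) (at (snd c p, \<theta> 0))"
    using smooth_on_has_derivative[OF N(3)] N(2) \<theta>(1) by simp
  then have dG: "(G has_derivative frechet_derivative G (at (snd c p, \<theta> 0))) (at (snd c p, \<theta> 0))" .
  define u where "u = frechet_derivative G (at (snd c p, \<theta> 0)) (0, a)"
  have "(\<psi> has_derivative (\<lambda>t. frechet_derivative G (at (snd c p, \<theta> 0)) (t *\<^sub>R (0, a)))) (at 0)"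
    unfolding \<psi>_def using has_derivative_compose[OF d1[unfolded has_vector_derivative_def] dG] .
  then have u: "(\<psi> has_vector_derivative u) (at 0)"
    unfolding has_vector_derivative_def u_def linear_cmul[OF has_derivative_linear[OF dG]] .
  have "continuous (at 0) \<theta>" using \<theta>(3) has_vector_derivative_continuous by blast
  then have "continuous (at 0) (\<lambda>t. (snd c p, \<theta> t))" by (intro continuous_intros)
  then have "\<forall>\<^sub>F t in at 0. (snd c p, \<theta> t) \<in> N"
    using N(1,2) \<theta>(1) by (auto simp: continuous_within intro: topological_tendstoD)
  then have ev: "\<forall>\<^sub>F t in nhds 0. (snd c p, \<theta> t) \<in> N"
    using N(2) \<theta>(1) by (simp add: eventually_nhds_conv_at)
  have \<psi>0: "\<psi> 0 = snd c p" using N(4)[OF c(2), of "mat 1"] SU2_one N(2) act_one by (simp add: \<psi>_def \<theta>(1))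
  have "generates AP act p a (coord_vec AP c p u)"
    unfolding generates_def
  proof (intro conjI exI[of _ \<theta>] allI impI \<theta>)
    show "coord_vec AP c p u \<in> tangent AP p" by (rule coord_vec_in_tangent[OF c])
    fix f assume f: "smooth_at AP p f"
    have "(f \<circ> chart_inv c) differentiable (at (snd c p))"
      using smooth_at_param_differentiable[OF P smooth_param_chart[OF P c(1)], of "snd c p" f] c f chart_inv_left[OF P c] by simp
    then have "((f \<circ> chart_inv c) has_derivative frechet_derivative (f \<circ> chart_inv c) (at (snd c p))) (at (\<psi> 0))"
      unfolding \<psi>0 by (simp add: frechet_derivative_works)
    from has_derivative_compose[OF u[unfolded has_vector_derivative_def] this]
    have "((\<lambda>t. f (chart_inv c (\<psi> t))) has_derivative (\<lambda>t. frechet_derivative (f \<circ> chart_inv c) (at (snd c p)) (t *\<^sub>R u))) (at 0)"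
      by (simp add: comp_def)
    moreover have "frechet_derivative (f \<circ> chart_inv c) (at (snd c p)) (t *\<^sub>R u) = coord_vec AP c p u f * t" for t
      using frechet_derivative_linear_simps(2)[OF \<open>(f \<circ> chart_inv c) differentiable (at (snd c p))\<close>] f by (simp add: coord_vec_def)
    ultimately have "((\<lambda>t. f (chart_inv c (\<psi> t))) has_real_derivative coord_vec AP c p u f) (at 0)"
      by (simp add: has_field_derivative_def)
    moreover have "\<forall>\<^sub>F t in nhds 0. f (chart_inv c (\<psi> t)) = f (act p (\<theta> t))"
      using ev
    proof eventually_elim
      case (elim t)
      then have "act p (\<theta> t) \<in> fst c" "snd c (act p (\<theta> t)) = \<psi> t" using N(4)[OF c(2) \<theta>(2)] by (auto simp: \<psi>_def)
      then show ?case using chart_inv_left[OF P c(1)] by metis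
    qed
    ultimately show "((\<lambda>t. f (act p (\<theta> t))) has_real_derivative coord_vec AP c p u f) (at 0)"
      by (simp add: DERIV_cong_ev)
  qed
  then show thesis using that by blast
qed

text \<open>Functions pulled back from the base are constant along orbits.\<close>

lemma generates_vertical:
  assumes "generates AP act p a X"
  shows "X \<in> vertical AM AP pr p"
proof -
  obtain \<theta> where X: "X \<in> tangent AP p" "\<And>t. \<theta> t \<in> SU2"
    "\<And>f. smooth_at AP p f \<Longrightarrow> ((\<lambda>t. f (act p (\<theta> t))) has_real_derivative X f) (at (0::real))"
    using assms by (auto simp: generates_def)
  have "push AM pr p X f = 0" for f
  proof (cases "smooth_at AM (pr p) f")
    case True
    have "((\<lambda>t. (f \<circ> pr) (act p (\<theta> t))) has_real_derivative X (f \<circ> pr)) (at 0)"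
      by (rule X(3)[OF smooth_at_comp[OF P M smooth_pr True]])
    then have "((\<lambda>t. f (pr p)) has_real_derivative X (f \<circ> pr)) (at 0)" by (simp add: pr_act X(2))
    then have "X (f \<circ> pr) = 0" using DERIV_const DERIV_unique by blast
    then show ?thesis by (simp add: push_def)
  qed (simp add: push_def)
  then show ?thesis using X(1) by (auto simp: vertical_def tzero_def)
qed

end

subsection \<open>A connection and a frame form a coframe\<close>

lemma exhaust_6: "(x::6) = 1 \<or> x = 2 \<or> x = 3 \<or> x = 4 \<or> x = 5 \<or> x = 6"
proof (induct x)
  case (of_int z)
  then have "z = 0 \<or> z = 1 \<or> z = 2 \<or> z = 3 \<or> z = 4 \<or> z = 5" by fastforce
  then show ?case by auto
qed

lemma forall_6: "(\<forall>i::6. P i) \<longleftrightarrow> P 1 \<and> P 2 \<and> P 3 \<and> P 4 \<and> P 5 \<and> P 6"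
  by (metis exhaust_6)

text \<open>Packs the values of w and e into one vector of the dimension of P, so that the coframe
  becomes a square matrix.\<close>

definition join6 :: "real ^ 3 \<Rightarrow> real ^ 3 \<Rightarrow> real ^ 6" where
  "join6 a b = (\<chi> i. if i = 1 then a $ 1 else if i = 2 then a $ 2 else if i = 3 then a $ 3
     else if i = 4 then b $ 1 else if i = 5 then b $ 2 else b $ 3)"

lemma join6_surj: "\<exists>a b. y = join6 a b"
  by (rule exI[of _ "\<chi> i. if i = 1 then y $ 1 else if i = 2 then y $ 2 else y $ 3"],
      rule exI[of _ "\<chi> i. if i = 1 then y $ 4 else if i = 2 then y $ 5 else y $ 6"])
     (simp add: join6_def vec_eq_iff forall_6)

lemma join6_linear: "join6 (a + a') (b + b') = join6 a b + join6 a' b'" "join6 (r *\<^sub>R a) (r *\<^sub>R b) = r *\<^sub>R join6 a b"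
  by (simp_all add: join6_def vec_eq_iff)

locale connection_frame = su2_bundle AM AP pr act
  for AM :: "('m::{t2_space,second_countable_topology}, 3) chart set"
    and AP :: "('p::{t2_space,second_countable_topology}, 6) chart set"
    and pr act +
  fixes W E :: "('p, cmat) form"
  assumes W: "is_connection AP act W" and E: "is_frame AM AP pr act E"
begin

definition w :: "'p \<Rightarrow> 'p tvec \<Rightarrow> real ^ 3" where "w p X = vec_of_su2 (W p [X])"
definition e :: "'p \<Rightarrow> 'p tvec \<Rightarrow> real ^ 3" where "e p X = vec_of_su2 (E p [X])"

lemma forms: "is_form AP 1 W" "is_form AP 1 E"
  using W E by (auto simp: is_connection_def is_frame_def)

lemma W_eq: "X \<in> tangent AP p \<Longrightarrow> W p [X] = su2_of_vec (w p X)"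
  and E_eq: "X \<in> tangent AP p \<Longrightarrow> E p [X] = su2_of_vec (e p X)"
  using W E by (auto simp: is_connection_def is_frame_def su2_valued_def w_def e_def su2_of_vec_of_su2)

lemma we_linear:
  assumes "X \<in> tangent AP p"
  shows "Y \<in> tangent AP p \<Longrightarrow> w p (tadd X Y) = w p X + w p Y" "w p (tscale r X) = r *\<^sub>R w p X"
    "Y \<in> tangent AP p \<Longrightarrow> e p (tadd X Y) = e p X + e p Y" "e p (tscale r X) = r *\<^sub>R e p X"
  using is_form_1_linear[OF forms(1) assms] is_form_1_linear[OF forms(2) assms]
  by (simp_all add: w_def e_def linear_add[OF linear_vec_of_su2] linear_cmul[OF linear_vec_of_su2])

lemma e_vertical: "X \<in> vertical AM AP pr p \<Longrightarrow> e p X = 0"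
  using E by (simp add: is_frame_def e_def linear_0[OF linear_vec_of_su2])

lemma w_generates: "generates AP act p (su2_of_vec a) X \<Longrightarrow> w p X = a"
proof -
  assume "generates AP act p (su2_of_vec a) X"
  then have "W p [X] = su2_of_vec a" using W su2_of_vec_in_su2 unfolding is_connection_def by blast
  then show ?thesis by (simp add: w_def)
qed

lemma vertical_exists:
  obtains X where "X \<in> vertical AM AP pr p" "generates AP act p (su2_of_vec a) X" "w p X = a" "e p X = 0"
  using generates_exists[OF su2_of_vec_in_su2[of a], of p] generates_vertical w_generates e_vertical by metis

text \<open>Independence of the components of E says that no nonzero covector annihilates the range
  of e, which is therefore not a proper subspace.\<close>

lemma e_surj: "\<exists>X\<in>tangent AP p. e p X = b"
proof -
  obtain c where c: "c \<in> AP" "p \<in> fst c" using chart_at[OF P] by blast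
  define L where "L u = e p (coord_vec AP c p u)" for u
  note t = coord_vec_in_tangent[OF c]
  have L: "linear L"
    by (rule linearI) (simp_all add: L_def coord_vec_linear[OF P c, symmetric] we_linear t)
  obtain f where f: "\<And>X. X \<in> tangent AP p \<Longrightarrow> E p [X] = (\<Sum>i\<in>UNIV. f i X *\<^sub>R \<tau> i)"
    "\<And>s::3 \<Rightarrow> real. (\<forall>X\<in>tangent AP p. (\<Sum>i\<in>UNIV. s i * f i X) = 0) \<Longrightarrow> (\<forall>i. s i = 0)"
  proof -
    have "\<exists>f. (\<forall>X\<in>tangent AP p. E p [X] = (\<Sum>i\<in>UNIV. f i X *\<^sub>R \<tau> i)) \<and>
        (\<forall>s::3 \<Rightarrow> real. (\<forall>X\<in>tangent AP p. (\<Sum>i\<in>UNIV. s i * f i X) = 0) \<longrightarrow> (\<forall>i. s i = 0))"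
      using E unfolding is_frame_def by blast
    then show thesis using that by blast
  qed
  have ef: "e p X = (\<chi> i. f i X)" if "X \<in> tangent AP p" for X
  proof -
    have "E p [X] = su2_of_vec (\<chi> i. f i X)" using f(1)[OF that] by (simp add: su2_of_vec_def)
    then show ?thesis by (simp add: e_def)
  qed
  have "range L = UNIV"
  proof (rule ccontr)
    assume ne: "range L \<noteq> UNIV"
    have sub: "span (range L) = range L" using linear_subspace_image[OF L subspace_UNIV] span_eq_iff by blast
    \<comment> \<open>A normal vector to a proper range would be a linear relation among the
      components of E.\<close>
    then obtain s where s: "s \<noteq> 0" "\<And>y. y \<in> span (range L) \<Longrightarrow> orthogonal s y"
    proof -
      have "span (range L) \<noteq> UNIV" unfolding sub by (rule ne)
      then have "span (range L) \<subset> span UNIV" unfolding span_UNIV by blast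
      then show thesis using orthogonal_to_subspace_exists_gen[of "range L" UNIV] that by metis
    qed
    have "(\<Sum>i\<in>UNIV. s $ i * f i X) = 0" if X: "X \<in> tangent AP p" for X
    proof -
      have "e p X = L (coords c X)" using coord_vec_coords[OF P c X] by (simp add: L_def)
      then have "s \<bullet> e p X = 0" using s(2)[of "e p X"] sub by (auto simp: orthogonal_def)
      then show ?thesis by (simp add: ef[OF X] inner_vec_def)
    qed
    then have "\<forall>i. s $ i = 0" by (intro f(2)) auto
    then show False using s(1) by (simp add: vec_eq_iff)
  qed
  then obtain u where "L u = b" by (metis UNIV_I imageE)
  then show ?thesis using t by (auto simp: L_def)
qed

text \<open>First attain the value of e, then correct w by a vertical vector, which e does not
  see.\<close>

lemma we_surj: "\<exists>X\<in>tangent AP p. w p X = a \<and> e p X = b"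
proof -
  obtain X where X: "X \<in> tangent AP p" "e p X = b" using e_surj by blast
  obtain Y where Y: "Y \<in> vertical AM AP pr p" "w p Y = a - w p X" "e p Y = 0" using vertical_exists by metis
  then have Yt: "Y \<in> tangent AP p" by (simp add: vertical_def)
  show ?thesis
    by (rule bexI[of _ "tadd X Y"]) (use X Y Yt in \<open>simp_all add: we_linear tangent_linear(1)[OF P]\<close>)
qed

lemma we_chart_linear:
  assumes c: "c \<in> AP" "p \<in> fst c"
  shows "linear (\<lambda>u. w p (coord_vec AP c p u))" "linear (\<lambda>u. e p (coord_vec AP c p u))"
  using coord_vec_in_tangent[OF c]
  by (auto intro!: linearI simp: coord_vec_linear[OF P c, symmetric] we_linear)

text \<open>Domain and codomain both have dimension six, so surjectivity gives injectivity. Here the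
  dimension of P enters.\<close>

lemma coframe_bij:
  assumes c: "c \<in> AP" "p \<in> fst c"
  shows "linear (\<lambda>u. join6 (w p (coord_vec AP c p u)) (e p (coord_vec AP c p u)))"
    "bij (\<lambda>u. join6 (w p (coord_vec AP c p u)) (e p (coord_vec AP c p u)))"
proof -
  let ?L = "\<lambda>u. join6 (w p (coord_vec AP c p u)) (e p (coord_vec AP c p u))"
  show lin: "linear ?L"
    by (rule linearI) (simp_all add: join6_linear[symmetric] linear_add[OF we_chart_linear(1)[OF c]] linear_add[OF we_chart_linear(2)[OF c]]
        linear_cmul[OF we_chart_linear(1)[OF c]] linear_cmul[OF we_chart_linear(2)[OF c]])
  have "surj ?L"
    unfolding surj_def
  proof
    fix y :: "real ^ 6"
    obtain a b where y: "y = join6 a b" using join6_surj by blast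
    obtain X where X: "X \<in> tangent AP p" "w p X = a" "e p X = b" using we_surj by blast
    show "\<exists>u. y = ?L u"
      by (rule exI[of _ "coords c X"]) (simp add: coord_vec_coords[OF P c X(1)] X y)
  qed
  then show "bij ?L" using linear_surj_imp_inj[OF lin] by (simp add: bij_def)
qed

lemma we_inject:
  assumes "X \<in> tangent AP p" "Y \<in> tangent AP p" "w p X = w p Y" "e p X = e p Y"
  shows "X = Y"
proof -
  obtain c where c: "c \<in> AP" "p \<in> fst c" using chart_at[OF P] by blast
  have "coords c X = coords c Y"
    using injD[OF bij_is_inj[OF coframe_bij(2)[OF c]], of "coords c X" "coords c Y"] assms coord_vec_coords[OF P c] by simp
  then show ?thesis using coord_vec_coords[OF P c] assms by metis
qed

text \<open>The inverse of the coframe (w, e): a vector prescribed by its coframe values. The lifts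
  of the axes form the dual frame.\<close>

definition lift :: "'p \<Rightarrow> real ^ 3 \<Rightarrow> real ^ 3 \<Rightarrow> 'p tvec" where
  "lift p a b = (THE X. X \<in> tangent AP p \<and> w p X = a \<and> e p X = b)"

lemma lift_props: "lift p a b \<in> tangent AP p" "w p (lift p a b) = a" "e p (lift p a b) = b"
proof -
  have "\<exists>!X. X \<in> tangent AP p \<and> w p X = a \<and> e p X = b" using we_surj we_inject by metis
  from theI'[OF this] show "lift p a b \<in> tangent AP p" "w p (lift p a b) = a" "e p (lift p a b) = b"
    unfolding lift_def by auto
qed

lemma lift_eqI: "X \<in> tangent AP p \<Longrightarrow> w p X = a \<Longrightarrow> e p X = b \<Longrightarrow> X = lift p a b"
  by (rule we_inject[OF _ lift_props(1)]) (simp_all only: lift_props)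

lemma lift_linear:
  "tadd (lift p a b) (lift p a' b') = lift p (a + a') (b + b')" "tscale r (lift p a b) = lift p (r *\<^sub>R a) (r *\<^sub>R b)"
  by (rule lift_eqI; simp add: lift_props we_linear tangent_linear[OF P lift_props(1) lift_props(1)])+

text \<open>Fundamental vectors already attain every value of w with e = 0, and the coframe is
  injective, so no further vectors have e = 0.\<close>

lemma vertical_iff: "X \<in> vertical AM AP pr p \<longleftrightarrow> X \<in> tangent AP p \<and> e p X = 0"
proof
  assume "X \<in> vertical AM AP pr p"
  then show "X \<in> tangent AP p \<and> e p X = 0" using e_vertical by (simp add: vertical_def)
next
  assume X: "X \<in> tangent AP p \<and> e p X = 0"
  obtain Y where Y: "Y \<in> vertical AM AP pr p" "w p Y = w p X" "e p Y = 0" using vertical_exists by metis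
  then have "X = Y" using X by (intro we_inject) (auto simp: vertical_def)
  then show "X \<in> vertical AM AP pr p" using Y by simp
qed

lemma generates_iff: "generates AP act p (su2_of_vec a) X \<longleftrightarrow> X \<in> tangent AP p \<and> w p X = a \<and> e p X = 0"
proof
  assume "generates AP act p (su2_of_vec a) X"
  then show "X \<in> tangent AP p \<and> w p X = a \<and> e p X = 0"
    using generates_vertical vertical_iff w_generates by blast
next
  assume X: "X \<in> tangent AP p \<and> w p X = a \<and> e p X = 0"
  obtain Y where Y: "Y \<in> vertical AM AP pr p" "generates AP act p (su2_of_vec a) Y" "w p Y = a" "e p Y = 0" using vertical_exists by metis
  then have "X = Y" using X by (intro we_inject) (auto simp: vertical_def)
  then show "generates AP act p (su2_of_vec a) X" using Y by simp
qed

end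

subsection \<open>Structure equations\<close>

lemma mwedge_1_1: "mwedge 1 1 \<alpha> \<beta> p [X, Y] = \<alpha> p [X] ** \<beta> p [Y] - \<alpha> p [Y] ** \<beta> p [X]"
  unfolding wedge_def by (rule alt_wedge_1_1)

lemma has_derivative_cross3:
  assumes "(f has_derivative f') (at x)" "(g has_derivative g') (at x)"
  shows "((\<lambda>x. f x \<times> g x) has_derivative (\<lambda>h. f x \<times> g' h + f' h \<times> g x)) (at x)"
  using bounded_bilinear.FDERIV[OF bilinear_conv_bounded_bilinear[THEN iffD1, OF bilinear_cross] assms] .

lemma smooth_on_cross3: "open S \<Longrightarrow> smooth_on S f \<Longrightarrow> smooth_on S g \<Longrightarrow> smooth_on S (\<lambda>x. f x \<times> g x)"
  using smooth_on_bilinear[OF bilinear_conv_bounded_bilinear[THEN iffD1, OF bilinear_cross]] by blast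

lemma extd_antisym: "extd A \<alpha> p [Y, X] = - extd A \<alpha> p [X, Y]"
  by (simp add: extd_1 Let_def)

lemma list_length_2: "length Xs = 2 \<Longrightarrow> \<exists>X Y. Xs = [X, Y]"
  by (auto simp: numeral_2_eq_2 length_Suc_conv)

lemma form_eq_2: "form_eq A 2 \<alpha> \<beta> \<longleftrightarrow> (\<forall>p. \<forall>X\<in>tangent A p. \<forall>Y\<in>tangent A p. \<alpha> p [X, Y] = \<beta> p [X, Y])"
proof
  assume "form_eq A 2 \<alpha> \<beta>"
  then show "\<forall>p. \<forall>X\<in>tangent A p. \<forall>Y\<in>tangent A p. \<alpha> p [X, Y] = \<beta> p [X, Y]" by (simp add: form_eq_def)
next
  assume r: "\<forall>p. \<forall>X\<in>tangent A p. \<forall>Y\<in>tangent A p. \<alpha> p [X, Y] = \<beta> p [X, Y]"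
  show "form_eq A 2 \<alpha> \<beta>" unfolding form_eq_def
  proof (intro allI impI)
    fix p Xs assume Xs: "length Xs = 2 \<and> set Xs \<subseteq> tangent A p"
    then obtain X Y where "Xs = [X, Y]" using list_length_2 by blast
    then show "\<alpha> p Xs = \<beta> p Xs" using r Xs by simp
  qed
qed

lemma form_eq_1: "form_eq A 1 \<alpha> \<beta> \<longleftrightarrow> (\<forall>p. \<forall>X\<in>tangent A p. \<alpha> p [X] = \<beta> p [X])"
proof
  assume "form_eq A 1 \<alpha> \<beta>"
  then show "\<forall>p. \<forall>X\<in>tangent A p. \<alpha> p [X] = \<beta> p [X]" by (simp add: form_eq_def)
next
  assume r: "\<forall>p. \<forall>X\<in>tangent A p. \<alpha> p [X] = \<beta> p [X]"
  show "form_eq A 1 \<alpha> \<beta>" unfolding form_eq_def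
  proof (intro allI impI)
    fix p Xs assume Xs: "length Xs = 1 \<and> set Xs \<subseteq> tangent A p"
    then obtain X where "Xs = [X]" by (auto simp: length_Suc_conv)
    then show "\<alpha> p Xs = \<beta> p Xs" using r Xs by simp
  qed
qed

context connection_frame
begin

definition dw :: "'p \<Rightarrow> 'p tvec \<Rightarrow> 'p tvec \<Rightarrow> real ^ 3" where "dw p X Y = vec_of_su2 (extd AP W p [X, Y])"
definition de :: "'p \<Rightarrow> 'p tvec \<Rightarrow> 'p tvec \<Rightarrow> real ^ 3" where "de p X Y = vec_of_su2 (extd AP E p [X, Y])"
definition tor :: "'p \<Rightarrow> 'p tvec \<Rightarrow> 'p tvec \<Rightarrow> real ^ 3" where
  "tor p X Y = de p X Y + w p X \<times> e p Y - w p Y \<times> e p X"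

lemma pullback_we:
  assumes \<phi>: "smooth_param AP S \<phi>"
  shows "smooth_on S (\<lambda>y. w (\<phi> y) (pvec AP \<phi> y (u::'a::real_normed_vector)))" (is ?w)
    and "smooth_on S (\<lambda>y. e (\<phi> y) (pvec AP \<phi> y u))" (is ?e)
    and "x \<in> S \<Longrightarrow> dw (\<phi> x) (pvec AP \<phi> x u) (pvec AP \<phi> x v) =
      frechet_derivative (\<lambda>y. w (\<phi> y) (pvec AP \<phi> y v)) (at x) u - frechet_derivative (\<lambda>y. w (\<phi> y) (pvec AP \<phi> y u)) (at x) v"
    and "x \<in> S \<Longrightarrow> de (\<phi> x) (pvec AP \<phi> x u) (pvec AP \<phi> x v) =
      frechet_derivative (\<lambda>y. e (\<phi> y) (pvec AP \<phi> y v)) (at x) u - frechet_derivative (\<lambda>y. e (\<phi> y) (pvec AP \<phi> y u)) (at x) v"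
proof -
  note bl = bounded_linear_vec_of_su2
  note S = smooth_param_open[OF \<phi>]
  note pw = pullback_1_form[OF P \<phi> forms(1)] and pe = pullback_1_form[OF P \<phi> forms(2)]
  show ?w ?e unfolding w_def e_def
    by (rule smooth_on_bounded_linear_comp[OF bl S pw(1)], rule smooth_on_bounded_linear_comp[OF bl S pe(1)])
  assume x: "x \<in> S"
  have fw: "frechet_derivative (\<lambda>y. w (\<phi> y) (pvec AP \<phi> y u)) (at x) v =
     vec_of_su2 (frechet_derivative (\<lambda>y. W (\<phi> y) [pvec AP \<phi> y u]) (at x) v)" for u v
    unfolding w_def by (rule frechet_derivative_bounded_linear[OF bl smooth_on_imp_differentiable[OF pw(1) x]])
  have fe: "frechet_derivative (\<lambda>y. e (\<phi> y) (pvec AP \<phi> y u)) (at x) v =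
     vec_of_su2 (frechet_derivative (\<lambda>y. E (\<phi> y) [pvec AP \<phi> y u]) (at x) v)" for u v
    unfolding e_def by (rule frechet_derivative_bounded_linear[OF bl smooth_on_imp_differentiable[OF pe(1) x]])
  show "dw (\<phi> x) (pvec AP \<phi> x u) (pvec AP \<phi> x v) =
      frechet_derivative (\<lambda>y. w (\<phi> y) (pvec AP \<phi> y v)) (at x) u - frechet_derivative (\<lambda>y. w (\<phi> y) (pvec AP \<phi> y u)) (at x) v"
    unfolding dw_def pw(2)[OF x, symmetric] fw by (rule linear_diff[OF linear_vec_of_su2])
  show "de (\<phi> x) (pvec AP \<phi> x u) (pvec AP \<phi> x v) =
      frechet_derivative (\<lambda>y. e (\<phi> y) (pvec AP \<phi> y v)) (at x) u - frechet_derivative (\<lambda>y. e (\<phi> y) (pvec AP \<phi> y u)) (at x) v"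
    unfolding de_def pe(2)[OF x, symmetric] fe by (rule linear_diff[OF linear_vec_of_su2])
qed

lemma chart_param:
  assumes "c \<in> AP" "p \<in> fst c" "X \<in> tangent AP p"
  shows "snd c p \<in> snd c ` fst c" "chart_inv c (snd c p) = p" "pvec AP (chart_inv c) (snd c p) (coords c X) = X"
  using assms chart_inv_left[OF P assms(1,2)] coord_vec_coords[OF P assms] coord_vec_eq_pvec[OF P assms(1,2)] by auto

text \<open>Membership in su(2) is being fixed by the linear map \<open>su2_of_vec\<close> after
  \<open>vec_of_su2\<close>, and a linear map commutes with the derivatives that make up
  \<open>extd\<close>.\<close>

lemma extd_in_su2:
  assumes \<alpha>: "is_form AP 1 \<alpha>" "su2_valued AP \<alpha>" and X: "X \<in> tangent AP p" "Y \<in> tangent AP p"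
  shows "extd AP \<alpha> p [X, Y] = su2_of_vec (vec_of_su2 (extd AP \<alpha> p [X, Y]))"
proof -
  obtain c where c: "c \<in> AP" "p \<in> fst c" using chart_at[OF P] by blast
  note \<phi> = smooth_param_chart[OF P c(1)] and x = chart_param[OF c X(1)] and y = chart_param[OF c X(2)]
  have eq: "\<alpha> (chart_inv c y) [pvec AP (chart_inv c) y u] = su2_of_vec (vec_of_su2 (\<alpha> (chart_inv c y) [pvec AP (chart_inv c) y u]))"
    if "y \<in> snd c ` fst c" for y u
    using \<alpha>(2) pvec_in_tangent[OF P \<phi> that] by (simp add: su2_valued_def su2_of_vec_of_su2)
  have fr: "frechet_derivative (\<lambda>y. \<alpha> (chart_inv c y) [pvec AP (chart_inv c) y u]) (at (snd c p)) v =
     su2_of_vec (vec_of_su2 (frechet_derivative (\<lambda>y. \<alpha> (chart_inv c y) [pvec AP (chart_inv c) y u]) (at (snd c p)) v))" for u v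
  proof -
    have "frechet_derivative (\<lambda>y. \<alpha> (chart_inv c y) [pvec AP (chart_inv c) y u]) (at (snd c p)) =
      frechet_derivative (\<lambda>y. su2_of_vec (vec_of_su2 (\<alpha> (chart_inv c y) [pvec AP (chart_inv c) y u]))) (at (snd c p))"
      by (rule frechet_derivative_cong_open[OF chart_open_image[OF P c(1)] x(1) eq])
    moreover have "frechet_derivative (\<lambda>y. su2_of_vec (vec_of_su2 (\<alpha> (chart_inv c y) [pvec AP (chart_inv c) y u]))) (at (snd c p)) v = su2_of_vec (vec_of_su2 (frechet_derivative (\<lambda>y. \<alpha> (chart_inv c y) [pvec AP (chart_inv c) y u]) (at (snd c p)) v))"
      by (rule frechet_derivative_bounded_linear[OF bounded_linear_compose[OF bounded_linear_su2_of_vec bounded_linear_vec_of_su2]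
        smooth_on_imp_differentiable[OF pullback_1_form(1)[OF P \<phi> \<alpha>(1)] x(1)]])
    ultimately show ?thesis by simp
  qed
  define A where "A = frechet_derivative (\<lambda>y. \<alpha> (chart_inv c y) [pvec AP (chart_inv c) y (coords c Y)]) (at (snd c p)) (coords c X)"
  define B where "B = frechet_derivative (\<lambda>y. \<alpha> (chart_inv c y) [pvec AP (chart_inv c) y (coords c X)]) (at (snd c p)) (coords c Y)"
  have AB: "su2_of_vec (vec_of_su2 A) = A" "su2_of_vec (vec_of_su2 B) = B"
    unfolding A_def B_def by (rule fr[symmetric])+
  have "A - B = extd AP \<alpha> p [X, Y]"
    using pullback_1_form(2)[OF P \<phi> \<alpha>(1) x(1), of "coords c Y" "coords c X", unfolded x y] unfolding A_def B_def .
  moreover have "su2_of_vec (vec_of_su2 (A - B)) = A - B"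
    by (simp only: linear_diff[OF linear_vec_of_su2] su2_of_vec_simps AB)
  ultimately show ?thesis by simp
qed

lemma extd_W: "X \<in> tangent AP p \<Longrightarrow> Y \<in> tangent AP p \<Longrightarrow> extd AP W p [X, Y] = su2_of_vec (dw p X Y)"
  and extd_E: "X \<in> tangent AP p \<Longrightarrow> Y \<in> tangent AP p \<Longrightarrow> extd AP E p [X, Y] = su2_of_vec (de p X Y)"
  using W E unfolding dw_def de_def is_connection_def is_frame_def by (blast intro: extd_in_su2)+

lemma mwedge_E_E: "X \<in> tangent AP p \<Longrightarrow> Y \<in> tangent AP p \<Longrightarrow> mwedge 1 1 E E p [X, Y] = su2_of_vec (e p X \<times> e p Y)"
  by (simp only: mwedge_1_1 E_eq su2_of_vec_commutator)

lemma curvature_eq: "X \<in> tangent AP p \<Longrightarrow> Y \<in> tangent AP p \<Longrightarrow>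
    curvature AP W p [X, Y] = su2_of_vec (dw p X Y + w p X \<times> w p Y)"
  by (simp only: curvature_def fadd_def mwedge_1_1 W_eq su2_of_vec_commutator extd_W su2_of_vec_simps)

lemma cov_ext_deriv_eq: 
  assumes "X \<in> tangent AP p" "Y \<in> tangent AP p"
  shows "cov_ext_deriv AP W E p [X, Y] = su2_of_vec (tor p X Y)"
proof -
  have "cov_ext_deriv AP W E p [X, Y] = su2_of_vec (de p X Y)
     + ((su2_of_vec (w p X) ** su2_of_vec (e p Y) - su2_of_vec (e p Y) ** su2_of_vec (w p X))
      - (su2_of_vec (w p Y) ** su2_of_vec (e p X) - su2_of_vec (e p X) ** su2_of_vec (w p Y)))"
    using assms by (simp add: cov_ext_deriv_def fadd_def mwedge_1_1[unfolded One_nat_def] W_eq E_eq extd_E)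
  then show ?thesis
    by (simp only: su2_of_vec_commutator tor_def su2_of_vec_simps) simp
qed

lemma tor_antisym: "tor p Y X = - tor p X Y"
  by (simp add: tor_def de_def extd_antisym[of AP E p Y X] linear_neg[OF linear_vec_of_su2])

end

locale cs_frame = connection_frame AM AP pr act W E
  for AM :: "('m::{t2_space,second_countable_topology}, 3) chart set"
    and AP :: "('p::{t2_space,second_countable_topology}, 6) chart set"
    and pr act W E +
  assumes F: "form_eq AP 2 (curvature AP W) (mwedge 1 1 E E)"
begin

lemma dw_eq:
  assumes "X \<in> tangent AP p" "Y \<in> tangent AP p"
  shows "dw p X Y = e p X \<times> e p Y - w p X \<times> w p Y"
proof -
  have "su2_of_vec (dw p X Y + w p X \<times> w p Y) = su2_of_vec (e p X \<times> e p Y)"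
    using F assms curvature_eq[OF assms] mwedge_E_E[OF assms] by (simp add: form_eq_2)
  then show ?thesis by (simp add: su2_of_vec_eq_iff algebra_simps)
qed

text \<open>Differentiate the structure equation for dw once more and take the cyclic sum: second
  derivatives of w cancel by symmetry, the cubic terms in w cancel by the Jacobi identity, and the
  derivatives of e combine with w into the torsion.\<close>

lemma bianchi:
  assumes X: "X \<in> tangent AP p" "Y \<in> tangent AP p" "Z \<in> tangent AP p"
  shows "tor p X Y \<times> e p Z + tor p Y Z \<times> e p X + tor p Z X \<times> e p Y = 0"
proof -
  obtain c where c: "c \<in> AP" "p \<in> fst c" using chart_at[OF P] by blast
  define S where "S = snd c ` fst c"
  define \<phi> where "\<phi> = chart_inv c"
  define x where "x = snd c p"
  have S: "open S" unfolding S_def by (rule chart_open_image[OF P c(1)])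
  have \<phi>: "smooth_param AP S \<phi>" unfolding S_def \<phi>_def by (rule smooth_param_chart[OF P c(1)])
  have x: "x \<in> S" "\<phi> x = p" using chart_param[OF c X(1)] by (auto simp: S_def \<phi>_def x_def)
  define a where "a u y = w (\<phi> y) (pvec AP \<phi> y u)" for u y
  define b where "b u y = e (\<phi> y) (pvec AP \<phi> y u)" for u y
  have a: "smooth_on S (a u)" and b: "smooth_on S (b u)" for u
    using pullback_we(1,2)[OF \<phi>, of u] by (auto simp: a_def[abs_def] b_def[abs_def])
  define Da where "Da u v y = frechet_derivative (a v) (at y) u" for u v y
  define Db where "Db u v y = frechet_derivative (b v) (at y) u" for u v y
  have Da: "smooth_on S (Da u v)" for u v unfolding Da_def[abs_def] by (rule smooth_on_frechet[OF a])
  have str: "Da u v y - Da v u y = b u y \<times> b v y - a u y \<times> a v y" if "y \<in> S" for u v y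
    using pullback_we(3)[OF \<phi> that, of u v] dw_eq[OF pvec_in_tangent[OF P \<phi> that] pvec_in_tangent[OF P \<phi> that], of u v]
    by (simp add: Da_def a_def[abs_def] b_def)
  define DDa where "DDa t u v = frechet_derivative (Da u v) (at x) t" for t u v
  have sym: "DDa t u v = DDa u t v" for t u v
    unfolding DDa_def Da_def[abs_def] by (rule frechet_derivative_commute[OF S x(1) a])
  have da: "(a v has_derivative (\<lambda>u. Da u v x)) (at x)" for v
    using smooth_on_has_derivative[OF a x(1)] by (simp add: Da_def)
  have db: "(b v has_derivative (\<lambda>u. Db u v x)) (at x)" for v
    using smooth_on_has_derivative[OF b x(1)] by (simp add: Db_def)
  have key: "DDa t u v - DDa t v u = b u x \<times> Db t v x + Db t u x \<times> b v x - (a u x \<times> Da t v x + Da t u x \<times> a v x)" for t u v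
  proof -
    have 1: "((\<lambda>y. Da u v y - Da v u y) has_derivative (\<lambda>t. DDa t u v - DDa t v u)) (at x)"
      unfolding DDa_def by (intro has_derivative_diff smooth_on_has_derivative[OF Da x(1)])
    have 2: "((\<lambda>y. b u y \<times> b v y - a u y \<times> a v y) has_derivative
       (\<lambda>t. b u x \<times> Db t v x + Db t u x \<times> b v x - (a u x \<times> Da t v x + Da t u x \<times> a v x))) (at x)"
      by (intro has_derivative_diff has_derivative_cross3 da db)
    have "((\<lambda>y. Da u v y - Da v u y) has_derivative
       (\<lambda>t. b u x \<times> Db t v x + Db t u x \<times> b v x - (a u x \<times> Da t v x + Da t u x \<times> a v x))) (at x)"
      by (rule has_derivative_transform_within_open[OF 2 S x(1)]) (simp add: str)
    from fun_cong[OF has_derivative_unique[OF 1 this], of t] show ?thesis .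
  qed
  define t u v where "t = coords c X" and "u = coords c Y" and "v = coords c Z"
  have vecs: "pvec AP \<phi> x t = X" "pvec AP \<phi> x u = Y" "pvec AP \<phi> x v = Z"
    using chart_param(3)[OF c X(1)] chart_param(3)[OF c X(2)] chart_param(3)[OF c X(3)] by (auto simp: \<phi>_def x_def t_def u_def v_def)
  have ax: "a t x = w p X" "a u x = w p Y" "a v x = w p Z" "b t x = e p X" "b u x = e p Y" "b v x = e p Z"
    by (simp_all add: a_def b_def vecs x(2))
  have te: "tor p X Y = Db t u x - Db u t x + w p X \<times> e p Y - w p Y \<times> e p X"
    "tor p Y Z = Db u v x - Db v u x + w p Y \<times> e p Z - w p Z \<times> e p Y"
    "tor p Z X = Db v t x - Db t v x + w p Z \<times> e p X - w p X \<times> e p Z"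
    using pullback_we(4)[OF \<phi> x(1), of t u] pullback_we(4)[OF \<phi> x(1), of u v] pullback_we(4)[OF \<phi> x(1), of v t]
    unfolding vecs x(2) by (simp_all add: tor_def Db_def b_def[abs_def])
  \<comment> \<open>The left sides of \<open>key\<close> cancel in pairs because \<open>DDa\<close>
    is symmetric in its first two arguments.\<close>
  have cyc: "(b u x \<times> Db t v x + Db t u x \<times> b v x - (a u x \<times> Da t v x + Da t u x \<times> a v x))
     + (b v x \<times> Db u t x + Db u v x \<times> b t x - (a v x \<times> Da u t x + Da u v x \<times> a t x))
     + (b t x \<times> Db v u x + Db v t x \<times> b u x - (a t x \<times> Da v u x + Da v t x \<times> a u x)) = 0"
    unfolding key[symmetric] by (simp add: sym[of u t v] sym[of v u t] sym[of t v u])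
  have dd: "Da t u x = Da u t x + b t x \<times> b u x - a t x \<times> a u x" "Da u v x = Da v u x + b u x \<times> b v x - a u x \<times> a v x"
    "Da v t x = Da t v x + b v x \<times> b t x - a v x \<times> a t x"
    using str[OF x(1), of t u] str[OF x(1), of u v] str[OF x(1), of v t] by (auto simp: algebra_simps)
  show ?thesis
    using cyc unfolding te dd ax
    by (simp add: vec_eq_iff forall_3 cross_components) (simp add: algebra_simps)
qed

text \<open>Additivity is not visible in \<open>de\<close>, which is defined through
  \<open>extd\<close>; it is recovered from coordinate derivatives. It lets the vertical part of an
  argument be split off.\<close>

lemma tor_linear:
  assumes X: "X \<in> tangent AP p" "Y \<in> tangent AP p" "Z \<in> tangent AP p"
  shows "tor p X (tadd Y Z) = tor p X Y + tor p X Z"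
proof -
  obtain c where c: "c \<in> AP" "p \<in> fst c" using chart_at[OF P] by blast
  note \<phi> = smooth_param_chart[OF P c(1)] and x = chart_param[OF c X(1)] 
  let ?b = "\<lambda>u y. e (chart_inv c y) (pvec AP (chart_inv c) y u)"
  have b: "?b u differentiable (at (snd c p))" for u
    by (rule smooth_on_imp_differentiable[OF pullback_we(2)[OF \<phi>] x(1)])
  have YZ: "tadd Y Z \<in> tangent AP p" using tangent_linear(1)[OF P X(2,3)] .
  have add: "frechet_derivative (?b (u + v)) (at (snd c p)) t = frechet_derivative (?b u) (at (snd c p)) t + frechet_derivative (?b v) (at (snd c p)) t" for u v t
  proof -
    have "?b (u + v) y = ?b u y + ?b v y" if "y \<in> snd c ` fst c" for y
      unfolding pvec_linear(1)[OF P \<phi> that, symmetric] by (rule we_linear(3)) (rule pvec_in_tangent[OF P \<phi> that])+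
    then have "frechet_derivative (?b (u + v)) (at (snd c p)) = frechet_derivative (\<lambda>y. ?b u y + ?b v y) (at (snd c p))"
      by (intro frechet_derivative_cong_open[OF chart_open_image[OF P c(1)] x(1)])
    moreover have 2: "((\<lambda>y. ?b u y + ?b v y) has_derivative (\<lambda>t. frechet_derivative (?b u) (at (snd c p)) t + frechet_derivative (?b v) (at (snd c p)) t)) (at (snd c p))"
      by (intro has_derivative_add) (use b in \<open>simp_all add: frechet_derivative_works[symmetric]\<close>)
    ultimately show ?thesis using fun_cong[OF frechet_derivative_at[OF 2], of t] by simp
  qed
  have de: "de p X' Y' = frechet_derivative (?b (coords c Y')) (at (snd c p)) (coords c X') - frechet_derivative (?b (coords c X')) (at (snd c p)) (coords c Y')"
    if "X' \<in> tangent AP p" "Y' \<in> tangent AP p" for X' Y'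
    using pullback_we(4)[OF \<phi> x(1), of "coords c X'" "coords c Y'"] chart_param(3)[OF c that(1)] chart_param(3)[OF c that(2)] x(2) by simp
  have "de p X (tadd Y Z) = de p X Y + de p X Z"
    unfolding de[OF X(1) YZ] de[OF X(1,2)] de[OF X(1,3)] coords_linear(1)[OF P c X(2,3)] add
      frechet_derivative_linear_simps(1)[OF b] by simp
  then show ?thesis
    by (simp add: tor_def we_linear X cross_add_left cross_add_right)
qed

text \<open>For vertical \<open>V\<close> the Bianchi identity reads \<open>T(V, Y) \<times> e(Z) = T(V, Z) \<times> e(Y)\<close>, which forces \<open>T(V, \<cdot>) = 0\<close>.\<close>

lemma tor_vertical:
  assumes V: "V \<in> tangent AP p" "e p V = 0" and Y: "Y \<in> tangent AP p"
  shows "tor p V Y = 0"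
proof -
  have sym: "tor p V Y \<times> e p Z = tor p V Z \<times> e p Y" if "Y \<in> tangent AP p" "Z \<in> tangent AP p" for Y Z
    using bianchi[OF V(1) that] V(2) tor_antisym[of p Z V] by simp
  define l where "l i = tor p V (lift p 0 (axis i 1))" for i :: 3
  have l: "tor p V Y \<times> axis i 1 = l i \<times> e p Y" if "Y \<in> tangent AP p" for i Y
    using sym[OF that lift_props(1), of 0 "axis i 1"] by (simp only: lift_props l_def)
  have ll: "l j \<times> axis i 1 = l i \<times> axis j 1" for i j
    using l[OF lift_props(1), of 0 "axis j 1" i] by (simp only: lift_props l_def)
  have "l 1 = 0 \<and> l 2 = 0 \<and> l 3 = 0"
    using ll[of 1 2] ll[of 1 3] ll[of 2 3]
    by (simp add: vec_eq_iff forall_3 cross_components axis_def)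
  then have "l i = 0" for i using exhaust_3[of i] by auto
  then have "tor p V Y \<times> axis i 1 = 0" for i using l[OF Y, of i] by simp
  from this[of 1] this[of 2] show ?thesis
    by (simp add: vec_eq_iff forall_3 cross_components axis_def)
qed

end

subsection \<open>Exterior derivatives of triple products\<close>

text \<open>Read \<open>a10\<close> as the derivative of \<open>a0\<close> in direction 1, and so
  on. The alternating sum retains only the antisymmetric parts \<open>s01\<close> etc., which are
  the values of the exterior derivative.\<close>

lemma d_tr3:
  fixes a0 a1 a2 a3 :: "real ^ 3"
  assumes "a01 = a10 + s01" "a02 = a20 + s02" "a03 = a30 + s03" "a12 = a21 + s12" "a13 = a31 + s13" "a23 = a32 + s23"
  shows "(tr3 a01 a2 a3 + tr3 a1 a02 a3 + tr3 a1 a2 a03) - (tr3 a10 a2 a3 + tr3 a0 a12 a3 + tr3 a0 a2 a13)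
    + (tr3 a20 a1 a3 + tr3 a0 a21 a3 + tr3 a0 a1 a23) - (tr3 a30 a1 a2 + tr3 a0 a31 a2 + tr3 a0 a1 a32)
   = tr3 s01 a2 a3 - tr3 s02 a1 a3 + tr3 s03 a1 a2 + tr3 s12 a0 a3 - tr3 s13 a0 a2 + tr3 s23 a0 a1"
proof -
  have sw: "tr3 x y z = - tr3 y x z" "tr3 x y z = tr3 z x y" for x y z
    by (simp_all add: tr3_components algebra_simps)
  show ?thesis
    unfolding assms tr3_linear
    using sw(1)[of a1 a20 a3] sw(1)[of a1 s02 a3] sw(2)[of a1 a2 a30] sw(2)[of a1 a2 s03] sw(1)[of a0 s12 a3] sw(2)[of a0 a2 s13]
      sw(2)[of a0 a2 a31] sw(1)[of a0 a31 a2] sw(1)[of a0 a21 a3] sw(2)[of a0 a1 s23] sw(2)[of a0 a1 a32] sw(2)[of a0 a1 a23]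
    by simp
qed

text \<open>Four interpolation points determine a cubic. Used to extract polarised identities from a
  one-parameter family.\<close>

lemma poly3_coeffs:
  fixes p0 p1 p2 p3 q0 q1 q2 q3 :: real
  assumes "\<And>t. p0 + t * p1 + t^2 * p2 + t^3 * p3 = q0 + t * q1 + t^2 * q2 + t^3 * q3"
  shows "p0 = q0" "p1 = q1" "p2 = q2" "p3 = q3"
  using assms[of 0] assms[of 1] assms[of "-1"] assms[of 2] by simp_all

subsection \<open>The exterior derivative of a two-form\<close>

lemma extd_2:
  "extd A \<beta> p [X, Y, Z] = (let c = some_chart A p; D = (\<lambda>U V. frechet_derivative (form_component A c \<beta> [coords c U, coords c V]) (at (snd c p))) in
     D Y Z (coords c X) - D X Z (coords c Y) + D X Y (coords c Z))"
  by (simp add: extd_def Let_def numeral_3_eq_3)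

lemma alternating_on_2D:
  assumes "alternating_on T 2 a" "X \<in> T" "Y \<in> T"
  shows "X' \<in> T \<Longrightarrow> a [tadd X X', Y] = a [X, Y] + a [X', Y]" "Y' \<in> T \<Longrightarrow> a [X, tadd Y Y'] = a [X, Y] + a [X, Y']"
    "a [tscale r X, Y] = r *\<^sub>R a [X, Y]" "a [X, tscale r Y] = r *\<^sub>R a [X, Y]" "a [X, X] = 0"
proof -
  have L: "length [U, V] = 2 \<and> set [U, V] \<subseteq> T" if "U \<in> T" "V \<in> T" for U V using that by simp
  note D = assms(1)[unfolded alternating_on_def, THEN spec, THEN mp, OF L]
  show "X' \<in> T \<Longrightarrow> a [tadd X X', Y] = a [X, Y] + a [X', Y]"
    using D[OF assms(2,3), THEN conjunct1, THEN spec, of 0] by simp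
  show "Y' \<in> T \<Longrightarrow> a [X, tadd Y Y'] = a [X, Y] + a [X, Y']"
    using D[OF assms(2,3), THEN conjunct1, THEN spec, of 1] by simp
  show "a [tscale r X, Y] = r *\<^sub>R a [X, Y]"
    using D[OF assms(2,3), THEN conjunct2, THEN conjunct1, THEN spec, of 0] by simp
  show "a [X, tscale r Y] = r *\<^sub>R a [X, Y]"
    using D[OF assms(2,3), THEN conjunct2, THEN conjunct1, THEN spec, of 1] by simp
  show "a [X, X] = 0"
    using D[OF assms(2,2), THEN conjunct2, THEN conjunct2, THEN spec, of 0] by (auto dest: spec[of _ 1])
qed

text \<open>Linearity in the first slot travels to the others through the two antisymmetries of
  adjacent slots, which over the reals also force vanishing on repeated arguments.\<close>

lemma alternating_on_3I:
  assumes "\<And>X Y Z. X \<in> T \<Longrightarrow> Y \<in> T \<Longrightarrow> Z \<in> T \<Longrightarrow> a [X, Y, Z] = G X Y Z"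
    and T: "\<And>X Y. X \<in> T \<Longrightarrow> Y \<in> T \<Longrightarrow> tadd X Y \<in> T" "\<And>X r. X \<in> T \<Longrightarrow> tscale r X \<in> T"
    and add: "\<And>X X' Y Z. X \<in> T \<Longrightarrow> X' \<in> T \<Longrightarrow> Y \<in> T \<Longrightarrow> Z \<in> T \<Longrightarrow> G (tadd X X') Y Z = G X Y Z + G X' Y Z"
    and scale: "\<And>X Y Z r. X \<in> T \<Longrightarrow> Y \<in> T \<Longrightarrow> Z \<in> T \<Longrightarrow> G (tscale r X) Y Z = r *\<^sub>R G X Y Z"
    and anti: "\<And>X Y Z. X \<in> T \<Longrightarrow> Y \<in> T \<Longrightarrow> Z \<in> T \<Longrightarrow> G Y X Z = - G X Y Z" "\<And>X Y Z. X \<in> T \<Longrightarrow> Y \<in> T \<Longrightarrow> Z \<in> T \<Longrightarrow> G X Z Y = - G X Y Z"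
  shows "alternating_on T 3 (a :: _ \<Rightarrow> real)"
  unfolding alternating_on_def
proof (intro allI impI)
  fix Xs assume "length Xs = 3 \<and> set Xs \<subseteq> T"
  then obtain X Y Z where Xs: "Xs = [X, Y, Z]" and XYZ: "X \<in> T" "Y \<in> T" "Z \<in> T"
    by (auto simp: numeral_3_eq_3 length_Suc_conv)
  have add2: "G X (tadd Y Y') Z = G X Y Z + G X Y' Z" if "X \<in> T" "Y \<in> T" "Y' \<in> T" "Z \<in> T" for X Y Y' Z
    using add[of Y Y' X Z] anti(1)[of X "tadd Y Y'" Z] anti(1)[of X Y Z] anti(1)[of X Y' Z] that T by simp
  have add3: "G X Y (tadd Z Z') = G X Y Z + G X Y Z'" if "X \<in> T" "Y \<in> T" "Z' \<in> T" "Z \<in> T" for X Y Z Z'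
    using add2[of X Z Z' Y] anti(2)[of X "tadd Z Z'" Y] anti(2)[of X Z Y] anti(2)[of X Z' Y] that T by simp
  have scale2: "G X (tscale r Y) Z = r *\<^sub>R G X Y Z" if "X \<in> T" "Y \<in> T" "Z \<in> T" for X Y Z r
    using scale[of Y X Z r] anti(1)[of X "tscale r Y" Z] anti(1)[of X Y Z] that T by simp
  have scale3: "G X Y (tscale r Z) = r *\<^sub>R G X Y Z" if "X \<in> T" "Y \<in> T" "Z \<in> T" for X Y Z r
    using scale2[of X Z Y r] anti(2)[of X "tscale r Z" Y] anti(2)[of X Z Y] that T by simp
  have z1: "G X X Z = 0" if "X \<in> T" "Z \<in> T" for X Z using anti(1)[of X X Z] that by simp
  have z2: "G X Z Z = 0" if "X \<in> T" "Z \<in> T" for X Z using anti(2)[of X Z Z] that by simp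
  have z3: "G X Z X = 0" if "X \<in> T" "Z \<in> T" for X Z using anti(1)[of X Z X] z2[of Z X] that by simp
  have all3: "(\<forall>i<3. Q i) \<longleftrightarrow> Q 0 \<and> Q 1 \<and> Q 2" for Q :: "nat \<Rightarrow> bool"
    by (auto simp: numeral_3_eq_3 less_Suc_eq numeral_2_eq_2)
  show "(\<forall>i<3. \<forall>Y\<in>T. a (Xs[i := tadd (Xs ! i) Y]) = a Xs + a (Xs[i := Y])) \<and>
       (\<forall>i<3. \<forall>r. a (Xs[i := tscale r (Xs ! i)]) = r *\<^sub>R a Xs) \<and>
       (\<forall>i<3. \<forall>j<3. i \<noteq> j \<and> Xs ! i = Xs ! j \<longrightarrow> a Xs = 0)"
    unfolding Xs all3 using XYZ
    by (auto simp: assms(1) T add add2 add3 scale scale2 scale3 z1 z2 z3)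
qed

lemma alternating_on_antisym:
  assumes "alternating_on T 2 a" "X \<in> T" "Y \<in> T" and T: "tadd X Y \<in> T"
  shows "a [Y, X] = - a [X, Y]"
proof -
  have "0 = a [tadd X Y, tadd X Y]" using alternating_on_2D(5)[OF assms(1) T T] by simp
  also have "\<dots> = a [X, tadd X Y] + a [Y, tadd X Y]" by (rule alternating_on_2D(1)[OF assms(1,2) T assms(3)])
  also have "\<dots> = (a [X, X] + a [X, Y]) + (a [Y, X] + a [Y, Y])"
    by (simp only: alternating_on_2D(2)[OF assms(1,2,2,3)] alternating_on_2D(2)[OF assms(1,3,2,3)])
  also have "\<dots> = a [Y, X] + a [X, Y]"
    by (simp add: alternating_on_2D(5)[OF assms(1,2,2)] alternating_on_2D(5)[OF assms(1,3,3)])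
  finally show ?thesis by (simp only: eq_neg_iff_add_eq_0)
qed

lemma form_component_2:
  assumes A: "oriented_atlas A" and c: "c \<in> A" "x \<in> snd c ` fst c" and \<beta>: "is_form A 2 \<beta>"
  shows "form_component A c \<beta> [u + u', v] x = form_component A c \<beta> [u, v] x + form_component A c \<beta> [u', v] x"
    "form_component A c \<beta> [u, v + v'] x = form_component A c \<beta> [u, v] x + form_component A c \<beta> [u, v'] x"
    "form_component A c \<beta> [r *\<^sub>R u, v] x = r *\<^sub>R form_component A c \<beta> [u, v] x"
    "form_component A c \<beta> [u, r *\<^sub>R v] x = r *\<^sub>R form_component A c \<beta> [u, v] x"
    "form_component A c \<beta> [v, u] x = - form_component A c \<beta> [u, v] x"
proof -
  have p: "chart_inv c x \<in> fst c" by (rule chart_inv_in[OF A c])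
  note t = coord_vec_in_tangent[OF c(1) p]
  have al: "alternating_on (tangent A (chart_inv c x)) 2 (\<beta> (chart_inv c x))" using \<beta> by (simp add: is_form_def)
  note a = alternating_on_2D[OF al t t]
  show "form_component A c \<beta> [u + u', v] x = form_component A c \<beta> [u, v] x + form_component A c \<beta> [u', v] x"
    "form_component A c \<beta> [u, v + v'] x = form_component A c \<beta> [u, v] x + form_component A c \<beta> [u, v'] x"
    "form_component A c \<beta> [r *\<^sub>R u, v] x = r *\<^sub>R form_component A c \<beta> [u, v] x"
    "form_component A c \<beta> [u, r *\<^sub>R v] x = r *\<^sub>R form_component A c \<beta> [u, v] x"
    by (simp_all add: form_component_def coord_vec_linear[OF A c(1) p, symmetric] a t)
  show "form_component A c \<beta> [v, u] x = - form_component A c \<beta> [u, v] x"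
    using alternating_on_antisym[OF al t[of u] t[of v] tangent_linear(1)[OF A t t]] by (simp add: form_component_def)
qed

lemma form_component_smooth: "is_form A k \<beta> \<Longrightarrow> c \<in> A \<Longrightarrow> length us = k \<Longrightarrow> smooth_on (snd c ` fst c) (form_component A c \<beta> us)"
  by (simp add: is_form_def)

lemma frechet_form_component_2:
  assumes A: "oriented_atlas A" and c: "c \<in> A" "x \<in> snd c ` fst c" and \<beta>: "is_form A 2 \<beta>"
  shows "frechet_derivative (form_component A c \<beta> [u + u', v]) (at x) t =
      frechet_derivative (form_component A c \<beta> [u, v]) (at x) t + frechet_derivative (form_component A c \<beta> [u', v]) (at x) t"
    "frechet_derivative (form_component A c \<beta> [r *\<^sub>R u, v]) (at x) t = r *\<^sub>R frechet_derivative (form_component A c \<beta> [u, v]) (at x) t"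
    "frechet_derivative (form_component A c \<beta> [v, u]) (at x) t = - frechet_derivative (form_component A c \<beta> [u, v]) (at x) t"
proof -
  note f = form_component_2[OF A c(1) _ \<beta>]
  note o = chart_open_image[OF A c(1)]
  have d: "(form_component A c \<beta> [u, v] has_derivative frechet_derivative (form_component A c \<beta> [u, v]) (at x)) (at x)" for u v
    by (rule smooth_on_has_derivative[OF form_component_smooth[OF \<beta> c(1)] c(2)]) simp
  have 1: "(form_component A c \<beta> [u + u', v] has_derivative (\<lambda>t. frechet_derivative (form_component A c \<beta> [u, v]) (at x) t
      + frechet_derivative (form_component A c \<beta> [u', v]) (at x) t)) (at x)"
    by (rule has_derivative_transform_within_open[OF has_derivative_add[OF d d] o c(2)]) (simp only: f(1))
  have 2: "(form_component A c \<beta> [r *\<^sub>R u, v] has_derivative (\<lambda>t. r *\<^sub>R frechet_derivative (form_component A c \<beta> [u, v]) (at x) t)) (at x)"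
    by (rule has_derivative_transform_within_open[OF has_derivative_scaleR_right[OF d] o c(2)]) (simp only: f(3))
  have 3: "(form_component A c \<beta> [v, u] has_derivative (\<lambda>t. - frechet_derivative (form_component A c \<beta> [u, v]) (at x) t)) (at x)"
    by (rule has_derivative_transform_within_open[OF has_derivative_minus[OF d] o c(2)]) (simp only: f(5)[of _ v u])
  show "frechet_derivative (form_component A c \<beta> [u + u', v]) (at x) t =
      frechet_derivative (form_component A c \<beta> [u, v]) (at x) t + frechet_derivative (form_component A c \<beta> [u', v]) (at x) t"
    "frechet_derivative (form_component A c \<beta> [r *\<^sub>R u, v]) (at x) t = r *\<^sub>R frechet_derivative (form_component A c \<beta> [u, v]) (at x) t"
    "frechet_derivative (form_component A c \<beta> [v, u]) (at x) t = - frechet_derivative (form_component A c \<beta> [u, v]) (at x) t"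
    using fun_cong[OF frechet_derivative_at[OF 1], of t] fun_cong[OF frechet_derivative_at[OF 2], of t] fun_cong[OF frechet_derivative_at[OF 3], of t]
    by auto
qed

lemma alternating_on_extd_2:
  assumes A: "oriented_atlas A" and \<beta>: "is_form A 2 (\<beta> :: (_, real) form)"
  shows "alternating_on (tangent A p) 3 (extd A \<beta> p)"
proof -
  define c where "c = some_chart A p"
  have c: "c \<in> A" "p \<in> fst c" using some_chart_in[OF A] by (auto simp: c_def)
  have x: "snd c p \<in> snd c ` fst c" using c by blast
  note f = frechet_form_component_2[OF A c(1) x \<beta>]
  have lin: "form_component A c \<beta> [u, v] differentiable (at (snd c p))" for u v
    by (rule smooth_on_imp_differentiable[OF form_component_smooth[OF \<beta> c(1)] x]) simp
  define D where "D U V = frechet_derivative (form_component A c \<beta> [coords c U, coords c V]) (at (snd c p))" for U V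
  have anti: "D V U t = - D U V t" for U V t unfolding D_def by (rule f(3))
  note Dl = frechet_derivative_linear_simps[OF lin, folded D_def]
  show ?thesis
  proof (rule alternating_on_3I[of _ _ "\<lambda>X Y Z. D Y Z (coords c X) - D X Z (coords c Y) + D X Y (coords c Z)"])
    fix X Y Z assume XYZ: "X \<in> tangent A p" "Y \<in> tangent A p" "Z \<in> tangent A p"
    show "extd A \<beta> p [X, Y, Z] = D Y Z (coords c X) - D X Z (coords c Y) + D X Y (coords c Z)"
      by (simp add: extd_2 Let_def c_def[symmetric] D_def)
    show "D X Z (coords c Y) - D Y Z (coords c X) + D Y X (coords c Z) = - (D Y Z (coords c X) - D X Z (coords c Y) + D X Y (coords c Z))"
      using anti[of Y X] by simp
    show "D Z Y (coords c X) - D X Y (coords c Z) + D X Z (coords c Y) = - (D Y Z (coords c X) - D X Z (coords c Y) + D X Y (coords c Z))"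
      using anti[of Z Y] by simp
    show "D Y Z (coords c (tscale r X)) - D (tscale r X) Z (coords c Y) + D (tscale r X) Y (coords c Z) =
       r *\<^sub>R (D Y Z (coords c X) - D X Z (coords c Y) + D X Y (coords c Z))" for r
      unfolding coords_linear(2)[OF A c XYZ(1,1)] Dl D_def coords_linear(2)[OF A c XYZ(1,1)] f(2)
      by (simp add: frechet_derivative_linear_simps[OF lin] algebra_simps)
    fix X' assume X': "X' \<in> tangent A p"
    show "D Y Z (coords c (tadd X X')) - D (tadd X X') Z (coords c Y) + D (tadd X X') Y (coords c Z) =
       (D Y Z (coords c X) - D X Z (coords c Y) + D X Y (coords c Z)) + (D Y Z (coords c X') - D X' Z (coords c Y) + D X' Y (coords c Z))"
      unfolding D_def coords_linear(1)[OF A c XYZ(1) X'] f(1)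
      by (simp add: frechet_derivative_linear_simps[OF lin])
  qed (simp_all add: tangent_linear[OF A])
qed

text \<open>The second derivatives of the transition map cancel because they are symmetric and \<open>\<beta>\<close> is alternating.\<close>

lemma extd_2_chart:
  fixes A :: "('m::{t2_space,second_countable_topology}, 'n::finite) chart set" and \<beta> :: "('m, real) form"
  assumes A: "oriented_atlas A" and \<beta>: "is_form A 2 \<beta>" and c: "c \<in> A" "p \<in> fst c"
  shows "extd A \<beta> p [coord_vec A c p u0, coord_vec A c p u1, coord_vec A c p u2] =
     frechet_derivative (form_component A c \<beta> [u1, u2]) (at (snd c p)) u0
     - frechet_derivative (form_component A c \<beta> [u0, u2]) (at (snd c p)) u1
     + frechet_derivative (form_component A c \<beta> [u0, u1]) (at (snd c p)) u2"
proof -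
  define d where "d = some_chart A p"
  have d: "d \<in> A" "p \<in> fst d" using some_chart_in[OF A] by (auto simp: d_def)
  define N where "N = snd c ` (fst c \<inter> fst d)"
  define x where "x = snd c p"
  define \<psi> where "\<psi> = snd d \<circ> chart_inv c"
  have N: "open N" "x \<in> N" unfolding N_def x_def
    using chart_image_open[OF A c(1) chart_open_dom[OF A d(1)]] c d by auto
  have \<psi>: "smooth_on N \<psi>" using A c(1) d(1) by (auto simp: oriented_atlas_def N_def \<psi>_def)
  have \<psi>x: "\<psi> x = snd d p" using chart_inv_left[OF A c] by (simp add: \<psi>_def x_def)
  define T where "T = snd d ` fst d"
  have T: "open T" unfolding T_def by (rule chart_open_image[OF A d(1)])
  have sub: "\<psi> ` N \<subseteq> T" using chart_inv_left[OF A c(1)] by (auto simp: N_def T_def \<psi>_def)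
  define B where "B z u v = form_component A d \<beta> [u, v] z" for z u v
  have B: "smooth_on T (\<lambda>z. B z u v)" for u v
    unfolding B_def T_def using form_component_smooth[OF \<beta> d(1), of "[u, v]"] by simp
  note f2 = form_component_2[OF A d(1) _ \<beta>, folded T_def B_def]
  have lin1: "linear (\<lambda>u. B z u v)" if "z \<in> T" for z v
    by (rule linearI; simp only: f2(1,3)[OF that])
  have lin2: "linear (B z u)" if "z \<in> T" for z u
    by (rule linearI; simp only: f2(2,4)[OF that])
  define q where "q u y = frechet_derivative \<psi> (at y) u" for u y
  have q: "smooth_on N (q u)" for u unfolding q_def[abs_def] by (rule smooth_on_frechet[OF \<psi>])
  define D2 where "D2 u t = frechet_derivative (q u) (at x) t" for u t
  have sym: "D2 u t = D2 t u" for u t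
    unfolding D2_def q_def[abs_def] by (rule frechet_derivative_commute[OF N \<psi>])
  have comp: "form_component A c \<beta> [u, v] y = B (\<psi> y) (q u y) (q v y)" if y: "y \<in> N" for u v y
  proof -
    have yc: "y \<in> snd c ` fst c" and yd: "chart_inv c y \<in> fst d" using y chart_inv_left[OF A c(1)] by (auto simp: N_def)
    have "coord_vec A c (chart_inv c y) u = coord_vec A d (chart_inv c y) (q u y)" for u
      unfolding coord_vec_eq_pvec'[OF A c(1) yc] pvec_coord[OF A smooth_param_chart[OF A c(1)] yc d(1) yd] by (simp add: q_def \<psi>_def)
    then show ?thesis using chart_inv_left[OF A d(1) yd] by (simp add: form_component_def B_def \<psi>_def)
  qed
  have der: "frechet_derivative (form_component A c \<beta> [u, v]) (at x) t =
     frechet_derivative (\<lambda>z. B z (q u x) (q v x)) (at (snd d p)) (q t x) + B (snd d p) (D2 u t) (q v x) + B (snd d p) (q u x) (D2 v t)" for u v t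
  proof -
    have g: "smooth_on N (\<lambda>y. B (\<psi> y) (q u y) w)" for w
      by (rule deriv_linear_family(1)[OF N(1) B lin1 \<psi> sub q])
    have g': "frechet_derivative (\<lambda>y. B (\<psi> y) (q u y) w) (at x) t =
       frechet_derivative (\<lambda>z. B z (q u x) w) (at (\<psi> x)) (q t x) + B (\<psi> x) (D2 u t) w" for w
      unfolding D2_def q_def[of t] by (rule deriv_linear_family(2)[OF N(1) B lin1 \<psi> sub q T N(2)])
    have gl: "linear (B (\<psi> y) (q u y))" if "y \<in> N" for y using lin2 sub that by blast
    have "frechet_derivative (\<lambda>y. B (\<psi> y) (q u y) (q v y)) (at x) t =
       frechet_derivative (\<lambda>y. B (\<psi> y) (q u y) (q v x)) (at x) t + B (\<psi> x) (q u x) (D2 v t)"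
      using deriv_linear_family(2)[where \<psi> = "\<lambda>x. x" and T = N, OF N(1) g gl smooth_on_ident _ q N(1) N(2), of v t]
      by (simp add: D2_def)
    moreover have "frechet_derivative (form_component A c \<beta> [u, v]) (at x) = frechet_derivative (\<lambda>y. B (\<psi> y) (q u y) (q v y)) (at x)"
      by (rule frechet_derivative_cong_open[OF N comp])
    ultimately show ?thesis by (simp add: g' \<psi>x)
  qed
  have cv: "coords d (coord_vec A c p u) = q u x" for u
  proof -
    have "coord_vec A c p u = coord_vec A d p (q u x)"
      using pvec_coord[OF A smooth_param_chart[OF A c(1)], of x d] c d chart_inv_left[OF A c] coord_vec_eq_pvec[OF A c]
      by (simp add: q_def \<psi>_def x_def)
    then show ?thesis using coords_coord_vec[OF A d] by simp
  qed
  have zT: "snd d p \<in> T" using d by (auto simp: T_def)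
  have "B (snd d p) (q u1 x) (D2 u2 u0) = - B (snd d p) (D2 u0 u2) (q u1 x)"
    using f2(5)[OF zT, of "D2 u0 u2" "q u1 x"] sym[of u0 u2] by simp
  then show ?thesis
    using der[of u1 u2 u0] der[of u0 u2 u1] der[of u0 u1 u2] sym[of u1 u0] sym[of u1 u2]
    unfolding extd_2 Let_def d_def[symmetric] cv x_def[symmetric] by (simp add: B_def[abs_def])
qed

section \<open>Proportionality of top-degree forms on M\<close>

lemma span_axis3: "\<exists>c. v = (\<Sum>i<3. c i *\<^sub>R [axis 1 1, axis 2 1, axis 3 (1::real)] ! i)" for v :: "real ^ 3"
  by (rule exI[of _ "\<lambda>i. [v $ 1, v $ 2, v $ 3] ! i"])
     (simp add: vec_eq_iff forall_3 axis_def numeral_3_eq_3 lessThan_Suc)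

text \<open>Cross-multiplied, so that it serves both to identify v with an oriented volume form and
  to turn \<rho> into a genuine quotient.\<close>

lemma top_form_proportional_3:
  fixes A :: "('m::{t2_space,second_countable_topology}, 3) chart set" and a v :: "'m tvec list \<Rightarrow> real"
  assumes A: "oriented_atlas A" and c: "c \<in> A" "p \<in> fst c"
    and a: "alternating_on (tangent A p) 3 a" and v: "alternating_on (tangent A p) 3 v"
    and Xs: "length Xs = 3" "set Xs \<subseteq> tangent A p"
  shows "a Xs * v (map (coord_vec A c p) std_basis) = a (map (coord_vec A c p) std_basis) * v Xs"
proof -
  have "map (coord_vec A c p) (map (coords c) Xs) = Xs"
    unfolding map_map by (rule map_idI) (use Xs(2) coord_vec_coords[OF A c] in auto)
  then show ?thesis
    using multi_alt_proportional[OF multi_alt_of_alternating[OF A c a] multi_alt_of_alternating[OF A c v], of "[axis 1 1, axis 2 1, axis 3 1]" "map (coords c) Xs"]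
      span_axis3 Xs(1) by (simp add: std_basis_3)
qed

subsection \<open>The deformed Chern-Simons form\<close>

lemma mwedge_1_2: "mwedge 1 2 \<alpha> \<beta> p [X, Y, Z] = (1 / 2) *\<^sub>R (\<alpha> p [X] ** \<beta> p [Y, Z] - \<alpha> p [X] ** \<beta> p [Z, Y]
   - \<alpha> p [Y] ** \<beta> p [X, Z] + \<alpha> p [Y] ** \<beta> p [Z, X] + \<alpha> p [Z] ** \<beta> p [X, Y] - \<alpha> p [Z] ** \<beta> p [Y, X])"
  unfolding wedge_def by (rule alt_wedge_1_2)

lemma mwedge_2_1: "mwedge 2 1 \<alpha> \<beta> p [X, Y, Z] = (1 / 2) *\<^sub>R (\<alpha> p [X, Y] ** \<beta> p [Z] - \<alpha> p [Y, X] ** \<beta> p [Z]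
   - \<alpha> p [X, Z] ** \<beta> p [Y] + \<alpha> p [Z, X] ** \<beta> p [Y] + \<alpha> p [Y, Z] ** \<beta> p [X] - \<alpha> p [Z, Y] ** \<beta> p [X])"
  unfolding wedge_def by (rule alt_wedge_2_1)

lemma Re_trace_linear:
  "Re (trace (A + B)) = Re (trace A) + Re (trace (B :: cmat))" "Re (trace (A - B)) = Re (trace A) - Re (trace B)"
  "Re (trace (r *\<^sub>R A)) = r * Re (trace A)"
  by (simp_all add: trace_def sum_2 algebra_simps)

lemma sum_lt_6: "(\<Sum>i<6. f i) = f 0 + f 1 + f 2 + f 3 + f 4 + f (5::nat)"
  by (simp add: eval_nat_numeral)

lemma covectorD:
  assumes "covector A p \<alpha>" "X \<in> tangent A p"
  shows "Y \<in> tangent A p \<Longrightarrow> \<alpha> (tadd X Y) = \<alpha> X + \<alpha> Y" "\<alpha> (tscale r X) = r * \<alpha> X"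
  using assms unfolding covector_def by blast+

context connection_frame
begin

text \<open>The constant -3/2 is the one compensated by -2/3 in
  \<open>orientation_compatible\<close>: the oriented volume form pulls back to the plain triple
  product of e.\<close>

lemma cubic_trace:
  assumes "X \<in> tangent AP p" "Y \<in> tangent AP p" "Z \<in> tangent AP p"
  shows "form_tr (mwedge 2 1 (mwedge 1 1 E E) E) p [X, Y, Z] = - (3 / 2) * tr3 (e p X) (e p Y) (e p Z)"
    "form_tr (mwedge 2 1 (mwedge 1 1 W W) W) p [X, Y, Z] = - (3 / 2) * tr3 (w p X) (w p Y) (w p Z)"
  unfolding form_tr_def mwedge_2_1 mwedge_1_1 W_eq[OF assms(1)] W_eq[OF assms(2)] W_eq[OF assms(3)]
    E_eq[OF assms(1)] E_eq[OF assms(2)] E_eq[OF assms(3)] su2_of_vec_commutator Re_trace_linear trace_su2_of_vec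
  by (simp_all add: inner_vec_def sum_3 cross_components tr3_components) (simp_all add: field_simps)

end

context cs_frame
begin

lemma chern_simons_eq:
  assumes "X \<in> tangent AP p" "Y \<in> tangent AP p" "Z \<in> tangent AP p"
  shows "chern_simons AP W p [X, Y, Z] = normal_form 0 (w p) (e p) [X, Y, Z]"
proof -
  have 1: "form_tr (mwedge 1 2 W (extd AP W)) p [X, Y, Z] =
     - (w p X \<bullet> dw p Y Z - w p Y \<bullet> dw p X Z + w p Z \<bullet> dw p X Y) / 2"
    unfolding form_tr_def mwedge_1_2 Re_trace_linear W_eq[OF assms(1)] W_eq[OF assms(2)] W_eq[OF assms(3)]
      extd_W[OF assms(1,2)] extd_W[OF assms(2,1)] extd_W[OF assms(1,3)] extd_W[OF assms(3,1)] extd_W[OF assms(2,3)] extd_W[OF assms(3,2)]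
      trace_su2_of_vec dw_eq[OF assms(1,2)] dw_eq[OF assms(2,1)] dw_eq[OF assms(1,3)] dw_eq[OF assms(3,1)] dw_eq[OF assms(2,3)] dw_eq[OF assms(3,2)]
    by (simp add: inner_vec_def sum_3 cross_components) (simp add: field_simps)
  have "chern_simons AP W p [X, Y, Z] = form_tr (mwedge 1 2 W (extd AP W)) p [X, Y, Z]
     + 2 / 3 * form_tr (mwedge 2 1 (mwedge 1 1 W W) W) p [X, Y, Z]"
    by (simp add: chern_simons_def form_tr_def fadd_def fscale_def Re_trace_linear)
  then show ?thesis
    unfolding 1 cubic_trace(2)[OF assms] dw_eq[OF assms(1,2)] dw_eq[OF assms(1,3)] dw_eq[OF assms(2,3)]
    by (simp add: normal_form_def inner_vec_def sum_3 cross_components tr3_components) (simp add: field_simps)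
qed

end

text \<open>The Gram matrix is the frame matrix times its transpose, so its determinant is a
  square.\<close>

lemma gram_det_3: "det (\<chi> i j. y i \<bullet> y j :: real ^ 3 ^ 3) = (tr3 (y 1) (y 2) (y 3))\<^sup>2"
  by (simp add: det_3 inner_vec_def sum_3 tr3_components power2_eq_square) algebra

locale deformed_cs = cs_frame AM AP pr act W E
  for AM :: "('m::{t2_space,second_countable_topology}, 3) chart set"
    and AP :: "('p::{t2_space,second_countable_topology}, 6) chart set"
    and pr act W E +
  fixes v0 \<Omega> :: "('p, real) form" and g\<^sub>E :: "'m \<Rightarrow> 'm tvec \<Rightarrow> 'm tvec \<Rightarrow> real"
    and v \<omega> b :: "('m, real) form" and \<rho> :: "'m \<Rightarrow> real"
  assumes v0: "positive_volume_form AP v0"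
    and orient: "orientation_compatible AM AP pr E"
    and g\<^sub>E: "metric_of_frame AM AP pr E g\<^sub>E"
    and v: "volume_form_of AM g\<^sub>E v"
    and \<omega>: "is_form AM 3 \<omega>" and b: "is_form AM 2 b"
    and \<Omega>_def: "\<Omega> = fadd (chern_simons AP W) (pullback AM pr (fadd \<omega> (extd AM b)))"
    and \<rho>_def: "\<rho> = (\<lambda>x. top_ratio AM x (fadd \<omega> (extd AM b) x) (v x))"
    and \<Omega>_stable: "stable_negative AP v0 \<Omega>"
begin

lemma v_alternating: "alternating_on (tangent AM x) 3 (v x)"
  using v by (simp add: volume_form_of_def is_form_def)

lemma push_tangent_pr: "X \<in> tangent AP p \<Longrightarrow> push AM pr p X \<in> tangent AM (pr p)"
  by (rule push_tangent[OF P M smooth_pr])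

lemma g\<^sub>E_push: "X \<in> tangent AP p \<Longrightarrow> Y \<in> tangent AP p \<Longrightarrow> g\<^sub>E (pr p) (push AM pr p X) (push AM pr p Y) = e p X \<bullet> e p Y"
  using g\<^sub>E by (simp add: metric_of_frame_def E_eq su2_inner_of_vec)

lemma pr_surj: "\<exists>p. pr p = x"
proof -
  obtain U \<gamma> where U: "x \<in> U" "local_trivialisation AM AP pr act U \<gamma>"
    using pbundle unfolding principal_SU2_bundle_def by blast
  then have "bij_betw (\<lambda>p. (pr p, \<gamma> p)) (pr -` U) (Sigma U (\<lambda>_. SU2))" by (simp add: local_trivialisation_def)
  moreover have "(x, mat 1) \<in> Sigma U (\<lambda>_. SU2)" using U(1) SU2_one by simp
  ultimately obtain p where "(pr p, \<gamma> p) = (x, mat 1)" unfolding bij_betw_def by (metis (no_types, lifting) imageE)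
  then show ?thesis by auto
qed

text \<open>The root in \<open>volume_form_of\<close> produces the absolute value of the triple
  product of e on lifted coordinate vectors. The positive form \<mu> supplied by
  \<open>orient\<close> takes the triple product itself there, so its positivity removes the
  absolute value and v = \<mu>.\<close>

lemma volume_pos: "c \<in> AM \<Longrightarrow> x \<in> fst c \<Longrightarrow> v x (map (coord_vec AM c x) std_basis) > 0"
  and volume_eq: "X \<in> tangent AP p \<Longrightarrow> Y \<in> tangent AP p \<Longrightarrow> Z \<in> tangent AP p \<Longrightarrow>
    v (pr p) [push AM pr p X, push AM pr p Y, push AM pr p Z] = tr3 (e p X) (e p Y) (e p Z)"
proof -
  obtain \<mu> where \<mu>: "positive_volume_form AM \<mu>"
    "form_eq AP 3 (pullback AM pr \<mu>) (fscale (\<lambda>p. - (2 / 3)) (form_tr (mwedge 2 1 (mwedge 1 1 E E) E)))"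
    using orient by (auto simp: orientation_compatible_def)
  have \<mu>alt: "alternating_on (tangent AM x) 3 (\<mu> x)" for x
    using \<mu>(1) by (simp add: positive_volume_form_def is_form_def)
  have pull: "\<mu> (pr p) [push AM pr p X, push AM pr p Y, push AM pr p Z] = tr3 (e p X) (e p Y) (e p Z)"
    if "X \<in> tangent AP p" "Y \<in> tangent AP p" "Z \<in> tangent AP p" for p X Y Z
  proof -
    have "pullback AM pr \<mu> p [X, Y, Z] = fscale (\<lambda>p. - (2 / 3)) (form_tr (mwedge 2 1 (mwedge 1 1 E E) E)) p [X, Y, Z]"
      using \<mu>(2) that by (simp add: form_eq_def)
    then show ?thesis unfolding fscale_def cubic_trace(1)[OF that] by (simp add: pullback_def)
  qed
  have eq: "v x (map (coord_vec AM c x) std_basis) = \<mu> x (map (coord_vec AM c x) std_basis) \<and> \<mu> x (map (coord_vec AM c x) std_basis) > 0"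
    if c: "c \<in> AM" "x \<in> fst c" for c x
  proof -
    obtain p where p: "pr p = x" using pr_surj by blast
    have "\<exists>Y. Y \<in> tangent AP p \<and> push AM pr p Y = coord_vec AM c x (axis i 1)" for i :: 3
      using push_surj[of "coord_vec AM c x (axis i 1)" p] coord_vec_in_tangent[OF c] unfolding p by metis
    then obtain Y where Y: "\<And>i. Y i \<in> tangent AP p" "\<And>i. push AM pr p (Y i) = coord_vec AM c x (axis i 1)" by metis
    have \<mu>Y: "\<mu> x (map (coord_vec AM c x) std_basis) = tr3 (e p (Y 1)) (e p (Y 2)) (e p (Y 3))"
      using pull[OF Y(1) Y(1) Y(1), of 1 2 3] unfolding p by (simp add: Y(2) std_basis_3)
    have pos: "\<mu> x (map (coord_vec AM c x) std_basis) > 0"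
      using \<mu>(1) c by (simp add: positive_volume_form_def)
    have "metric_matrix AM g\<^sub>E c (snd c x) = (\<chi> i j. e p (Y i) \<bullet> e p (Y j))"
      using g\<^sub>E_push[OF Y(1) Y(1)] unfolding p by (simp add: metric_matrix_def Let_def chart_inv_left[OF M c] Y(2) vec_eq_iff)
    then have "v x (map (coord_vec AM c x) std_basis) = sqrt ((tr3 (e p (Y 1)) (e p (Y 2)) (e p (Y 3)))\<^sup>2)"
      using v c by (simp add: volume_form_of_def gram_det_3[of "\<lambda>i. e p (Y i)"])
    then show ?thesis using pos \<mu>Y by simp
  qed
  then show "c \<in> AM \<Longrightarrow> x \<in> fst c \<Longrightarrow> v x (map (coord_vec AM c x) std_basis) > 0" by simp
  assume X: "X \<in> tangent AP p" "Y \<in> tangent AP p" "Z \<in> tangent AP p"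
  obtain c where c: "c \<in> AM" "pr p \<in> fst c" using chart_at[OF M] by blast
  have "v (pr p) [push AM pr p X, push AM pr p Y, push AM pr p Z] = \<mu> (pr p) [push AM pr p X, push AM pr p Y, push AM pr p Z]"
    using top_form_proportional_3[OF M c v_alternating \<mu>alt, of "[push AM pr p X, push AM pr p Y, push AM pr p Z]"]
      push_tangent_pr X eq[OF c] by simp
  then show "v (pr p) [push AM pr p X, push AM pr p Y, push AM pr p Z] = tr3 (e p X) (e p Y) (e p Z)"
    using pull[OF X] by simp
qed

lemma \<eta>_alternating: "alternating_on (tangent AM x) 3 (fadd \<omega> (extd AM b) x)"
proof -
  have "alternating_on (tangent AM x) 3 (\<omega> x)" using \<omega> by (simp add: is_form_def)
  moreover have "alternating_on (tangent AM x) 3 (extd AM b x)" by (rule alternating_on_extd_2[OF M b])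
  ultimately show ?thesis unfolding alternating_on_def fadd_def by (simp add: algebra_simps)
qed

text \<open>Existence of the quotient is proportionality of top forms; uniqueness holds because v is
  nonzero on a coordinate basis.\<close>

lemma \<rho>_ratio:
  assumes c: "c \<in> AM" "x \<in> fst c"
  shows "\<rho> x = fadd \<omega> (extd AM b) x (map (coord_vec AM c x) std_basis) / v x (map (coord_vec AM c x) std_basis)"
    and "length Xs = 3 \<Longrightarrow> set Xs \<subseteq> tangent AM x \<Longrightarrow> fadd \<omega> (extd AM b) x Xs = \<rho> x * v x Xs"
proof -
  let ?B = "map (coord_vec AM c x) std_basis"
  have B: "length ?B = CARD(3)" "set ?B \<subseteq> tangent AM x"
    using coord_vec_in_tangent[OF c] by (auto simp: std_basis_3)
  have v0: "v x ?B \<noteq> 0" using volume_pos[OF c] by simp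
  have prp: "fadd \<omega> (extd AM b) x Xs = fadd \<omega> (extd AM b) x ?B / v x ?B * v x Xs"
    if "length Xs = 3" "set Xs \<subseteq> tangent AM x" for Xs
    using top_form_proportional_3[OF M c \<eta>_alternating v_alternating that] v0 by (simp add: field_simps)
  show "\<rho> x = fadd \<omega> (extd AM b) x ?B / v x ?B"
    unfolding \<rho>_def top_ratio_def
  proof (rule the_equality)
    show "\<forall>Xs. length Xs = CARD(3) \<and> set Xs \<subseteq> tangent AM x \<longrightarrow> fadd \<omega> (extd AM b) x Xs = fadd \<omega> (extd AM b) x ?B / v x ?B * v x Xs"
      using prp by simp
    fix r assume "\<forall>Xs. length Xs = CARD(3) \<and> set Xs \<subseteq> tangent AM x \<longrightarrow> fadd \<omega> (extd AM b) x Xs = r * v x Xs"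
    then have "fadd \<omega> (extd AM b) x ?B = r * v x ?B" using B by blast
    then show "r = fadd \<omega> (extd AM b) x ?B / v x ?B" using v0 by (simp add: field_simps)
  qed
  then show "length Xs = 3 \<Longrightarrow> set Xs \<subseteq> tangent AM x \<Longrightarrow> fadd \<omega> (extd AM b) x Xs = \<rho> x * v x Xs"
    using prp by simp
qed

text \<open>The exterior derivative of b must be read in one chart throughout a neighbourhood,
  although \<open>extd\<close> uses \<open>some_chart\<close> at each point;
  \<open>extd_2_chart\<close> permits this, and \<rho> becomes a quotient of smooth
  components.\<close>

lemma \<rho>_smooth:
  assumes c: "c \<in> AM"
  shows "smooth_on (snd c ` fst c) (\<rho> \<circ> chart_inv c)"
proof -
  let ?S = "snd c ` fst c"
  let ?b = "[axis 1 1, axis 2 1, axis 3 1] :: (real ^ 3) list"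
  let ?D = "\<lambda>u v t x. frechet_derivative (form_component AM c b [u, v]) (at x) t"
  have S: "open ?S" by (rule chart_open_image[OF M c])
  have "smooth_on ?S (\<lambda>x. (form_component AM c \<omega> ?b x + (?D (axis 2 1) (axis 3 1) (axis 1 1) x - ?D (axis 1 1) (axis 3 1) (axis 2 1) x
      + ?D (axis 1 1) (axis 2 1) (axis 3 1) x)) / form_component AM c v ?b x)"
  proof (intro smooth_on_divide smooth_on_add smooth_on_diff S smooth_on_frechet form_component_smooth[OF b c] form_component_smooth[OF \<omega> c])
    show "smooth_on ?S (form_component AM c v ?b)"
      using v c by (intro form_component_smooth[of _ 3]) (auto simp: volume_form_of_def)
    show "form_component AM c v ?b x \<noteq> 0" if "x \<in> ?S" for x
      using volume_pos[OF c chart_inv_in[OF M c that]] by (simp add: form_component_def std_basis_3)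
  qed simp_all
  then show ?thesis
  proof (rule smooth_on_cong[OF _ S])
    fix x assume x: "x \<in> ?S"
    note p = chart_inv_in[OF M c x] and r = chart_inv_right[OF M c x]
    show "(form_component AM c \<omega> ?b x + (?D (axis 2 1) (axis 3 1) (axis 1 1) x - ?D (axis 1 1) (axis 3 1) (axis 2 1) x
      + ?D (axis 1 1) (axis 2 1) (axis 3 1) x)) / form_component AM c v ?b x = (\<rho> \<circ> chart_inv c) x"
      using \<rho>_ratio(1)[OF c p] extd_2_chart[OF M b c p, of "axis 1 1" "axis 2 1" "axis 3 1", unfolded r]
      by (simp add: fadd_def std_basis_3 form_component_def[of _ _ \<omega>] form_component_def[of _ _ v])
  qed
qed

lemma \<rho>_smooth_at: "smooth_at AM x \<rho>"
  unfolding smooth_at_def smooth_fun_on_def by (rule exI[of _ UNIV]) (simp add: \<rho>_smooth)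

lemma \<Omega>_normal_form:
  assumes X: "X \<in> tangent AP p" "Y \<in> tangent AP p" "Z \<in> tangent AP p"
  shows "\<Omega> p [X, Y, Z] = normal_form (\<rho> (pr p)) (w p) (e p) [X, Y, Z]"
proof -
  obtain c where c: "c \<in> AM" "pr p \<in> fst c" using chart_at[OF M] by blast
  have "pullback AM pr (fadd \<omega> (extd AM b)) p [X, Y, Z] = \<rho> (pr p) * tr3 (e p X) (e p Y) (e p Z)"
    using \<rho>_ratio(2)[OF c, of "[push AM pr p X, push AM pr p Y, push AM pr p Z]"] push_tangent_pr X volume_eq[OF X]
    by (simp add: pullback_def)
  then show ?thesis
    unfolding \<Omega>_def using chern_simons_eq[OF X] by (simp add: fadd_def normal_form_def)
qed

subsection \<open>The almost-complex structure\<close>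

lemma covector_expand:
  assumes \<alpha>: "covector AP p \<alpha>" and X: "X \<in> tangent AP p"
  shows "\<alpha> X = (\<Sum>i<6. [\<alpha> (lift p (axis 1 1) 0), \<alpha> (lift p (axis 2 1) 0), \<alpha> (lift p (axis 3 1) 0),
     \<alpha> (lift p 0 (axis 1 1)), \<alpha> (lift p 0 (axis 2 1)), \<alpha> (lift p 0 (axis 3 1))] ! i * cov (w p) (e p) i X)"
proof -
  have add: "\<alpha> (lift p (a + a') (b' + b'')) = \<alpha> (lift p a b') + \<alpha> (lift p a' b'')" for a a' b' b''
    using \<alpha> lift_props(1) unfolding covector_def lift_linear(1)[symmetric] by blast
  have sc: "\<alpha> (lift p (r *\<^sub>R a) (r *\<^sub>R b')) = r * \<alpha> (lift p a b')" for a b' r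
    using \<alpha> lift_props(1) unfolding covector_def lift_linear(2)[symmetric] by blast
  have ex: "x = x$1 *\<^sub>R axis 1 1 + (x$2 *\<^sub>R axis 2 1 + x$3 *\<^sub>R axis 3 1)" for x :: "real ^ 3"
    by (simp add: vec_eq_iff forall_3 axis_def)
  have h1: "\<alpha> (lift p a 0) = a$1 * \<alpha> (lift p (axis 1 1) 0) + (a$2 * \<alpha> (lift p (axis 2 1) 0) + a$3 * \<alpha> (lift p (axis 3 1) 0))" for a
    using add[of "a$1 *\<^sub>R axis 1 1" "a$2 *\<^sub>R axis 2 1 + a$3 *\<^sub>R axis 3 1" 0 0] add[of "a$2 *\<^sub>R axis 2 1" "a$3 *\<^sub>R axis 3 1" 0 0]
      sc[of "a$1" "axis 1 1" 0] sc[of "a$2" "axis 2 1" 0] sc[of "a$3" "axis 3 1" 0] ex[of a] by simp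
  have h2: "\<alpha> (lift p 0 a) = a$1 * \<alpha> (lift p 0 (axis 1 1)) + (a$2 * \<alpha> (lift p 0 (axis 2 1)) + a$3 * \<alpha> (lift p 0 (axis 3 1)))" for a
    using add[of 0 0 "a$1 *\<^sub>R axis 1 1" "a$2 *\<^sub>R axis 2 1 + a$3 *\<^sub>R axis 3 1"] add[of 0 0 "a$2 *\<^sub>R axis 2 1" "a$3 *\<^sub>R axis 3 1"]
      sc[of "a$1" 0 "axis 1 1"] sc[of "a$2" 0 "axis 2 1"] sc[of "a$3" 0 "axis 3 1"] ex[of a] by simp
  have h3: "\<alpha> X = \<alpha> (lift p (w p X) 0) + \<alpha> (lift p 0 (e p X))"
    using add[of "w p X" 0 0 "e p X"] lift_eqI[OF X refl refl] by simp
  show ?thesis unfolding h3 h1[of "w p X"] h2[of "e p X"] sum_lt_6 by (simp add: cov_def eval_nat_numeral)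
qed

lemma covector_cov: "i < 6 \<Longrightarrow> covector AP p (cov (w p) (e p) i)"
  by (auto simp: covector_def cov_def we_linear less_Suc_eq eval_nat_numeral)

text \<open>The factor between \<open>v\<^sub>0\<close> and \<open>w\<^sup>1 \<and> w\<^sup>2 \<and> w\<^sup>3 \<and> e\<^sup>1 \<and> e\<^sup>2 \<and> e\<^sup>3\<close>.\<close>

definition vol :: "'p \<Rightarrow> real" where
  "vol p = v0 p [lift p (axis 1 1) 0, lift p (axis 2 1) 0, lift p (axis 3 1) 0, lift p 0 (axis 1 1), lift p 0 (axis 2 1), lift p 0 (axis 3 1)]"

end

text \<open>Only the identity permutation contributes on a dual frame.\<close>

lemma ext_prod_dual:
  assumes "length cs = n" "\<And>i j. i < n \<Longrightarrow> j < n \<Longrightarrow> (cs ! i) (Xs ! j) = (if i = j then 1 else 0)"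
  shows "ext_prod cs Xs = 1"
proof -
  have "real_of_int (sign \<sigma>) * (\<Prod>i<n. (cs ! i) (Xs ! \<sigma> i)) = (if \<sigma> = id then 1 else 0)" if s: "\<sigma> permutes {..<n}" for \<sigma>
  proof (cases "\<sigma> = id")
    case True
    then show ?thesis using assms(2) by simp
  next
    case False
    then obtain i where i: "\<sigma> i \<noteq> i" by (auto simp: fun_eq_iff)
    then have "i < n" using permutes_not_in[OF s, of i] by auto
    moreover have "\<sigma> i < n" using permutes_in_image[OF s, of i] \<open>i < n\<close> by simp
    ultimately have "(cs ! i) (Xs ! \<sigma> i) = 0" using assms(2) i by simp
    then have "(\<Prod>i<n. (cs ! i) (Xs ! \<sigma> i)) = 0" using \<open>i < n\<close> by (intro prod_zero) auto
    then show ?thesis using False by simp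
  qed
  then have "ext_prod cs Xs = (\<Sum>\<sigma> | \<sigma> permutes {..<n}. if \<sigma> = id then 1 else 0)"
    unfolding ext_prod_def assms(1) by (intro sum.cong) auto
  also have "\<dots> = 1" by (subst sum.delta) (auto simp: finite_permutations permutes_id)
  finally show ?thesis .
qed

context deformed_cs
begin

text \<open>Both sides are alternating of top degree, and the coframe product is 1 on the dual
  frame, so \<open>vol p\<close> is their ratio. It is nonzero because \<open>v0\<close> is positive
  on a coordinate basis; its sign is left open.\<close>

lemma v0_eq:
  shows "length Xs = 6 \<Longrightarrow> set Xs \<subseteq> tangent AP p \<Longrightarrow> v0 p Xs = vol p * six (cov (w p) (e p)) Xs 0 1 2 3 4 5"
    and "vol p \<noteq> 0"
proof -
  obtain c where c: "c \<in> AP" "p \<in> fst c" using chart_at[OF P] by blast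
  let ?B = "[lift p (axis 1 1) 0, lift p (axis 2 1) 0, lift p (axis 3 1) 0, lift p 0 (axis 1 1), lift p 0 (axis 2 1), lift p 0 (axis 3 1)]"
  let ?cs = "map (cov (w p) (e p)) [0,1,2,3,4,5]"
  have Bt: "set ?B \<subseteq> tangent AP p" using lift_props(1) by auto
  have "alternating_on (tangent AP p) 6 (v0 p)" using v0 by (simp add: positive_volume_form_def is_form_def)
  note m1 = multi_alt_of_alternating[OF P c this]
  have lin: "linear (\<lambda>u. cov (w p) (e p) i (coord_vec AP c p u))" if "i < 6" for i
    using covector_cov[OF that, of p] coord_vec_in_tangent[OF c] by (auto intro!: linearI simp: coord_vec_linear[OF P c, symmetric] covectorD)
  let ?ds = "map (\<lambda>i u. cov (w p) (e p) i (coord_vec AP c p u)) [0,1,2,3,4,5]"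
  have len: "length ?cs = 6" "length ?ds = 6" by simp_all
  have comp: "ext_prod ?cs (map (coord_vec AP c p) us) = ext_prod ?ds us" if "length us = 6" for us
    unfolding ext_prod_def len
  proof (intro sum.cong arg_cong2[of _ _ _ _ "(*)"] prod.cong refl)
    fix \<sigma> i assume s: "\<sigma> \<in> {\<sigma>. \<sigma> permutes {..<6::nat}}" and i: "i \<in> {..<6::nat}"
    then have "\<sigma> i < 6" using permutes_in_image[of \<sigma> "{..<6}" i] by simp
    then have "map (coord_vec AP c p) us ! \<sigma> i = coord_vec AP c p (us ! \<sigma> i)" using that by simp
    moreover have "i = 0 \<or> i = 1 \<or> i = 2 \<or> i = 3 \<or> i = 4 \<or> i = 5" using i by auto
    ultimately show "(?cs ! i) (map (coord_vec AP c p) us ! \<sigma> i) = (?ds ! i) (us ! \<sigma> i)"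
      by (elim disjE) simp_all
  qed
  have m2: "multi_alt 6 (ext_prod (map (\<lambda>i u. cov (w p) (e p) i (coord_vec AP c p u)) [0,1,2,3,4,5]))"
    by (rule multi_alt_ext_prod) (auto intro: lin)
  have six: "six (cov (w p) (e p)) Ys 0 1 2 3 4 5 = ext_prod ?cs Ys" for Ys by (simp add: six_def)
  have dual: "ext_prod ?cs ?B = 1"
    by (rule ext_prod_dual[of _ 6]) (auto simp: less_Suc_eq eval_nat_numeral cov_def lift_props axis_def)
  let ?bs = "map (coords c) ?B"
  have cB: "map (coord_vec AP c p) ?bs = ?B"
    unfolding map_map by (rule map_idI) (use Bt coord_vec_coords[OF P c] in auto)
  \<comment> \<open>The coordinates of the dual frame span: the coefficients of a vector are its six
    coframe values.\<close>
  have sp: "\<exists>k. u = (\<Sum>i<6. k i *\<^sub>R ?bs ! i)" for u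
  proof -
    let ?X = "coord_vec AP c p u"
    let ?k = "\<lambda>i. [w p ?X $ 1, w p ?X $ 2, w p ?X $ 3, e p ?X $ 1, e p ?X $ 2, e p ?X $ 3] ! i"
    let ?s = "\<Sum>i<6. ?k i *\<^sub>R ?bs ! i"
    have t: "coord_vec AP c p ?s = ?X"
    proof (rule we_inject)
      note l = we_chart_linear[OF c]
      have cb: "coord_vec AP c p (coords c (lift p a a')) = lift p a a'" for a a'
        by (rule coord_vec_coords[OF P c lift_props(1)])
      have "w p (coord_vec AP c p ?s) = (\<Sum>i<6. ?k i *\<^sub>R w p (coord_vec AP c p (?bs ! i)))"
        by (simp only: linear_sum[OF l(1)] linear_cmul[OF l(1)])
      also have "\<dots> = w p ?X" by (simp add: sum_lt_6 cb lift_props vec_eq_iff forall_3 axis_def)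
      finally show "w p (coord_vec AP c p ?s) = w p ?X" .
      have "e p (coord_vec AP c p ?s) = (\<Sum>i<6. ?k i *\<^sub>R e p (coord_vec AP c p (?bs ! i)))"
        by (simp only: linear_sum[OF l(2)] linear_cmul[OF l(2)])
      also have "\<dots> = e p ?X" by (simp add: sum_lt_6 cb lift_props vec_eq_iff forall_3 axis_def)
      finally show "e p (coord_vec AP c p ?s) = e p ?X" .
    qed (rule coord_vec_in_tangent[OF c])+
    have "?s = u" using arg_cong[OF t, of "coords c"] coords_coord_vec[OF P c] by simp
    from sym[OF this] show ?thesis by (rule exI[of _ ?k])
  qed
  have prp: "v0 p Xs = vol p * six (cov (w p) (e p)) Xs 0 1 2 3 4 5" if Xs: "length Xs = 6" "set Xs \<subseteq> tangent AP p" for Xs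
  proof -
    have X: "map (coord_vec AP c p) (map (coords c) Xs) = Xs"
      unfolding map_map by (rule map_idI) (use Xs coord_vec_coords[OF P c] in auto)
    have lX: "length (map (coords c) Xs) = 6" and lB: "length ?bs = 6" using Xs(1) by simp_all
    have e1: "ext_prod ?ds (map (coords c) Xs) = ext_prod ?cs Xs" using comp[OF lX] unfolding X by (rule sym)
    have e2: "ext_prod ?ds ?bs = ext_prod ?cs ?B" using comp[OF lB] unfolding cB by (rule sym)
    have "v0 p Xs * ext_prod ?cs ?B = v0 p ?B * ext_prod ?cs Xs"
      using multi_alt_proportional[OF m1 m2 lB sp lX] unfolding X cB e1 e2 .
    then show ?thesis unfolding dual six vol_def by simp
  qed
  then show "length Xs = 6 \<Longrightarrow> set Xs \<subseteq> tangent AP p \<Longrightarrow> v0 p Xs = vol p * six (cov (w p) (e p)) Xs 0 1 2 3 4 5" .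
  have "v0 p (map (coord_vec AP c p) std_basis) > 0" using v0 c by (simp add: positive_volume_form_def)
  moreover have "length (map (coord_vec AP c p) (std_basis :: (real ^ 6) list)) = 6" by (simp add: std_basis_def)
  moreover have "set (map (coord_vec AP c p) std_basis) \<subseteq> tangent AP p" using coord_vec_in_tangent[OF c] by auto
  ultimately show "vol p \<noteq> 0" using prp by force
qed

text \<open>K is dual to the endomorphism taking (w, e) to (\<rho>w - e, w - \<rho>e) / (2 vol). The
  covector \<alpha>' has to agree with \<alpha> only on tangent vectors: this is what allows K to be
  iterated, as \<open>K_op\<close> is not controlled on other arguments.\<close>

lemma K_op_eq:
  assumes \<alpha>: "covector AP p \<alpha>" and \<xi>: "\<xi> \<in> tangent AP p"
    and \<alpha>': "\<And>X. X \<in> tangent AP p \<Longrightarrow> \<alpha>' X = \<alpha> X"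
  shows "K_op AP v0 \<Omega> p \<alpha>' \<xi> = \<alpha> (lift p (\<rho> (pr p) *\<^sub>R w p \<xi> - e p \<xi>) (w p \<xi> - \<rho> (pr p) *\<^sub>R e p \<xi>)) / (2 * vol p)"
proof -
  let ?\<beta> = "cov (w p) (e p)"
  let ?r = "\<rho> (pr p)"
  let ?a = "\<lambda>i. [\<alpha> (lift p (axis 1 1) 0), \<alpha> (lift p (axis 2 1) 0), \<alpha> (lift p (axis 3 1) 0),
     \<alpha> (lift p 0 (axis 1 1)), \<alpha> (lift p 0 (axis 2 1)), \<alpha> (lift p 0 (axis 3 1))] ! i"
  let ?Y = "lift p (?r *\<^sub>R w p \<xi> - e p \<xi>) (w p \<xi> - ?r *\<^sub>R e p \<xi>)"
  let ?six = "alt_wedge (*) 3 3 (alt_wedge (*) 1 2 (\<lambda>Ys. \<alpha>' (hd Ys)) (\<lambda>Ys. \<Omega> p (\<xi> # Ys))) (\<Omega> p)"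
  have "(\<Sum>i<6. ?a i * ((if i < 3 then ?r * ?\<beta> i \<xi> - ?\<beta> (i + 3) \<xi> else ?\<beta> (i - 3) \<xi> - ?r * ?\<beta> i \<xi>) / 2)) = \<alpha> ?Y / 2"
    by (subst covector_expand[OF \<alpha> lift_props(1), of "?r *\<^sub>R w p \<xi> - e p \<xi>" "w p \<xi> - ?r *\<^sub>R e p \<xi>"])
       (simp add: sum_lt_6 cov_def lift_props eval_nat_numeral field_simps)
  note coef = this
  have eq: "?six Xs = \<alpha> ?Y / 2 * six ?\<beta> Xs 0 1 2 3 4 5" if "length Xs = 6" "set Xs \<subseteq> tangent AP p" for Xs
  proof -
    have 1: "\<alpha>' X = (\<Sum>i<6. ?a i * ?\<beta> i X)" if "X \<in> tangent AP p" for X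
      unfolding \<alpha>'[OF that] by (rule covector_expand[OF \<alpha> that])
    have 2: "\<Omega> p [X, Y, Z] = comb ?\<beta> (normal_terms ?r) [X, Y, Z]" if "X \<in> tangent AP p" "Y \<in> tangent AP p" "Z \<in> tangent AP p" for X Y Z
      unfolding \<Omega>_normal_form[OF that] by (rule normal_form_eq_comb)
    from wedge_contract[where T = "tangent AP p" and \<beta> = ?\<beta> and \<rho> = ?r and a = ?a and \<alpha> = \<alpha>' and \<Omega> = "\<Omega> p", OF 1 2 \<xi> that]
    show ?thesis unfolding coef .
  qed
  then have eq': "?six Xs = \<alpha> ?Y / (2 * vol p) * v0 p Xs" if "length Xs = 6" "set Xs \<subseteq> tangent AP p" for Xs
    unfolding eq[OF that] v0_eq(1)[OF that] using v0_eq(2)[of p] by simp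
  obtain c where c: "c \<in> AP" "p \<in> fst c" using chart_at[OF P] by blast
  let ?B = "map (coord_vec AP c p) (std_basis :: (real ^ 6) list)"
  have B: "length ?B = CARD(6)" "set ?B \<subseteq> tangent AP p" "v0 p ?B \<noteq> 0"
  proof -
    show "length ?B = CARD(6)" by (simp add: std_basis_def)
    show "set ?B \<subseteq> tangent AP p" using coord_vec_in_tangent[OF c] by auto
    have "v0 p ?B > 0" using v0 c unfolding positive_volume_form_def by blast
    then show "v0 p ?B \<noteq> 0" by (rule less_imp_neq[symmetric])
  qed
  show ?thesis
    unfolding K_op_def top_ratio_def
  proof (rule the_equality)
    show "\<forall>Xs. length Xs = CARD(6) \<and> set Xs \<subseteq> tangent AP p \<longrightarrow> ?six Xs = \<alpha> ?Y / (2 * vol p) * v0 p Xs"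
      using eq' by simp
    fix r assume "\<forall>Xs. length Xs = CARD(6) \<and> set Xs \<subseteq> tangent AP p \<longrightarrow> ?six Xs = r * v0 p Xs"
    then have "?six ?B = r * v0 p ?B" using B by blast
    then have "r * v0 p ?B = \<alpha> ?Y / (2 * vol p) * v0 p ?B" using eq'[of ?B] B by simp
    then show "r = \<alpha> ?Y / (2 * vol p)" using mult_right_cancel[OF B(3)] by blast
  qed
qed

text \<open>The endomorphism \<kappa> dual to K, up to the factor 1/(2 vol), squares to \<rho>^2 -
  1. Hence K^2 is scalar, and its trace over six coordinates cancels the factor 1/6.\<close>

lemma lambda_eq: "lambda_of AP v0 \<Omega> p = ((\<rho> (pr p))\<^sup>2 - 1) / (2 * vol p)\<^sup>2"
proof -
  define c where "c = some_chart AP p"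
  have c: "c \<in> AP" "p \<in> fst c" using some_chart_in[OF P] by (auto simp: c_def)
  let ?r = "\<rho> (pr p)"
  define \<kappa> where "\<kappa> \<xi> = lift p (?r *\<^sub>R w p \<xi> - e p \<xi>) (w p \<xi> - ?r *\<^sub>R e p \<xi>)" for \<xi>
  have \<kappa>t: "\<kappa> \<xi> \<in> tangent AP p" for \<xi> by (simp only: \<kappa>_def lift_props)
  have \<kappa>add: "\<kappa> (tadd X Y) = tadd (\<kappa> X) (\<kappa> Y)" "\<kappa> (tscale s X) = tscale s (\<kappa> X)" if "X \<in> tangent AP p" "Y \<in> tangent AP p" for X Y s
    unfolding \<kappa>_def lift_linear by (simp_all add: we_linear that algebra_simps)
  have \<kappa>\<kappa>: "\<kappa> (\<kappa> X) = tscale (?r\<^sup>2 - 1) X" if "X \<in> tangent AP p" for X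
  proof (rule we_inject[OF \<kappa>t tangent_linear(2)[OF P that that]])
    show "w p (\<kappa> (\<kappa> X)) = w p (tscale (?r\<^sup>2 - 1) X)" "e p (\<kappa> (\<kappa> X)) = e p (tscale (?r\<^sup>2 - 1) X)"
      unfolding \<kappa>_def lift_props we_linear(2)[OF that] we_linear(4)[OF that]
      by (simp_all add: algebra_simps power2_eq_square)
  qed
  have "K_op AP v0 \<Omega> p (K_op AP v0 \<Omega> p \<alpha>) \<xi> = (?r\<^sup>2 - 1) / (2 * vol p)\<^sup>2 * \<alpha> \<xi>" if \<alpha>: "covector AP p \<alpha>" and \<xi>: "\<xi> \<in> tangent AP p" for \<alpha> \<xi>
  proof -
    have cv: "covector AP p (\<lambda>X. \<alpha> (\<kappa> X) / (2 * vol p))"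
      using \<alpha> \<kappa>add \<kappa>t unfolding covector_def by (auto simp: add_divide_distrib)
    have "K_op AP v0 \<Omega> p (K_op AP v0 \<Omega> p \<alpha>) \<xi> = \<alpha> (\<kappa> (\<kappa> \<xi>)) / (2 * vol p) / (2 * vol p)"
      using K_op_eq[OF cv \<xi>, of "K_op AP v0 \<Omega> p \<alpha>"] K_op_eq[OF \<alpha>, of _ \<alpha>] by (simp add: \<kappa>_def)
    also have "\<alpha> (\<kappa> (\<kappa> \<xi>)) = (?r\<^sup>2 - 1) * \<alpha> \<xi>" using \<alpha> \<xi> unfolding \<kappa>\<kappa>[OF \<xi>] covector_def by blast
    finally show ?thesis by (simp add: power2_eq_square)
  qed
  note KK = this
  have cc: "covector AP p (\<lambda>X. coords c X $ i)" for i
    by (simp add: covector_def coords_linear[OF P c])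
  have "cotangent_trace AP p (K_op AP v0 \<Omega> p \<circ> K_op AP v0 \<Omega> p) = (\<Sum>i\<in>(UNIV :: 6 set). (?r\<^sup>2 - 1) / (2 * vol p)\<^sup>2)"
    unfolding cotangent_trace_def Let_def c_def[symmetric] comp_def
    using KK[OF cc coord_vec_in_tangent[OF c]] by (simp add: coords_coord_vec[OF P c])
  then have "cotangent_trace AP p (K_op AP v0 \<Omega> p \<circ> K_op AP v0 \<Omega> p) = 6 * ((?r\<^sup>2 - 1) / (2 * vol p)\<^sup>2)"
    by (simp only: sum_constant, simp?)
  then show ?thesis by (simp only: lambda_of_def, simp?)
qed

lemma \<rho>_bound: "(\<rho> (pr p))\<^sup>2 < 1"
  using \<Omega>_stable v0_eq(2)[of p] unfolding stable_negative_def lambda_eq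
  by (auto simp: divide_less_0_iff dest: spec[of _ p])

definition eps :: "'p \<Rightarrow> real" where "eps p = sgn (vol p)"
definition sc :: "'p \<Rightarrow> real" where "sc p = sqrt (1 - (\<rho> (pr p))\<^sup>2)"

lemma sc: "sc p > 0" "(sc p)\<^sup>2 = 1 - (\<rho> (pr p))\<^sup>2"
  using \<rho>_bound[of p] by (auto simp: sc_def)

lemma eps: "(eps p)\<^sup>2 = 1" "eps p \<noteq> 0"
  using v0_eq(2)[of p] by (auto simp: eps_def sgn_if)

text \<open>K contains 1/(2 vol) with its sign, whereas sqrt(-\<lambda>) contains only the absolute
  value; the quotient leaves \<open>eps\<close>. The \<open>THE\<close> is unique because the
  coframe covectors alone separate tangent vectors.\<close>

lemma J_eq:
  assumes X: "X \<in> tangent AP p"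
  shows "J_of AP v0 \<Omega> p X = lift p ((eps p / sc p) *\<^sub>R (\<rho> (pr p) *\<^sub>R w p X - e p X)) ((eps p / sc p) *\<^sub>R (w p X - \<rho> (pr p) *\<^sub>R e p X))"
    (is "_ = ?Y")
proof -
  let ?r = "\<rho> (pr p)"
  have "- lambda_of AP v0 \<Omega> p = (sc p / (2 * vol p))\<^sup>2"
    unfolding lambda_eq power_divide sc(2) by (simp add: minus_divide_left)
  then have sl: "sqrt (- lambda_of AP v0 \<Omega> p) = sc p / (2 * \<bar>vol p\<bar>)"
    using sc(1)[of p] by (simp add: abs_divide abs_mult)
  have J: "J_cotangent AP v0 \<Omega> p \<alpha> X = \<alpha> ?Y" if \<alpha>: "covector AP p \<alpha>" for \<alpha>
  proof -
    define L where "L = \<alpha> (lift p (?r *\<^sub>R w p X - e p X) (w p X - ?r *\<^sub>R e p X))"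
    have aY: "\<alpha> ?Y = eps p / sc p * \<alpha> (lift p (?r *\<^sub>R w p X - e p X) (w p X - ?r *\<^sub>R e p X))"
      using \<alpha> lift_props(1) unfolding covector_def lift_linear(2)[symmetric] by blast
    show ?thesis
      unfolding J_cotangent_def sl K_op_eq[OF \<alpha> X refl] aY L_def[symmetric] using v0_eq(2)[of p] sc(1)[of p]
      by (simp add: eps_def sgn_if field_simps)
  qed
  show ?thesis
    unfolding J_of_def
  proof (rule the_equality)
    show "?Y \<in> tangent AP p \<and> (\<forall>\<alpha>. covector AP p \<alpha> \<longrightarrow> \<alpha> ?Y = J_cotangent AP v0 \<Omega> p \<alpha> X)"
      using J lift_props(1) by auto
    fix Y assume Y: "Y \<in> tangent AP p \<and> (\<forall>\<alpha>. covector AP p \<alpha> \<longrightarrow> \<alpha> Y = J_cotangent AP v0 \<Omega> p \<alpha> X)"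
    then have eq: "cov (w p) (e p) i Y = cov (w p) (e p) i ?Y" if "i < 6" for i using J covector_cov[OF that] by simp
    show "Y = ?Y"
    proof (rule we_inject)
      show "w p Y = w p ?Y" "e p Y = e p ?Y"
        using eq[of 0] eq[of 1] eq[of 2] eq[of 3] eq[of 4] eq[of 5]
        by (simp_all add: cov_def vec_eq_iff forall_3 eval_nat_numeral del: w_def e_def)
    qed (use Y lift_props(1) in auto)
  qed
qed

end

subsection \<open>The exterior derivative of the dual form\<close>

definition cubA :: "(nat \<Rightarrow> real ^ 3) \<Rightarrow> nat \<Rightarrow> nat \<Rightarrow> nat \<Rightarrow> real" where
  "cubA a j k l = tr3 (a j) (a k) (a l)"
definition cubB :: "(nat \<Rightarrow> real ^ 3) \<Rightarrow> (nat \<Rightarrow> real ^ 3) \<Rightarrow> nat \<Rightarrow> nat \<Rightarrow> nat \<Rightarrow> real" where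
  "cubB a b j k l = tr3 (a j) (a k) (b l) + tr3 (a j) (b k) (a l) + tr3 (b j) (a k) (a l)"

text \<open>\<open>m i j\<close> is the derivative of \<open>a j\<close> in the i-th direction, so
  this is the Leibniz expansion of the derivative of \<open>cubA\<close>; in \<open>dcubB\<close>, n
  plays the same part for b.\<close>

definition dcubA :: "(nat \<Rightarrow> nat \<Rightarrow> real ^ 3) \<Rightarrow> (nat \<Rightarrow> real ^ 3) \<Rightarrow> nat \<Rightarrow> nat \<Rightarrow> nat \<Rightarrow> nat \<Rightarrow> real" where
  "dcubA m a i j k l = tr3 (m i j) (a k) (a l) + tr3 (a j) (m i k) (a l) + tr3 (a j) (a k) (m i l)"
definition dcubB :: "(nat \<Rightarrow> nat \<Rightarrow> real ^ 3) \<Rightarrow> (nat \<Rightarrow> nat \<Rightarrow> real ^ 3) \<Rightarrow> (nat \<Rightarrow> real ^ 3) \<Rightarrow> (nat \<Rightarrow> real ^ 3) \<Rightarrow>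
    nat \<Rightarrow> nat \<Rightarrow> nat \<Rightarrow> nat \<Rightarrow> real" where
  "dcubB m n a b i j k l =
     tr3 (m i j) (a k) (b l) + tr3 (a j) (m i k) (b l) + tr3 (a j) (a k) (n i l)
     + tr3 (m i j) (b k) (a l) + tr3 (a j) (n i k) (a l) + tr3 (a j) (b k) (m i l)
     + tr3 (n i j) (a k) (a l) + tr3 (b j) (m i k) (a l) + tr3 (b j) (a k) (m i l)"

text \<open>The shape of \<open>extd\<close> on four vectors: the first index is the direction of
  differentiation, the others number the remaining arguments in increasing order.\<close>

definition alt4 :: "(nat \<Rightarrow> nat \<Rightarrow> nat \<Rightarrow> nat \<Rightarrow> real) \<Rightarrow> real" where
  "alt4 F = F 0 1 2 3 - F 1 0 2 3 + F 2 0 1 3 - F 3 0 1 2"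

text \<open>Sum over splittings of four arguments into a pair for the 2-form s and one argument each
  for a and b, the earlier one going to a. The wedge product with distinct a and b is
  \<open>split4 s a b + split4 s b a\<close>.\<close>

definition split4 :: "(nat \<Rightarrow> nat \<Rightarrow> real ^ 3) \<Rightarrow> (nat \<Rightarrow> real ^ 3) \<Rightarrow> (nat \<Rightarrow> real ^ 3) \<Rightarrow> real" where
  "split4 s a b = tr3 (s 0 1) (a 2) (b 3) - tr3 (s 0 2) (a 1) (b 3) + tr3 (s 0 3) (a 1) (b 2)
     + tr3 (s 1 2) (a 0) (b 3) - tr3 (s 1 3) (a 0) (b 2) + tr3 (s 2 3) (a 0) (b 1)"

lemma split4_linear:
  "split4 (\<lambda>i j. s i j + s' i j) a b = split4 s a b + split4 s' a b" "split4 (\<lambda>i j. s i j - s' i j) a b = split4 s a b - split4 s' a b"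
  "split4 (\<lambda>i j. r *\<^sub>R s i j) a b = r * split4 s a b"
  "split4 s (\<lambda>i. a i + a' i) b = split4 s a b + split4 s a' b" "split4 s a (\<lambda>i. b i + b' i) = split4 s a b + split4 s a b'"
  "split4 s (\<lambda>i. r *\<^sub>R a i) b = r * split4 s a b" "split4 s a (\<lambda>i. r *\<^sub>R b i) = r * split4 s a b"
  by (simp_all add: split4_def tr3_linear algebra_simps)

text \<open>Polarisation: the first identity holds for the sum of a and z times b for every z, and
  the other three are its higher coefficients in z.\<close>

lemma alt4_dcub:
  assumes m: "\<And>i j. m i j = m j i + s i j" and n: "\<And>i j. n i j = n j i + t i j"
  shows "alt4 (dcubA m a) = split4 s a a"
    and "alt4 (dcubB m n a b) = split4 t a a + split4 s a b + split4 s b a"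
    and "alt4 (dcubB n m b a) = split4 s b b + split4 t a b + split4 t b a"
    and "alt4 (dcubA n b) = split4 t b b"
proof -
  have A: "alt4 (dcubA m a) = split4 s a a" if "\<And>i j. m i j = m j i + s i j" for m s a
    unfolding alt4_def dcubA_def split4_def
    by (rule d_tr3[OF that that that that that that])
  have "alt4 (dcubA m a) + z * alt4 (dcubB m n a b) + z^2 * alt4 (dcubB n m b a) + z^3 * alt4 (dcubA n b)
     = split4 s a a + z * (split4 t a a + split4 s a b + split4 s b a) + z^2 * (split4 s b b + split4 t a b + split4 t b a) + z^3 * split4 t b b" for z
  proof -
    have e: "dcubA (\<lambda>i j. m i j + z *\<^sub>R n i j) (\<lambda>i. a i + z *\<^sub>R b i) i j k l =
       dcubA m a i j k l + z * dcubB m n a b i j k l + z^2 * dcubB n m b a i j k l + z^3 * dcubA n b i j k l" for i j k l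
      unfolding dcubA_def dcubB_def tr3_linear by algebra
    have "alt4 (dcubA (\<lambda>i j. m i j + z *\<^sub>R n i j) (\<lambda>i. a i + z *\<^sub>R b i)) = split4 (\<lambda>i j. s i j + z *\<^sub>R t i j) (\<lambda>i. a i + z *\<^sub>R b i) (\<lambda>i. a i + z *\<^sub>R b i)"
    proof (rule A)
      fix i j
      show "m i j + z *\<^sub>R n i j = m j i + z *\<^sub>R n j i + (s i j + z *\<^sub>R t i j)"
        using m[of i j] n[of i j] by (simp add: algebra_simps)
    qed
    moreover have "alt4 (dcubA (\<lambda>i j. m i j + z *\<^sub>R n i j) (\<lambda>i. a i + z *\<^sub>R b i)) =
      alt4 (dcubA m a) + z * alt4 (dcubB m n a b) + z^2 * alt4 (dcubB n m b a) + z^3 * alt4 (dcubA n b)"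
      unfolding alt4_def e by algebra
    ultimately show ?thesis
      unfolding split4_linear by (simp add: power2_eq_square power3_eq_cube algebra_simps)
  qed
  from poly3_coeffs[OF this]
  show "alt4 (dcubA m a) = split4 s a a"
    "alt4 (dcubB m n a b) = split4 t a a + split4 s a b + split4 s b a"
    "alt4 (dcubB n m b a) = split4 s b b + split4 t a b + split4 t b a"
    "alt4 (dcubA n b) = split4 t b b" .
qed

text \<open>With a, b for w, e, the terms of dw and de other than the torsion are cross products.
  They cancel from the alternated derivatives except in the fourth identity, whose right side
  contributes to the 2\<rho> term of \<open>extd_hat\<close>. The first and third are needed again
  when the torsion is itself a multiple of e x e.\<close>

lemma split4_identities:
  "split4 (\<lambda>i j. a i \<times> a j) a a = 0"
  "split4 (\<lambda>i j. a j \<times> b i - a i \<times> b j) a a + split4 (\<lambda>i j. b i \<times> b j - a i \<times> a j) a b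
     + split4 (\<lambda>i j. b i \<times> b j - a i \<times> a j) b a = 0"
  "split4 (\<lambda>i j. b i \<times> b j) a b + split4 (\<lambda>i j. b i \<times> b j) b a = 0"
  "split4 (\<lambda>i j. b i \<times> b j - a i \<times> a j) b b + split4 (\<lambda>i j. a j \<times> b i - a i \<times> b j) a b
     + split4 (\<lambda>i j. a j \<times> b i - a i \<times> b j) b a = split4 (\<lambda>i j. b i \<times> b j) a a"
  "split4 (\<lambda>i j. a j \<times> b i - a i \<times> b j) b b = 0"
  unfolding split4_def tr3_components cross_components vector_minus_component
  by algebra+

lemma has_derivative_tr3:
  assumes "(f has_derivative f') (at x)" "(g has_derivative g') (at x)" "(h has_derivative h') (at x)"
  shows "((\<lambda>y. tr3 (f y) (g y) (h y)) has_derivative (\<lambda>u. tr3 (f' u) (g x) (h x) + tr3 (f x) (g' u) (h x) + tr3 (f x) (g x) (h' u))) (at x)"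
  unfolding tr3_def
  by (rule has_derivative_eq_rhs[OF has_derivative_inner[OF assms(1) has_derivative_cross3[OF assms(2,3)]]])
     (simp add: fun_eq_iff inner_add)

text \<open>The sign \<epsilon> is treated as a constant. The factor of \<open>dr\<close>
  multiplying www adds up to \<epsilon>(s^2 + r^2)/(2 s^3) = \<epsilon>/(2 s^3), from
  differentiating -r and the prefactor; this is why the leading coefficient in
  \<open>extd_hat\<close> cannot vanish.\<close>

lemma dual_form_derivative:
  fixes r :: "'a::real_normed_vector \<Rightarrow> real"
  assumes r: "(r has_derivative dr) (at x)" "(r x)\<^sup>2 < 1"
    and a: "\<And>j. ((\<lambda>y. a y j) has_derivative da j) (at x)" and b: "\<And>j. ((\<lambda>y. b y j) has_derivative db j) (at x)"
  defines "s \<equiv> sqrt (1 - (r x)\<^sup>2)"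
  shows "((\<lambda>y. - \<epsilon> / (2 * sqrt (1 - (r y)\<^sup>2)) * (- r y * cubA (a y) j k l + cubB (a y) (b y) j k l
       - r y * cubB (b y) (a y) j k l + (2 * (r y)\<^sup>2 - 1) * cubA (b y) j k l)) has_derivative
     (\<lambda>u. dr u * (\<epsilon> / (2 * s ^ 3) * (cubA (a x) j k l + cubB (b x) (a x) j k l) - \<epsilon> * r x / (2 * s ^ 3) * cubB (a x) (b x) j k l
         - (\<epsilon> * r x * (2 * (r x)\<^sup>2 - 1) / (2 * s ^ 3) + 2 * \<epsilon> * r x / s) * cubA (b x) j k l)
       + - \<epsilon> / (2 * s) * (- r x * dcubA (\<lambda>_ j. da j u) (a x) i j k l + dcubB (\<lambda>_ j. da j u) (\<lambda>_ j. db j u) (a x) (b x) i j k l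
       - r x * dcubB (\<lambda>_ j. db j u) (\<lambda>_ j. da j u) (b x) (a x) i j k l + (2 * (r x)\<^sup>2 - 1) * dcubA (\<lambda>_ j. db j u) (b x) i j k l))) (at x)"
proof -
  have s: "s > 0" "s\<^sup>2 = 1 - (r x)\<^sup>2" using r(2) by (auto simp: s_def)
  have A: "((\<lambda>y. cubA (a y) j k l) has_derivative (\<lambda>u. dcubA (\<lambda>_ j. da j u) (a x) i j k l)) (at x)"
    if "\<And>j. ((\<lambda>y. a y j) has_derivative da j) (at x)" for a da
    unfolding cubA_def dcubA_def by (rule has_derivative_tr3[OF that that that])
  have B: "((\<lambda>y. cubB (a y) (b y) j k l) has_derivative (\<lambda>u. dcubB (\<lambda>_ j. da j u) (\<lambda>_ j. db j u) (a x) (b x) i j k l)) (at x)"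
    if a: "\<And>j. ((\<lambda>y. a y j) has_derivative da j) (at x)" and b: "\<And>j. ((\<lambda>y. b y j) has_derivative db j) (at x)" for a b da db
    unfolding cubB_def dcubB_def
    by (rule has_derivative_eq_rhs[OF has_derivative_add[OF has_derivative_add[OF has_derivative_tr3[OF a a b] has_derivative_tr3[OF a b a]] has_derivative_tr3[OF b a a]]])
       (simp add: fun_eq_iff)
  have K0: "((\<lambda>t. - \<epsilon> / (2 * sqrt (1 - t\<^sup>2))) has_real_derivative - (\<epsilon> * r x) / (2 * s ^ 3)) (at (r x))"
  proof -
    have "((\<lambda>t. sqrt (1 - t\<^sup>2)) has_real_derivative (- r x / s)) (at (r x))"
      by (rule derivative_eq_intros refl | use r(2) in \<open>simp add: s_def field_simps\<close>)+
    then have "((\<lambda>t. inverse (sqrt (1 - t\<^sup>2))) has_real_derivative - (- r x / s * inverse (s ^ Suc (Suc 0)))) (at (r x))"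
      unfolding s_def by (rule DERIV_inverse_fun) (use s(1) in \<open>simp add: s_def\<close>)
    from DERIV_cmult[OF this, of "- \<epsilon> / 2"]
    show ?thesis using s(1) by (simp add: field_simps power3_eq_cube)
  qed
  have K: "((\<lambda>y. - \<epsilon> / (2 * sqrt (1 - (r y)\<^sup>2))) has_derivative (\<lambda>u. dr u * (- (\<epsilon> * r x) / (2 * s ^ 3)))) (at x)"
    by (rule DERIV_compose_FDERIV[OF K0 r(1)])
  have R2: "((\<lambda>y. 2 * (r y)\<^sup>2 - 1) has_derivative (\<lambda>u. 4 * r x * dr u)) (at x)"
    by (rule has_derivative_eq_rhs[OF has_derivative_diff[OF has_derivative_mult_right[OF has_derivative_power[OF r(1)]] has_derivative_const]])
       (simp add: fun_eq_iff)
  note D = has_derivative_mult[OF K has_derivative_add[OF has_derivative_diff[OF has_derivative_add[OF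
     has_derivative_mult[OF has_derivative_minus[OF r(1)] A[OF a]] B[OF a b]] has_derivative_mult[OF r(1) B[OF b a]]] has_derivative_mult[OF R2 A[OF b]]]]
  show ?thesis
  proof (rule has_derivative_eq_rhs[OF D], rule ext)
    fix u
    have 1: "1 / (2 * s) = (1 / (2 * s ^ 3)) * (1 - (r x)\<^sup>2)" unfolding s(2)[symmetric] using s(1) by (simp add: power2_eq_square power3_eq_cube)
    \<comment> \<open>Every denominator is a polynomial multiple of z, because 1/(2s) = z (1 - r^2);
      afterwards the claim is a polynomial identity.\<close>
    define z where "z = 1 / (2 * s ^ 3)"
    have zz: "\<epsilon> / (2 * s) = \<epsilon> * z * (1 - (r x)\<^sup>2)" "\<epsilon> / (2 * s ^ 3) = \<epsilon> * z" "\<epsilon> * r x / (2 * s ^ 3) = \<epsilon> * r x * z"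
      "- \<epsilon> / (2 * s) = - \<epsilon> * z * (1 - (r x)\<^sup>2)" "- (\<epsilon> * r x) / (2 * s ^ 3) = - \<epsilon> * r x * z"
      "\<epsilon> * r x * (2 * (r x)\<^sup>2 - 1) / (2 * s ^ 3) + 2 * \<epsilon> * r x / s = \<epsilon> * r x * (2 * (r x)\<^sup>2 - 1) * z + 4 * \<epsilon> * r x * z * (1 - (r x)\<^sup>2)"
    proof -
      have z1: "1 / (2 * s) = z * (1 - (r x)\<^sup>2)" using 1 by (simp add: z_def)
      have q1: "k / (2 * s) = k * z * (1 - (r x)\<^sup>2)" for k
      proof -
        have "k / (2 * s) = k * (1 / (2 * s))" by simp
        then show ?thesis unfolding z1 by simp
      qed
      have q2: "k / (2 * s ^ 3) = k * z" for k by (simp add: z_def)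
      have "2 * \<epsilon> * r x / s = (4 * \<epsilon> * r x) / (2 * s)" by simp
      then have q3: "2 * \<epsilon> * r x / s = 4 * \<epsilon> * r x * z * (1 - (r x)\<^sup>2)" unfolding q1 .
      show "\<epsilon> / (2 * s) = \<epsilon> * z * (1 - (r x)\<^sup>2)" "\<epsilon> / (2 * s ^ 3) = \<epsilon> * z" "\<epsilon> * r x / (2 * s ^ 3) = \<epsilon> * r x * z"
        "- \<epsilon> / (2 * s) = - \<epsilon> * z * (1 - (r x)\<^sup>2)" by (rule q1 q2)+
      show "- (\<epsilon> * r x) / (2 * s ^ 3) = - \<epsilon> * r x * z" unfolding q2 by simp
      show "\<epsilon> * r x * (2 * (r x)\<^sup>2 - 1) / (2 * s ^ 3) + 2 * \<epsilon> * r x / s = \<epsilon> * r x * (2 * (r x)\<^sup>2 - 1) * z + 4 * \<epsilon> * r x * z * (1 - (r x)\<^sup>2)"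
        unfolding q2 q3 by simp
    qed
    have s': "- \<epsilon> / (2 * sqrt (1 - (r x)\<^sup>2)) = - \<epsilon> * z * (1 - (r x)\<^sup>2)" using zz(4) by (simp add: s_def)
    show "- \<epsilon> / (2 * sqrt (1 - (r x)\<^sup>2)) * (- r x * dcubA (\<lambda>_ j. da j u) (a x) i j k l + - dr u * cubA (a x) j k l +
           dcubB (\<lambda>_ j. da j u) (\<lambda>_ j. db j u) (a x) (b x) i j k l -
           (r x * dcubB (\<lambda>_ j. db j u) (\<lambda>_ j. da j u) (b x) (a x) i j k l + dr u * cubB (b x) (a x) j k l) +
           ((2 * (r x)\<^sup>2 - 1) * dcubA (\<lambda>_ j. db j u) (b x) i j k l + 4 * r x * dr u * cubA (b x) j k l)) +
         dr u * (- (\<epsilon> * r x) / (2 * s ^ 3)) * (- r x * cubA (a x) j k l + cubB (a x) (b x) j k l - r x * cubB (b x) (a x) j k l + (2 * (r x)\<^sup>2 - 1) * cubA (b x) j k l)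
       = dr u * (\<epsilon> / (2 * s ^ 3) * (cubA (a x) j k l + cubB (b x) (a x) j k l) - \<epsilon> * r x / (2 * s ^ 3) * cubB (a x) (b x) j k l
         - (\<epsilon> * r x * (2 * (r x)\<^sup>2 - 1) / (2 * s ^ 3) + 2 * \<epsilon> * r x / s) * cubA (b x) j k l)
       + - \<epsilon> / (2 * s) * (- r x * dcubA (\<lambda>_ j. da j u) (a x) i j k l + dcubB (\<lambda>_ j. da j u) (\<lambda>_ j. db j u) (a x) (b x) i j k l
       - r x * dcubB (\<lambda>_ j. db j u) (\<lambda>_ j. da j u) (b x) (a x) i j k l + (2 * (r x)\<^sup>2 - 1) * dcubA (\<lambda>_ j. db j u) (b x) i j k l)"
      unfolding s' zz by algebra
  qed
qed

lemma extd_3: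
  "extd A \<alpha> p (map X [0,1,2,3]) = (let c = some_chart A p; D = (\<lambda>i j k l. frechet_derivative
       (form_component A c \<alpha> [coords c (X j), coords c (X k), coords c (X l)]) (at (snd c p)) (coords c (X i))) in alt4 D)"
  for X :: "nat \<Rightarrow> _" and \<alpha> :: "(_, real) form"
  by (simp add: extd_def Let_def alt4_def eval_nat_numeral)

context deformed_cs
begin

lemma \<rho>_pr_smooth:
  assumes \<phi>: "smooth_param AP S \<phi>"
  shows "smooth_on S (\<lambda>y. \<rho> (pr (\<phi> y)))"
proof (rule smooth_on_local)
  fix x assume x: "x \<in> S"
  have "smooth_param AM S (pr \<circ> \<phi>)" by (rule smooth_param_comp[OF P M smooth_pr \<phi>])
  from M this x \<rho>_smooth_at
  obtain N where "open N" "x \<in> N" "N \<subseteq> S" "smooth_on N (\<rho> \<circ> (pr \<circ> \<phi>))" by (rule smooth_at_param)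
  then show "\<exists>N. open N \<and> x \<in> N \<and> smooth_on N (\<lambda>y. \<rho> (pr (\<phi> y)))" by (auto simp: comp_def)
qed

text \<open>Let f be the coframe product on the coordinate basis. Then \<open>vol\<close> times f is
  the value of \<open>v0\<close> there, hence positive, so \<open>eps\<close> is the sign of f.
  Writing the sign as f / sqrt (f * f) makes it accessible to the smoothness rules.\<close>

lemma eps_smooth:
  assumes c: "c \<in> AP"
  shows "smooth_on (snd c ` fst c) (\<lambda>y. eps (chart_inv c y))"
proof -
  let ?S = "snd c ` fst c"
  have S: "open ?S" by (rule chart_open_image[OF P c])
  note \<phi> = smooth_param_chart[OF P c]
  define f where "f y = six (cov (w (chart_inv c y)) (e (chart_inv c y))) (map (coord_vec AP c (chart_inv c y)) std_basis) 0 1 2 3 4 5" for y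
  have len: "length (std_basis :: (real ^ 6) list) = 6" by (simp add: std_basis_def)
  have "smooth_on ?S (\<lambda>y. \<Sum>\<sigma> | \<sigma> permutes {..<6}. real_of_int (sign \<sigma>) * (\<Prod>i<6. cov (w (chart_inv c y)) (e (chart_inv c y)) i (pvec AP (chart_inv c) y (std_basis ! \<sigma> i))))"
  proof (intro smooth_on_sum smooth_on_mult smooth_on_const smooth_on_prod S)
    fix \<sigma> and i :: nat assume "i \<in> {..<6}"
    then have i: "i = 0 \<or> i = 1 \<or> i = 2 \<or> i = 3 \<or> i = 4 \<or> i = 5" by auto
    note sw = smooth_on_vec_nth[OF S pullback_we(1)[OF \<phi>, of "std_basis ! \<sigma> i"]] and se = smooth_on_vec_nth[OF S pullback_we(2)[OF \<phi>, of "std_basis ! \<sigma> i"]]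
    show "smooth_on ?S (\<lambda>y. cov (w (chart_inv c y)) (e (chart_inv c y)) i (pvec AP (chart_inv c) y (std_basis ! \<sigma> i)))"
      using i sw[of 1] sw[of 2] sw[of 3] se[of 1] se[of 2] se[of 3] by (elim disjE) (simp_all add: cov_def)
  qed
  then have f: "smooth_on ?S f"
  proof (rule smooth_on_cong[OF _ S])
    fix y assume y: "y \<in> ?S"
    let ?cs = "map (cov (w (chart_inv c y)) (e (chart_inv c y))) [0,1,2,3,4,5]"
    have l: "length ?cs = 6" by simp
    show "(\<Sum>\<sigma> | \<sigma> permutes {..<6}. real_of_int (sign \<sigma>) * (\<Prod>i<6. cov (w (chart_inv c y)) (e (chart_inv c y)) i (pvec AP (chart_inv c) y (std_basis ! \<sigma> i)))) = f y"
      unfolding f_def six_def ext_prod_def l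
    proof (intro sum.cong arg_cong2[of _ _ _ _ "(*)"] prod.cong refl)
      fix \<sigma> i assume s: "\<sigma> \<in> {\<sigma>. \<sigma> permutes {..<6::nat}}" and i: "i \<in> {..<6::nat}"
      then have "\<sigma> i < 6" using permutes_in_image[of \<sigma> "{..<6}" i] by simp
      then have "map (coord_vec AP c (chart_inv c y)) std_basis ! \<sigma> i = pvec AP (chart_inv c) y (std_basis ! \<sigma> i)"
        using len coord_vec_eq_pvec'[OF P c y] by simp
      moreover have "i = 0 \<or> i = 1 \<or> i = 2 \<or> i = 3 \<or> i = 4 \<or> i = 5" using i by auto
      ultimately show "cov (w (chart_inv c y)) (e (chart_inv c y)) i (pvec AP (chart_inv c) y (std_basis ! \<sigma> i)) =
         (?cs ! i) (map (coord_vec AP c (chart_inv c y)) std_basis ! \<sigma> i)"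
        by (elim disjE) simp_all
    qed
  qed
  have fv: "vol (chart_inv c y) * f y > 0" if y: "y \<in> ?S" for y
  proof -
    have p: "chart_inv c y \<in> fst c" by (rule chart_inv_in[OF P c y])
    have "v0 (chart_inv c y) (map (coord_vec AP c (chart_inv c y)) std_basis) > 0"
      using v0 c p unfolding positive_volume_form_def by blast
    moreover have "set (map (coord_vec AP c (chart_inv c y)) std_basis) \<subseteq> tangent AP (chart_inv c y)"
      using coord_vec_in_tangent[OF c p] by auto
    ultimately show ?thesis using v0_eq(1)[of "map (coord_vec AP c (chart_inv c y)) std_basis" "chart_inv c y"] len
      by (simp add: f_def)
  qed
  have "smooth_on ?S (\<lambda>y. f y / sqrt (f y * f y))"
  proof (intro smooth_on_divide smooth_on_sqrt smooth_on_mult S f)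
    show "0 < f y * f y" "sqrt (f y * f y) \<noteq> 0" if "y \<in> ?S" for y using fv[OF that] by (auto simp: zero_less_mult_iff)
  qed
  then show ?thesis
  proof (rule smooth_on_cong[OF _ S])
    fix y assume y: "y \<in> ?S"
    show "f y / sqrt (f y * f y) = eps (chart_inv c y)"
      using fv[OF y] by (auto simp: eps_def sgn_if zero_less_mult_iff abs_if)
  qed
qed

text \<open>The values are 1 and -1, so by continuity a ball of radius 1 around the value isolates
  it.\<close>

lemma eps_locally_constant:
  assumes c: "c \<in> AP" "p \<in> fst c"
  obtains N where "open N" "snd c p \<in> N" "N \<subseteq> snd c ` fst c" "\<And>y. y \<in> N \<Longrightarrow> eps (chart_inv c y) = eps p"
proof -
  let ?S = "snd c ` fst c"
  define N where "N = ?S \<inter> (\<lambda>y. eps (chart_inv c y)) -` ball (eps p) 1"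
  have S: "open ?S" by (rule chart_open_image[OF P c(1)])
  have "open N" unfolding N_def
    by (rule continuous_open_preimage[OF smooth_on_imp_continuous_on[OF eps_smooth[OF c(1)]] S]) simp
  moreover have "snd c p \<in> N" using c chart_inv_left[OF P c] by (simp add: N_def)
  moreover have "eps (chart_inv c y) = eps p" if "y \<in> N" for y
  proof -
    have "eps q = 1 \<or> eps q = - 1" for q using v0_eq(2)[of q] by (auto simp: eps_def sgn_if)
    note ec = this
    have "dist (eps p) (eps (chart_inv c y)) < 1" using that by (simp add: N_def)
    then show ?thesis using ec[of p] ec[of "chart_inv c y"] by (elim disjE) (simp_all add: dist_real_def)
  qed
  moreover have "N \<subseteq> ?S" by (simp add: N_def)
  ultimately show thesis using that by blast
qed

lemma hat_eq:
  assumes X: "X \<in> tangent AP p" "Y \<in> tangent AP p" "Z \<in> tangent AP p"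
  shows "hat AP v0 \<Omega> p [X, Y, Z] = - eps p / (2 * sqrt (1 - (\<rho> (pr p))\<^sup>2)) * (- \<rho> (pr p) * tr3 (w p X) (w p Y) (w p Z)
     + (tr3 (w p X) (w p Y) (e p Z) + tr3 (w p X) (e p Y) (w p Z) + tr3 (e p X) (w p Y) (w p Z))
     - \<rho> (pr p) * (tr3 (w p X) (e p Y) (e p Z) + tr3 (e p X) (w p Y) (e p Z) + tr3 (e p X) (e p Y) (w p Z))
     + (2 * (\<rho> (pr p))\<^sup>2 - 1) * tr3 (e p X) (e p Y) (e p Z))"
proof -
  let ?J = "J_of AP v0 \<Omega> p"
  have JX: "?J U \<in> tangent AP p" "w p (?J U) = (eps p / sc p) *\<^sub>R (\<rho> (pr p) *\<^sub>R w p U - e p U)"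
    "e p (?J U) = (eps p / sc p) *\<^sub>R (w p U - \<rho> (pr p) *\<^sub>R e p U)" if "U \<in> {X, Y, Z}" for U
    using J_eq[of U p] that X by (auto simp only: insert_iff empty_iff lift_props)
  have "hat AP v0 \<Omega> p [X, Y, Z] = - normal_form (\<rho> (pr p)) (w p) (e p) [?J X, ?J Y, ?J Z]"
    unfolding hat_def using \<Omega>_normal_form[OF JX(1) JX(1) JX(1), of X Y Z] by simp
  also have "normal_form (\<rho> (pr p)) (w p) (e p) [?J X, ?J Y, ?J Z] = normal_form (\<rho> (pr p)) (\<lambda>U. w p (?J U)) (\<lambda>U. e p (?J U)) [X, Y, Z]"
    by (simp add: normal_form_def)
  also have "\<dots> = eps p / (2 * sc p) * (- \<rho> (pr p) * tr3 (w p X) (w p Y) (w p Z)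
     + (tr3 (w p X) (w p Y) (e p Z) + tr3 (w p X) (e p Y) (w p Z) + tr3 (e p X) (w p Y) (w p Z))
     - \<rho> (pr p) * (tr3 (w p X) (e p Y) (e p Z) + tr3 (e p X) (w p Y) (e p Z) + tr3 (e p X) (e p Y) (w p Z))
     + (2 * (\<rho> (pr p))\<^sup>2 - 1) * tr3 (e p X) (e p Y) (e p Z))"
    using sc(1)[of p] by (intro normal_form_rotate[OF eps(1) sc(2)] JX(2,3)) simp_all
  finally show ?thesis by (simp add: sc_def)
qed

definition dr :: "'p \<Rightarrow> 'p tvec \<Rightarrow> real" where "dr p X = X (\<rho> \<circ> pr)"

lemma \<rho>_pr_smooth_at: "smooth_at AP p (\<rho> \<circ> pr)"
  by (rule smooth_at_comp[OF P M smooth_pr \<rho>_smooth_at])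

lemma dr_push: "dr p X = push AM pr p X \<rho>"
  by (simp add: dr_def push_def \<rho>_smooth_at)

lemma dr_linear: "dr p (tadd X Y) = dr p X + dr p Y"
  by (simp add: dr_def tadd_def)

lemma dr_vertical: "X \<in> vertical AM AP pr p \<Longrightarrow> dr p X = 0"
  by (simp add: dr_push vertical_def tzero_def)

text \<open>The part with \<open>dr\<close> and the part with torsion are kept apart. Of the three
  coefficients of \<open>dr\<close> only the nonvanishing of \<open>cA\<close> is recorded: it
  extracts dr from the www component, after which the whole first part is zero.\<close>

lemma extd_hat:
  obtains cA cB cD where "cA \<noteq> 0"
    "\<And>X. (\<And>i. X i \<in> tangent AP p) \<Longrightarrow> extd AP (hat AP v0 \<Omega>) p (map X [0,1,2,3]) =
      alt4 (\<lambda>i j k l. dr p (X i) * (cA * (cubA (\<lambda>j. w p (X j)) j k l + cubB (\<lambda>j. e p (X j)) (\<lambda>j. w p (X j)) j k l)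
         + cB * cubB (\<lambda>j. w p (X j)) (\<lambda>j. e p (X j)) j k l + cD * cubA (\<lambda>j. e p (X j)) j k l))
      - eps p / (2 * sc p) * (split4 (\<lambda>i j. tor p (X i) (X j)) (\<lambda>j. w p (X j)) (\<lambda>j. w p (X j))
         - \<rho> (pr p) * (split4 (\<lambda>i j. tor p (X i) (X j)) (\<lambda>j. w p (X j)) (\<lambda>j. e p (X j)) + split4 (\<lambda>i j. tor p (X i) (X j)) (\<lambda>j. e p (X j)) (\<lambda>j. w p (X j)))
         + (2 * (\<rho> (pr p))\<^sup>2 - 1) * split4 (\<lambda>i j. tor p (X i) (X j)) (\<lambda>j. e p (X j)) (\<lambda>j. e p (X j))
         - 2 * \<rho> (pr p) * split4 (\<lambda>i j. e p (X i) \<times> e p (X j)) (\<lambda>j. w p (X j)) (\<lambda>j. w p (X j)))"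
proof -
  define c where "c = some_chart AP p"
  have c: "c \<in> AP" "p \<in> fst c" using some_chart_in[OF P] by (auto simp: c_def)
  \<comment> \<open>On N the sign is the constant \<open>eps p\<close>, so it contributes no
    derivative.\<close>
  obtain N where N: "open N" "snd c p \<in> N" "N \<subseteq> snd c ` fst c" "\<And>y. y \<in> N \<Longrightarrow> eps (chart_inv c y) = eps p"
    using eps_locally_constant[OF c] by blast
  let ?\<phi> = "chart_inv c" and ?x = "snd c p" and ?\<rho> = "\<rho> (pr p)"
  note \<phi> = smooth_param_subset[OF smooth_param_chart[OF P c(1)] N(1,3)]
  have \<phi>x: "?\<phi> ?x = p" by (rule chart_inv_left[OF P c])
  define r where "r y = \<rho> (pr (?\<phi> y))" for y
  have rx: "r ?x = ?\<rho>" by (simp add: r_def \<phi>x)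
  have rs: "smooth_on N r" unfolding r_def[abs_def] by (rule \<rho>_pr_smooth[OF \<phi>])
  have rd: "(r has_derivative frechet_derivative r (at ?x)) (at ?x)" by (rule smooth_on_has_derivative[OF rs N(2)])
  have r1: "(r ?x)\<^sup>2 < 1" using \<rho>_bound[of p] by (simp add: rx)
  have sx: "sqrt (1 - (r ?x)\<^sup>2) = sc p" by (simp add: rx sc_def)
  define cA where "cA = eps p / (2 * sc p ^ 3)"
  define cB where "cB = - (eps p * ?\<rho> / (2 * sc p ^ 3))"
  define cD where "cD = - (eps p * ?\<rho> * (2 * ?\<rho>\<^sup>2 - 1) / (2 * sc p ^ 3) + 2 * eps p * ?\<rho> / sc p)"
  have "cA \<noteq> 0" using eps(2)[of p] sc(1)[of p] by (simp add: cA_def)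
  moreover have "extd AP (hat AP v0 \<Omega>) p (map X [0,1,2,3]) =
      alt4 (\<lambda>i j k l. dr p (X i) * (cA * (cubA (\<lambda>j. w p (X j)) j k l + cubB (\<lambda>j. e p (X j)) (\<lambda>j. w p (X j)) j k l)
         + cB * cubB (\<lambda>j. w p (X j)) (\<lambda>j. e p (X j)) j k l + cD * cubA (\<lambda>j. e p (X j)) j k l))
      - eps p / (2 * sc p) * (split4 (\<lambda>i j. tor p (X i) (X j)) (\<lambda>j. w p (X j)) (\<lambda>j. w p (X j))
         - ?\<rho> * (split4 (\<lambda>i j. tor p (X i) (X j)) (\<lambda>j. w p (X j)) (\<lambda>j. e p (X j)) + split4 (\<lambda>i j. tor p (X i) (X j)) (\<lambda>j. e p (X j)) (\<lambda>j. w p (X j)))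
         + (2 * ?\<rho>\<^sup>2 - 1) * split4 (\<lambda>i j. tor p (X i) (X j)) (\<lambda>j. e p (X j)) (\<lambda>j. e p (X j))
         - 2 * ?\<rho> * split4 (\<lambda>i j. e p (X i) \<times> e p (X j)) (\<lambda>j. w p (X j)) (\<lambda>j. w p (X j)))"
    if X: "\<And>i. X i \<in> tangent AP p" for X :: "nat \<Rightarrow> 'p tvec"
  proof -
    define u where "u i = coords c (X i)" for i
    define a where "a y j = w (?\<phi> y) (pvec AP ?\<phi> y (u j))" for y j
    define b where "b y j = e (?\<phi> y) (pvec AP ?\<phi> y (u j))" for y j
    define da where "da j = frechet_derivative (\<lambda>y. a y j) (at ?x)" for j
    define db where "db j = frechet_derivative (\<lambda>y. b y j) (at ?x)" for j
    have ad: "((\<lambda>y. a y j) has_derivative da j) (at ?x)" and bd: "((\<lambda>y. b y j) has_derivative db j) (at ?x)" for j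
      using smooth_on_has_derivative[OF pullback_we(1)[OF \<phi>] N(2)] smooth_on_has_derivative[OF pullback_we(2)[OF \<phi>] N(2)]
      unfolding a_def b_def da_def db_def by blast+
    have pv: "pvec AP ?\<phi> ?x (u j) = X j" for j using chart_param(3)[OF c X] by (simp add: u_def)
    have ax: "a ?x = (\<lambda>j. w p (X j))" "b ?x = (\<lambda>j. e p (X j))" by (simp_all add: a_def b_def fun_eq_iff \<phi>x pv)
    define m where "m i j = da j (u i)" for i j
    define n where "n i j = db j (u i)" for i j
    have m: "m i j = m j i + dw p (X i) (X j)" and n: "n i j = n j i + de p (X i) (X j)" for i j
      using pullback_we(3)[OF \<phi> N(2), of "u i" "u j"] pullback_we(4)[OF \<phi> N(2), of "u i" "u j"]
      unfolding \<phi>x pv by (simp_all add: m_def n_def da_def db_def a_def b_def)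
    have comp: "form_component AP c (hat AP v0 \<Omega>) [u j, u k, u l] y = - eps p / (2 * sqrt (1 - (r y)\<^sup>2)) * (- r y * cubA (a y) j k l + cubB (a y) (b y) j k l
       - r y * cubB (b y) (a y) j k l + (2 * (r y)\<^sup>2 - 1) * cubA (b y) j k l)" if y: "y \<in> N" for y j k l
    proof -
      have yS: "y \<in> snd c ` fst c" using y N(3) by blast
      note t = pvec_in_tangent[OF P \<phi> y]
      show ?thesis
        unfolding form_component_def list.map coord_vec_eq_pvec'[OF P c(1) yS] hat_eq[OF t t t] N(4)[OF y]
        by (simp add: r_def cubA_def cubB_def a_def b_def)
    qed
    have fr: "frechet_derivative (form_component AP c (hat AP v0 \<Omega>) [u j, u k, u l]) (at ?x) (u i) =
       dr p (X i) * (cA * (cubA (a ?x) j k l + cubB (b ?x) (a ?x) j k l) + cB * cubB (a ?x) (b ?x) j k l + cD * cubA (b ?x) j k l)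
       + - eps p / (2 * sc p) * (- ?\<rho> * dcubA m (a ?x) i j k l + dcubB m n (a ?x) (b ?x) i j k l
       - ?\<rho> * dcubB n m (b ?x) (a ?x) i j k l + (2 * ?\<rho>\<^sup>2 - 1) * dcubA n (b ?x) i j k l)" for i j k l
    proof -
      note D = dual_form_derivative[where a = a and b = b and da = da and db = db and \<epsilon> = "eps p" and i = i and j = j and k = k and l = l, OF rd r1 ad bd, unfolded sx, unfolded rx]
      have "frechet_derivative (form_component AP c (hat AP v0 \<Omega>) [u j, u k, u l]) (at ?x) = frechet_derivative (\<lambda>y. - eps p / (2 * sqrt (1 - (r y)\<^sup>2)) * (- r y * cubA (a y) j k l + cubB (a y) (b y) j k l
         - r y * cubB (b y) (a y) j k l + (2 * (r y)\<^sup>2 - 1) * cubA (b y) j k l)) (at ?x)"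
        by (rule frechet_derivative_cong_open[OF N(1,2) comp])
      then have "frechet_derivative (form_component AP c (hat AP v0 \<Omega>) [u j, u k, u l]) (at ?x) (u i) = frechet_derivative r (at ?x) (u i) *
         (eps p / (2 * sc p ^ 3) * (cubA (a ?x) j k l + cubB (b ?x) (a ?x) j k l) - eps p * ?\<rho> / (2 * sc p ^ 3) * cubB (a ?x) (b ?x) j k l
         - (eps p * ?\<rho> * (2 * ?\<rho>\<^sup>2 - 1) / (2 * sc p ^ 3) + 2 * eps p * ?\<rho> / sc p) * cubA (b ?x) j k l)
       + - eps p / (2 * sc p) * (- ?\<rho> * dcubA (\<lambda>_ j. da j (u i)) (a ?x) i j k l + dcubB (\<lambda>_ j. da j (u i)) (\<lambda>_ j. db j (u i)) (a ?x) (b ?x) i j k l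
       - ?\<rho> * dcubB (\<lambda>_ j. db j (u i)) (\<lambda>_ j. da j (u i)) (b ?x) (a ?x) i j k l + (2 * ?\<rho>\<^sup>2 - 1) * dcubA (\<lambda>_ j. db j (u i)) (b ?x) i j k l)"
        using fun_cong[OF frechet_derivative_at[OF D], of "u i"] by simp
      moreover have "frechet_derivative r (at ?x) (u i) = dr p (X i)"
      proof -
        have "X i = coord_vec AP c p (u i)" using coord_vec_coords[OF P c X] by (simp add: u_def)
        then show ?thesis using \<rho>_pr_smooth_at[of p] by (simp add: dr_def coord_vec_def r_def[abs_def] comp_def)
      qed
      moreover have "dcubA (\<lambda>_ j. da j (u i)) z i j k l = dcubA m z i j k l" "dcubA (\<lambda>_ j. db j (u i)) z i j k l = dcubA n z i j k l"
        "dcubB (\<lambda>_ j. da j (u i)) (\<lambda>_ j. db j (u i)) z z' i j k l = dcubB m n z z' i j k l"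
        "dcubB (\<lambda>_ j. db j (u i)) (\<lambda>_ j. da j (u i)) z z' i j k l = dcubB n m z z' i j k l" for z z'
        by (simp_all add: dcubA_def dcubB_def m_def n_def)
      moreover have "eps p / (2 * sc p ^ 3) = cA" "eps p * ?\<rho> / (2 * sc p ^ 3) = - cB"
        "eps p * ?\<rho> * (2 * ?\<rho>\<^sup>2 - 1) / (2 * sc p ^ 3) + 2 * eps p * ?\<rho> / sc p = - cD"
        by (simp_all add: cA_def cB_def cD_def)
      ultimately show ?thesis by simp
    qed
    let ?a = "\<lambda>j. w p (X j)" and ?b = "\<lambda>j. e p (X j)" and ?T = "\<lambda>i j. tor p (X i) (X j)"
    have s: "(\<lambda>i j. dw p (X i) (X j)) = (\<lambda>i j. ?b i \<times> ?b j - ?a i \<times> ?a j)" by (simp add: fun_eq_iff dw_eq[OF X X])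
    have t: "(\<lambda>i j. de p (X i) (X j)) = (\<lambda>i j. ?T i j + (?a j \<times> ?b i - ?a i \<times> ?b j))" by (simp add: fun_eq_iff tor_def)
    have "alt4 (\<lambda>i j k l. - ?\<rho> * dcubA m ?a i j k l + dcubB m n ?a ?b i j k l - ?\<rho> * dcubB n m ?b ?a i j k l + (2 * ?\<rho>\<^sup>2 - 1) * dcubA n ?b i j k l)
       = - ?\<rho> * alt4 (dcubA m ?a) + alt4 (dcubB m n ?a ?b) - ?\<rho> * alt4 (dcubB n m ?b ?a) + (2 * ?\<rho>\<^sup>2 - 1) * alt4 (dcubA n ?b)"
      unfolding alt4_def by algebra
    \<comment> \<open>The last term arises twice with coefficient -\<rho>: from e x e in dw inside
      www, and from the fourth identity of \<open>split4_identities\<close>.\<close>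
    also have "\<dots> = split4 ?T ?a ?a - ?\<rho> * (split4 ?T ?a ?b + split4 ?T ?b ?a) + (2 * ?\<rho>\<^sup>2 - 1) * split4 ?T ?b ?b
         - 2 * ?\<rho> * split4 (\<lambda>i j. ?b i \<times> ?b j) ?a ?a"
      unfolding alt4_dcub[OF m n] s t split4_linear(1)
      using split4_identities(1)[of ?a] split4_identities(2)[of ?a ?b] split4_identities(4)[of ?b ?a] split4_identities(5)[of ?a ?b]
      unfolding split4_linear(2)[of "\<lambda>i j. ?b i \<times> ?b j" "\<lambda>i j. ?a i \<times> ?a j"] by algebra
    finally have q: "alt4 (\<lambda>i j k l. - ?\<rho> * dcubA m ?a i j k l + dcubB m n ?a ?b i j k l - ?\<rho> * dcubB n m ?b ?a i j k l + (2 * ?\<rho>\<^sup>2 - 1) * dcubA n ?b i j k l)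
       = split4 ?T ?a ?a - ?\<rho> * (split4 ?T ?a ?b + split4 ?T ?b ?a) + (2 * ?\<rho>\<^sup>2 - 1) * split4 ?T ?b ?b - 2 * ?\<rho> * split4 (\<lambda>i j. ?b i \<times> ?b j) ?a ?a" .
    have al: "alt4 (\<lambda>i j k l. F i j k l + z * G i j k l) = alt4 F + z * alt4 G" for F G and z :: real
      by (simp add: alt4_def algebra_simps)
    show ?thesis
      unfolding extd_3 Let_def c_def[symmetric] u_def[symmetric] fr ax by (subst al, subst q, simp)
  qed
  ultimately show thesis using that by blast
qed

end

subsection \<open>Sectional curvature from a coframe\<close>

lemma cross_sum_left: "(\<Sum>i\<in>I. f i) \<times> z = (\<Sum>i\<in>I. f i \<times> z)"
  and cross_sum_right: "z \<times> (\<Sum>i\<in>I. f i) = (\<Sum>i\<in>I. z \<times> f i)"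
proof -
  have "linear (\<lambda>x. x \<times> z)" "linear (\<lambda>x. z \<times> x)" by (auto intro!: linearI simp: cross_add_left cross_add_right cross_mult_left cross_mult_right)
  then show "(\<Sum>i\<in>I. f i) \<times> z = (\<Sum>i\<in>I. f i \<times> z)" "z \<times> (\<Sum>i\<in>I. f i) = (\<Sum>i\<in>I. z \<times> f i)"
    using linear_sum[of "\<lambda>x. x \<times> z" f I] linear_sum[of "\<lambda>x. z \<times> x" f I] by auto
qed

text \<open>The frame vectors are the rows of an invertible matrix.\<close>

lemma frame_separates:
  assumes "tr3 (e 1) (e 2) (e (3::3)) \<noteq> 0" "\<And>m. z \<bullet> e m = z' \<bullet> e m"
  shows "z = z'"
proof -
  let ?M = "\<chi> m. e m :: real ^ 3 ^ 3"
  have d: "det ?M \<noteq> 0" using assms(1) by (simp add: det_3 tr3_components algebra_simps)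
  have "?M *v (z - z') = 0" using assms(2) by (simp add: vec_eq_iff matrix_vector_mul_component inner_diff_right inner_commute)
  then have "z - z' = 0" using d by (metis invertible_det_nz matrix_left_invertible_ker invertible_left_inverse)
  then show ?thesis by simp
qed

lemma matrix_inv_right: "det (G :: real ^ 'n ^ 'n) \<noteq> 0 \<Longrightarrow> G ** matrix_inv G = mat 1"
proof -
  assume "det G \<noteq> 0"
  then have "\<exists>B. G ** B = mat 1 \<and> B ** G = mat 1" using invertible_det_nz[of G] by (simp add: invertible_def)
  from someI_ex[OF this] show ?thesis unfolding matrix_inv_def by blast
qed

text \<open>Cartan's structure equations in coordinates: \<open>e i\<close> and \<open>w i\<close>
  are the values of a soldering form and of a connection form on the i-th coordinate field. The
  connection is torsion-free with curvature \<kappa> times e x e, and e is an isometry onto the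
  standard inner product.\<close>

locale flat_coframe =
  fixes A :: "('m::topological_space, 3) chart set" and g :: "'m \<Rightarrow> 'm tvec \<Rightarrow> 'm tvec \<Rightarrow> real" and c :: "('m, 3) chart"
    and S :: "(real ^ 3) set" and e w :: "3 \<Rightarrow> real ^ 3 \<Rightarrow> real ^ 3" and \<kappa> :: real
  assumes S: "open S" and e: "\<And>i. smooth_on S (e i)" and w: "\<And>i. smooth_on S (w i)"
    and torsion: "\<And>y i j. y \<in> S \<Longrightarrow> frechet_derivative (e j) (at y) (axis i 1) - frechet_derivative (e i) (at y) (axis j 1)
       + w i y \<times> e j y - w j y \<times> e i y = 0"
    and curv: "\<And>y i j. y \<in> S \<Longrightarrow> frechet_derivative (w j) (at y) (axis i 1) - frechet_derivative (w i) (at y) (axis j 1)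
       + w i y \<times> w j y = \<kappa> *\<^sub>R (e i y \<times> e j y)"
    and indep: "\<And>y. y \<in> S \<Longrightarrow> tr3 (e 1 y) (e 2 y) (e 3 y) \<noteq> 0"
    and metric: "\<And>y. y \<in> S \<Longrightarrow> metric_matrix A g c y = (\<chi> i j. e i y \<bullet> e j y)"
begin

definition \<Gamma> :: "3 \<Rightarrow> 3 \<Rightarrow> 3 \<Rightarrow> real ^ 3 \<Rightarrow> real" where "\<Gamma> k i j y = christoffel A g c k i j y"
definition nab :: "3 \<Rightarrow> 3 \<Rightarrow> real ^ 3 \<Rightarrow> real ^ 3" where
  "nab i j y = frechet_derivative (e j) (at y) (axis i 1) + w i y \<times> e j y"

lemma nab_sym: "y \<in> S \<Longrightarrow> nab i j y = nab j i y"
  using torsion[of y j i] by (simp add: nab_def algebra_simps)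

text \<open>The cross product with \<open>w i\<close> is skew, so it can be added to the derivatives
  of e without changing that of the inner product: \<open>nab\<close> is a metric
  connection.\<close>

lemma pd_metric:
  assumes y: "y \<in> S"
  shows "pd i (\<lambda>y. metric_matrix A g c y $ j $ l) y = nab i j y \<bullet> e l y + e j y \<bullet> nab i l y"
proof -
  have de: "(e j has_derivative frechet_derivative (e j) (at y)) (at y)" for j by (rule smooth_on_has_derivative[OF e y])
  have "frechet_derivative (\<lambda>y. metric_matrix A g c y $ j $ l) (at y) = frechet_derivative (\<lambda>y. e j y \<bullet> e l y) (at y)"
    by (rule frechet_derivative_cong_open[OF S y]) (simp add: metric)
  then have "pd i (\<lambda>y. metric_matrix A g c y $ j $ l) y = e j y \<bullet> frechet_derivative (e l) (at y) (axis i 1) + frechet_derivative (e j) (at y) (axis i 1) \<bullet> e l y"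
    unfolding pd_def using fun_cong[OF frechet_derivative_at[OF has_derivative_inner[OF de de]], of j l "axis i 1"] by simp
  moreover have "(a \<times> b) \<bullet> d + b \<bullet> (a \<times> d) = 0" for a b d :: "real ^ 3"
    by (simp add: inner_vec_def sum_3 cross_components algebra_simps)
  ultimately show ?thesis by (simp add: nab_def inner_add)
qed

text \<open>Koszul's argument: as \<open>nab\<close> is symmetric and metric, the three derivatives
  of the metric combine to twice the inner product of \<open>nab i j\<close> with
  \<open>e l\<close>. The inverse Gram matrix then converts these inner products into coefficients
  in the frame.\<close>

lemma christoffel_sum:
  assumes y: "y \<in> S"
  shows "(\<Sum>k\<in>UNIV. \<Gamma> k i j y *\<^sub>R e k y) = nab i j y"
proof (rule frame_separates[of "\<lambda>i. e i y", OF indep[OF y]])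
  fix m
  let ?G = "metric_matrix A g c y"
  have G: "?G = (\<chi> i j. e i y \<bullet> e j y)" by (rule metric[OF y])
  have "det ?G \<noteq> 0" unfolding G gram_det_3[of "\<lambda>i. e i y"] using indep[OF y] by simp
  from matrix_inv_right[OF this] have inv: "(\<Sum>k\<in>UNIV. ?G $ m $ k * matrix_inv ?G $ k $ l) = (if m = l then 1 else 0)" for l
    by (simp add: matrix_matrix_mult_def mat_def vec_eq_iff)
  have ch: "\<Gamma> k i j y = (\<Sum>l\<in>UNIV. matrix_inv ?G $ k $ l * (nab i j y \<bullet> e l y))" for k
  proof -
    have "\<Gamma> k i j y = (1 / 2) * (\<Sum>l\<in>UNIV. matrix_inv ?G $ k $ l * (2 * (nab i j y \<bullet> e l y)))"
      unfolding \<Gamma>_def christoffel_def Let_def pd_metric[OF y]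
    proof (intro arg_cong2[of _ _ _ _ "(*)"] sum.cong refl)
      fix l
      show "nab i j y \<bullet> e l y + e j y \<bullet> nab i l y + (nab j i y \<bullet> e l y + e i y \<bullet> nab j l y) - (nab l i y \<bullet> e j y + e i y \<bullet> nab l j y)
         = 2 * (nab i j y \<bullet> e l y)"
        using nab_sym[OF y, of j i] nab_sym[OF y, of l i] nab_sym[OF y, of l j] by (simp add: inner_commute)
    qed
    then show ?thesis by (simp add: sum_distrib_left mult.left_commute)
  qed
  have "(\<Sum>k\<in>UNIV. \<Gamma> k i j y *\<^sub>R e k y) \<bullet> e m y = (\<Sum>k\<in>UNIV. \<Sum>l\<in>UNIV. matrix_inv ?G $ k $ l * (nab i j y \<bullet> e l y) * ?G $ m $ k)"
    unfolding inner_sum_left ch by (simp add: G sum_distrib_right inner_commute)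
  also have "\<dots> = (\<Sum>l\<in>UNIV. (nab i j y \<bullet> e l y) * (\<Sum>k\<in>UNIV. ?G $ m $ k * matrix_inv ?G $ k $ l))"
    by (subst sum.swap) (simp add: sum_distrib_left ac_simps)
  also have "\<dots> = nab i j y \<bullet> e m y" by (simp add: inv if_distrib cong: if_cong)
  finally show "(\<Sum>k\<in>UNIV. \<Gamma> k i j y *\<^sub>R e k y) \<bullet> e m y = nab i j y \<bullet> e m y" .
qed

lemma nab_smooth: "smooth_on S (nab i j)"
  unfolding nab_def[abs_def] by (intro smooth_on_add smooth_on_cross3 S smooth_on_frechet e w)

text \<open>The symbols are the coefficients of the smooth vector \<open>nab i j\<close> in the
  frame, so Cramer's rule applies in place of a derivative of \<open>matrix_inv\<close>.\<close>

lemma \<Gamma>_smooth: "smooth_on S (\<Gamma> k i j)"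
proof -
  have "smooth_on S (\<lambda>y. \<chi> k. \<Gamma> k i j y)"
  proof (rule smooth_on_linear_solve[OF S, where M = "\<lambda>y. \<chi> a k. e k y $ a" and b = "nab i j"])
    fix y assume y: "y \<in> S"
    show "det (\<chi> a k. e k y $ a) \<noteq> 0" using indep[OF y] by (simp add: det_3 tr3_components algebra_simps)
    show "(\<chi> a k. e k y $ a) *v (\<chi> k. \<Gamma> k i j y) = nab i j y"
      unfolding christoffel_sum[OF y, symmetric] by (simp add: vec_eq_iff matrix_vector_mult_def mult.commute)
  qed (simp_all add: smooth_on_vec_nth[OF S] e nab_smooth)
  from smooth_on_vec_nth[OF S this, of k] show ?thesis by simp
qed

text \<open>The covariant derivative of \<open>nab\<close> is computed twice. From its definition,
  antisymmetrising leaves the curvature of w acting on \<open>e j\<close>; from the expansion in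
  Christoffel symbols, it leaves the curvature tensor.\<close>

lemma curvature_sum:
  assumes x: "x \<in> S"
  shows "(\<Sum>m\<in>UNIV. curvature_tensor A g c m j l i x *\<^sub>R e m x) = \<kappa> *\<^sub>R ((e l x \<times> e i x) \<times> e j x)"
proof -
  let ?D = "\<lambda>f i. frechet_derivative f (at x) (axis i 1)"
  have de: "(e j has_derivative frechet_derivative (e j) (at x)) (at x)" for j by (rule smooth_on_has_derivative[OF e x])
  have dw: "(w j has_derivative frechet_derivative (w j) (at x)) (at x)" for j by (rule smooth_on_has_derivative[OF w x])
  have d\<Gamma>: "(\<Gamma> k i j has_derivative frechet_derivative (\<Gamma> k i j) (at x)) (at x)" for k i j by (rule smooth_on_has_derivative[OF \<Gamma>_smooth x])
  define DD where "DD l i j = frechet_derivative (\<lambda>y. frechet_derivative (e j) (at y) (axis i 1)) (at x) (axis l 1)" for l i j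
  have sym: "DD l i j = DD i l j" for l i j unfolding DD_def by (rule frechet_derivative_commute[OF S x e])
  have 1: "?D (nab i j) l = DD l i j + w i x \<times> ?D (e j) l + ?D (w i) l \<times> e j x" for l i j
  proof -
    have "(nab i j has_derivative (\<lambda>u. frechet_derivative (\<lambda>y. frechet_derivative (e j) (at y) (axis i 1)) (at x) u
       + (w i x \<times> frechet_derivative (e j) (at x) u + frechet_derivative (w i) (at x) u \<times> e j x))) (at x)"
      unfolding nab_def[abs_def]
      by (intro has_derivative_add smooth_on_has_derivative[OF smooth_on_frechet[OF e] x] has_derivative_cross3 de dw)
    from fun_cong[OF frechet_derivative_at[OF this], of "axis l 1"] show ?thesis by (simp add: DD_def add.assoc)
  qed
  \<comment> \<open>The second computation: differentiate the Christoffel expansion instead of the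
    definition of \<open>nab\<close>.\<close>
  have 2: "?D (nab i j) l = (\<Sum>k\<in>UNIV. \<Gamma> k i j x *\<^sub>R ?D (e k) l + pd l (\<Gamma> k i j) x *\<^sub>R e k x)" for l i j
  proof -
    have "((\<lambda>y. \<Sum>k\<in>UNIV. \<Gamma> k i j y *\<^sub>R e k y) has_derivative
      (\<lambda>u. \<Sum>k\<in>UNIV. \<Gamma> k i j x *\<^sub>R frechet_derivative (e k) (at x) u + frechet_derivative (\<Gamma> k i j) (at x) u *\<^sub>R e k x)) (at x)"
      by (intro has_derivative_sum has_derivative_scaleR d\<Gamma> de)
    then have "(nab i j has_derivative
      (\<lambda>u. \<Sum>k\<in>UNIV. \<Gamma> k i j x *\<^sub>R frechet_derivative (e k) (at x) u + frechet_derivative (\<Gamma> k i j) (at x) u *\<^sub>R e k x)) (at x)"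
      by (rule has_derivative_transform_within_open[OF _ S x]) (rule christoffel_sum)
    from fun_cong[OF frechet_derivative_at[OF this], of "axis l 1"] show ?thesis by (simp add: pd_def)
  qed
  have 3: "?D (nab i j) l + w l x \<times> nab i j x = (\<Sum>m\<in>UNIV. (pd l (\<Gamma> m i j) x + (\<Sum>k\<in>UNIV. \<Gamma> m l k x * \<Gamma> k i j x)) *\<^sub>R e m x)" for l i j
  proof -
    have "?D (nab i j) l + w l x \<times> nab i j x = (\<Sum>k\<in>UNIV. pd l (\<Gamma> k i j) x *\<^sub>R e k x) + (\<Sum>k\<in>UNIV. \<Gamma> k i j x *\<^sub>R nab l k x)"
    proof -
      have "w l x \<times> nab i j x = (\<Sum>k\<in>UNIV. \<Gamma> k i j x *\<^sub>R (w l x \<times> e k x))"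
        by (simp only: christoffel_sum[OF x, symmetric] cross_sum_right cross_mult_right)
      then show ?thesis unfolding 2 by (simp add: nab_def[of l] sum.distrib scaleR_add_right)
    qed
    also have "(\<Sum>k\<in>UNIV. \<Gamma> k i j x *\<^sub>R nab l k x) = (\<Sum>m\<in>UNIV. (\<Sum>k\<in>UNIV. \<Gamma> m l k x * \<Gamma> k i j x) *\<^sub>R e m x)"
      unfolding christoffel_sum[OF x, where i = l, symmetric] scaleR_sum_right scaleR_sum_left
      by (subst sum.swap) (simp add: mult.commute)
    finally show ?thesis by (simp add: scaleR_add_left sum.distrib)
  qed
  have "(\<Sum>m\<in>UNIV. curvature_tensor A g c m j l i x *\<^sub>R e m x) = (?D (nab i j) l + w l x \<times> nab i j x) - (?D (nab l j) i + w i x \<times> nab l j x)"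
    unfolding 3 sum_subtractf[symmetric] scaleR_diff_left[symmetric]
    by (simp add: curvature_tensor_def Let_def \<Gamma>_def[abs_def] sum_subtractf algebra_simps)
  also have "\<dots> = (?D (w i) l - ?D (w l) i + w l x \<times> w i x) \<times> e j x"
    unfolding 1 sym[of l i j] nab_def
    by (simp add: vec_eq_iff forall_3 cross_components) (simp add: algebra_simps)
  also have "\<dots> = \<kappa> *\<^sub>R ((e l x \<times> e i x) \<times> e j x)"
    unfolding curv[OF x] by (rule cross_mult_left)
  finally show ?thesis .
qed

text \<open>By Lagrange's identity both numerator and denominator reduce to the squared length of
  the cross product of the frame images; the double cross product in the numerator brings the minus
  sign.\<close>

lemma sectional_curvature_const:
  assumes x: "x \<in> S" and uv: "u \<noteq> v" "independent {u, v}"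
  shows "sectional_curvature A g c x u v = - \<kappa>"
proof -
  define vec where "vec u = (\<Sum>i\<in>UNIV. u $ i *\<^sub>R e i x)" for u :: "real ^ 3"
  let ?G = "metric_matrix A g c x"
  let ?R = "\<lambda>l k i j. curvature_tensor A g c l k i j x"
  have G: "?G = (\<chi> i j. e i x \<bullet> e j x)" by (rule metric[OF x])
  have ip: "a \<bullet> (?G *v b) = vec a \<bullet> vec b" for a b
    by (simp add: G vec_def inner_vec_def[of a] matrix_vector_mult_def inner_sum_left inner_sum_right sum_distrib_left ac_simps)
       (subst sum.swap, simp add: inner_commute)
  have num: "(\<Sum>m\<in>UNIV. \<Sum>l\<in>UNIV. \<Sum>k\<in>UNIV. \<Sum>i\<in>UNIV. \<Sum>j\<in>UNIV. ?G $ m $ l * ?R l k i j * u $ i * v $ j * v $ k * u $ m)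
      = \<kappa> * (vec u \<bullet> ((vec u \<times> vec v) \<times> vec v))"
  proof -
    have "\<kappa> *\<^sub>R ((vec u \<times> vec v) \<times> vec v) = (\<Sum>k\<in>UNIV. \<Sum>i\<in>UNIV. \<Sum>j\<in>UNIV. (u $ i * v $ j * v $ k) *\<^sub>R (\<kappa> *\<^sub>R ((e i x \<times> e j x) \<times> e k x)))"
    proof -
      have "vec u \<times> vec v = (\<Sum>i\<in>UNIV. \<Sum>j\<in>UNIV. (u $ i * v $ j) *\<^sub>R (e i x \<times> e j x))"
        unfolding vec_def cross_sum_left cross_sum_right cross_mult_left cross_mult_right
        by (simp add: scaleR_sum_right) (subst sum.swap, simp add: mult.commute)
      note uxv = this
      have xv: "X \<times> vec v = (\<Sum>k\<in>UNIV. v $ k *\<^sub>R (X \<times> e k x))" for X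
        by (simp only: vec_def cross_sum_right cross_mult_right)
      have "(vec u \<times> vec v) \<times> vec v = (\<Sum>k\<in>UNIV. \<Sum>i\<in>UNIV. \<Sum>j\<in>UNIV. (u $ i * v $ j * v $ k) *\<^sub>R ((e i x \<times> e j x) \<times> e k x))"
        unfolding xv[of "vec u \<times> vec v"] unfolding uxv cross_sum_left cross_mult_left by (simp add: scaleR_sum_right mult.commute)
      then show ?thesis by (simp add: scaleR_sum_right mult.commute)
    qed
    also have "\<dots> = (\<Sum>k\<in>UNIV. \<Sum>i\<in>UNIV. \<Sum>j\<in>UNIV. \<Sum>l\<in>UNIV. (?R l k i j * u $ i * v $ j * v $ k) *\<^sub>R e l x)"
      unfolding curvature_sum[OF x, symmetric] scaleR_sum_right by (simp add: ac_simps)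
    finally have K: "\<kappa> *\<^sub>R ((vec u \<times> vec v) \<times> vec v) = (\<Sum>k\<in>UNIV. \<Sum>i\<in>UNIV. \<Sum>j\<in>UNIV. \<Sum>l\<in>UNIV. (?R l k i j * u $ i * v $ j * v $ k) *\<^sub>R e l x)" .
    have "\<kappa> * (vec u \<bullet> ((vec u \<times> vec v) \<times> vec v)) = vec u \<bullet> (\<kappa> *\<^sub>R ((vec u \<times> vec v) \<times> vec v))" by simp
    also have "\<dots> = (\<Sum>m\<in>UNIV. \<Sum>k\<in>UNIV. \<Sum>i\<in>UNIV. \<Sum>j\<in>UNIV. \<Sum>l\<in>UNIV. ?G $ m $ l * ?R l k i j * u $ i * v $ j * v $ k * u $ m)"
    proof -
      have h: "vec u \<bullet> Z = (\<Sum>m\<in>UNIV. (u $ m *\<^sub>R e m x) \<bullet> Z)" for Z by (simp only: vec_def inner_sum_left)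
      show ?thesis unfolding h unfolding K by (simp only: inner_sum_right G) (simp add: ac_simps)
    qed
    also have "\<dots> = (\<Sum>m\<in>UNIV. \<Sum>l\<in>UNIV. \<Sum>k\<in>UNIV. \<Sum>i\<in>UNIV. \<Sum>j\<in>UNIV. ?G $ m $ l * ?R l k i j * u $ i * v $ j * v $ k * u $ m)"
    proof (rule sum.cong[OF refl])
      fix m
      let ?f = "\<lambda>k i j l. ?G $ m $ l * ?R l k i j * u $ i * v $ j * v $ k * u $ m"
      have "(\<Sum>k\<in>UNIV. \<Sum>i\<in>UNIV. \<Sum>j\<in>UNIV. \<Sum>l\<in>UNIV. ?f k i j l) = (\<Sum>k\<in>UNIV. \<Sum>i\<in>UNIV. \<Sum>l\<in>UNIV. \<Sum>j\<in>UNIV. ?f k i j l)"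
        by (intro sum.cong refl sum.swap)
      also have "\<dots> = (\<Sum>k\<in>UNIV. \<Sum>l\<in>UNIV. \<Sum>i\<in>UNIV. \<Sum>j\<in>UNIV. ?f k i j l)"
        by (intro sum.cong refl sum.swap)
      also have "\<dots> = (\<Sum>l\<in>UNIV. \<Sum>k\<in>UNIV. \<Sum>i\<in>UNIV. \<Sum>j\<in>UNIV. ?f k i j l)" by (rule sum.swap)
      finally show "(\<Sum>k\<in>UNIV. \<Sum>i\<in>UNIV. \<Sum>j\<in>UNIV. \<Sum>l\<in>UNIV. ?f k i j l) = (\<Sum>l\<in>UNIV. \<Sum>k\<in>UNIV. \<Sum>i\<in>UNIV. \<Sum>j\<in>UNIV. ?f k i j l)" .
    qed
    finally show ?thesis by simp
  qed
  have lag: "a \<bullet> ((a \<times> b) \<times> b) = - ((a \<bullet> a) * (b \<bullet> b) - (a \<bullet> b)\<^sup>2)" "(a \<bullet> a) * (b \<bullet> b) - (a \<bullet> b)\<^sup>2 = (a \<times> b) \<bullet> (a \<times> b)" for a b :: "real ^ 3"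
    by (simp_all add: inner_vec_def sum_3 cross_components power2_eq_square algebra_simps)
  have nz: "vec u \<times> vec v \<noteq> 0"
  proof
    assume 0: "vec u \<times> vec v = 0"
    \<comment> \<open>The cross product of the images, paired with the frame, is u x v times the
      frame determinant, so independence of u and v survives.\<close>
    have "(vec u \<times> vec v) \<bullet> e 1 x = (u \<times> v) $ 1 * tr3 (e 1 x) (e 2 x) (e 3 x)"
      "(vec u \<times> vec v) \<bullet> e 2 x = (u \<times> v) $ 2 * tr3 (e 1 x) (e 2 x) (e 3 x)"
      "(vec u \<times> vec v) \<bullet> e 3 x = (u \<times> v) $ 3 * tr3 (e 1 x) (e 2 x) (e 3 x)"
      unfolding vec_def sum_3 inner_vec_def cross_components tr3_components vector_add_component vector_scaleR_component inner_real_def real_scaleR_def by algebra+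
    then have "u \<times> v = 0" using indep[OF x] unfolding 0 by (simp add: vec_eq_iff forall_3)
    then have "u = 0 \<or> v = 0 \<or> (\<exists>r. v = r *\<^sub>R u)" using cross_eq_0 collinear_lemma by blast
    moreover have "u \<noteq> 0" "v \<noteq> 0" using uv(2) dependent_zero by blast+
    moreover have "v \<noteq> r *\<^sub>R u" for r
    proof
      assume "v = r *\<^sub>R u"
      then have "v \<in> span ({u, v} - {v})" using uv(1) by (simp add: insert_Diff_if span_mul span_base)
      then show False using uv(2) by (auto simp: dependent_def)
    qed
    ultimately show False by blast
  qed
  then have d: "(vec u \<bullet> vec u) * (vec v \<bullet> vec v) - (vec u \<bullet> vec v)\<^sup>2 \<noteq> 0" unfolding lag by simp
  show ?thesis
    unfolding sectional_curvature_def Let_def num ip unfolding lag(1) using d by (simp add: field_simps)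
qed

end

section \<open>Constant curvature of the metrics on M\<close>

context deformed_cs
begin

text \<open>One statement for two metrics: k = 1 gives \<open>g\<^sub>E\<close>, k = sqrt(1 - r^2)
  the metric of J. Along a local section, passing from w to w - r e removes the torsion 2r e x e and
  turns the curvature e x e into (1 - r^2) e x e; rescaling e by k divides this constant by
  k^2.\<close>

lemma constant_curvature_of_structure:
  assumes r: "\<And>x. \<rho> x = r" and tor: "\<And>p X Y. X \<in> tangent AP p \<Longrightarrow> Y \<in> tangent AP p \<Longrightarrow> tor p X Y = (2 * r) *\<^sub>R (e p X \<times> e p Y)"
    and k: "k > 0" and g: "\<And>p X Y. X \<in> tangent AP p \<Longrightarrow> Y \<in> tangent AP p \<Longrightarrow>
      g (pr p) (push AM pr p X) (push AM pr p Y) = k\<^sup>2 * (e p X \<bullet> e p Y)"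
  shows "constant_negative_curvature AM g"
  unfolding constant_negative_curvature_def
proof (intro exI[of _ "- ((1 - r\<^sup>2) / k\<^sup>2)"] conjI ballI allI impI)
  have "r\<^sup>2 < 1" using \<rho>_bound r by metis
  then show "- ((1 - r\<^sup>2) / k\<^sup>2) < 0" using k by simp
  fix c x u z assume c: "c \<in> AM" and x: "x \<in> snd c ` fst c" and uv: "u \<noteq> z \<and> independent {u, z :: real ^ 3}"
  obtain p where p: "pr p = chart_inv c x" using pr_surj by blast
  obtain U \<sigma> where s: "open U" "pr p \<in> U" "\<sigma> (pr p) = p" "\<And>x. x \<in> U \<Longrightarrow> pr (\<sigma> x) = x"
    "\<And>c. c \<in> AM \<Longrightarrow> smooth_param AP (snd c ` (fst c \<inter> U)) (\<lambda>x. \<sigma> (chart_inv c x))"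
    using local_section[of p] by blast
  define S where "S = snd c ` (fst c \<inter> U)"
  define \<phi> where "\<phi> y = \<sigma> (chart_inv c y)" for y
  have S: "open S" unfolding S_def by (rule chart_image_open[OF M c s(1)])
  have xS: "x \<in> S" using s(2) p chart_inv_in[OF M c x] chart_inv_right[OF M c x] unfolding S_def by (intro image_eqI[of _ _ "chart_inv c x"]) auto
  have \<phi>: "smooth_param AP S \<phi>" unfolding S_def \<phi>_def[abs_def] by (rule s(5)[OF c])
  note t = pvec_in_tangent[OF P \<phi>]
  have pr\<phi>: "pr (\<phi> y) = chart_inv c y" if "y \<in> S" for y
    using that s(4) chart_inv_left[OF M c] by (auto simp: S_def \<phi>_def)
  have push: "push AM pr (\<phi> y) (pvec AP \<phi> y z) = coord_vec AM c (chart_inv c y) z" if "y \<in> S" for y z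
    using push_section[OF c s(1,4), of y z] that by (simp add: S_def \<phi>_def[abs_def])
  define ee where "ee i y = k *\<^sub>R e (\<phi> y) (pvec AP \<phi> y (axis i 1))" for i :: 3 and y
  define ww where "ww i y = w (\<phi> y) (pvec AP \<phi> y (axis i 1)) - r *\<^sub>R e (\<phi> y) (pvec AP \<phi> y (axis i 1))" for i :: 3 and y
  note se = pullback_we(2)[OF \<phi>] and sw = pullback_we(1)[OF \<phi>]
  interpret flat_coframe AM g c S ee ww "(1 - r\<^sup>2) / k\<^sup>2"
  proof
    show "open S" by (rule S)
    show "smooth_on S (ee i)" for i unfolding ee_def[abs_def] by (intro smooth_on_scaleR smooth_on_const S se)
    show "smooth_on S (ww i)" for i unfolding ww_def[abs_def] by (intro smooth_on_diff smooth_on_scaleR smooth_on_const S se sw)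
    fix y assume y: "y \<in> S"
    have De: "frechet_derivative (ee j) (at y) z = k *\<^sub>R frechet_derivative (\<lambda>y. e (\<phi> y) (pvec AP \<phi> y (axis j 1))) (at y) z" for j z
      unfolding ee_def[abs_def] by (rule frechet_derivative_bounded_linear[OF bounded_linear_scaleR_right smooth_on_imp_differentiable[OF se y]])
    have Dw: "frechet_derivative (ww j) (at y) z = frechet_derivative (\<lambda>y. w (\<phi> y) (pvec AP \<phi> y (axis j 1))) (at y) z
        - r *\<^sub>R frechet_derivative (\<lambda>y. e (\<phi> y) (pvec AP \<phi> y (axis j 1))) (at y) z" for j z
    proof -
      have "(ww j has_derivative (\<lambda>z. frechet_derivative (\<lambda>y. w (\<phi> y) (pvec AP \<phi> y (axis j 1))) (at y) z
        - r *\<^sub>R frechet_derivative (\<lambda>y. e (\<phi> y) (pvec AP \<phi> y (axis j 1))) (at y) z)) (at y)"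
        unfolding ww_def[abs_def]
        by (intro has_derivative_diff has_derivative_scaleR_right smooth_on_has_derivative[OF se y] smooth_on_has_derivative[OF sw y])
      from fun_cong[OF frechet_derivative_at[OF this], of z] show ?thesis by simp
    qed
    define a where "a i = w (\<phi> y) (pvec AP \<phi> y (axis i 1))" for i :: 3
    define b where "b i = e (\<phi> y) (pvec AP \<phi> y (axis i 1))" for i :: 3
    have eb: "ee i y = k *\<^sub>R b i" "ww i y = a i - r *\<^sub>R b i" for i by (simp_all add: ee_def ww_def a_def b_def)
    have dee: "frechet_derivative (\<lambda>y. e (\<phi> y) (pvec AP \<phi> y (axis j 1))) (at y) (axis i 1) - frechet_derivative (\<lambda>y. e (\<phi> y) (pvec AP \<phi> y (axis i 1))) (at y) (axis j 1)
       = (2 * r) *\<^sub>R (b i \<times> b j) - a i \<times> b j + a j \<times> b i" for i j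
    proof -
      have h: "de (\<phi> y) (pvec AP \<phi> y (axis i 1)) (pvec AP \<phi> y (axis j 1)) + a i \<times> b j - a j \<times> b i = (2 * r) *\<^sub>R (b i \<times> b j)"
        using tor[OF t[OF y] t[OF y], of "axis i 1" "axis j 1"] by (simp add: tor_def a_def b_def)
      have "de (\<phi> y) (pvec AP \<phi> y (axis i 1)) (pvec AP \<phi> y (axis j 1)) = (2 * r) *\<^sub>R (b i \<times> b j) - a i \<times> b j + a j \<times> b i"
        unfolding h[symmetric] by simp
      then show ?thesis using pullback_we(4)[OF \<phi> y, of "axis i 1" "axis j 1"] by simp
    qed
    have dww: "frechet_derivative (\<lambda>y. w (\<phi> y) (pvec AP \<phi> y (axis j 1))) (at y) (axis i 1) - frechet_derivative (\<lambda>y. w (\<phi> y) (pvec AP \<phi> y (axis i 1))) (at y) (axis j 1)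
       = b i \<times> b j - a i \<times> a j" for i j
      using pullback_we(3)[OF \<phi> y, of "axis i 1" "axis j 1"] dw_eq[OF t[OF y] t[OF y], of "axis i 1" "axis j 1"]
      by (simp add: a_def b_def)
    show "frechet_derivative (ee j) (at y) (axis i 1) - frechet_derivative (ee i) (at y) (axis j 1) + ww i y \<times> ee j y - ww j y \<times> ee i y = 0" for i j
      unfolding De scaleR_diff_right[symmetric] dee eb
      by (simp add: vec_eq_iff forall_3 cross_components) (simp add: algebra_simps)
    have "frechet_derivative (ww j) (at y) (axis i 1) - frechet_derivative (ww i) (at y) (axis j 1)
      = (frechet_derivative (\<lambda>y. w (\<phi> y) (pvec AP \<phi> y (axis j 1))) (at y) (axis i 1) - frechet_derivative (\<lambda>y. w (\<phi> y) (pvec AP \<phi> y (axis i 1))) (at y) (axis j 1))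
       - r *\<^sub>R (frechet_derivative (\<lambda>y. e (\<phi> y) (pvec AP \<phi> y (axis j 1))) (at y) (axis i 1) - frechet_derivative (\<lambda>y. e (\<phi> y) (pvec AP \<phi> y (axis i 1))) (at y) (axis j 1))" for i j
      unfolding Dw by (simp add: algebra_simps)
    then have Dww: "frechet_derivative (ww j) (at y) (axis i 1) - frechet_derivative (ww i) (at y) (axis j 1)
      = (b i \<times> b j - a i \<times> a j) - r *\<^sub>R ((2 * r) *\<^sub>R (b i \<times> b j) - a i \<times> b j + a j \<times> b i)" for i j
      unfolding dee dww .
    show "frechet_derivative (ww j) (at y) (axis i 1) - frechet_derivative (ww i) (at y) (axis j 1) + ww i y \<times> ww j y
       = ((1 - r\<^sup>2) / k\<^sup>2) *\<^sub>R (ee i y \<times> ee j y)" for i j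
    proof -
      have "((1 - r\<^sup>2) / k\<^sup>2) *\<^sub>R (ee i y \<times> ee j y) = (1 - r\<^sup>2) *\<^sub>R (b i \<times> b j)"
        using k by (simp add: eb cross_mult_left cross_mult_right power2_eq_square)
      then show ?thesis
        unfolding Dww eb by (simp add: vec_eq_iff forall_3 cross_components power2_eq_square) (simp add: algebra_simps)
    qed
    have yc: "y \<in> snd c ` fst c" using y by (auto simp: S_def)
    have "tr3 (b 1) (b 2) (b 3) = v (chart_inv c y) (map (coord_vec AM c (chart_inv c y)) std_basis)"
      using volume_eq[OF t[OF y] t[OF y] t[OF y], of "axis 1 1" "axis 2 1" "axis 3 1"] unfolding push[OF y] pr\<phi>[OF y]
      by (simp add: b_def std_basis_3)
    then have "tr3 (b 1) (b 2) (b 3) > 0" using volume_pos[OF c chart_inv_in[OF M c yc]] by simp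
    then show "tr3 (ee 1 y) (ee 2 y) (ee 3 y) \<noteq> 0" using k by (simp add: eb tr3_linear)
    have "g (chart_inv c y) (coord_vec AM c (chart_inv c y) (axis i 1)) (coord_vec AM c (chart_inv c y) (axis j 1)) = ee i y \<bullet> ee j y" for i j
      using g[OF t[OF y] t[OF y], of "axis i 1" "axis j 1"] unfolding push[OF y] pr\<phi>[OF y]
      by (simp add: eb b_def power2_eq_square)
    then show "metric_matrix AM g c y = (\<chi> i j. ee i y \<bullet> ee j y)"
      by (simp add: metric_matrix_def Let_def)
  qed
  show "sectional_curvature AM g c x u z = - ((1 - r\<^sup>2) / k\<^sup>2)"
    using sectional_curvature_const[OF xS] uv by blast
qed

end

subsection \<open>The almost-complex structure is admissible\<close>

text \<open>The elements of SU(2) are the matrices with rows (a, b) and (-cnj b, cnj a) where |a|^2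
  + |b|^2 = 1, so the group is a linear image of the 3-sphere.\<close>

lemma connected_SU2: "connected SU2"
proof -
  define f :: "real ^ 4 \<Rightarrow> cmat" where "f q = (\<chi> i j. if i = 1 then (if j = 1 then Complex (q$1) (q$2) else Complex (q$3) (q$4))
     else (if j = 1 then Complex (- q$3) (q$4) else Complex (q$1) (- q$2)))" for q
  have f: "f q $ 1 $ 1 = Complex (q$1) (q$2)" "f q $ 1 $ 2 = Complex (q$3) (q$4)"
    "f q $ 2 $ 1 = Complex (- q$3) (q$4)" "f q $ 2 $ 2 = Complex (q$1) (- q$2)" for q
    by (simp_all add: f_def)
  have "linear f"
    by (rule linearI) (simp_all add: vec_eq_iff forall_2 f complex_eq_iff)
  then have "continuous_on (sphere 0 1) f" by (rule linear_continuous_on[OF linear_conv_bounded_linear[THEN iffD1]])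
  moreover have "connected (sphere (0 :: real ^ 4) 1)" by (rule connected_sphere) simp
  moreover have "f ` sphere 0 1 = SU2"
  proof (intro set_eqI iffI)
    fix g assume "g \<in> f ` sphere 0 1"
    then obtain q where q: "g = f q" "norm q = 1" by auto
    then have "q \<bullet> q = 1" by (simp add: norm_eq_sqrt_inner)
    then have n: "q$1 * q$1 + q$2 * q$2 + q$3 * q$3 + q$4 * q$4 = 1" by (simp add: inner_vec_def sum_4)
    have "g ** adjoint_mat g = mat 1"
      using n by (simp add: q(1) vec_eq_iff forall_2 matrix_matrix_mult_def sum_2 adjoint_mat_def f mat_def complex_eq_iff algebra_simps)
    moreover have "det g = 1" using n by (simp add: q(1) det_2 f complex_eq_iff algebra_simps)
    ultimately show "g \<in> SU2" by (simp add: SU2_def)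
  next
    fix g assume g: "g \<in> SU2"
    define a b c d where "a = g$1$1" and "b = g$1$2" and "c = g$2$1" and "d = g$2$2"
    have "g ** adjoint_mat g = mat 1" and dt: "a * d - b * c = 1"
      using g by (auto simp: SU2_def det_2 a_def b_def c_def d_def)
    then have 1: "a * cnj a + b * cnj b = 1" "c * cnj a + d * cnj b = 0"
      by (simp_all add: vec_eq_iff forall_2 matrix_matrix_mult_def sum_2 adjoint_mat_def mat_def a_def b_def c_def d_def)
    \<comment> \<open>Multiply the determinant equation by cnj a; orthogonality of the rows replaces
      c cnj a by -d cnj b, and the unit length of the first row remains as a factor of d.\<close>
    have d: "d = cnj a" using 1 dt by algebra
    have c: "c = - cnj b" using 1 dt by algebra
    define q :: "real ^ 4" where "q = (\<chi> i. if i = 1 then Re a else if i = 2 then Im a else if i = 3 then Re b else Im b)"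
    have q: "q$1 = Re a" "q$2 = Im a" "q$3 = Re b" "q$4 = Im b" by (simp_all add: q_def)
    have "q \<bullet> q = 1" using 1(1) by (simp add: inner_vec_def sum_4 q complex_eq_iff)
    then have "q \<in> sphere 0 1" by (simp add: norm_eq_sqrt_inner)
    moreover have "g = f q" using c d by (simp add: vec_eq_iff forall_2 f q a_def b_def c_def d_def complex_eq_iff)
    ultimately show "g \<in> f ` sphere 0 1" by blast
  qed
  ultimately show ?thesis using connected_continuous_image by metis
qed

lemma smooth_on_join6:
  assumes "open S" "smooth_on S f" "smooth_on S g"
  shows "smooth_on S (\<lambda>x. join6 (f x) (g x) $ i)"
  using exhaust_6[of i] by (elim disjE) (simp_all add: join6_def smooth_on_vec_nth assms)

context connection_frame
begin

text \<open>The adjoint action of the inverse of g, as is natural for a right action, in coordinates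
  on su(2).\<close>

definition Ad :: "cmat \<Rightarrow> real ^ 3 \<Rightarrow> real ^ 3" where
  "Ad g a = vec_of_su2 (matrix_inv g ** su2_of_vec a ** g)"

lemma linear_Ad: "linear (Ad g)"
proof -
  have "bounded_linear (\<lambda>a. matrix_inv g ** su2_of_vec a ** g)"
    by (rule bounded_linear_compose[OF bounded_linear_matrix_mult_right bounded_linear_compose[OF bounded_linear_matrix_mult_left bounded_linear_su2_of_vec]])
  from bounded_linear.linear[OF bounded_linear_compose[OF bounded_linear_vec_of_su2 this]]
  show ?thesis by (simp add: Ad_def[abs_def])
qed

lemma push_act_tangent: "g \<in> SU2 \<Longrightarrow> X \<in> tangent AP p \<Longrightarrow> push AP (\<lambda>q. act q g) p X \<in> tangent AP (act p g)"
  by (rule push_tangent[OF P P smooth_act])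

lemma we_act:
  assumes g: "g \<in> SU2" and X: "X \<in> tangent AP p"
  shows "w (act p g) (push AP (\<lambda>q. act q g) p X) = Ad g (w p X)"
    "e (act p g) (push AP (\<lambda>q. act q g) p X) = Ad g (e p X)"
proof -
  have "form_eq AP 1 (pullback AP (\<lambda>p. act p g) W) (\<lambda>p Xs. matrix_inv g ** W p Xs ** g)"
    "form_eq AP 1 (pullback AP (\<lambda>p. act p g) E) (\<lambda>p Xs. matrix_inv g ** E p Xs ** g)"
    using W E g by (auto simp: is_connection_def is_frame_def equivariant_form_def)
  then have "W (act p g) [push AP (\<lambda>q. act q g) p X] = matrix_inv g ** W p [X] ** g"
    "E (act p g) [push AP (\<lambda>q. act q g) p X] = matrix_inv g ** E p [X] ** g"
    using X by (simp_all add: form_eq_1[unfolded One_nat_def] pullback_def)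
  then show "w (act p g) (push AP (\<lambda>q. act q g) p X) = Ad g (w p X)"
    "e (act p g) (push AP (\<lambda>q. act q g) p X) = Ad g (e p X)"
    unfolding w_def[of "act p g"] e_def[of "act p g"] Ad_def by (simp_all add: W_eq[OF X] E_eq[OF X])
qed

lemma push_act_lift:
  assumes g: "g \<in> SU2"
  shows "push AP (\<lambda>q. act q g) p (lift p a b) = lift (act p g) (Ad g a) (Ad g b)"
  by (rule lift_eqI) (simp_all only: push_act_tangent[OF g] we_act[OF g] lift_props)

lemma we_chart_smooth:
  assumes c: "c \<in> AP"
  shows "smooth_on (snd c ` fst c) (\<lambda>y. w (chart_inv c y) (coord_vec AP c (chart_inv c y) u))"
    "smooth_on (snd c ` fst c) (\<lambda>y. e (chart_inv c y) (coord_vec AP c (chart_inv c y) u))"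
  by (rule smooth_on_cong[OF pullback_we(1)[OF smooth_param_chart[OF P c]] chart_open_image[OF P c]], simp add: coord_vec_eq_pvec'[OF P c])
     (rule smooth_on_cong[OF pullback_we(2)[OF smooth_param_chart[OF P c]] chart_open_image[OF P c]], simp add: coord_vec_eq_pvec'[OF P c])

text \<open>The coordinates of a vector field solve a linear system whose matrix and right side are
  coframe values, so Cramer's rule makes them smooth.\<close>

lemma smooth_of_coframe:
  assumes c: "c \<in> AP" and Y: "\<And>y. y \<in> snd c ` fst c \<Longrightarrow> Y y \<in> tangent AP (chart_inv c y)"
    and smooth: "smooth_on (snd c ` fst c) (\<lambda>y. w (chart_inv c y) (Y y))" "smooth_on (snd c ` fst c) (\<lambda>y. e (chart_inv c y) (Y y))"
  shows "smooth_on (snd c ` fst c) (\<lambda>y. coords c (Y y))"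
proof -
  let ?S = "snd c ` fst c"
  let ?L = "\<lambda>y u. join6 (w (chart_inv c y) (coord_vec AP c (chart_inv c y) u)) (e (chart_inv c y) (coord_vec AP c (chart_inv c y) u))"
  have S: "open ?S" by (rule chart_open_image[OF P c])
  show ?thesis
  proof (rule smooth_on_linear_solve[OF S])
    show "smooth_on ?S (\<lambda>y. matrix (?L y) $ i $ j)" for i j
      unfolding matrix_def vec_lambda_beta by (rule smooth_on_join6[OF S we_chart_smooth[OF c]])
    show "smooth_on ?S (\<lambda>y. join6 (w (chart_inv c y) (Y y)) (e (chart_inv c y) (Y y)) $ i)" for i
      by (rule smooth_on_join6[OF S smooth])
    fix y assume y: "y \<in> ?S"
    note ci = chart_inv_in[OF P c y]
    show "det (matrix (?L y)) \<noteq> 0"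
      using det_nz_iff_inj[OF coframe_bij(1)[OF c ci]] bij_is_inj[OF coframe_bij(2)[OF c ci]] by blast
    have "matrix (?L y) *v coords c (Y y) = ?L y (coords c (Y y))"
      using fun_cong[OF matrix_vector_mul(2)[OF coframe_bij(1)[OF c ci]]] .
    then show "matrix (?L y) *v coords c (Y y) = join6 (w (chart_inv c y) (Y y)) (e (chart_inv c y) (Y y))"
      unfolding coord_vec_coords[OF P c ci Y[OF y]] .
  qed
qed

end

context deformed_cs
begin

lemma J_props:
  assumes "X \<in> tangent AP p"
  shows "J_of AP v0 \<Omega> p X \<in> tangent AP p"
    "w p (J_of AP v0 \<Omega> p X) = (eps p / sc p) *\<^sub>R (\<rho> (pr p) *\<^sub>R w p X - e p X)"
    "e p (J_of AP v0 \<Omega> p X) = (eps p / sc p) *\<^sub>R (w p X - \<rho> (pr p) *\<^sub>R e p X)"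
  unfolding J_eq[OF assms] by (simp_all only: lift_props)

lemma J_J:
  assumes X: "X \<in> tangent AP p"
  shows "J_of AP v0 \<Omega> p (J_of AP v0 \<Omega> p X) = tscale (- 1) X"
proof -
  let ?r = "\<rho> (pr p)"
  have k: "(eps p / sc p)\<^sup>2 * (1 - ?r\<^sup>2) = 1"
    unfolding sc(2)[symmetric] power_divide eps(1) using sc(1)[of p] by simp
  \<comment> \<open>Stated for arbitrary k and r, so that the quotient \<open>eps p / sc p\<close>
    stays opaque; the one fact needed about it is that its square times 1 - \<rho>^2 is 1.\<close>
  have alg: "k *\<^sub>R (r *\<^sub>R (k *\<^sub>R (r *\<^sub>R a - b)) - k *\<^sub>R (a - r *\<^sub>R b)) = - ((k\<^sup>2 * (1 - r\<^sup>2)) *\<^sub>R a)"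
    "k *\<^sub>R (k *\<^sub>R (r *\<^sub>R a - b) - r *\<^sub>R (k *\<^sub>R (a - r *\<^sub>R b))) = - ((k\<^sup>2 * (1 - r\<^sup>2)) *\<^sub>R b)"
    for k r and a b :: "real ^ 3"
    by (simp_all add: vec_eq_iff power2_eq_square algebra_simps)
  have 1: "(eps p / sc p) *\<^sub>R (?r *\<^sub>R ((eps p / sc p) *\<^sub>R (?r *\<^sub>R a - b)) - (eps p / sc p) *\<^sub>R (a - ?r *\<^sub>R b)) = - a" for a b :: "real ^ 3"
  proof -
    have "(eps p / sc p) *\<^sub>R (?r *\<^sub>R ((eps p / sc p) *\<^sub>R (?r *\<^sub>R a - b)) - (eps p / sc p) *\<^sub>R (a - ?r *\<^sub>R b))
       = - (((eps p / sc p)\<^sup>2 * (1 - ?r\<^sup>2)) *\<^sub>R a)"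
      by (rule alg(1))
    then show ?thesis unfolding k by simp
  qed
  have 2: "(eps p / sc p) *\<^sub>R ((eps p / sc p) *\<^sub>R (?r *\<^sub>R a - b) - ?r *\<^sub>R ((eps p / sc p) *\<^sub>R (a - ?r *\<^sub>R b))) = - b" for a b :: "real ^ 3"
  proof -
    have "(eps p / sc p) *\<^sub>R ((eps p / sc p) *\<^sub>R (?r *\<^sub>R a - b) - ?r *\<^sub>R ((eps p / sc p) *\<^sub>R (a - ?r *\<^sub>R b)))
       = - (((eps p / sc p)\<^sup>2 * (1 - ?r\<^sup>2)) *\<^sub>R b)"
      by (rule alg(2))
    then show ?thesis unfolding k by simp
  qed
  show ?thesis
    by (rule we_inject[OF J_props(1)[OF J_props(1)[OF X]] tangent_linear(2)[OF P X X]])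
       (simp_all only: J_props(2,3)[OF J_props(1)[OF X]] J_props(2,3)[OF X] 1 2 we_linear(2,4)[OF X] scaleR_minus1_left)
qed

lemma J_linear:
  assumes X: "X \<in> tangent AP p" and Y: "Y \<in> tangent AP p"
  shows "J_of AP v0 \<Omega> p (tadd X Y) = tadd (J_of AP v0 \<Omega> p X) (J_of AP v0 \<Omega> p Y)"
    "J_of AP v0 \<Omega> p (tscale s X) = tscale s (J_of AP v0 \<Omega> p X)"
  unfolding J_eq[OF X] J_eq[OF Y] J_eq[OF tangent_linear(1)[OF P X Y]] J_eq[OF tangent_linear(2)[OF P X X]] lift_linear
    we_linear(1,3)[OF X Y] we_linear(2,4)[OF X]
  by (simp_all add: algebra_simps)

lemma J_smooth:
  assumes c: "c \<in> AP"
  shows "smooth_on (snd c ` fst c) (\<lambda>x. coords c (J_of AP v0 \<Omega> (chart_inv c x) (coord_vec AP c (chart_inv c x) u)))"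
proof (rule smooth_of_coframe[OF c])
  let ?S = "snd c ` fst c"
  have S: "open ?S" by (rule chart_open_image[OF P c])
  have t: "coord_vec AP c (chart_inv c y) u \<in> tangent AP (chart_inv c y)" if "y \<in> ?S" for y
    by (rule coord_vec_in_tangent[OF c chart_inv_in[OF P c that]])
  show "J_of AP v0 \<Omega> (chart_inv c y) (coord_vec AP c (chart_inv c y) u) \<in> tangent AP (chart_inv c y)" if "y \<in> ?S" for y
    by (rule J_props(1)[OF t[OF that]])
  have \<rho>: "smooth_on ?S (\<lambda>y. \<rho> (pr (chart_inv c y)))" by (rule \<rho>_pr_smooth[OF smooth_param_chart[OF P c]])
  have "smooth_on ?S (\<lambda>y. sqrt (1 - \<rho> (pr (chart_inv c y)) * \<rho> (pr (chart_inv c y))))"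
    by (intro smooth_on_sqrt smooth_on_diff smooth_on_const smooth_on_mult S \<rho>)
       (use \<rho>_bound in \<open>simp add: power2_eq_square\<close>)
  then have "smooth_on ?S (\<lambda>y. sc (chart_inv c y))" by (simp add: sc_def power2_eq_square)
  moreover have "sc q \<noteq> 0" for q using sc(1)[of q] by simp
  ultimately have k: "smooth_on ?S (\<lambda>y. eps (chart_inv c y) / sc (chart_inv c y))"
    by (intro smooth_on_divide S eps_smooth[OF c]) auto
  note I = smooth_on_scaleR[OF S] smooth_on_diff[OF S] k \<rho> we_chart_smooth[OF c]
  show "smooth_on ?S (\<lambda>y. w (chart_inv c y) (J_of AP v0 \<Omega> (chart_inv c y) (coord_vec AP c (chart_inv c y) u)))"
    by (rule smooth_on_cong[OF _ S]) (rule I(1)[OF k I(2)[OF I(1)[OF \<rho> we_chart_smooth(1)[OF c]] we_chart_smooth(2)[OF c]]], simp only: J_props(2)[OF t])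
  show "smooth_on ?S (\<lambda>y. e (chart_inv c y) (J_of AP v0 \<Omega> (chart_inv c y) (coord_vec AP c (chart_inv c y) u)))"
    by (rule smooth_on_cong[OF _ S]) (rule I(1)[OF k I(2)[OF we_chart_smooth(1)[OF c] I(1)[OF \<rho> we_chart_smooth(2)[OF c]]]], simp only: J_props(3)[OF t])
qed

text \<open>\<open>eps\<close> is locally constant and \<open>SU(2)\<close> is connected.\<close>

lemma eps_act:
  assumes g: "g \<in> SU2"
  shows "eps (act p g) = eps p"
proof -
  have "(\<lambda>h. eps (act p h)) constant_on SU2"
  proof (rule locally_constant_imp_constant[OF connected_SU2])
    fix h assume h: "h \<in> SU2"
    obtain c where c: "c \<in> AP" "p \<in> fst c" using chart_at[OF P] by blast
    obtain d where d: "d \<in> AP" "act p h \<in> fst d" using chart_at[OF P] by blast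
    have "smooth_on_product AP AP UNIV SU2 act" using pbundle by (simp add: principal_SU2_bundle_def)
    from this[unfolded smooth_on_product_def, rule_format, OF c(1) d(1) UNIV_I h conjI[OF c(2) d(2)]]
    obtain N G where N: "open N" "(snd c p, h) \<in> N" "smooth_on N G"
      "\<And>k. k \<in> SU2 \<Longrightarrow> (snd c p, k) \<in> N \<Longrightarrow> act p k \<in> fst d \<and> snd d (act p k) = G (snd c p, k)"
      using c(2) by (metis IntI UNIV_I)
    obtain N' where N': "open N'" "snd d (act p h) \<in> N'" "\<And>y. y \<in> N' \<Longrightarrow> eps (chart_inv d y) = eps (act p h)"
      using eps_locally_constant[OF d] by metis
    define T where "T = SU2 \<inter> (\<lambda>k. (snd c p, k)) -` (N \<inter> G -` N')"
    have "open (N \<inter> G -` N')" by (rule continuous_open_preimage[OF smooth_on_imp_continuous_on[OF N(3)] N(1) N'(1)])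
    then have "open ((\<lambda>k. (snd c p, k)) -` (N \<inter> G -` N'))" by (rule open_vimage) (intro continuous_intros)
    then have "openin (top_of_set SU2) T" unfolding T_def by (rule openin_open_Int)
    moreover have "h \<in> T" using h N(2) N(4)[OF h N(2)] N'(2) by (simp add: T_def)
    moreover have "eps (act p k) = eps (act p h)" if "k \<in> T" for k
    proof -
      have k: "k \<in> SU2" "(snd c p, k) \<in> N" "G (snd c p, k) \<in> N'" using that by (auto simp: T_def)
      then show ?thesis using N(4)[OF k(1,2)] N'(3)[OF k(3)] chart_inv_left[OF P d(1)] by metis
    qed
    ultimately show "\<exists>T. openin (top_of_set SU2) T \<and> h \<in> T \<and> (\<forall>k\<in>T. eps (act p k) = eps (act p h))" by blast
  qed
  then have "eps (act p g) = eps (act p (mat 1))" using g SU2_one unfolding constant_on_def by metis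
  then show ?thesis by (simp only: act_one)
qed

lemma J_act:
  assumes g: "g \<in> SU2" and X: "X \<in> tangent AP p"
  shows "push AP (\<lambda>q. act q g) p (J_of AP v0 \<Omega> p X) = J_of AP v0 \<Omega> (act p g) (push AP (\<lambda>q. act q g) p X)"
proof -
  have "sc (act p g) = sc p" by (simp add: sc_def pr_act[OF g])
  then show ?thesis
    unfolding J_eq[OF X] J_eq[OF push_act_tangent[OF g X]] push_act_lift[OF g] we_act[OF g X] pr_act[OF g] eps_act[OF g]
    by (simp add: linear_diff[OF linear_Ad] linear_cmul[OF linear_Ad])
qed

lemma tzero_we: "w p tzero = 0" "e p tzero = 0" "tzero \<in> tangent AP p" 
proof -
  obtain X where X: "X \<in> tangent AP p" using lift_props(1) by blast
  have "tzero = tscale 0 X" by (simp add: tscale_def tzero_def)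
  then show "w p tzero = 0" "e p tzero = 0" using we_linear(2,4)[OF X, of 0] by simp_all
  show "tzero \<in> tangent AP p" by (rule tangent_linear(3)[OF P X X])
qed

text \<open>For vertical X the value of e on J X is a nonzero multiple of w X, so J X is vertical
  only for X = 0.\<close>

lemma J_admissible: "admissible_acs AM AP pr act (J_of AP v0 \<Omega>)"
proof -
  let ?J = "J_of AP v0 \<Omega>"
  have "?J p ` vertical AM AP pr p \<inter> vertical AM AP pr p = {tzero}" for p
  proof (intro set_eqI iffI)
    fix Y assume "Y \<in> ?J p ` vertical AM AP pr p \<inter> vertical AM AP pr p"
    then obtain X where X: "X \<in> tangent AP p" "e p X = 0" "Y = ?J p X" "e p Y = 0" by (auto simp: vertical_iff)
    then have "w p X = 0" using J_props(3)[OF X(1)] sc(1)[of p] eps(2)[of p] by simp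
    then have "w p Y = 0" using J_props(2)[OF X(1)] X by simp
    then show "Y \<in> {tzero}" using we_inject[OF J_props(1)[OF X(1)] tzero_we(3)] X tzero_we(1,2) by simp
  next
    fix Y :: "'p tvec" assume Y: "Y \<in> {tzero}"
    have "w p (?J p tzero) = 0" "e p (?J p tzero) = 0"
      using J_props(2,3)[OF tzero_we(3)] by (simp_all add: tzero_we(1,2))
    then have "tzero = ?J p tzero"
      by (intro we_inject[OF tzero_we(3) J_props(1)[OF tzero_we(3)]]) (simp_all add: tzero_we(1,2))
    moreover have "tzero \<in> vertical AM AP pr p" unfolding vertical_iff using tzero_we by simp
    ultimately show "Y \<in> ?J p ` vertical AM AP pr p \<inter> vertical AM AP pr p" using Y by blast
  qed
  then show ?thesis
    unfolding admissible_acs_def almost_complex_structure_def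
    using J_props(1) J_linear J_J J_smooth J_act by blast
qed

end

subsection \<open>The connection and the metric defined by the almost-complex structure\<close>

lemma alternating_on_add_scale:
  assumes "alternating_on T k a" "alternating_on T k b"
  shows "alternating_on T k (\<lambda>Xs. a Xs + r *\<^sub>R b Xs)"
  using assms unfolding alternating_on_def by (simp add: algebra_simps)

lemma alternating_on_zero: "alternating_on T k (\<lambda>Xs. 0)"
  by (simp add: alternating_on_def)

lemma is_form_add_scale:
  fixes A :: "('m::{t2_space,second_countable_topology}, 'n::finite) chart set"
  assumes A: "oriented_atlas A" and \<alpha>: "is_form A k \<alpha>" and \<beta>: "is_form A k \<beta>"
    and f: "\<And>c. c \<in> A \<Longrightarrow> smooth_on (snd c ` fst c) (\<lambda>y. f (chart_inv c y))"
  shows "is_form A k (fadd \<alpha> (fscale f \<beta>))"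
  unfolding is_form_def
proof (intro conjI allI ballI impI)
  show "alternating_on (tangent A p) k (fadd \<alpha> (fscale f \<beta>) p)" for p
    unfolding fadd_def fscale_def using \<alpha> \<beta> by (intro alternating_on_add_scale) (simp_all add: is_form_def)
  fix c us assume c: "c \<in> A" and us: "length (us :: (real ^ 'n) list) = k"
  have S: "open (snd c ` fst c)" by (rule chart_open_image[OF A c])
  show "smooth_on (snd c ` fst c) (form_component A c (fadd \<alpha> (fscale f \<beta>)) us)"
    by (rule smooth_on_cong[OF smooth_on_add[OF S form_component_smooth[OF \<alpha> c us] smooth_on_scaleR[OF S f[OF c] form_component_smooth[OF \<beta> c us]]] S])
       (simp add: form_component_def fadd_def fscale_def)
qed

lemma is_form_zero:
  assumes A: "oriented_atlas A"
  shows "is_form A k (fzero :: ('m::{t2_space,second_countable_topology}, 'b::real_normed_vector) form)"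
  unfolding is_form_def fzero_def form_component_def
  using alternating_on_zero smooth_on_const by blast

lemma is_form_scale:
  assumes A: "oriented_atlas A" and \<beta>: "is_form A k \<beta>"
    and f: "\<And>c. c \<in> A \<Longrightarrow> smooth_on (snd c ` fst c) (\<lambda>y. f (chart_inv c y))"
  shows "is_form A k (fscale f \<beta>)"
  using is_form_add_scale[OF A is_form_zero[OF A] \<beta> f] by (simp add: fadd_def fzero_def)

lemma linear_conjugation: "linear (\<lambda>x. a ** x ** b)" for a b :: cmat
  by (rule bounded_linear.linear[OF bounded_linear_compose[OF bounded_linear_matrix_mult_right bounded_linear_matrix_mult_left]])

lemma equivariant_add_scale:
  assumes \<alpha>: "equivariant_form AP act 1 \<alpha>" and \<beta>: "equivariant_form AP act 1 \<beta>" and f: "\<And>p g. g \<in> SU2 \<Longrightarrow> f (act p g) = f p"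
  shows "equivariant_form AP act 1 (fadd \<alpha> (fscale f \<beta>))"
  unfolding equivariant_form_def form_eq_1
proof (intro ballI allI)
  fix g p X assume g: "g \<in> SU2" and X: "X \<in> tangent AP p"
  have 1: "pullback AP (\<lambda>p. act p g) \<alpha> p [X] = matrix_inv g ** \<alpha> p [X] ** g"
    "pullback AP (\<lambda>p. act p g) \<beta> p [X] = matrix_inv g ** \<beta> p [X] ** g"
    using \<alpha> \<beta> g X unfolding equivariant_form_def form_eq_1 by blast+
  have "pullback AP (\<lambda>p. act p g) (fadd \<alpha> (fscale f \<beta>)) p [X] =
     pullback AP (\<lambda>p. act p g) \<alpha> p [X] + f p *\<^sub>R pullback AP (\<lambda>p. act p g) \<beta> p [X]"
    by (simp add: pullback_def fadd_def fscale_def f[OF g])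
  then show "pullback AP (\<lambda>p. act p g) (fadd \<alpha> (fscale f \<beta>)) p [X] = matrix_inv g ** fadd \<alpha> (fscale f \<beta>) p [X] ** g"
    unfolding 1 fadd_def fscale_def
    by (simp only: linear_add[OF linear_conjugation] linear_cmul[OF linear_conjugation])
qed

context deformed_cs
begin

lemma \<rho>_bound_base: "(\<rho> x)\<^sup>2 < 1"
  using pr_surj[of x] \<rho>_bound by metis

lemma \<rho>_pr_chart_smooth: "c \<in> AP \<Longrightarrow> smooth_on (snd c ` fst c) (\<lambda>y. \<rho> (pr (chart_inv c y)))"
  by (rule \<rho>_pr_smooth[OF smooth_param_chart[OF P]])

lemma sqrt_smooth: "c \<in> AP \<Longrightarrow> smooth_on (snd c ` fst c) (\<lambda>y. sqrt (1 - (\<rho> (pr (chart_inv c y)))\<^sup>2))"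
  unfolding power2_eq_square
  by (intro smooth_on_sqrt smooth_on_diff smooth_on_const smooth_on_mult chart_open_image[OF P] \<rho>_pr_chart_smooth)
     (use \<rho>_bound in \<open>simp_all add: power2_eq_square\<close>)

abbreviation WJ :: "('p, cmat) form" where "WJ \<equiv> fadd W (fscale (\<lambda>p. - \<rho> (pr p)) E)"
abbreviation sE :: "('p, cmat) form" where "sE \<equiv> fscale (\<lambda>p. sqrt (1 - (\<rho> (pr p))\<^sup>2)) E"

lemma WJ_eq:
  assumes "X \<in> tangent AP p"
  shows "WJ p [X] = su2_of_vec (w p X - \<rho> (pr p) *\<^sub>R e p X)"
  unfolding fadd_def fscale_def W_eq[OF assms] E_eq[OF assms]
  by (simp add: linear_diff[OF linear_su2_of_vec] linear_cmul[OF linear_su2_of_vec])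

lemma sE_eq:
  assumes "X \<in> tangent AP p"
  shows "sE p [X] = su2_of_vec (sc p *\<^sub>R e p X)"
  unfolding fscale_def E_eq[OF assms] sc_def by (simp add: linear_cmul[OF linear_su2_of_vec])

lemma WJ_form: "is_form AP 1 WJ"
  by (rule is_form_add_scale[OF P forms smooth_on_minus[OF chart_open_image[OF P] \<rho>_pr_chart_smooth]])

lemma WJ_connection: "is_connection AP act WJ"
  unfolding is_connection_def
proof (intro conjI allI ballI impI)
  show "is_form AP 1 WJ" by (rule WJ_form)
  show "su2_valued AP WJ" unfolding su2_valued_def using WJ_eq su2_of_vec_in_su2 by metis
  show "equivariant_form AP act 1 WJ"
    by (rule equivariant_add_scale) (use W E in \<open>simp_all add: is_connection_def is_frame_def pr_act\<close>)
  fix p X a assume a: "a \<in> su2" and X: "generates AP act p a X"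
  have "generates AP act p (su2_of_vec (vec_of_su2 a)) X" using X su2_of_vec_of_su2[OF a] by simp
  then have "X \<in> tangent AP p" "w p X = vec_of_su2 a" "e p X = 0" unfolding generates_iff by blast+
  then show "WJ p [X] = a" using WJ_eq su2_of_vec_of_su2[OF a] by simp
qed

lemma sE_frame: "is_frame AM AP pr act sE"
  unfolding is_frame_def
proof (intro conjI allI ballI)
  show "is_form AP 1 sE" by (rule is_form_scale[OF P forms(2) sqrt_smooth])
  show "su2_valued AP sE" unfolding su2_valued_def using sE_eq su2_of_vec_in_su2 by metis
  have "equivariant_form AP act 1 (fadd fzero sE)"
  proof (rule equivariant_add_scale)
    show "equivariant_form AP act 1 fzero"
      by (simp add: equivariant_form_def form_eq_def pullback_def fzero_def linear_0[OF linear_conjugation])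
  qed (use E in \<open>simp_all add: is_frame_def pr_act\<close>)
  then show "equivariant_form AP act 1 sE" by (simp add: fadd_def fzero_def)
  show "sE p [X] = 0" if "X \<in> vertical AM AP pr p" for p X
    using E that by (simp add: is_frame_def fscale_def)
  fix p
  obtain f where f: "\<And>X. X \<in> tangent AP p \<Longrightarrow> E p [X] = (\<Sum>i\<in>UNIV. f i X *\<^sub>R \<tau> i)"
    "\<And>s::3 \<Rightarrow> real. (\<forall>X\<in>tangent AP p. (\<Sum>i\<in>UNIV. s i * f i X) = 0) \<Longrightarrow> (\<forall>i. s i = 0)"
  proof -
    have "\<exists>f. (\<forall>X\<in>tangent AP p. E p [X] = (\<Sum>i\<in>UNIV. f i X *\<^sub>R \<tau> i)) \<and>
        (\<forall>s::3 \<Rightarrow> real. (\<forall>X\<in>tangent AP p. (\<Sum>i\<in>UNIV. s i * f i X) = 0) \<longrightarrow> (\<forall>i. s i = 0))"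
      using E unfolding is_frame_def by blast
    then show thesis using that by blast
  qed
  show "\<exists>f. (\<forall>X\<in>tangent AP p. sE p [X] = (\<Sum>i\<in>UNIV. f i X *\<^sub>R \<tau> i)) \<and>
        (\<forall>s::3 \<Rightarrow> real. (\<forall>X\<in>tangent AP p. (\<Sum>i\<in>UNIV. s i * f i X) = 0) \<longrightarrow> (\<forall>i. s i = 0))"
  proof (intro exI[of _ "\<lambda>i X. sc p * f i X"] conjI ballI allI impI)
    show "sE p [X] = (\<Sum>i\<in>UNIV. (sc p * f i X) *\<^sub>R \<tau> i)" if "X \<in> tangent AP p" for X
      by (simp add: fscale_def sc_def f(1)[OF that] scaleR_sum_right)
    fix s :: "3 \<Rightarrow> real" and i
    assume s: "\<forall>X\<in>tangent AP p. (\<Sum>i\<in>UNIV. s i * (sc p * f i X)) = 0"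
    have "(\<Sum>i\<in>UNIV. s i * f i X) = 0" if "X \<in> tangent AP p" for X
    proof -
      have "sc p * (\<Sum>i\<in>UNIV. s i * f i X) = (\<Sum>i\<in>UNIV. s i * (sc p * f i X))"
        by (simp add: sum_distrib_left mult_ac)
      then show ?thesis using s that sc(1)[of p] by simp
    qed
    then show "s i = 0" using f(2) by blast
  qed
qed

text \<open>J takes a vertical vector with w = a to a multiple of (w, e) = (\<rho>a, a). Conversely,
  if w = \<rho>e then -J X is vertical, and J maps it back to X.\<close>

lemma J_vertical_iff: "X \<in> J_of AP v0 \<Omega> p ` vertical AM AP pr p \<longleftrightarrow> X \<in> tangent AP p \<and> w p X = \<rho> (pr p) *\<^sub>R e p X"
proof
  assume "X \<in> J_of AP v0 \<Omega> p ` vertical AM AP pr p"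
  then obtain V where V: "V \<in> tangent AP p" "e p V = 0" "X = J_of AP v0 \<Omega> p V" by (auto simp: vertical_iff)
  then show "X \<in> tangent AP p \<and> w p X = \<rho> (pr p) *\<^sub>R e p X"
    using J_props[OF V(1)] by simp
next
  assume X: "X \<in> tangent AP p \<and> w p X = \<rho> (pr p) *\<^sub>R e p X"
  let ?V = "tscale (- 1) (J_of AP v0 \<Omega> p X)"
  have JX: "J_of AP v0 \<Omega> p X \<in> tangent AP p" using X J_props(1) by blast
  have Vt: "?V \<in> tangent AP p" by (rule tangent_linear(2)[OF P JX JX])
  have "e p ?V = 0" using we_linear(4)[OF JX] J_props(3)[of X p] X by simp
  then have "?V \<in> vertical AM AP pr p" using Vt by (simp add: vertical_iff)
  moreover have "J_of AP v0 \<Omega> p ?V = X"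
    using J_linear(2)[OF JX JX, of "- 1"] J_J[of X p] X by (simp add: tscale_def fun_eq_iff)
  ultimately show "X \<in> J_of AP v0 \<Omega> p ` vertical AM AP pr p" by (metis imageI)
qed

lemma connection_of_J: "connection_defined_by AM AP pr act (J_of AP v0 \<Omega>) WJ"
  unfolding connection_defined_by_def
proof (intro conjI allI J_admissible WJ_connection set_eqI)
  fix p and X :: "'p tvec"
  have "WJ p [X] = 0 \<longleftrightarrow> w p X = \<rho> (pr p) *\<^sub>R e p X" if "X \<in> tangent AP p"
    unfolding WJ_eq[OF that] using su2_of_vec_eq_iff[of _ 0] linear_0[OF linear_su2_of_vec] by simp
  then show "X \<in> {X \<in> tangent AP p. WJ p [X] = 0} \<longleftrightarrow> X \<in> J_of AP v0 \<Omega> p ` vertical AM AP pr p"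
    unfolding J_vertical_iff by blast
qed

text \<open>Where w = \<rho>e, the vector J X is vertical with w = \<epsilon>(\<rho>^2 - 1)/s times
  e X, and the quotient collapses to -\<epsilon> s.\<close>

lemma J_generates:
  assumes X: "X \<in> tangent AP p" "w p X = \<rho> (pr p) *\<^sub>R e p X"
  shows "generates AP act p (su2_of_vec a) (J_of AP v0 \<Omega> p X) \<longleftrightarrow> a = (- eps p * sc p) *\<^sub>R e p X"
proof -
  let ?r = "\<rho> (pr p)"
  have k: "eps p / sc p * (?r * ?r - 1) = - eps p * sc p"
  proof -
    have "?r * ?r - 1 = - (sc p * sc p)" using sc(2)[of p] by (simp add: power2_eq_square)
    then show ?thesis using sc(1)[of p] by simp
  qed
  have alg: "k *\<^sub>R (r *\<^sub>R r *\<^sub>R x - x) = (k * (r * r - 1)) *\<^sub>R x" for k r and x :: "real ^ 3"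
    by (simp add: algebra_simps)
  have "w p (J_of AP v0 \<Omega> p X) = (eps p / sc p * (?r * ?r - 1)) *\<^sub>R e p X"
    unfolding J_props(2)[OF X(1)] X(2) by (rule alg)
  then have "w p (J_of AP v0 \<Omega> p X) = (- eps p * sc p) *\<^sub>R e p X" unfolding k .
  moreover have "e p (J_of AP v0 \<Omega> p X) = 0" unfolding J_props(3)[OF X(1)] X(2) by simp
  ultimately show ?thesis using J_props(1)[OF X(1)] unfolding generates_iff by auto
qed

lemma J_metric_value: "su2_inner (su2_of_vec ((- eps p * sc p) *\<^sub>R x)) (su2_of_vec ((- eps p * sc p) *\<^sub>R y)) = (1 - (\<rho> (pr p))\<^sup>2) * (x \<bullet> y)"
proof -
  have "su2_inner (su2_of_vec ((- eps p * sc p) *\<^sub>R x)) (su2_of_vec ((- eps p * sc p) *\<^sub>R y)) = (eps p)\<^sup>2 * (sc p)\<^sup>2 * (x \<bullet> y)"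
    unfolding su2_inner_of_vec by (simp add: power2_eq_square)
  then show ?thesis unfolding eps(1) sc(2) by simp
qed

text \<open>The generators of J X and J Y are -\<epsilon> s e X and -\<epsilon> s e Y: the sign
  squares away, and s^2 = 1 - \<rho>^2 is the conformal factor relative to
  \<open>g\<^sub>E\<close>.\<close>

lemma metric_of_J_exists: "metric_defined_by AM AP pr act (J_of AP v0 \<Omega>) (\<lambda>x X Y. (1 - (\<rho> x)\<^sup>2) * g\<^sub>E x X Y)"
  unfolding metric_defined_by_def
proof (intro conjI J_admissible allI ballI impI)
  have gE: "riemannian_metric AM g\<^sub>E" using g\<^sub>E by (simp add: metric_of_frame_def)
  show "riemannian_metric AM (\<lambda>x X Y. (1 - (\<rho> x)\<^sup>2) * g\<^sub>E x X Y)"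
    unfolding riemannian_metric_def
  proof (intro conjI allI ballI impI)
    fix x X Y Z and s :: real
    assume X: "X \<in> tangent AM x" and Y: "Y \<in> tangent AM x" and Z: "Z \<in> tangent AM x"
    have *: "g\<^sub>E x X Y = g\<^sub>E x Y X \<and> g\<^sub>E x (tadd X Y) Z = g\<^sub>E x X Z + g\<^sub>E x Y Z \<and>
        g\<^sub>E x (tscale s X) Y = s * g\<^sub>E x X Y \<and> (X \<noteq> tzero \<longrightarrow> g\<^sub>E x X X > 0)"
      using gE X Y Z unfolding riemannian_metric_def by blast
    then show "(1 - (\<rho> x)\<^sup>2) * g\<^sub>E x X Y = (1 - (\<rho> x)\<^sup>2) * g\<^sub>E x Y X"
      "(1 - (\<rho> x)\<^sup>2) * g\<^sub>E x (tadd X Y) Z = (1 - (\<rho> x)\<^sup>2) * g\<^sub>E x X Z + (1 - (\<rho> x)\<^sup>2) * g\<^sub>E x Y Z"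
      "(1 - (\<rho> x)\<^sup>2) * g\<^sub>E x (tscale s X) Y = s * ((1 - (\<rho> x)\<^sup>2) * g\<^sub>E x X Y)"
      by (simp_all add: distrib_left)
    show "(1 - (\<rho> x)\<^sup>2) * g\<^sub>E x X X > 0" if "X \<noteq> tzero" using * that \<rho>_bound_base[of x] by simp
  next
    fix c assume c: "c \<in> AM"
    have S: "open (snd c ` fst c)" by (rule chart_open_image[OF M c])
    have "smooth_on (snd c ` fst c) (metric_matrix AM g\<^sub>E c)" using gE c by (simp add: riemannian_metric_def)
    moreover have "smooth_on (snd c ` fst c) (\<lambda>x. 1 - \<rho> (chart_inv c x) * \<rho> (chart_inv c x))"
      using \<rho>_smooth[OF c] by (intro smooth_on_diff smooth_on_const smooth_on_mult S) (simp_all add: comp_def)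
    ultimately have "smooth_on (snd c ` fst c) (\<lambda>x. (1 - \<rho> (chart_inv c x) * \<rho> (chart_inv c x)) *\<^sub>R metric_matrix AM g\<^sub>E c x)"
      by (intro smooth_on_scaleR S)
    then show "smooth_on (snd c ` fst c) (metric_matrix AM (\<lambda>x X Y. (1 - (\<rho> x)\<^sup>2) * g\<^sub>E x X Y) c)"
      by (rule smooth_on_cong[OF _ S]) (simp add: metric_matrix_def Let_def vec_eq_iff power2_eq_square)
  qed
  fix p X Y a b
  assume X: "X \<in> J_of AP v0 \<Omega> p ` vertical AM AP pr p" and Y: "Y \<in> J_of AP v0 \<Omega> p ` vertical AM AP pr p"
    and a: "a \<in> su2" and b: "b \<in> su2"
    and gen: "generates AP act p a (J_of AP v0 \<Omega> p X) \<and> generates AP act p b (J_of AP v0 \<Omega> p Y)"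
  note X = X[unfolded J_vertical_iff, THEN conjunct1] X[unfolded J_vertical_iff, THEN conjunct2]
  note Y = Y[unfolded J_vertical_iff, THEN conjunct1] Y[unfolded J_vertical_iff, THEN conjunct2]
  have "generates AP act p (su2_of_vec (vec_of_su2 a)) (J_of AP v0 \<Omega> p X)"
    "generates AP act p (su2_of_vec (vec_of_su2 b)) (J_of AP v0 \<Omega> p Y)"
    using gen a b by (simp_all add: su2_of_vec_of_su2)
  then have "vec_of_su2 a = (- eps p * sc p) *\<^sub>R e p X" "vec_of_su2 b = (- eps p * sc p) *\<^sub>R e p Y"
    unfolding J_generates[OF X] J_generates[OF Y] .
  then have "a = su2_of_vec ((- eps p * sc p) *\<^sub>R e p X)" "b = su2_of_vec ((- eps p * sc p) *\<^sub>R e p Y)"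
    using su2_of_vec_of_su2[OF a] su2_of_vec_of_su2[OF b] by metis+
  then show "(1 - (\<rho> (pr p))\<^sup>2) * g\<^sub>E (pr p) (push AM pr p X) (push AM pr p Y) = su2_inner a b"
    by (simp only: J_metric_value g\<^sub>E_push[OF X(1) Y(1)])
qed

lemma push_eqI:
  assumes X: "X \<in> tangent AP p" and Y: "Y \<in> tangent AP p" and e: "e p X = e p Y"
  shows "push AM pr p X = push AM pr p Y"
proof -
  have t: "tscale (- 1) Y \<in> tangent AP p" by (rule tangent_linear(2)[OF P Y Y])
  have "e p (tadd X (tscale (- 1) Y)) = 0" by (simp add: we_linear(3)[OF X t] we_linear(4)[OF Y] e)
  then have "tadd X (tscale (- 1) Y) \<in> vertical AM AP pr p" unfolding vertical_iff using tangent_linear(1)[OF P X t] by blast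
  then have "push AM pr p (tadd X (tscale (- 1) Y)) = tzero" by (simp add: vertical_def)
  then have "tadd (push AM pr p X) (tscale (- 1) (push AM pr p Y)) = tzero" unfolding push_linear .
  then show ?thesis by (simp add: tadd_def tscale_def tzero_def fun_eq_iff)
qed

text \<open>The definition constrains g only on projections of J(V). Any vector may be replaced by
  the one with the same e and with w = \<rho>e: it lies in J(V) and has the same projection.\<close>

lemma metric_of_J_value:
  assumes g: "metric_defined_by AM AP pr act (J_of AP v0 \<Omega>) g" and X: "X \<in> tangent AP p" and Y: "Y \<in> tangent AP p"
  shows "g (pr p) (push AM pr p X) (push AM pr p Y) = (1 - (\<rho> (pr p))\<^sup>2) * (e p X \<bullet> e p Y)"
proof -
  let ?J = "J_of AP v0 \<Omega> p"
  define H where "H x = lift p (\<rho> (pr p) *\<^sub>R x) x" for x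
  have H: "H x \<in> tangent AP p" "w p (H x) = \<rho> (pr p) *\<^sub>R e p (H x)" "e p (H x) = x" for x
    unfolding H_def lift_props by (rule lift_props(1) refl)+
  have HV: "H x \<in> ?J ` vertical AM AP pr p" for x unfolding J_vertical_iff using H(1,2) by blast
  have gen: "generates AP act p (su2_of_vec ((- eps p * sc p) *\<^sub>R x)) (?J (H x))" for x
    unfolding J_generates[OF H(1,2)] H(3) ..
  have val: "g (pr p) (push AM pr p A) (push AM pr p B) = su2_inner a b"
    if "A \<in> ?J ` vertical AM AP pr p" "B \<in> ?J ` vertical AM AP pr p" "a \<in> su2" "b \<in> su2"
      "generates AP act p a (?J A)" "generates AP act p b (?J B)" for A B a b
    using g that unfolding metric_defined_by_def by blast
  have "g (pr p) (push AM pr p (H x)) (push AM pr p (H y)) = (1 - (\<rho> (pr p))\<^sup>2) * (x \<bullet> y)" for x y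
    unfolding J_metric_value[symmetric] by (rule val[OF HV HV su2_of_vec_in_su2 su2_of_vec_in_su2 gen gen])
  moreover have "push AM pr p (H (e p X)) = push AM pr p X" "push AM pr p (H (e p Y)) = push AM pr p Y"
    by (rule push_eqI[OF H(1) X H(3)], rule push_eqI[OF H(1) Y H(3)])
  ultimately show ?thesis by metis
qed

lemma metric_of_J_frame:
  assumes g: "metric_defined_by AM AP pr act (J_of AP v0 \<Omega>) g"
  shows "metric_of_frame AM AP pr sE g"
  unfolding metric_of_frame_def
proof (intro conjI allI ballI)
  show "riemannian_metric AM g" using g by (simp add: metric_defined_by_def)
  fix p X Y assume X: "X \<in> tangent AP p" and Y: "Y \<in> tangent AP p"
  have "(sc p *\<^sub>R e p X) \<bullet> (sc p *\<^sub>R e p Y) = (sc p)\<^sup>2 * (e p X \<bullet> e p Y)" by (simp add: power2_eq_square)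
  then show "g (pr p) (push AM pr p X) (push AM pr p Y) = su2_inner (sE p [X]) (sE p [Y])"
    unfolding sE_eq[OF X] sE_eq[OF Y] su2_inner_of_vec sc(2) by (simp only: metric_of_J_value[OF g X Y])
qed

end

subsection \<open>Closedness of the dual form\<close>

lemma tr3_zeroI:
  assumes "\<And>a b. tr3 x a b = 0"
  shows "x = 0"
  using assms[of "axis 2 1" "axis 3 1"] assms[of "axis 3 1" "axis 1 1"] assms[of "axis 1 1" "axis 2 1"]
  by (simp add: tr3_components axis_def vec_eq_iff forall_3)

text \<open>A total function on indices, constant from 3 on, so that test vectors meet the
  hypothesis of \<open>extd_hat\<close> that every \<open>X i\<close> is tangent.\<close>

definition four :: "'x \<Rightarrow> 'x \<Rightarrow> 'x \<Rightarrow> 'x \<Rightarrow> nat \<Rightarrow> 'x" where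
  "four A B C D i = (if i = 0 then A else if i = 1 then B else if i = 2 then C else D)"

lemma four_simps: "four A B C D 0 = A" "four A B C D 1 = B" "four A B C D (Suc 0) = B" "four A B C D 2 = C" "four A B C D 3 = D"
  by (simp_all add: four_def)

lemma form_eq_4:
  "form_eq A 4 \<alpha> \<beta> \<longleftrightarrow> (\<forall>p (X :: nat \<Rightarrow> _). (\<forall>i. X i \<in> tangent A p) \<longrightarrow> \<alpha> p (map X [0,1,2,3]) = \<beta> p (map X [0,1,2,3]))"
proof
  assume l: "form_eq A 4 \<alpha> \<beta>"
  show "\<forall>p (X :: nat \<Rightarrow> _). (\<forall>i. X i \<in> tangent A p) \<longrightarrow> \<alpha> p (map X [0,1,2,3]) = \<beta> p (map X [0,1,2,3])"
  proof (intro allI impI)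
    fix p and X :: "nat \<Rightarrow> 'a tvec" assume "\<forall>i. X i \<in> tangent A p"
    then have "length (map X [0,1,2,3]) = 4" "set (map X [0,1,2,3]) \<subseteq> tangent A p" by auto
    then show "\<alpha> p (map X [0,1,2,3]) = \<beta> p (map X [0,1,2,3])" using l unfolding form_eq_def by blast
  qed
next
  assume r: "\<forall>p (X :: nat \<Rightarrow> _). (\<forall>i. X i \<in> tangent A p) \<longrightarrow> \<alpha> p (map X [0,1,2,3]) = \<beta> p (map X [0,1,2,3])"
  show "form_eq A 4 \<alpha> \<beta>"
    unfolding form_eq_def
  proof (intro allI impI)
    fix p and Xs :: "'a tvec list" assume Xs: "length Xs = 4 \<and> set Xs \<subseteq> tangent A p"
    then obtain X0 X1 X2 X3 where X: "Xs = [X0, X1, X2, X3]" by (auto simp: eval_nat_numeral length_Suc_conv)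
    have "\<forall>i. four X0 X1 X2 X3 i \<in> tangent A p" using Xs by (auto simp: X four_def)
    then have "\<alpha> p (map (four X0 X1 X2 X3) [0,1,2,3]) = \<beta> p (map (four X0 X1 X2 X3) [0,1,2,3])" using r by blast
    then show "\<alpha> p Xs = \<beta> p Xs" by (simp add: X four_simps)
  qed
qed

lemma extd_form_of_fun:
  assumes A: "oriented_atlas A" and f: "smooth_at A x f" and X: "X \<in> tangent A x"
  shows "extd A (form_of_fun f) x [X] = X f"
proof -
  define c where "c = some_chart A x"
  have c: "c \<in> A" "x \<in> fst c" using some_chart_in[OF A] by (auto simp: c_def)
  have "form_component A c (form_of_fun f) [] = f \<circ> chart_inv c"
    by (simp add: form_component_def form_of_fun_def fun_eq_iff)
  then have "extd A (form_of_fun f) x [X] = coord_vec A c x (coords c X) f"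
    using f by (simp add: extd_def Let_def c_def[symmetric] coord_vec_def)
  then show ?thesis by (simp only: coord_vec_coords[OF A c X])
qed

context deformed_cs
begin

lemma lift_split: "X \<in> tangent AP p \<Longrightarrow> X = tadd (lift p (w p X) 0) (lift p 0 (e p X))"
  unfolding lift_linear by (rule lift_eqI) simp_all

text \<open>The vertical part of either argument contributes nothing by \<open>tor_vertical\<close>,
  so the torsion can be tested on lifts with w = 0.\<close>

lemma tor_eq_lift:
  assumes X: "X \<in> tangent AP p" and Y: "Y \<in> tangent AP p"
  shows "tor p X Y = tor p (lift p 0 (e p X)) (lift p 0 (e p Y))"
proof -
  have red: "tor p Z X = tor p Z (lift p 0 (e p X))" if Z: "Z \<in> tangent AP p" and X: "X \<in> tangent AP p" for X Z
  proof -
    have "tor p Z X = tor p Z (lift p (w p X) 0) + tor p Z (lift p 0 (e p X))"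
      by (subst lift_split[OF X]) (rule tor_linear[OF Z lift_props(1) lift_props(1)])
    moreover have "tor p (lift p (w p X) 0) Z = 0" by (rule tor_vertical[OF lift_props(1) lift_props(3) Z])
    then have "tor p Z (lift p (w p X) 0) = 0" by (subst tor_antisym) simp
    ultimately show ?thesis by simp
  qed
  have "tor p X Y = tor p X (lift p 0 (e p Y))" by (rule red[OF X Y])
  also have "\<dots> = - tor p (lift p 0 (e p Y)) X" by (rule tor_antisym)
  also have "\<dots> = - tor p (lift p 0 (e p Y)) (lift p 0 (e p X))" by (simp only: red[OF lift_props(1) X])
  also have "\<dots> = tor p (lift p 0 (e p X)) (lift p 0 (e p Y))" by (subst tor_antisym) simp
  finally show ?thesis .
qed

text \<open>Every tangent vector of M is the projection of one of P, so the derivative of \<rho> can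
  be tested upstairs.\<close>

lemma extd_\<rho>_iff:
  "form_eq AM 1 (extd AM (form_of_fun \<rho>)) fzero \<longleftrightarrow> (\<forall>p. \<forall>X\<in>tangent AP p. dr p X = 0)"
  (is "?l \<longleftrightarrow> ?r")
proof -
  have l: "?l \<longleftrightarrow> (\<forall>x. \<forall>Y\<in>tangent AM x. Y \<rho> = 0)"
    unfolding form_eq_1 fzero_def using extd_form_of_fun[OF M \<rho>_smooth_at] by metis
  show ?thesis
    unfolding l
  proof (intro iffI allI ballI)
    show "dr p X = 0" if "\<forall>x. \<forall>Y\<in>tangent AM x. Y \<rho> = 0" "X \<in> tangent AP p" for p X
      unfolding dr_push using that push_tangent_pr by blast
    show "Y \<rho> = 0" if dr: "\<forall>p. \<forall>X\<in>tangent AP p. dr p X = 0" and Y: "Y \<in> tangent AM x" for x Y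
    proof -
      obtain p where p: "pr p = x" using pr_surj by blast
      then obtain X where X: "X \<in> tangent AP p" "push AM pr p X = Y" using push_surj Y by blast
      then have "dr p X = 0" using dr by blast
      then show ?thesis unfolding dr_push X(2) .
    qed
  qed
qed

lemma cov_ext_deriv_iff:
  "form_eq AP 2 (cov_ext_deriv AP W E) (fscale (\<lambda>p. 2 * \<rho> (pr p)) (mwedge 1 1 E E)) \<longleftrightarrow>
     (\<forall>p. \<forall>X\<in>tangent AP p. \<forall>Y\<in>tangent AP p. tor p X Y = (2 * \<rho> (pr p)) *\<^sub>R (e p X \<times> e p Y))"
proof -
  have "fscale (\<lambda>p. 2 * \<rho> (pr p)) (mwedge 1 1 E E) p [X, Y] = su2_of_vec ((2 * \<rho> (pr p)) *\<^sub>R (e p X \<times> e p Y))"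
    if "X \<in> tangent AP p" "Y \<in> tangent AP p" for p X Y
    by (simp only: fscale_def mwedge_E_E[OF that] su2_of_vec_simps)
  then show ?thesis
    unfolding form_eq_2 using cov_ext_deriv_eq su2_of_vec_eq_iff by metis
qed

text \<open>Replacing W by W - \<rho>E changes the torsion by -\<rho>(e X x e Y - e Y x e X), which
  is -2\<rho> e X x e Y; hence the factor 2.\<close>

lemma cov_ext_deriv_WJ_iff:
  "form_eq AP 2 (cov_ext_deriv AP WJ E) fzero \<longleftrightarrow>
     (\<forall>p. \<forall>X\<in>tangent AP p. \<forall>Y\<in>tangent AP p. tor p X Y = (2 * \<rho> (pr p)) *\<^sub>R (e p X \<times> e p Y))"
proof -
  have "cov_ext_deriv AP WJ E p [X, Y] = su2_of_vec (tor p X Y - (2 * \<rho> (pr p)) *\<^sub>R (e p X \<times> e p Y))"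
    if X: "X \<in> tangent AP p" and Y: "Y \<in> tangent AP p" for p X Y
  proof -
    let ?a = "\<lambda>X. w p X - \<rho> (pr p) *\<^sub>R e p X"
    have "cov_ext_deriv AP WJ E p [X, Y] = extd AP E p [X, Y]
       + ((WJ p [X] ** E p [Y] - WJ p [Y] ** E p [X]) + (E p [X] ** WJ p [Y] - E p [Y] ** WJ p [X]))"
      unfolding cov_ext_deriv_def by (simp only: fadd_def[of "extd AP E"] fadd_def[of "mwedge 1 1 WJ E"] mwedge_1_1)
    also have "\<dots> = su2_of_vec (de p X Y) + ((su2_of_vec (?a X) ** su2_of_vec (e p Y) - su2_of_vec (e p Y) ** su2_of_vec (?a X))
       - (su2_of_vec (?a Y) ** su2_of_vec (e p X) - su2_of_vec (e p X) ** su2_of_vec (?a Y)))"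
      unfolding WJ_eq[OF X] WJ_eq[OF Y] E_eq[OF X] E_eq[OF Y] extd_E[OF X Y] by simp
    also have "\<dots> = su2_of_vec (de p X Y + (?a X \<times> e p Y - ?a Y \<times> e p X))"
      by (simp only: su2_of_vec_commutator) (simp only: su2_of_vec_simps(1,2))
    also have "de p X Y + (?a X \<times> e p Y - ?a Y \<times> e p X) = tor p X Y - (2 * \<rho> (pr p)) *\<^sub>R (e p X \<times> e p Y)"
      by (simp add: tor_def vec_eq_iff forall_3 cross_components algebra_simps)
    finally show ?thesis .
  qed
  then have "cov_ext_deriv AP WJ E p [X, Y] = 0 \<longleftrightarrow> tor p X Y = (2 * \<rho> (pr p)) *\<^sub>R (e p X \<times> e p Y)"
    if "X \<in> tangent AP p" "Y \<in> tangent AP p" for p X Y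
    using that su2_of_vec_eq_iff[of _ 0] by (simp add: su2_of_vec_simps(4))
  then show ?thesis unfolding form_eq_2 fzero_def by blast
qed

text \<open>With torsion 2\<rho> e x e the terms with two factors w cancel against the last one; the
  mixed terms and those with only factors e vanish by the third and first of
  \<open>split4_identities\<close>.\<close>

lemma extd_hat_zero:
  assumes dr: "\<And>X. X \<in> tangent AP p \<Longrightarrow> dr p X = 0"
    and tor: "\<And>X Y. X \<in> tangent AP p \<Longrightarrow> Y \<in> tangent AP p \<Longrightarrow> tor p X Y = (2 * \<rho> (pr p)) *\<^sub>R (e p X \<times> e p Y)"
    and X: "\<And>i :: nat. X i \<in> tangent AP p"
  shows "extd AP (hat AP v0 \<Omega>) p (map X [0,1,2,3]) = 0"
proof -
  obtain cA cB cD where "cA \<noteq> 0" and d: "\<And>X. (\<And>i. X i \<in> tangent AP p) \<Longrightarrow> extd AP (hat AP v0 \<Omega>) p (map X [0,1,2,3]) =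
      alt4 (\<lambda>i j k l. dr p (X i) * (cA * (cubA (\<lambda>j. w p (X j)) j k l + cubB (\<lambda>j. e p (X j)) (\<lambda>j. w p (X j)) j k l)
         + cB * cubB (\<lambda>j. w p (X j)) (\<lambda>j. e p (X j)) j k l + cD * cubA (\<lambda>j. e p (X j)) j k l))
      - eps p / (2 * sc p) * (split4 (\<lambda>i j. tor p (X i) (X j)) (\<lambda>j. w p (X j)) (\<lambda>j. w p (X j))
         - \<rho> (pr p) * (split4 (\<lambda>i j. tor p (X i) (X j)) (\<lambda>j. w p (X j)) (\<lambda>j. e p (X j)) + split4 (\<lambda>i j. tor p (X i) (X j)) (\<lambda>j. e p (X j)) (\<lambda>j. w p (X j)))
         + (2 * (\<rho> (pr p))\<^sup>2 - 1) * split4 (\<lambda>i j. tor p (X i) (X j)) (\<lambda>j. e p (X j)) (\<lambda>j. e p (X j))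
         - 2 * \<rho> (pr p) * split4 (\<lambda>i j. e p (X i) \<times> e p (X j)) (\<lambda>j. w p (X j)) (\<lambda>j. w p (X j)))"
    by (fact extd_hat)
  let ?a = "\<lambda>j. w p (X j)" and ?b = "\<lambda>j. e p (X j)"
  let ?B = "split4 (\<lambda>i j. e p (X i) \<times> e p (X j))"
  have 3: "?B ?a ?b + ?B ?b ?a = 0" by (rule split4_identities(3))
  have 1: "?B ?b ?b = 0" by (rule split4_identities(1))
  have "2 * \<rho> (pr p) * ?B ?a ?a - \<rho> (pr p) * (2 * \<rho> (pr p) * ?B ?a ?b + 2 * \<rho> (pr p) * ?B ?b ?a)
    + (2 * (\<rho> (pr p))\<^sup>2 - 1) * (2 * \<rho> (pr p) * ?B ?b ?b) - 2 * \<rho> (pr p) * ?B ?a ?a = 0"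
    unfolding distrib_left[symmetric] 3 1 by simp
  then show ?thesis
    unfolding d[of X, OF X] dr[OF X] tor[OF X X] split4_linear(3) by (simp only: mult_zero_left alt4_def)
qed

text \<open>Components are isolated by test vectors with w = 0 or e = 0, since torsion and dr both
  vanish on vertical vectors. The derivative of \<rho> has to be dealt with first, so that it is
  absent when the torsion is extracted.\<close>

lemma extd_hat_zeroD:
  assumes zero: "\<And>X :: nat \<Rightarrow> 'p tvec. (\<And>i. X i \<in> tangent AP p) \<Longrightarrow> extd AP (hat AP v0 \<Omega>) p (map X [0,1,2,3]) = 0"
  shows "X \<in> tangent AP p \<Longrightarrow> dr p X = 0"
    and "X \<in> tangent AP p \<Longrightarrow> Y \<in> tangent AP p \<Longrightarrow> tor p X Y = (2 * \<rho> (pr p)) *\<^sub>R (e p X \<times> e p Y)"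
proof -
  obtain cA cB cD where cA: "cA \<noteq> 0" and d: "\<And>X. (\<And>i. X i \<in> tangent AP p) \<Longrightarrow> extd AP (hat AP v0 \<Omega>) p (map X [0,1,2,3]) =
      alt4 (\<lambda>i j k l. dr p (X i) * (cA * (cubA (\<lambda>j. w p (X j)) j k l + cubB (\<lambda>j. e p (X j)) (\<lambda>j. w p (X j)) j k l)
         + cB * cubB (\<lambda>j. w p (X j)) (\<lambda>j. e p (X j)) j k l + cD * cubA (\<lambda>j. e p (X j)) j k l))
      - eps p / (2 * sc p) * (split4 (\<lambda>i j. tor p (X i) (X j)) (\<lambda>j. w p (X j)) (\<lambda>j. w p (X j))
         - \<rho> (pr p) * (split4 (\<lambda>i j. tor p (X i) (X j)) (\<lambda>j. w p (X j)) (\<lambda>j. e p (X j)) + split4 (\<lambda>i j. tor p (X i) (X j)) (\<lambda>j. e p (X j)) (\<lambda>j. w p (X j)))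
         + (2 * (\<rho> (pr p))\<^sup>2 - 1) * split4 (\<lambda>i j. tor p (X i) (X j)) (\<lambda>j. e p (X j)) (\<lambda>j. e p (X j))
         - 2 * \<rho> (pr p) * split4 (\<lambda>i j. e p (X i) \<times> e p (X j)) (\<lambda>j. w p (X j)) (\<lambda>j. w p (X j)))"
    by (fact extd_hat)
  have four_t: "four A B C D i \<in> tangent AP p"
    if "A \<in> tangent AP p" "B \<in> tangent AP p" "C \<in> tangent AP p" "D \<in> tangent AP p" for A B C D i
    using that by (simp add: four_def)
  have tV: "tor p (lift p a 0) Y = 0" if "Y \<in> tangent AP p" for a Y
    by (rule tor_vertical[OF lift_props(1) lift_props(3) that])
  have tV': "tor p Y (lift p a 0) = 0" if "Y \<in> tangent AP p" for a Y
    by (subst tor_antisym) (simp only: tV[OF that] minus_zero)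
  have drV: "dr p (lift p a 0) = 0" for a
    by (rule dr_vertical) (simp only: vertical_iff lift_props simp_thms)
  have drH: "dr p (lift p 0 b) = 0" for b
  proof -
    \<comment> \<open>One horizontal and three vertical vectors: every pair contains a vertical one,
      so torsion and e x e disappear. What is left is dr times \<open>cA\<close> times the triple
      product of the axes, which is 1.\<close>
    define X where "X = four (lift p 0 b) (lift p (axis 1 1) 0) (lift p (axis 2 1) 0) (lift p (axis 3 1) 0)"
    have Xt: "X i \<in> tangent AP p" for i unfolding X_def by (rule four_t) (rule lift_props(1))+
    have X: "X 0 = lift p 0 b" "X 1 = lift p (axis 1 1) 0" "X 2 = lift p (axis 2 1) 0" "X 3 = lift p (axis 3 1) 0"
      by (simp_all only: X_def four_simps)
    have t3: "tr3 (axis 1 1) (axis 2 1) (axis 3 1) = 1" by (simp add: tr3_components axis_def)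
    have "dr p (lift p 0 b) * cA = 0"
      using zero[of X, OF Xt] unfolding d[of X, OF Xt] alt4_def split4_def cubA_def cubB_def X drV lift_props tV[OF lift_props(1)] tV'[OF lift_props(1)]
      by (simp add: tr3_linear t3)
    then show ?thesis using cA by simp
  qed
  have dr: "dr p X = 0" if X: "X \<in> tangent AP p" for X
    by (subst lift_split[OF X]) (simp add: dr_linear drV drH)
  then show "X \<in> tangent AP p \<Longrightarrow> dr p X = 0" .
  assume X: "X \<in> tangent AP p" and Y: "Y \<in> tangent AP p"
  define T where "T = tor p (lift p 0 (e p X)) (lift p 0 (e p Y))"
  have "tr3 (T - (2 * \<rho> (pr p)) *\<^sub>R (e p X \<times> e p Y)) a a' = 0" for a a'
  proof -
    \<comment> \<open>Two vertical and two horizontal vectors: only the pair (2, 3) has torsion, and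
      it is paired with the arbitrary vectors a and a'.\<close>
    define Z where "Z = four (lift p a 0) (lift p a' 0) (lift p 0 (e p X)) (lift p 0 (e p Y))"
    have Zt: "Z i \<in> tangent AP p" for i unfolding Z_def by (rule four_t) (rule lift_props(1))+
    have Z: "Z 0 = lift p a 0" "Z 1 = lift p a' 0" "Z 2 = lift p 0 (e p X)" "Z 3 = lift p 0 (e p Y)"
      by (simp_all only: Z_def four_simps)
    have "eps p / (2 * sc p) * (tr3 T a a' - 2 * \<rho> (pr p) * tr3 (e p X \<times> e p Y) a a') = 0"
      using zero[of Z, OF Zt] unfolding d[of Z, OF Zt] alt4_def split4_def dr[OF Zt] Z lift_props tV[OF lift_props(1)] tV'[OF lift_props(1)] T_def[symmetric]
      by (simp add: tr3_linear cross_zero_left cross_zero_right)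
    then have "tr3 T a a' - 2 * \<rho> (pr p) * tr3 (e p X \<times> e p Y) a a' = 0"
      using eps(2)[of p] sc(1)[of p] by simp
    then show ?thesis by (simp add: tr3_linear)
  qed
  then have "T - (2 * \<rho> (pr p)) *\<^sub>R (e p X \<times> e p Y) = 0" by (rule tr3_zeroI)
  then show "tor p X Y = (2 * \<rho> (pr p)) *\<^sub>R (e p X \<times> e p Y)"
    unfolding tor_eq_lift[OF X Y] T_def by simp
qed

lemma extd_hat_iff:
  "form_eq AP 4 (extd AP (hat AP v0 \<Omega>)) fzero \<longleftrightarrow>
     (\<forall>p. \<forall>X\<in>tangent AP p. dr p X = 0) \<and>
     (\<forall>p. \<forall>X\<in>tangent AP p. \<forall>Y\<in>tangent AP p. tor p X Y = (2 * \<rho> (pr p)) *\<^sub>R (e p X \<times> e p Y))"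
  (is "?l \<longleftrightarrow> ?r")
proof
  assume ?l
  then have zero: "extd AP (hat AP v0 \<Omega>) p (map X [0,1,2,3]) = 0" if "\<And>i. X i \<in> tangent AP p" for p and X :: "nat \<Rightarrow> 'p tvec"
    using that unfolding form_eq_4 fzero_def by blast
  show ?r using extd_hat_zeroD[OF zero] by blast
next
  assume r: ?r
  show ?l
    unfolding form_eq_4 fzero_def using extd_hat_zero r by blast
qed

subsection \<open>Curvature in the closed case\<close>

text \<open>As \<rho> has zero derivative, d of W - \<rho>E is dW - \<rho> dE. The torsion then
  contributes -2\<rho>^2 and the square of \<rho>E contributes \<rho>^2 to the coefficient 1 of e x
  e.\<close>

lemma curvature_WJ:
  assumes dr: "\<And>X. X \<in> tangent AP p \<Longrightarrow> dr p X = 0"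
    and tor: "\<And>X Y. X \<in> tangent AP p \<Longrightarrow> Y \<in> tangent AP p \<Longrightarrow> tor p X Y = (2 * \<rho> (pr p)) *\<^sub>R (e p X \<times> e p Y)"
    and X: "X \<in> tangent AP p" and Y: "Y \<in> tangent AP p"
  shows "curvature AP WJ p [X, Y] = (1 - (\<rho> (pr p))\<^sup>2) *\<^sub>R mwedge 1 1 E E p [X, Y]"
proof -
  let ?r = "\<rho> (pr p)"
  define c where "c = some_chart AP p"
  have c: "c \<in> AP" "p \<in> fst c" using some_chart_in[OF P] by (auto simp: c_def)
  have xc: "snd c p \<in> snd c ` fst c" using c by blast
  have S: "open (snd c ` fst c)" by (rule chart_open_image[OF P c(1)])
  have deriv: "frechet_derivative (form_component AP c WJ [u]) (at (snd c p)) (coords c Z) =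
     frechet_derivative (form_component AP c W [u]) (at (snd c p)) (coords c Z)
     - ?r *\<^sub>R frechet_derivative (form_component AP c E [u]) (at (snd c p)) (coords c Z)" if Z: "Z \<in> tangent AP p" for u Z
  proof -
    let ?D = "\<lambda>f. frechet_derivative f (at (snd c p))"
    let ?\<rho> = "(\<rho> \<circ> pr) \<circ> chart_inv c"
    have d: "(f has_derivative ?D f) (at (snd c p))" if "smooth_on (snd c ` fst c) f" for f :: "_ \<Rightarrow> 'b::real_normed_vector"
      using smooth_on_imp_differentiable[OF that xc] frechet_derivative_works by blast
    have dW: "(form_component AP c W [u] has_derivative ?D (form_component AP c W [u])) (at (snd c p))"
      and dE: "(form_component AP c E [u] has_derivative ?D (form_component AP c E [u])) (at (snd c p))"
      using d form_component_smooth[OF forms(1) c(1), of "[u]"] form_component_smooth[OF forms(2) c(1), of "[u]"] by auto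
    have d\<rho>: "(?\<rho> has_derivative ?D ?\<rho>) (at (snd c p))"
      by (rule d[OF smooth_on_cong[OF \<rho>_pr_chart_smooth[OF c(1)] S]]) simp
    have eq: "form_component AP c WJ [u] = (\<lambda>y. form_component AP c W [u] y - ?\<rho> y *\<^sub>R form_component AP c E [u] y)"
      by (simp add: form_component_def fadd_def fscale_def fun_eq_iff)
    have z: "?D ?\<rho> (coords c Z) = 0"
    proof -
      have "coord_vec AP c p (coords c Z) (\<rho> \<circ> pr) = 0"
        using dr[OF Z] unfolding coord_vec_coords[OF P c Z] dr_def .
      then show ?thesis using \<rho>_pr_smooth_at[of p] by (simp add: coord_vec_def)
    qed
    have r: "?\<rho> (snd c p) = ?r" using chart_inv_left[OF P c] by simp
    show ?thesis
      unfolding eq frechet_derivative_at[OF has_derivative_diff[OF dW has_derivative_scaleR[OF d\<rho> dE]], symmetric] z r by simp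
  qed
  have "extd AP WJ p [X, Y] = extd AP W p [X, Y] - ?r *\<^sub>R extd AP E p [X, Y]"
    unfolding extd_1 Let_def c_def[symmetric] deriv[OF X] deriv[OF Y] by (simp add: algebra_simps)
  then have "curvature AP WJ p [X, Y] = su2_of_vec (dw p X Y - ?r *\<^sub>R de p X Y + (w p X - ?r *\<^sub>R e p X) \<times> (w p Y - ?r *\<^sub>R e p Y))"
    unfolding curvature_def fadd_def[of "extd AP WJ"] mwedge_1_1 WJ_eq[OF X] WJ_eq[OF Y] extd_W[OF X Y] extd_E[OF X Y] su2_of_vec_commutator
    by (simp only: su2_of_vec_simps)
  moreover have de: "de p X Y = (2 * ?r) *\<^sub>R (e p X \<times> e p Y) - w p X \<times> e p Y + w p Y \<times> e p X"
    using tor[OF X Y] by (simp add: tor_def algebra_simps)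
  have "dw p X Y - ?r *\<^sub>R de p X Y + (w p X - ?r *\<^sub>R e p X) \<times> (w p Y - ?r *\<^sub>R e p Y) = (1 - ?r\<^sup>2) *\<^sub>R (e p X \<times> e p Y)"
    unfolding dw_eq[OF X Y] de by (simp add: vec_eq_iff forall_3 cross_components power2_eq_square algebra_simps)
  ultimately show ?thesis unfolding mwedge_E_E[OF X Y] by (simp only: su2_of_vec_simps)
qed

text \<open>Vanishing derivative makes \<rho> constant on coordinate balls, which are convex;
  connectedness of M then gives one global value.\<close>

lemma \<rho>_constant:
  assumes conn: "connected (UNIV :: 'm set)" and d\<rho>: "form_eq AM 1 (extd AM (form_of_fun \<rho>)) fzero"
  obtains r where "\<And>x. \<rho> x = r"
proof -
  have zero: "Y \<rho> = 0" if "Y \<in> tangent AM x" for x Y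
    using d\<rho> extd_form_of_fun[OF M \<rho>_smooth_at that] that unfolding form_eq_1 fzero_def by metis
  have "\<rho> constant_on UNIV"
  proof (rule locally_constant_imp_constant[OF conn])
    fix x
    obtain c where c: "c \<in> AM" "x \<in> fst c" using chart_at[OF M] by blast
    have S: "open (snd c ` fst c)" by (rule chart_open_image[OF M c(1)])
    then obtain \<epsilon> where \<epsilon>: "\<epsilon> > 0" "ball (snd c x) \<epsilon> \<subseteq> snd c ` fst c" using c(2) openE by blast
    have "((\<rho> \<circ> chart_inv c) has_derivative (\<lambda>u. 0)) (at y within ball (snd c x) \<epsilon>)" if y: "y \<in> ball (snd c x) \<epsilon>" for y
    proof -
      have yc: "y \<in> snd c ` fst c" using y \<epsilon>(2) by blast
      note ci = chart_inv_in[OF M c(1) yc]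
      have "frechet_derivative (\<rho> \<circ> chart_inv c) (at y) u = 0" for u
        using zero[OF coord_vec_in_tangent[OF c(1) ci], of u] \<rho>_smooth_at chart_inv_right[OF M c(1) yc]
        by (simp add: coord_vec_def)
      then have "frechet_derivative (\<rho> \<circ> chart_inv c) (at y) = (\<lambda>u. 0)" by blast
      moreover have "((\<rho> \<circ> chart_inv c) has_derivative frechet_derivative (\<rho> \<circ> chart_inv c) (at y)) (at y)"
        using smooth_on_imp_differentiable[OF \<rho>_smooth[OF c(1)] yc] frechet_derivative_works by blast
      ultimately show ?thesis using has_derivative_at_withinI by metis
    qed
    then obtain k where k: "\<And>y. y \<in> ball (snd c x) \<epsilon> \<Longrightarrow> (\<rho> \<circ> chart_inv c) y = k"
      using has_derivative_zero_constant[OF convex_ball, of "snd c x" \<epsilon> "\<rho> \<circ> chart_inv c"] by blast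
    define T where "T = fst c \<inter> snd c -` ball (snd c x) \<epsilon>"
    have "open T" unfolding T_def by (rule continuous_open_preimage[OF chart_continuous[OF M c(1)] chart_open_dom[OF M c(1)] open_ball])
    moreover have "x \<in> T" using c(2) \<epsilon>(1) by (simp add: T_def)
    moreover have "\<rho> y = k" if "y \<in> T" for y
      using k[of "snd c y"] that chart_inv_left[OF M c(1), of y] by (simp add: T_def)
    ultimately show "\<exists>T. openin (top_of_set UNIV) T \<and> x \<in> T \<and> (\<forall>y\<in>T. \<rho> y = \<rho> x)"
      by (intro exI[of _ T]) simp
  qed
  then show thesis using that unfolding constant_on_def by blast
qed

end

theorem mainTheorem5:
  fixes AM :: "('m::{t2_space,second_countable_topology}, 3) chart set"
    and AP :: "('p::{t2_space,second_countable_topology}, 6) chart set"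
    and pr :: "'p \<Rightarrow> 'm"
    and act :: "'p \<Rightarrow> cmat \<Rightarrow> 'p"
    and v0 \<Omega> :: "('p, real) form"
    and W E W\<^sub>J :: "('p, cmat) form"
    and g\<^sub>E :: "'m \<Rightarrow> 'm tvec \<Rightarrow> 'm tvec \<Rightarrow> real"
    and v \<omega> b :: "('m, real) form"
    and \<rho> :: "'m \<Rightarrow> real"
    and J :: "'p \<Rightarrow> 'p tvec \<Rightarrow> 'p tvec"
  assumes M: "oriented_atlas AM" "connected (UNIV :: 'm set)"
    and P: "oriented_atlas AP" "principal_SU2_bundle AM AP pr act"
    and v0: "positive_volume_form AP v0"
    and W: "is_connection AP act W" "negative_definite AP v0 W"
    and E: "is_frame AM AP pr act E" "orientation_compatible AM AP pr E"
      "form_eq AP 2 (curvature AP W) (mwedge 1 1 E E)"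
    and g\<^sub>E: "metric_of_frame AM AP pr E g\<^sub>E"
    and v: "volume_form_of AM g\<^sub>E v"
    and \<omega>: "is_form AM 3 \<omega>" "form_eq AM 4 (extd AM \<omega>) fzero"
    and b: "is_form AM 2 b"
    and \<Omega>_def: "\<Omega> = fadd (chern_simons AP W) (pullback AM pr (fadd \<omega> (extd AM b)))"
    and \<rho>_def: "\<rho> = (\<lambda>x. top_ratio AM x (fadd \<omega> (extd AM b) x) (v x))"
    and \<Omega>_stable: "stable_negative AP v0 \<Omega>"
    and J_def: "J = J_of AP v0 \<Omega>"
    and W\<^sub>J_def: "W\<^sub>J = fadd W (fscale (\<lambda>p. - \<rho> (pr p)) E)"
  shows "(connection_defined_by AM AP pr act J W\<^sub>J \<and>
      (\<forall>x. (\<rho> x)\<^sup>2 < 1) \<and>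
      is_frame AM AP pr act (fscale (\<lambda>p. sqrt (1 - (\<rho> (pr p))\<^sup>2)) E) \<and>
      (\<exists>g. metric_defined_by AM AP pr act J g) \<and>
      (\<forall>g. metric_defined_by AM AP pr act J g \<longrightarrow>
         metric_of_frame AM AP pr (fscale (\<lambda>p. sqrt (1 - (\<rho> (pr p))\<^sup>2)) E) g))
    \<and>
     ((form_eq AP 4 (extd AP (hat AP v0 \<Omega>)) fzero \<longleftrightarrow>
         form_eq AM 1 (extd AM (form_of_fun \<rho>)) fzero \<and>
         form_eq AP 2 (cov_ext_deriv AP W E) (fscale (\<lambda>p. 2 * \<rho> (pr p)) (mwedge 1 1 E E))) \<and>
      (form_eq AP 2 (cov_ext_deriv AP W E) (fscale (\<lambda>p. 2 * \<rho> (pr p)) (mwedge 1 1 E E)) \<longleftrightarrow>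
         form_eq AP 2 (cov_ext_deriv AP W\<^sub>J E) fzero))
    \<and>
     (form_eq AP 4 (extd AP (hat AP v0 \<Omega>)) fzero \<longrightarrow>
        form_eq AP 2 (curvature AP W\<^sub>J)
          (fscale (\<lambda>p. 1 - (\<rho> (pr p))\<^sup>2) (mwedge 1 1 E E)) \<and>
        (\<exists>r. \<forall>x. \<rho> x = r) \<and>
        constant_negative_curvature AM g\<^sub>E \<and>
        (\<forall>g. metric_defined_by AM AP pr act J g \<longrightarrow> constant_negative_curvature AM g))"
proof -
  note conn = M(2)
  interpret deformed_cs AM AP pr act W E v0 \<Omega> g\<^sub>E v \<omega> b \<rho>
    by unfold_locales (fact assms)+
  have closed: "form_eq AP 2 (curvature AP WJ) (fscale (\<lambda>p. 1 - (\<rho> (pr p))\<^sup>2) (mwedge 1 1 E E)) \<and>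
        (\<exists>r. \<forall>x. \<rho> x = r) \<and> constant_negative_curvature AM g\<^sub>E \<and>
        (\<forall>g. metric_defined_by AM AP pr act (J_of AP v0 \<Omega>) g \<longrightarrow> constant_negative_curvature AM g)"
    if "form_eq AP 4 (extd AP (hat AP v0 \<Omega>)) fzero"
  proof -
    have dr: "\<forall>p. \<forall>X\<in>tangent AP p. dr p X = 0"
      and tor: "\<forall>p. \<forall>X\<in>tangent AP p. \<forall>Y\<in>tangent AP p. tor p X Y = (2 * \<rho> (pr p)) *\<^sub>R (e p X \<times> e p Y)"
      using that unfolding extd_hat_iff by blast+
    obtain r where r: "\<And>x. \<rho> x = r" using \<rho>_constant[OF conn extd_\<rho>_iff[THEN iffD2, OF dr]] by blast
    have r1: "1 - r\<^sup>2 > 0" using \<rho>_bound_base r by simp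
    have tor': "\<And>p X Y. X \<in> tangent AP p \<Longrightarrow> Y \<in> tangent AP p \<Longrightarrow> tor p X Y = (2 * r) *\<^sub>R (e p X \<times> e p Y)"
      using tor unfolding r by blast
    have "form_eq AP 2 (curvature AP WJ) (fscale (\<lambda>p. 1 - (\<rho> (pr p))\<^sup>2) (mwedge 1 1 E E))"
      unfolding form_eq_2 fscale_def[of "\<lambda>p. 1 - (\<rho> (pr p))\<^sup>2"] using curvature_WJ dr tor by blast
    \<comment> \<open>Here k = 1; the metric of J is the same statement with k = sqrt(1 - r^2), for
      which the curvature constant becomes -1.\<close>
    moreover have "constant_negative_curvature AM g\<^sub>E"
      by (rule constant_curvature_of_structure[OF r tor', of 1]) (simp_all add: g\<^sub>E_push)
    moreover have "constant_negative_curvature AM g" if "metric_defined_by AM AP pr act (J_of AP v0 \<Omega>) g" for g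
      by (rule constant_curvature_of_structure[OF r tor', of "sqrt (1 - r\<^sup>2)"])
         (use r1 in \<open>simp_all add: metric_of_J_value[OF that] r\<close>)
    ultimately show ?thesis using r by blast
  qed
  show ?thesis
    unfolding J_def W\<^sub>J_def
    using connection_of_J \<rho>_bound_base sE_frame metric_of_J_exists metric_of_J_frame closed
      extd_hat_iff extd_\<rho>_iff cov_ext_deriv_iff cov_ext_deriv_WJ_iff by (intro conjI) blast+
qed

end
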